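(* Assume that for some $\gamma\in(0,1]$: $\sum_{i=0}^{\infty}|a_i|^{\gamma}<\infty$, $\int_{\mathbb{R}}|\lambda|^{2\gamma}|\phi_{\varepsilon}(\lambda)|^2\,d\lambda<\infty$, and there is a finite constant $c_{\gamma,4}$ such that $$\mathbb{E}\,|e^{\iota\lambda\varepsilon_1}-\phi_{\varepsilon}(\lambda)|^{4}\leq c_{\gamma,4}\,(|\lambda|^{4\gamma}\wedge 1)\quad\text{for all }\lambda\in\mathbb{R}.$$ Assume further that the density $f$ is bounded. Then there exist positive constants $c_1,c_2$, independent of $n$, such that $$\Big|\mathbb{E}\,T_n(h_n)-\int_{\mathbb{R}}f^2(x)\,dx\Big|\leq c_1\Big(\frac1n+h_n^{2\gamma}\Big),$$ $$\mathbb{E}\Big(T_n(h_n)-\mathbb{E}\,T_n(h_n)-\frac1n\sum_{i=1}^nY_i\Big)^2\leq c_2\Big(\frac{1}{n^2h_n}+\frac{\eta_{n,\gamma}}{n^2}+\frac{h_n^{2\gamma}}{n}\Big),$$ and, if additionally $nh_n\to\infty$ as $n\to\infty$, $$\sqrt n\,\big[T_n(h_n)-\mathbb{E}\,T_n(h_n)\big]\overset{\mathcal{L}}{\longrightarrow}N(0,4\sigma^2),$$ where $Y_i=2\big(f(X_i)-\int_{\mathbb{R}}f^2(x)\,dx\big)$, $\eta_{n,\gamma}=\sum_{\ell=0}^{n}\sum_{i=\ell}^{\infty}|a_i|^{\gamma}$, and $\sigma^2=\lim_{n\to\infty}n^{-1}\mathrm{Var}(S_n)$ with $S_n=\sum_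{i=1}^n\big(f(X_i)-\int_{\mathbb{R}}f^2(x)\,dx\big)$.
   Context: $\{\varepsilon_i\}_{i\in\mathbb{Z}}$ are i.i.d. real random variables and $\{a_i\}_{i\ge0}$ are real coefficients such that $\sum_{i=0}^\infty a_i\varepsilon_{n-i}$ converges in distribution; the linear process is $X_n=\sum_{i=0}^\infty a_i\varepsilon_{n-i}$, $n\in\mathbb{N}$, and it is assumed to have a probability density function $f$. $\phi_\varepsilon(\lambda)=\mathbb{E}[e^{\iota\lambda\varepsilon_1}]$ with $\iota=\sqrt{-1}$. The kernel $K:\mathbb{R}\to\mathbb{R}$ is symmetric and bounded with $\int_{\mathbb{R}}K(u)\,du=1$ and $\int_{\mathbb{R}}u^2|K(u)|\,du<\infty$. The bandwidths satisfy $0<h_n\to0$ as $n\to\infty$. For $n\ge2$, $$T_n(h_n)=\frac{2}{n(n-1)h_n}\sum_{1\le i<j\le n}K\Big(\frac{X_i-X_j}{h_n}\Big).$$ $\overset{\mathcal{L}}{\longrightarrow}$ denotes convergence in distribution. *)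

theory Defs
  imports "HOL-Probability.Probability"
begin

definition conv_in_distribution :: "'a measure \<Rightarrow> (nat \<Rightarrow> 'a \<Rightarrow> real) \<Rightarrow> bool" where
  "conv_in_distribution M Z \<longleftrightarrow>
     (\<exists>\<mu>. real_distribution \<mu> \<and> weak_conv_m (\<lambda>N. distr M borel (Z N)) \<mu>)"

text \<open>
  For series of independent random variables, convergence in distribution and almost sure
  convergence are equivalent, so the pointwise sum below is the linear process up to a null set,
  on which the value of the divergent series is irrelevant.
\<close>

definition linear_process ::
    "(nat \<Rightarrow> real) \<Rightarrow> (int \<Rightarrow> 'a \<Rightarrow> real) \<Rightarrow> nat \<Rightarrow> 'a \<Rightarrow> real" where
  "linear_process a \<epsilon> n \<omega> = (\<Sum>i. a i * \<epsilon> (int n - int i) \<omega>)"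

definition kernel_estimator ::
    "(real \<Rightarrow> real) \<Rightarrow> (nat \<Rightarrow> 'a \<Rightarrow> real) \<Rightarrow> nat \<Rightarrow> real \<Rightarrow> 'a \<Rightarrow> real" where
  "kernel_estimator K X n b \<omega> =
     2 / (real n * (real n - 1) * b) *
       (\<Sum>j = 1..n. \<Sum>i = 1..<j. K ((X i \<omega> - X j \<omega>) / b))"

definition quadratic_functional :: "(real \<Rightarrow> real) \<Rightarrow> real" where
  "quadratic_functional f = (LINT x|lborel. (f x)\<^sup>2)"

definition coeff_tail_sum :: "(nat \<Rightarrow> real) \<Rightarrow> real \<Rightarrow> nat \<Rightarrow> real" where
  "coeff_tail_sum a \<gamma> n = (\<Sum>l = 0..n. \<Sum>i. \<bar>a (l + i)\<bar> powr \<gamma>)"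

text \<open>
  The second argument is the variance (not the standard deviation); variance 0 gives the
  point mass, since the long-run variance of the statistic may vanish.
\<close>

definition normal_law :: "real \<Rightarrow> real \<Rightarrow> real measure" where
  "normal_law m v =
     (if v = 0 then return borel m else density lborel (\<lambda>x. ennreal (normal_density m (sqrt v) x)))"

end

theory Submission
 imports Defs
begin

text \<open>
  Write \<open>X i = U i + W i\<close>, where \<open>U i\<close> collects the last \<open>L\<close> innovations and \<open>W i\<close> the older ones, with \<open>L\<close>
  so large that \<open>U i\<close> has a bounded density. With \<open>fk x = E k (x - X 0)\<close> and \<open>\<theta> = E fk (X 0)\<close>, every kernel
  term splits as \<open>k (X j - X i) = DD i j + T i j + fk (X i) + fk (X j) - \<theta>\<close>. Here \<open>DD i j\<close> averages to zero
  over \<open>U i\<close> and over \<open>U j\<close>, so the terms of its double sum are nearly orthogonal. By Fourier inversion the double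
  sum of \<open>T i j\<close> is an integral of products of centred empirical characteristic functions, and a martingale
  estimate bounds the fourth moments of these. The bias and the error of replacing \<open>fk\<close> by \<open>f\<close> are controlled by the
  Hoelder bound of order \<open>2 \<gamma>\<close> at 0 of the autocorrelation of \<open>f\<close>, whose Fourier transform is the squared modulus
  of the characteristic function of \<open>X 0\<close>. The central limit theorem for the sums of \<open>f (X i)\<close> follows
  by averaging out, for each term, the innovations before its block, which leaves independent blocks.
\<close>

text \<open>The rescaled kernel K(x/h)/h has a fixed L1 norm, but its supremum grows like 1/h and
  its Fourier transform need not be integrable. Inversion is therefore applied only after averaging
  over U, which multiplies the transform by the integrable characteristic function of U; the
  unsmoothed rest is \<open>DD\<close>. The supremum enters the second moment of the remainder only
  linearly and yields 1/(n^2 h); its other constants use the L1 norm alone. Orthogonality of the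
  \<open>DD\<close> terms is only approximate because \<open>W j\<close> contains innovations of an
  earlier \<open>U i\<close>; this dependence has size \<open>tail_norm (j - i)\<close>, and the sum
  of these tails is eta. Fourth moments enter because the L2 norm of a product of two empirical
  characteristic functions is bounded by their L4 norms. The characteristic function of one
  innovation is only square-integrable, so an integrable one needs two nonzero coefficients. With
  finitely many coefficients this may fail; then the assumed bound on f and independence beyond lag
  L replace the Fourier argument.\<close>

hide_fact (open)
  Henstock_Kurzweil_Integration.integrable_add
  Henstock_Kurzweil_Integration.integrable_bound
  Henstock_Kurzweil_Integration.integrable_diff
  Henstock_Kurzweil_Integration.integrable_sum
  Henstock_Kurzweil_Integration.integral_add
  Henstock_Kurzweil_Integration.integral_cnj
  Henstock_Kurzweil_Integration.integral_cong
  Henstock_Kurzweil_Integration.integral_diff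
  Henstock_Kurzweil_Integration.integral_nonneg
  Henstock_Kurzweil_Integration.integral_sum

notation (input) LIMSEQ (infixr "---->" 60)

lemma cnj_measurable[measurable]: "cnj \<in> borel_measurable borel"
 by (intro borel_measurable_continuous_onI continuous_intros)

section \<open>Fourier inversion and autocorrelation of densities\<close>

lemma (in pair_sigma_finite) integrable_times:
 fixes f :: "_ => real" and g :: "_ => real"
 assumes "integrable M1 f" "integrable M2 g"
 shows "integrable (M1 \<Otimes>\<^sub>M M2) (\<lambda>(x, y). f x * g y)"
proof -
 have [measurable]: "f \<in> borel_measurable M1" "g \<in> borel_measurable M2"
  using assms by auto
 show ?thesis
  using assms by (intro Fubini_integrable) (auto simp: abs_mult)
qed

lemma char_uminus_cnj: "char N (- t) = cnj (char N t)"
 unfolding char_def by (subst integral_cnj[symmetric]) (simp add: exp_cnj)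

text \<open>The inversion formula for an integrable characteristic function. \<open>Re\<close> only
  adjusts the type: \<open>inv_char_complex\<close> shows that the integral is real.\<close>

definition inv_char :: "real measure => real => real" where
 "inv_char N x = Re (LINT t|lborel. char N t * iexp (- (t * x))) / (2 * pi)"

context real_distribution
begin

text \<open>Substituting -t for t conjugates the integrand, so the integral equals its own
  conjugate.\<close>

lemma inv_char_complex:
 "(LINT t|lborel. char M t * iexp (- (t * x))) = complex_of_real (2 * pi * inv_char M x)"
proof -
 let ?I = "LINT t|lborel. char M t * iexp (- (t * x))"
 have "?I = (LINT t|lborel. char M (- t) * iexp (t * x))"
  by (subst lborel_integral_real_affine[where c = "-1" and t = 0]) simp_all
 also have "... = cnj ?I"
  by (subst integral_cnj[symmetric]) (simp add: char_uminus_cnj exp_cnj)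
 finally have "Im ?I = 0"
  by (metis Reals_cnj_iff complex_is_Real_iff)
 then show ?thesis
  by (simp add: inv_char_def complex_eq_iff)
qed

context
 assumes integrable_char: "integrable lborel (char M)"
begin

lemma integrable_char_iexp: "integrable lborel (\<lambda>t. char M t * iexp (- (t * x)))"
 by (rule integrable_bound[OF integrable_char])
  (auto simp: norm_mult borel_measurable_integrable[OF integrable_char])

lemma abs_inv_char_le: "\<bar>inv_char M x\<bar> <= (LINT t|lborel. cmod (char M t)) / (2 * pi)"
proof -
 have "\<bar>Re (LINT t|lborel. char M t * iexp (- (t * x)))\<bar> <= cmod (LINT t|lborel. char M t * iexp (- (t * x)))"
  by (rule abs_Re_le_cmod)
 also have "... <= (LINT t|lborel. cmod (char M t * iexp (- (t * x))))"
  by (rule integral_norm_bound)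
 finally show ?thesis
  by (simp add: inv_char_def norm_mult field_simps)
qed

lemma isCont_inv_char: "isCont (inv_char M) x"
 unfolding continuous_at_sequentially comp_def
proof safe
 fix X assume X: "X ----> x"
 have "(\<lambda>n. LINT t|lborel. char M t * iexp (- (t * X n))) ----> (LINT t|lborel. char M t * iexp (- (t * x)))"
  by (rule integral_dominated_convergence[where w = "\<lambda>t. cmod (char M t)"])
   (use integrable_char in \<open>auto intro!: tendsto_intros X simp: norm_mult\<close>)
 then show "(\<lambda>n. inv_char M (X n)) ----> inv_char M x"
  unfolding inv_char_def by (intro tendsto_intros) auto
qed

lemma inv_char_measurable[measurable]: "inv_char M \<in> borel_measurable borel"
 by (auto intro!: borel_measurable_continuous_onI continuous_at_imp_continuous_on isCont_inv_char)

lemma integral_iexp_Icc: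
 assumes "a <= b" "t \<noteq> 0"
 shows "(LINT x|lborel. indicator {a..b} x *\<^sub>R iexp (- (t * x)))
  = (iexp (- (t * a)) - iexp (- (t * b))) / (\<i> * t)"
proof -
 have i2: "- (\<i> * (z * \<i>)) = z" for z
  by (simp add: complex_eq_iff)
 have "(LINT x|lborel. indicator {a..b} x *\<^sub>R iexp (- (t * x)))
  = (\<lambda>x. - iexp (- (t * x)) / (\<i> * t)) b - (\<lambda>x. - iexp (- (t * x)) / (\<i> * t)) a"
 proof (rule integral_FTC_atLeastAtMost[OF \<open>a <= b\<close>])
  fix x
  have "((\<lambda>z::complex. - exp (\<i> * (- (t * z))) / (\<i> * t)) has_field_derivative exp (\<i> * (- (t * of_real x)))) (at (of_real x))"
   using \<open>t \<noteq> 0\<close> i2 by (auto intro!: derivative_eq_intros)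
  from has_vector_derivative_real_field[OF this]
  show "((\<lambda>x. - iexp (- (t * x)) / (\<i> * t)) has_vector_derivative iexp (- (t * x))) (at x within {a..b})"
   by simp
 qed (auto intro!: continuous_intros)
 then show ?thesis
  by (simp add: diff_divide_distrib)
qed

text \<open>Levy's theorem gives the mass as a limit of truncated integrals. Integrability of the
  characteristic function removes the truncation, and once the quotient is written as an integral of
  \<open>iexp (- (t * x))\<close> over [a, b], Fubini brings out the inverse transform.\<close>

lemma measure_Ioc_inv_char:
 assumes "a <= b" "measure M {a} = 0" "measure M {b} = 0"
 shows "measure M {a<..b} = (LINT x|lborel. indicator {a..b} x * inv_char M x)"
proof -
 let ?F = "\<lambda>t. (iexp (- (t * a)) - iexp (- (t * b))) / (\<i> * t)"
 have [measurable]: "char M \<in> borel_measurable borel" by simp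
 have F_bound: "cmod (?F t) <= b - a" for t
 proof (cases "t = 0")
  case False
  have "cmod (?F t) = cmod ((iexp (t * -a) - iexp (t * -b)) / (\<i> * t))" by simp
  also have "... <= -a - -b"
   using assms False by (intro Levy_Inversion_aux2) auto
  finally show ?thesis by simp
 qed (use assms in auto)
 have "(\<lambda>T::nat. 1 / (2 * pi) * (CLBINT t=-real T..real T. ?F t * char M t)) ----> of_real (measure M {a<..b})"
  using Levy_Inversion[OF assms] by simp
 moreover have "(\<lambda>T::nat. 1 / (2 * pi) * (CLBINT t=-real T..real T. ?F t * char M t))
   ----> 1 / (2 * pi) * (LINT t|lborel. ?F t * char M t)"
 proof (intro tendsto_intros)
  have "(CLBINT t=-real T..real T. ?F t * char M t) = (LINT t|lborel. indicator {-real T..real T} t *\<^sub>R (?F t * char M t))" for T :: nat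
   by (subst interval_integral_Icc) (auto simp: set_lebesgue_integral_def)
  moreover have "(\<lambda>T::nat. LINT t|lborel. indicator {-real T..real T} t *\<^sub>R (?F t * char M t)) ----> (LINT t|lborel. ?F t * char M t)"
  proof (rule integral_dominated_convergence[where w = "\<lambda>t. (b - a) * cmod (char M t)"])
   show "AE t in lborel. (\<lambda>T::nat. indicator {-real T..real T} t *\<^sub>R (?F t * char M t)) ----> ?F t * char M t"
   proof (rule AE_I2)
    fix t :: real
    obtain N :: nat where N: "\<bar>t\<bar> <= real N" using real_arch_simple by blast
    have "\<forall>\<^sub>F T::nat in sequentially. indicator {-real T..real T} t *\<^sub>R (?F t * char M t) = ?F t * char M t"
     using eventually_ge_at_top[of N] by eventually_elim (use N in \<open>auto simp: indicator_def\<close>)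
    then show "(\<lambda>T::nat. indicator {-real T..real T} t *\<^sub>R (?F t * char M t)) ----> ?F t * char M t"
     by (rule tendsto_eventually)
   qed
   show "AE t in lborel. norm (indicator {-real T..real T} t *\<^sub>R (?F t * char M t)) <= (b - a) * cmod (char M t)" for T :: nat
    using mult_right_mono[OF F_bound, of "cmod (char M t)" t for t] assms
    by (intro AE_I2) (auto simp: norm_mult[of _ "char M _"] indicator_def simp del: of_real_mult times_divide_eq_left)
  qed (use integrable_char in auto)
  ultimately show "(\<lambda>T::nat. CLBINT t=-real T..real T. ?F t * char M t) ----> (LINT t|lborel. ?F t * char M t)"
   by simp
 qed
 ultimately have "of_real (measure M {a<..b}) = 1 / (2 * pi) * (LINT t|lborel. ?F t * char M t)"
  by (rule LIMSEQ_unique)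
 also have "(LINT t|lborel. ?F t * char M t)
   = (LINT t|lborel. (LINT x|lborel. indicator {a..b} x *\<^sub>R (char M t * iexp (- (t * x)))))"
 proof (rule integral_cong_AE)
  \<comment> \<open>At t = 0 the quotient is 0 by convention while the inner integral is b - a, so
    the identity is claimed almost everywhere only.\<close>
  have "AE t in lborel. t \<noteq> (0::real)"
   by (rule AE_lborel_singleton)
  then show "AE t in lborel. ?F t * char M t = (LINT x|lborel. indicator {a..b} x *\<^sub>R (char M t * iexp (- (t * x))))"
  proof eventually_elim
   case (elim t)
   have "(LINT x|lborel. indicator {a..b} x *\<^sub>R (char M t * iexp (- (t * x))))
     = (LINT x|lborel. char M t * (indicator {a..b} x *\<^sub>R iexp (- (t * x))))"
    by (intro integral_cong) (auto simp: indicator_def)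
   also have "... = char M t * ?F t"
    by (simp only: integral_mult_right_zero integral_iexp_Icc[OF assms(1) elim])
   finally show ?case by (simp only: mult.commute)
  qed
 qed auto
 also have "... = (LINT x|lborel. (LINT t|lborel. indicator {a..b} x *\<^sub>R (char M t * iexp (- (t * x)))))"
 proof (rule lborel_pair.Fubini_integral[symmetric])
  show "integrable (lborel \<Otimes>\<^sub>M lborel) (\<lambda>(t, x). indicator {a..b} x *\<^sub>R (char M t * iexp (- (t * x))))"
  proof (rule integrable_bound)
   show "integrable (lborel \<Otimes>\<^sub>M lborel) (\<lambda>(t, x). cmod (char M t) * indicator {a..b} (x::real) :: real)"
    by (intro lborel_pair.integrable_times) (use integrable_char in \<open>auto intro!: integrable_real_indicator simp: emeasure_lborel_Icc_eq\<close>)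
  qed (auto simp: norm_mult indicator_def)
 qed
 also have "... = (LINT x|lborel. complex_of_real (2 * pi * (indicator {a..b} x * inv_char M x)))"
 proof (intro integral_cong refl)
  fix x
  have "(LINT t|lborel. indicator {a..b} x *\<^sub>R (char M t * iexp (- (t * x))))
    = indicator {a..b} x *\<^sub>R complex_of_real (2 * pi * inv_char M x)"
   by (subst integral_scaleR_right) (auto simp only: inv_char_complex intro: integrable_char_iexp)
  then show "(LINT t|lborel. indicator {a..b} x *\<^sub>R (char M t * iexp (- (t * x))))
    = complex_of_real (2 * pi * (indicator {a..b} x * inv_char M x))"
   by (simp only: scaleR_conv_of_real of_real_mult mult_ac)
 qed
 also have "... = complex_of_real (2 * pi * (LINT x|lborel. indicator {a..b} x * inv_char M x))"
  by (simp del: of_real_mult)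
 finally show ?thesis
  by (simp flip: of_real_mult of_real_divide)
qed

lemma integrable_indicator_inv_char: "integrable lborel (\<lambda>y. indicator {a..b} y * inv_char M y)"
proof (rule integrable_bound)
 show "integrable lborel (\<lambda>y. indicator {a..b} y * ((LINT t|lborel. cmod (char M t)) / (2 * pi)))"
  by (intro integrable_mult_left integrable_real_indicator) (auto simp: emeasure_lborel_Icc_eq)
qed (use order_trans[OF abs_inv_char_le abs_ge_self] in \<open>auto simp: indicator_def\<close>)

text \<open>An interval around x with endpoints outside the countable set of atoms carries at least
  the mass of x, but by \<open>measure_Ioc_inv_char\<close> at most C times its length. Short
  intervals contradict an atom.\<close>

lemma measure_singleton_zero: "measure M {x} = 0"
proof (rule ccontr)
 let ?N = "{x. measure M {x} \<noteq> 0}"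
 assume "measure M {x} \<noteq> 0"
 then have pos: "measure M {x} > 0" by (simp add: zero_less_measure_iff)
 define C where "C = (LINT t|lborel. cmod (char M t)) / (2 * pi)"
 have C: "0 <= C" using abs_inv_char_le[of 0] unfolding C_def by linarith
 \<comment> \<open>This makes 2 e (C + 1) half of the mass of the supposed atom; C + 1 instead of C
   avoids a division by zero.\<close>
 define e where "e = measure M {x} / (4 * (C + 1))"
 have e: "0 < e" using pos C by (simp add: e_def)
 obtain a where a: "a \<in> {x - e<..<x} - ?N"
  using open_minus_countable[OF countable_support, of "{x - e<..<x}"] e by (auto simp: not_less)
 obtain b where b: "b \<in> {x<..<x + e} - ?N"
  using open_minus_countable[OF countable_support, of "{x<..<x + e}"] e by (auto simp: not_less)
 have "measure M {x} <= measure M {a<..b}"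
  using a b by (intro finite_measure_mono) auto
 also have "... = (LINT x|lborel. indicator {a..b} x * inv_char M x)"
  using a b by (intro measure_Ioc_inv_char) auto
 also have "... <= (LINT x|lborel. indicator {a..b} x * C)"
 proof (rule integral_mono')
  show "integrable lborel (\<lambda>x. indicator {a..b} x * C)"
   by (intro integrable_mult_left integrable_real_indicator) (auto simp: emeasure_lborel_Icc_eq)
  show "indicator {a..b} x * inv_char M x <= indicator {a..b} x * C" for x
   using abs_inv_char_le[of x, folded C_def] by (auto simp: indicator_def)
 qed (use C in \<open>auto simp: indicator_def\<close>)
 also have "... = (b - a) * C"
  using a b by simp
 also have "... <= (2 * e) * (C + 1)"
  using a b C e by (intro mult_mono) auto
 also have "... = measure M {x} / 2"
  using C by (simp add: e_def field_simps add_eq_0_iff)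
 finally show False using pos by simp
qed

text \<open>A negative value would persist on a short interval by continuity, and that interval
  would get negative mass.\<close>

lemma inv_char_nonneg: "0 <= inv_char M x"
proof (rule ccontr)
 assume "\<not> ?thesis"
 then have neg: "inv_char M x < 0" by simp
 have "\<forall>\<^sub>F y in at x. inv_char M y < inv_char M x / 2"
  using isCont_inv_char[of x] neg unfolding isCont_def by (intro order_tendstoD(2)[where a = "inv_char M x / 2"]) auto
 then obtain d where d: "d > 0" "\<And>y. y \<noteq> x ==> dist y x < d ==> inv_char M y < inv_char M x / 2"
  by (auto simp: eventually_at)
 have le: "inv_char M y <= inv_char M x / 2" if "y \<in> {x..x + d / 2}" for y
  using d(2)[of y] that d(1) neg by (cases "y = x") (auto simp: dist_real_def)
 have "0 <= measure M {x<..x + d / 2}" by simp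
 also have "... = (LINT y|lborel. indicator {x..x + d / 2} y * inv_char M y)"
  using d(1) by (intro measure_Ioc_inv_char measure_singleton_zero) auto
 also have "... <= (LINT y|lborel. indicator {x..x + d / 2} y * (inv_char M x / 2))"
 proof (rule integral_mono)
  show "integrable lborel (\<lambda>y. indicator {x..x + d / 2} y * inv_char M y)"
   by (rule integrable_indicator_inv_char)
  show "integrable lborel (\<lambda>y. indicator {x..x + d / 2} y * (inv_char M x / 2))"
   by (intro integrable_mult_left integrable_real_indicator) (auto simp: emeasure_lborel_Icc_eq)
 qed (use le in \<open>auto simp: indicator_def\<close>)
 also have "... = d / 2 * (inv_char M x / 2)"
  using d(1) by simp
 finally show False
  using d(1) neg by (auto simp: zero_le_mult_iff)
qed

text \<open>Bounded intervals are settled by \<open>measure_Ioc_inv_char\<close>; half-lines, which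
  determine a finite measure, are increasing unions of them.\<close>

theorem density_inv_char: "M = density lborel (\<lambda>x. ennreal (inv_char M x))"
proof (rule measure_eqI_lessThan)
 let ?D = "density lborel (\<lambda>x. ennreal (inv_char M x))"
 have Ioc: "emeasure M {a<..b} = emeasure ?D {a<..b}" if "a <= b" for a b
 proof -
  have "emeasure M {a<..b} = ennreal (LINT x|lborel. indicator {a..b} x * inv_char M x)"
   using measure_Ioc_inv_char[OF that measure_singleton_zero measure_singleton_zero] by (simp add: emeasure_eq_measure)
  also have "... = (\<integral>\<^sup>+x. ennreal (indicator {a..b} x * inv_char M x) \<partial>lborel)"
  proof (rule nn_integral_eq_integral[symmetric])
   show "integrable lborel (\<lambda>y. indicator {a..b} y * inv_char M y)"
    by (rule integrable_indicator_inv_char)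
  qed (auto simp: inv_char_nonneg)
  also have "... = (\<integral>\<^sup>+x. ennreal (inv_char M x) * indicator {a<..b} x \<partial>lborel)"
  proof (rule nn_integral_cong_AE)
   have "AE x in lborel. x \<noteq> a" by (rule AE_lborel_singleton)
   then show "AE x in lborel. ennreal (indicator {a..b} x * inv_char M x) = ennreal (inv_char M x) * indicator {a<..b} x"
    by eventually_elim (auto simp: indicator_def)
  qed
  finally show ?thesis by (simp add: emeasure_density)
 qed
 show "emeasure M {x<..} = emeasure ?D {x<..}" for x
 proof -
  have *: "{x<..} = (\<Union>n::nat. {x<..x + real n})"
  proof safe
   fix y assume "x < y"
   moreover obtain n :: nat where "y - x <= real n" using real_arch_simple by blast
   ultimately show "y \<in> (\<Union>n::nat. {x<..x + real n})" by (auto intro!: exI[of _ n])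
  qed auto
  have inc: "incseq (\<lambda>n::nat. {x<..x + real n})" by (auto simp: incseq_def)
  have "emeasure M {x<..} = (SUP n. emeasure M {x<..x + real n})"
   unfolding * by (intro SUP_emeasure_incseq[symmetric] inc) auto
  also have "... = (SUP n. emeasure ?D {x<..x + real n})"
   by (intro SUP_cong refl Ioc) auto
  also have "... = emeasure ?D {x<..}"
   unfolding * by (intro SUP_emeasure_incseq inc) auto
  finally show ?thesis .
 qed
qed (auto simp: emeasure_eq_measure)

end

end

text \<open>Continuity of translation in L1 by approximation: outside a large interval f has a small
  integral, and inside it f is close in L1 to a continuous function, for which dominated convergence
  applies.\<close>

lemma translation_L1_tendsto:
 fixes f :: "real => real"
 assumes int: "integrable lborel f" and bnd: "\<And>x. \<bar>f x\<bar> <= C" and v: "v ----> 0"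
 shows "(\<lambda>k. LINT x|lborel. \<bar>f (x + v k) - f x\<bar>) ----> 0"
proof (rule LIMSEQ_I)
 fix e :: real assume "0 < e"
 \<comment> \<open>Five quantities below e' are added at the end: the tail and the approximation
   error, each with and without the shift, and the translation error of g.\<close>
 define e' where "e' = e / 6"
 have e': "0 < e'" using \<open>0 < e\<close> by (simp add: e'_def)
 have C: "0 <= C" using bnd[of 0] by linarith
 have [measurable]: "f \<in> borel_measurable borel" using int by auto
 define J :: "real => real => real" where "J R x = indicator {x. R < \<bar>x\<bar>} x" for R x
 have [measurable]: "J R \<in> borel_measurable borel" for R unfolding J_def by measurable
 have "(\<lambda>n::nat. LINT x|lborel. J (real n) x * \<bar>f x\<bar>) ----> (LINT x|(lborel::real measure). 0)"
 proof (rule integral_dominated_convergence[where w = "\<lambda>x. \<bar>f x\<bar>"])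
  show "AE x in lborel. (\<lambda>n::nat. J (real n) x * \<bar>f x\<bar>) ----> 0"
  proof (rule AE_I2)
   fix x :: real
   obtain N :: nat where N: "\<bar>x\<bar> <= real N" using real_arch_simple by blast
   have "\<forall>\<^sub>F n::nat in sequentially. J (real n) x * \<bar>f x\<bar> = 0"
    using eventually_ge_at_top[of N] by eventually_elim (use N in \<open>auto simp: J_def\<close>)
   then show "(\<lambda>n::nat. J (real n) x * \<bar>f x\<bar>) ----> 0" by (rule tendsto_eventually)
  qed
 qed (use int in \<open>auto simp: J_def indicator_def\<close>)
 then obtain R :: nat where R: "(LINT x|lborel. J (real R) x * \<bar>f x\<bar>) < e'"
  using e' by (auto dest!: order_tendstoD(2)[where a = e'] eventually_happens'[OF sequentially_bot])
 \<comment> \<open>The margin 2 absorbs a shift below 1: for |x| at most R + 1 both x and x + v k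
   lie in the window of \<open>I\<close>; for larger |x| both exceed R in modulus.\<close>
 define I :: "real => real" where "I = indicator {-(real R + 2)..real R + 2}"
 have [measurable]: "I \<in> borel_measurable borel" unfolding I_def by measurable
 have I_int: "integrable lborel I" unfolding I_def
  by (intro integrable_real_indicator) (auto simp: emeasure_lborel_Icc_eq)
 obtain g where g: "continuous_on UNIV g" "\<And>x. \<bar>g x\<bar> <= C" "(LINT x|lborel. I x * \<bar>f x - g x\<bar>) < e'"
 proof -
  have "f \<in> borel_measurable lebesgue" using measurable_completion[of f lborel borel] by simp
  then have "f measurable_on UNIV"
   by (subst measurable_on_iff_borel_measurable) auto
  then obtain N g where N: "negligible N" and g: "\<And>n::nat. continuous_on UNIV (g n)"
   and lim: "\<And>x. x \<notin> N ==> (\<lambda>n. g n x) ----> f x"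
   unfolding measurable_on_def by auto
  \<comment> \<open>Clipping to [-C, C] does not change the limit f, whose values lie there, and
    provides the dominating function.\<close>
  define g' where "g' n x = max (-C) (min C (g n x))" for n x
  have cont: "continuous_on UNIV (g' n)" for n
   unfolding g'_def by (intro continuous_intros g)
  have [measurable]: "g' n \<in> borel_measurable borel" for n
   using cont by (rule borel_measurable_continuous_onI)
  have bnd': "\<bar>g' n x\<bar> <= C" for n x using C by (auto simp: g'_def)
  have aux: "AE x in lborel. x \<notin> N"
   using N AE_not_in[of N lebesgue] by (simp add: negligible_iff_null_sets AE_completion_iff)
  have "(\<lambda>n. LINT x|lborel. I x * \<bar>f x - g' n x\<bar>) ----> (LINT x|(lborel::real measure). 0)"
  proof (rule integral_dominated_convergence[where w = "\<lambda>x. I x * (2 * C)"])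
   show "AE x in lborel. (\<lambda>n. I x * \<bar>f x - g' n x\<bar>) ----> 0"
    using aux
   proof eventually_elim
    case (elim x)
    have "(\<lambda>n. g' n x) ----> max (-C) (min C (f x))"
     unfolding g'_def by (intro tendsto_intros lim elim)
    also have "max (-C) (min C (f x)) = f x" using bnd[of x] by auto
    finally have "(\<lambda>n. I x * \<bar>f x - g' n x\<bar>) ----> I x * \<bar>f x - f x\<bar>"
     by (intro tendsto_intros)
    then show ?case by simp
   qed
   show "AE x in lborel. norm (I x * \<bar>f x - g' n x\<bar>) <= I x * (2 * C)" for n
   proof (rule AE_I2)
    fix x show "norm (I x * \<bar>f x - g' n x\<bar>) <= I x * (2 * C)"
     using bnd[of x] bnd'[of n x] by (auto simp: I_def indicator_def)
   qed
  qed (use I_int in auto)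
  then obtain n where "(LINT x|lborel. I x * \<bar>f x - g' n x\<bar>) < e'"
   using e' by (auto dest!: order_tendstoD(2)[where a = e'] eventually_happens'[OF sequentially_bot])
  with cont bnd' show ?thesis by (rule that)
 qed
 have [measurable]: "g \<in> borel_measurable borel" using g(1) by (rule borel_measurable_continuous_onI)
 have "(\<lambda>k. LINT x|lborel. I x * \<bar>g (x + v k) - g x\<bar>) ----> (LINT x|(lborel::real measure). 0)"
 proof (rule integral_dominated_convergence[where w = "\<lambda>x. I x * (2 * C)"])
  show "AE x in lborel. (\<lambda>k. I x * \<bar>g (x + v k) - g x\<bar>) ----> 0"
  proof (rule AE_I2)
   fix x
   have "(\<lambda>k. I x * \<bar>g (x + v k) - g x\<bar>) ----> I x * \<bar>g (x + 0) - g x\<bar>"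
    by (intro tendsto_intros continuous_on_tendsto_compose[OF g(1)] v) auto
   then show "(\<lambda>k. I x * \<bar>g (x + v k) - g x\<bar>) ----> 0" by simp
  qed
  show "AE x in lborel. norm (I x * \<bar>g (x + v k) - g x\<bar>) <= I x * (2 * C)" for k
  proof (rule AE_I2)
   fix x show "norm (I x * \<bar>g (x + v k) - g x\<bar>) <= I x * (2 * C)"
    using g(2)[of x] g(2)[of "x + v k"] by (auto simp: I_def indicator_def)
  qed
 qed (use I_int in auto)
 then have "\<forall>\<^sub>F k in sequentially. (LINT x|lborel. I x * \<bar>g (x + v k) - g x\<bar>) < e'"
  using e' by (auto dest!: order_tendstoD(2)[where a = e'])
 moreover have "\<forall>\<^sub>F k in sequentially. \<bar>v k\<bar> < 1"
  using tendsto_rabs[OF v] by (auto dest!: order_tendstoD(2)[where a = 1])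
 ultimately have "\<forall>\<^sub>F k in sequentially. (LINT x|lborel. \<bar>f (x + v k) - f x\<bar>) < e"
 proof eventually_elim
  case (elim k)
  let ?J = "\<lambda>x. J (real R) x * \<bar>f x\<bar>" and ?D = "\<lambda>x. I x * \<bar>f x - g x\<bar>" and ?E = "\<lambda>x. I x * \<bar>g (x + v k) - g x\<bar>"
  have J_int: "integrable lborel ?J"
   by (rule integrable_bound[OF int]) (auto simp: J_def indicator_def)
  have D_int: "integrable lborel ?D"
  proof (rule integrable_bound)
   show "integrable lborel (\<lambda>x. I x * (2 * C))" using I_int by simp
   show "AE x in lborel. norm (?D x) <= norm (I x * (2 * C))"
   proof (rule AE_I2)
    fix x show "norm (?D x) <= norm (I x * (2 * C))"
     using bnd[of x] g(2)[of x] C by (auto simp: I_def indicator_def)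
   qed
  qed auto
  have E_int: "integrable lborel ?E"
  proof (rule integrable_bound)
   show "integrable lborel (\<lambda>x. I x * (2 * C))" using I_int by simp
   show "AE x in lborel. norm (?E x) <= norm (I x * (2 * C))"
   proof (rule AE_I2)
    fix x show "norm (?E x) <= norm (I x * (2 * C))"
     using g(2)[of "x + v k"] g(2)[of x] C by (auto simp: I_def indicator_def)
   qed
  qed auto
  have shift: "integrable lborel (\<lambda>x. h (x + v k))" "(LINT x|lborel. h (x + v k)) = (LINT x|lborel. h x)"
   if "integrable lborel h" for h :: "real => real"
   using lborel_integrable_real_affine[OF that, of 1 "v k"] lborel_integral_real_affine[of 1 h "v k"]
   by (simp_all add: add.commute)
  have "(LINT x|lborel. \<bar>f (x + v k) - f x\<bar>)
    <= (LINT x|lborel. ?J (x + v k) + ?J x + ?D (x + v k) + ?D x + ?E x)"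
  proof (rule integral_mono)
   show "integrable lborel (\<lambda>x. \<bar>f (x + v k) - f x\<bar>)"
    using int shift(1)[OF int] by auto
   show "integrable lborel (\<lambda>x. ?J (x + v k) + ?J x + ?D (x + v k) + ?D x + ?E x)"
    using shift(1)[OF J_int] shift(1)[OF D_int] J_int D_int E_int by auto
   show "\<bar>f (x + v k) - f x\<bar> <= ?J (x + v k) + ?J x + ?D (x + v k) + ?D x + ?E x" for x
   proof (cases "\<bar>x\<bar> <= real R + 1")
    case True
    have J0: "0 <= ?J y" for y by (auto simp: J_def)
    have I1: "I x = 1" "I (x + v k) = 1"
     using True elim(2) by (auto simp: I_def indicator_def)
    have "\<bar>f (x + v k) - f x\<bar> <= \<bar>f (x + v k) - g (x + v k)\<bar> + \<bar>f x - g x\<bar> + \<bar>g (x + v k) - g x\<bar>"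
     by linarith
    then show ?thesis
     unfolding I1 mult_1_left using J0[of x] J0[of "x + v k"] by linarith
   next
    case False
    have I0: "0 <= ?D y" "0 <= ?E y" for y by (auto simp: I_def)
    have J1: "J (real R) x = 1" "J (real R) (x + v k) = 1"
     using False elim(2) by (auto simp: J_def indicator_def)
    have "\<bar>f (x + v k) - f x\<bar> <= \<bar>f (x + v k)\<bar> + \<bar>f x\<bar>"
     by linarith
    then show ?thesis
     unfolding J1 mult_1_left using I0(1)[of x] I0(1)[of "x + v k"] I0(2)[of x] by linarith
   qed
  qed
  also have "... = 2 * (LINT x|lborel. ?J x) + 2 * (LINT x|lborel. ?D x) + (LINT x|lborel. ?E x)"
   using shift[OF J_int] shift[OF D_int] J_int D_int E_int by simp
  also have "... < e"
   using R g(3) elim(1) \<open>0 < e\<close> unfolding e'_def by linarith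
  finally show ?case .
 qed
 then show "\<exists>no. \<forall>n\<ge>no. norm ((LINT x|lborel. \<bar>f (x + v n) - f x\<bar>) - 0) < e"
  by (auto simp: eventually_sequentially)
qed

text \<open>Interpolation: 1 - cos y is at most y^2 for |y| up to 1 and at most 2 beyond, and |y|^p
  dominates y^2 in the first range and 1 in the second.\<close>

lemma one_minus_cos_le_powr:
 fixes y p :: real
 assumes "0 <= p" "p <= 2"
 shows "1 - cos y <= 2 * \<bar>y\<bar> powr p"
proof (cases "\<bar>y\<bar> <= 1")
 case True
 have "1 - cos y <= y^2"
 proof -
  have "1 - cos y = 2 * (sin (y / 2))^2"
   using cos_double_sin[of "y / 2"] by simp
  also have "... <= 2 * \<bar>y / 2\<bar>^2"
   using abs_sin_x_le_abs_x[of "y / 2"] by (intro mult_left_mono) (auto simp: abs_le_square_iff[symmetric])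
  finally show ?thesis by (simp add: power2_eq_square field_simps) (use zero_le_square[of y] in linarith)
 qed
 also have "... <= 2 * \<bar>y\<bar> powr p"
 proof (cases "y = 0")
  case False
  have "\<bar>y\<bar> powr 2 <= \<bar>y\<bar> powr p"
   using True False assms by (intro powr_mono') auto
  moreover have "\<bar>y\<bar> powr 2 = y^2" using False by (simp add: powr_numeral)
  ultimately show ?thesis by (smt (verit) powr_ge_zero)
 qed auto
 finally show ?thesis .
next
 case False
 then have "1 <= \<bar>y\<bar> powr p" using assms by (intro ge_one_powr_ge_zero) auto
 then show ?thesis using cos_ge_minus_one[of y] by linarith
qed

text \<open>The density of Y - X for independent X and Y with density f
  (\<open>autocorr_law\<close>). Its value at 0 is the integral of f^2, the quantity to be
  estimated.\<close>

definition autocorr :: "(real => real) => real => real" where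
 "autocorr f v = (LINT x|lborel. f x * f (x + v))"

locale bounded_density =
 fixes f :: "real => real" and C :: real
 assumes f_measurable[measurable]: "f \<in> borel_measurable borel"
  and f_nonneg: "\<And>x. 0 <= f x" and f_le: "\<And>x. f x <= C"
  and f_integral: "(\<integral>\<^sup>+x. ennreal (f x) \<partial>lborel) = 1"
begin

lemma integrable_f: "integrable lborel f"
 using f_integral f_nonneg by (intro integrableI_nonneg) auto

lemma C_nonneg: "0 <= C" using f_nonneg[of 0] f_le[of 0] by linarith

lemma integrable_autocorr: "integrable lborel (\<lambda>x. f x * f (x + v))"
proof (rule integrable_bound)
 show "integrable lborel (\<lambda>x. f x * C)" using integrable_f by simp
 show "AE x in lborel. norm (f x * f (x + v)) <= norm (f x * C)"
  using f_nonneg f_le C_nonneg by (intro AE_I2) (auto simp: abs_mult intro!: mult_left_mono)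
qed auto

lemma autocorr_nonneg: "0 <= autocorr f v"
 unfolding autocorr_def using f_nonneg by (intro integral_nonneg) auto

lemma autocorr_measurable[measurable]: "autocorr f \<in> borel_measurable borel"
 unfolding autocorr_def by measurable

text \<open>Boundedness of f reduces this to \<open>translation_L1_tendsto\<close>. Continuity at 0
  matters because Fourier inversion identifies the autocorrelation only almost everywhere, which by
  itself says nothing about the point 0.\<close>

lemma autocorr_tendsto: "v ----> 0 ==> (\<lambda>k. autocorr f (v k)) ----> autocorr f 0"
proof -
 assume v: "v ----> 0"
 have shift: "integrable lborel (\<lambda>x. f (x + w))" for w
  using lborel_integrable_real_affine[OF integrable_f, of 1 w] by (simp add: add.commute)
 have "(\<lambda>k. autocorr f (v k) - autocorr f 0) ----> 0"
 proof (rule Lim_null_comparison)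
  show "\<forall>\<^sub>F k in sequentially. norm (autocorr f (v k) - autocorr f 0) <= C * (LINT x|lborel. \<bar>f (x + v k) - f x\<bar>)"
  proof (rule always_eventually, safe)
   fix k
   have "autocorr f (v k) - autocorr f 0 = (LINT x|lborel. f x * (f (x + v k) - f x))"
    unfolding autocorr_def using integrable_autocorr[of "v k"] integrable_autocorr[of 0]
    by (subst integral_diff[symmetric]) (auto simp: right_diff_distrib)
   also have "norm ... <= (LINT x|lborel. norm (f x * (f (x + v k) - f x)))"
    by (rule integral_norm_bound)
   also have "... <= (LINT x|lborel. C * \<bar>f (x + v k) - f x\<bar>)"
   proof (rule integral_mono')
    show "integrable lborel (\<lambda>x. C * \<bar>f (x + v k) - f x\<bar>)"
     using integrable_f shift[of "v k"] by auto
   qed (use f_nonneg f_le C_nonneg in \<open>auto simp: abs_mult intro!: mult_right_mono\<close>)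
   finally show "norm (autocorr f (v k) - autocorr f 0) <= C * (LINT x|lborel. \<bar>f (x + v k) - f x\<bar>)"
    by simp
  qed
  have "\<bar>f x\<bar> <= C" for x using f_nonneg[of x] f_le[of x] by simp
  from tendsto_mult_left[OF translation_L1_tendsto[OF integrable_f this v], of C]
  show "(\<lambda>k. C * (LINT x|lborel. \<bar>f (x + v k) - f x\<bar>)) ----> 0" by simp
 qed
 then show ?thesis by (rule LIM_zero_cancel)
qed

abbreviation law :: "real measure" where "law \<equiv> density lborel (\<lambda>x. ennreal (f x))"

lemma real_distribution_law: "real_distribution law"
 by (intro real_distribution.intro real_distribution_axioms.intro prob_spaceI)
  (auto simp: emeasure_density f_integral)

lemma autocorr_law:
 "distr (law \<Otimes>\<^sub>M law) borel (\<lambda>(x, y). y - x) = density lborel (\<lambda>v. ennreal (autocorr f v))"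
proof (rule measure_eqI)
 interpret L: real_distribution law by (rule real_distribution_law)
 interpret P: pair_prob_space law law ..
 fix A assume "A \<in> sets (distr (law \<Otimes>\<^sub>M law) borel (\<lambda>(x, y). y - x))"
 then have [measurable]: "A \<in> sets borel" by simp
 have "emeasure (distr (law \<Otimes>\<^sub>M law) borel (\<lambda>(x, y). y - x)) A
   = (\<integral>\<^sup>+z. indicator A z \<partial>distr (law \<Otimes>\<^sub>M law) borel (\<lambda>(x, y). y - x))"
  by simp
 also have "... = (\<integral>\<^sup>+z. indicator A (snd z - fst z) \<partial>(law \<Otimes>\<^sub>M law))"
  by (subst nn_integral_distr) (auto simp: split_beta')
 also have "... = (\<integral>\<^sup>+x. \<integral>\<^sup>+y. indicator A (y - x) \<partial>law \<partial>law)"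
  by (subst L.nn_integral_fst[symmetric]) auto
 also have "... = (\<integral>\<^sup>+x. ennreal (f x) * (\<integral>\<^sup>+y. ennreal (f y) * indicator A (y - x) \<partial>lborel) \<partial>lborel)"
  by (subst nn_integral_density, measurable)
   (intro nn_integral_cong arg_cong2[where f = "(*)"] refl nn_integral_density, auto)
 also have "... = (\<integral>\<^sup>+x. ennreal (f x) * (\<integral>\<^sup>+v. ennreal (f (x + v)) * indicator A v \<partial>lborel) \<partial>lborel)"
 proof -
  have "(\<integral>\<^sup>+y. ennreal (f y) * indicator A (y - x) \<partial>lborel) = (\<integral>\<^sup>+v. ennreal (f (x + v)) * indicator A v \<partial>lborel)" for x
   by (subst nn_integral_real_affine[where c = 1 and t = x]) auto
  then show ?thesis by simp
 qed
 also have "... = (\<integral>\<^sup>+x. \<integral>\<^sup>+v. ennreal (f x * f (x + v)) * indicator A v \<partial>lborel \<partial>lborel)"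
  using f_nonneg by (subst nn_integral_cmult[symmetric]) (auto simp: ennreal_mult' mult.assoc)
 also have "... = (\<integral>\<^sup>+v. \<integral>\<^sup>+x. ennreal (f x * f (x + v)) * indicator A v \<partial>lborel \<partial>lborel)"
  by (rule lborel_pair.Fubini') measurable
 also have "... = (\<integral>\<^sup>+v. ennreal (autocorr f v) * indicator A v \<partial>lborel)"
  using f_nonneg unfolding autocorr_def
  by (intro nn_integral_cong, subst nn_integral_multc) (auto simp: nn_integral_eq_integral[OF integrable_autocorr])
 finally show "emeasure (distr (law \<Otimes>\<^sub>M law) borel (\<lambda>(x, y). y - x)) A = emeasure (density lborel (\<lambda>v. ennreal (autocorr f v))) A"
  by (simp add: emeasure_density)
qed simp

text \<open>The difference of two independent copies has characteristic function |char|^2, so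
  \<open>autocorr f\<close> agrees almost everywhere with the inverse transform of |char|^2. The
  increment of that transform is an integral against 1 - cos (t v), which contributes |v|^p.\<close>

theorem autocorr_holder:
 assumes sq: "integrable lborel (\<lambda>t. (cmod (char law t))^2)"
  and sob: "integrable lborel (\<lambda>t. \<bar>t\<bar> powr p * (cmod (char law t))^2)"
  and p: "0 <= p" "p <= 2"
 shows "AE v in lborel. \<bar>autocorr f v - autocorr f 0\<bar>
  <= (LINT t|lborel. \<bar>t\<bar> powr p * (cmod (char law t))^2) / pi * \<bar>v\<bar> powr p"
proof -
 interpret L: real_distribution law by (rule real_distribution_law)
 interpret P: pair_prob_space law law ..
 let ?D = "distr (law \<Otimes>\<^sub>M law) borel (\<lambda>(x, y). y - x)"
 interpret D: real_distribution ?D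
  by (rule P.real_distribution_distr) measurable
 have char_D: "char ?D t = complex_of_real ((cmod (char law t))^2)" for t
 proof -
  have "char ?D t = (LINT z|(law \<Otimes>\<^sub>M law). iexp (t * snd z) * iexp (- t * fst z))"
   unfolding char_def by (subst integral_distr) (auto simp: split_beta' exp_add[symmetric] algebra_simps)
  also have "... = (LINT x|law. LINT y|law. iexp (t * y) * iexp (- t * x))"
  proof (subst P.integral_fst'[symmetric])
   show "integrable (law \<Otimes>\<^sub>M law) (\<lambda>z. iexp (t * snd z) * iexp (- t * fst z))"
    by (rule P.integrable_const_bound[where B = 1]) (auto simp: norm_mult)
  qed simp
  also have "... = char law t * char law (- t)"
   by (simp add: char_def)
  finally show ?thesis
   by (simp only: char_uminus_cnj complex_norm_square)
 qed
 have intD: "integrable lborel (char ?D)"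
 proof -
  have "char ?D = (\<lambda>t. complex_of_real ((cmod (char law t))^2))" using char_D by blast
  then show ?thesis using integrable_of_real[OF sq, where ?'a = complex] by simp
 qed
 let ?q = "inv_char ?D"
 have ae: "AE v in lborel. autocorr f v = ?q v"
 proof -
  have "density lborel (\<lambda>v. ennreal (autocorr f v)) = density lborel (\<lambda>v. ennreal (?q v))"
   using D.density_inv_char[OF intD] autocorr_law by simp
  then have "AE v in lborel. ennreal (autocorr f v) = ennreal (?q v)"
   using D.inv_char_measurable[OF intD] by (subst (asm) sigma_finite_measure.density_unique_iff[OF sigma_finite_lborel]) auto
  then show ?thesis
   by eventually_elim (auto simp: autocorr_nonneg D.inv_char_nonneg[OF intD])
 qed
 \<comment> \<open>A null set contains no interval, so points of agreement accumulate at 0;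
   continuity of both functions at 0 then identifies their values there.\<close>
 have "\<exists>v. 0 < v \<and> v < 1 / real (Suc n) \<and> autocorr f v = ?q v" for n
 proof (rule ccontr)
  assume "\<not> ?thesis"
  then have "AE v in lborel. v \<notin> {0<..<1 / real (Suc n)}"
   using ae by (auto elim!: eventually_mono)
  then have "emeasure lborel {0<..<1 / real (Suc n)} = 0"
   by (subst (asm) AE_iff_measurable[where N = "{0<..<1 / real (Suc n)}"]) auto
  then show False by simp
 qed
 then obtain v where v: "\<And>n. 0 < v n" "\<And>n. v n < 1 / real (Suc n)" "\<And>n. autocorr f (v n) = ?q (v n)"
  by metis
 have v0: "v ----> 0"
  by (rule tendsto_sandwich[OF _ _ tendsto_const LIMSEQ_inverse_real_of_nat])
   (use v in \<open>auto intro!: always_eventually less_imp_le simp: inverse_eq_divide\<close>)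
 have "(\<lambda>n. ?q (v n)) ----> ?q 0"
  using D.isCont_inv_char[OF intD, of 0] v0 by (metis continuous_at_sequentially comp_def isCont_tendsto_compose)
 with autocorr_tendsto[OF v0] have zero: "autocorr f 0 = ?q 0"
  unfolding v(3) using LIMSEQ_unique by blast
 show ?thesis
  using ae
 proof eventually_elim
  case (elim w)
  have i1: "integrable lborel (\<lambda>t. (cmod (char law t))^2 * cos (t * w))"
   by (rule integrable_bound[OF sq]) (auto simp: abs_mult mult_left_le)
  have q: "2 * pi * ?q w = (LINT t|lborel. (cmod (char law t))^2 * cos (t * w))" for w
  proof -
   have "2 * pi * ?q w = Re (LINT t|lborel. char ?D t * iexp (- (t * w)))"
    by (simp add: inv_char_def)
   also have "... = (LINT t|lborel. Re (char ?D t * iexp (- (t * w))))"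
    by (rule integral_Re[symmetric, OF D.integrable_char_iexp[OF intD]])
   also have "... = (LINT t|lborel. (cmod (char law t))^2 * cos (t * w))"
    unfolding char_D by (intro integral_cong refl) (simp add: Re_exp)
   finally show ?thesis .
  qed
  have "2 * pi * (?q 0 - ?q w) = (LINT t|lborel. (cmod (char law t))^2 * (1 - cos (t * w)))"
   using q[of 0] q[of w] i1 sq by (simp add: right_diff_distrib)
  moreover have "0 <= (LINT t|lborel. (cmod (char law t))^2 * (1 - cos (t * w)))"
   by (intro integral_nonneg) auto
  moreover have "(LINT t|lborel. (cmod (char law t))^2 * (1 - cos (t * w)))
    <= (LINT t|lborel. 2 * \<bar>w\<bar> powr p * (\<bar>t\<bar> powr p * (cmod (char law t))^2))"
  proof (rule integral_mono')
   show "(cmod (char law t))^2 * (1 - cos (t * w)) <= 2 * \<bar>w\<bar> powr p * (\<bar>t\<bar> powr p * (cmod (char law t))^2)" for t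
   proof -
    have "(cmod (char law t))^2 * (1 - cos (t * w)) <= (cmod (char law t))^2 * (2 * \<bar>t * w\<bar> powr p)"
     by (intro mult_left_mono one_minus_cos_le_powr p) auto
    then show ?thesis by (simp add: abs_mult powr_mult mult_ac)
   qed
  qed (use sob in auto)
  ultimately have "\<bar>2 * pi * (?q 0 - ?q w)\<bar> <= 2 * \<bar>w\<bar> powr p * (LINT t|lborel. (\<bar>t\<bar> powr p * (cmod (char law t))^2))"
   using sob by simp
  moreover have "\<bar>2 * pi * (?q 0 - ?q w)\<bar> = 2 * pi * \<bar>?q w - ?q 0\<bar>"
   by (simp add: abs_mult abs_minus_commute)
  ultimately have "pi * \<bar>?q w - ?q 0\<bar> <= \<bar>w\<bar> powr p * (LINT t|lborel. (\<bar>t\<bar> powr p * (cmod (char law t))^2))"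
   by linarith
  then show ?case
   unfolding elim zero by (simp add: field_simps)
 qed
qed

end

section \<open>Integral forms of Minkowski's inequality and bounded random variables\<close>

lemma ennreal_power2_le_imp_le: "x^2 <= y^2 ==> x <= (y::ennreal)"
 by (cases x; cases y) (auto simp: ennreal_power top_power_ennreal top_unique intro: power2_le_imp_le)

text \<open>The square of the inner integral is a double integral. After exchanging the order,
  Cauchy-Schwarz bounds the mixed moment of \<open>Z s\<close> and \<open>Z t\<close> by
  \<open>b s * b t\<close>, and the double integral factorises again.\<close>

lemma minkowski_nn_integral:
 assumes "sigma_finite_measure T" "sigma_finite_measure M"
  and [measurable]: "A \<in> borel_measurable T" "(\<lambda>(t, w). Z t w) \<in> borel_measurable (T \<Otimes>\<^sub>M M)" "b \<in> borel_measurable T"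
  and le: "\<And>t. t \<in> space T ==> (\<integral>\<^sup>+w. (Z t w)^2 \<partial>M) <= (b t)^2"
 shows "(\<integral>\<^sup>+w. (\<integral>\<^sup>+t. A t * Z t w \<partial>T)^2 \<partial>M) <= (\<integral>\<^sup>+t. A t * b t \<partial>T)^2"
proof -
 interpret T: sigma_finite_measure T by fact
 interpret M: sigma_finite_measure M by fact
 interpret TM: pair_sigma_finite T M ..
 have [measurable]: "(\<lambda>x. Z (f x) (g x)) \<in> borel_measurable N"
  if "f \<in> measurable N T" "g \<in> measurable N M" for f g N
  using measurable_compose[OF measurable_Pair[OF that] assms(4)] by simp
 have "(\<integral>\<^sup>+w. (\<integral>\<^sup>+t. A t * Z t w \<partial>T)^2 \<partial>M) = (\<integral>\<^sup>+w. \<integral>\<^sup>+s. \<integral>\<^sup>+t. A s * A t * (Z s w * Z t w) \<partial>T \<partial>T \<partial>M)"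
 proof (intro nn_integral_cong)
  fix w assume [measurable]: "w \<in> space M"
  have "(\<integral>\<^sup>+s. \<integral>\<^sup>+t. A s * A t * (Z s w * Z t w) \<partial>T \<partial>T) = (\<integral>\<^sup>+s. (A s * Z s w) * (\<integral>\<^sup>+t. A t * Z t w \<partial>T) \<partial>T)"
   by (intro nn_integral_cong, subst nn_integral_cmult[symmetric]) (auto simp: mult_ac)
  then show "(\<integral>\<^sup>+t. A t * Z t w \<partial>T)^2 = (\<integral>\<^sup>+s. \<integral>\<^sup>+t. A s * A t * (Z s w * Z t w) \<partial>T \<partial>T)"
   by (simp add: nn_integral_multc power2_eq_square)
 qed
 also have "... = (\<integral>\<^sup>+s. \<integral>\<^sup>+w. \<integral>\<^sup>+t. A s * A t * (Z s w * Z t w) \<partial>T \<partial>M \<partial>T)"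
  by (rule TM.Fubini') measurable
 also have "... = (\<integral>\<^sup>+s. \<integral>\<^sup>+t. \<integral>\<^sup>+w. A s * A t * (Z s w * Z t w) \<partial>M \<partial>T \<partial>T)"
  by (intro nn_integral_cong TM.Fubini') measurable
 also have "... <= (\<integral>\<^sup>+s. \<integral>\<^sup>+t. A s * A t * (b s * b t) \<partial>T \<partial>T)"
 proof (intro nn_integral_mono)
  fix s t assume st[measurable]: "s \<in> space T" "t \<in> space T"
  have "(\<integral>\<^sup>+w. Z s w * Z t w \<partial>M)^2 <= (\<integral>\<^sup>+w. (Z s w)^2 \<partial>M) * (\<integral>\<^sup>+w. (Z t w)^2 \<partial>M)"
   by (rule Cauchy_Schwarz_nn_integral) measurable
  also have "... <= (b s)^2 * (b t)^2" by (intro mult_mono le st) auto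
  finally have "(\<integral>\<^sup>+w. Z s w * Z t w \<partial>M)^2 <= (b s * b t)^2"
   by (simp add: power_mult_distrib)
  then have "(\<integral>\<^sup>+w. Z s w * Z t w \<partial>M) <= b s * b t"
   by (rule ennreal_power2_le_imp_le)
  then show "(\<integral>\<^sup>+w. A s * A t * (Z s w * Z t w) \<partial>M) <= A s * A t * (b s * b t)"
   by (subst nn_integral_cmult) (auto intro!: mult_left_mono)
 qed
 also have "... = (\<integral>\<^sup>+s. (A s * b s) * (\<integral>\<^sup>+t. A t * b t \<partial>T) \<partial>T)"
  by (intro nn_integral_cong, subst nn_integral_cmult[symmetric]) (auto simp: mult_ac)
 also have "... = (\<integral>\<^sup>+t. A t * b t \<partial>T)^2"
  by (simp add: nn_integral_multc power2_eq_square)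
 finally show ?thesis .
qed

lemma (in prob_space) minkowski_integral:
 fixes A :: "real => complex" and Z :: "real => 'a => complex" and b :: "real => real"
 assumes [measurable]: "A \<in> borel_measurable borel" "(\<lambda>(t, w). Z t w) \<in> borel_measurable (borel \<Otimes>\<^sub>M M)"
   "b \<in> borel_measurable borel"
  and b: "\<And>t. 0 <= b t"
  and le: "\<And>t. (\<integral>\<^sup>+w. ennreal ((cmod (Z t w))^2) \<partial>M) <= ennreal ((b t)^2)"
  and int: "integrable lborel (\<lambda>t. cmod (A t) * b t)"
 shows "(\<integral>\<^sup>+w. ennreal ((cmod (LINT t|lborel. A t * Z t w))^2) \<partial>M) <= ennreal ((LINT t|lborel. cmod (A t) * b t)^2)"
proof -
 have [measurable]: "(\<lambda>x. Z (f x) (g x)) \<in> borel_measurable N"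
  if "f \<in> borel_measurable N" "g \<in> measurable N M" for f g N
  using measurable_compose[OF measurable_Pair[OF that] assms(2)] by simp
 have "(\<integral>\<^sup>+w. ennreal ((cmod (LINT t|lborel. A t * Z t w))^2) \<partial>M)
   <= (\<integral>\<^sup>+w. (\<integral>\<^sup>+t. ennreal (cmod (A t)) * ennreal (cmod (Z t w)) \<partial>lborel)^2 \<partial>M)"
 proof (intro nn_integral_mono)
  fix w
  have "ennreal (cmod (LINT t|lborel. A t * Z t w)) <= (\<integral>\<^sup>+t. ennreal (cmod (A t * Z t w)) \<partial>lborel)"
  proof (cases "integrable lborel (\<lambda>t. A t * Z t w)")
   case True then show ?thesis by (rule integral_norm_bound_ennreal)
  \<comment> \<open>A non-integrable integrand has Bochner integral 0, so the bound holds
    trivially.\<close>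
  qed (simp add: not_integrable_integral_eq)
  then have "ennreal (cmod (LINT t|lborel. A t * Z t w)) <= (\<integral>\<^sup>+t. ennreal (cmod (A t)) * ennreal (cmod (Z t w)) \<partial>lborel)"
   by (simp add: norm_mult ennreal_mult')
  then show "ennreal ((cmod (LINT t|lborel. A t * Z t w))^2) <= (\<integral>\<^sup>+t. ennreal (cmod (A t)) * ennreal (cmod (Z t w)) \<partial>lborel)^2"
   unfolding ennreal_power[OF norm_ge_zero, symmetric] by (intro power_mono) auto
 qed
 also have "... <= (\<integral>\<^sup>+t. ennreal (cmod (A t)) * ennreal (b t) \<partial>lborel)^2"
  by (intro minkowski_nn_integral lborel.sigma_finite_measure_axioms sigma_finite_measure_axioms)
   (use le b in \<open>auto simp: ennreal_power\<close>)
 also have "(\<integral>\<^sup>+t. ennreal (cmod (A t)) * ennreal (b t) \<partial>lborel) = ennreal (LINT t|lborel. cmod (A t) * b t)"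
  using b by (subst nn_integral_eq_integral[OF int, symmetric]) (auto simp: ennreal_mult')
 finally show ?thesis
  using b by (simp add: ennreal_power)
qed

context prob_space
begin

abbreviation (input) "\<E> \<equiv> expectation"

text \<open>Nearly every random variable below is bounded. The class is closed under the algebraic
  operations and consists of integrable variables, so integrability becomes a structural check by
  \<open>bdd_rv_intros\<close>.\<close>

definition bdd_rv :: "('a => 'b::{banach, second_countable_topology}) => bool" where
 "bdd_rv f \<longleftrightarrow> f \<in> borel_measurable M \<and> (\<exists>B. \<forall>w\<in>space M. norm (f w) <= B)"

lemma bdd_rvI: "f \<in> borel_measurable M ==> (\<And>w. w \<in> space M ==> norm (f w) <= B) ==> bdd_rv f"
 unfolding bdd_rv_def by blast

lemma bdd_rv_measurable[measurable_dest]: "bdd_rv f ==> f \<in> borel_measurable M"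
 unfolding bdd_rv_def by blast

lemma bdd_rvE:
 assumes "bdd_rv f"
 obtains B where "0 <= B" "\<And>w. w \<in> space M ==> norm (f w) <= B"
proof -
 obtain B where "\<And>w. w \<in> space M ==> norm (f w) <= B"
  using assms unfolding bdd_rv_def by blast
 then show thesis
  by (intro that[of "max 0 B"]) (auto simp: le_max_iff_disj)
qed

lemma bdd_rv_integrable: "bdd_rv f ==> integrable M f"
proof -
 assume f: "bdd_rv f"
 then obtain B where "\<And>w. w \<in> space M ==> norm (f w) <= B" by (rule bdd_rvE) blast
 then show ?thesis using bdd_rv_measurable[OF f] by (intro integrable_const_bound[where B = B]) auto
qed

lemma bdd_rv_const[simp, intro]: "bdd_rv (\<lambda>_. c)"
 by (rule bdd_rvI[where B = "norm c"]) auto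

lemma bdd_rv_add: "bdd_rv f ==> bdd_rv g ==> bdd_rv (\<lambda>w. f w + g w)"
proof -
 assume fg[measurable]: "bdd_rv f" "bdd_rv g"
 obtain A B where "\<And>w. w \<in> space M ==> norm (f w) <= A" "\<And>w. w \<in> space M ==> norm (g w) <= B"
  using fg by (metis bdd_rvE)
 then show ?thesis
  by (intro bdd_rvI[where B = "A + B"]) (auto intro!: norm_triangle_mono)
qed

lemma bdd_rv_mult:
 fixes f g :: "'a => 'b::{banach, second_countable_topology, real_normed_algebra}"
 shows "bdd_rv f ==> bdd_rv g ==> bdd_rv (\<lambda>w. f w * g w)"
proof -
 assume fg[measurable]: "bdd_rv f" "bdd_rv g"
 obtain A where A: "0 <= A" "\<And>w. w \<in> space M ==> norm (f w) <= A" using fg(1) by (rule bdd_rvE) blast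
 obtain B where B: "0 <= B" "\<And>w. w \<in> space M ==> norm (g w) <= B" using fg(2) by (rule bdd_rvE) blast
 from A B show ?thesis
  by (intro bdd_rvI[where B = "A * B"]) (auto intro!: order_trans[OF norm_mult_ineq] mult_mono)
qed

lemma bdd_rv_uminus: "bdd_rv f ==> bdd_rv (\<lambda>w. - f w)"
 unfolding bdd_rv_def by auto

lemma bdd_rv_diff: "bdd_rv f ==> bdd_rv g ==> bdd_rv (\<lambda>w. f w - g w)"
 using bdd_rv_add[of f "\<lambda>w. - g w"] bdd_rv_uminus[of g] by simp

lemma bdd_rv_power:
 fixes f :: "'a => 'b::{banach, second_countable_topology, real_normed_field}"
 shows "bdd_rv f ==> bdd_rv (\<lambda>w. f w ^ n)"
 by (induction n) (auto intro: bdd_rv_mult)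

lemma bdd_rv_sum: "(\<And>i. i \<in> I ==> bdd_rv (f i)) ==> bdd_rv (\<lambda>w. \<Sum>i\<in>I. f i w)"
 by (induction I rule: infinite_finite_induct) (auto intro: bdd_rv_add)

lemma bdd_rv_norm: "bdd_rv f ==> bdd_rv (\<lambda>w. norm (f w))"
 unfolding bdd_rv_def by auto

lemma bdd_rv_Re: "bdd_rv f ==> bdd_rv (\<lambda>w. Re (f w))"
 unfolding bdd_rv_def using abs_Re_le_cmod order_trans by (auto simp: ) blast

lemma bdd_rv_Im: "bdd_rv f ==> bdd_rv (\<lambda>w. Im (f w))"
 unfolding bdd_rv_def using abs_Im_le_cmod order_trans by (auto simp: ) blast

lemma bdd_rv_of_real: "bdd_rv f ==> bdd_rv (\<lambda>w. complex_of_real (f w))"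
 unfolding bdd_rv_def by auto

lemma bdd_rv_abs: fixes f :: "'a => real" shows "bdd_rv f ==> bdd_rv (\<lambda>w. \<bar>f w\<bar>)"
 unfolding bdd_rv_def by auto

lemma bdd_rv_iexp: "f \<in> borel_measurable M ==> bdd_rv (\<lambda>w. iexp (f w))"
 by (rule bdd_rvI[where B = 1]) auto

lemmas bdd_rv_intros = bdd_rv_const bdd_rv_add bdd_rv_mult bdd_rv_uminus bdd_rv_diff
 bdd_rv_power bdd_rv_sum bdd_rv_norm bdd_rv_Re bdd_rv_Im bdd_rv_of_real bdd_rv_abs
 bdd_rv_iexp

lemma expectation_square_le:
 fixes f :: "'a => real"
 assumes f: "bdd_rv f"
 shows "(\<E> f)^2 <= \<E> (\<lambda>w. (f w)^2)"
proof -
 have "0 <= variance f" by (rule variance_positive)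
 also have "... = \<E> (\<lambda>w. (f w)^2) - (\<E> f)^2"
  by (intro variance_eq bdd_rv_integrable bdd_rv_intros f)
 finally show ?thesis by simp
qed

text \<open>Convexity of the fourth power with weights p/(p+q) and q/(p+q), applied pointwise to
  |x|/p and |y|/q, gives Minkowski's inequality in L4 after taking expectations.\<close>

lemma minkowski4_pos:
 fixes x y :: "'a => complex"
 assumes b: "bdd_rv x" "bdd_rv y" and "0 < p" "0 < q"
  and x: "\<E> (\<lambda>w. cmod (x w) ^ 4) <= p ^ 4" and y: "\<E> (\<lambda>w. cmod (y w) ^ 4) <= q ^ 4"
 shows "\<E> (\<lambda>w. cmod (x w + y w) ^ 4) <= (p + q) ^ 4"
proof -
 have conv: "convex_on UNIV (\<lambda>z::real. z ^ 4)"
  by (rule convex_power_even) simp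
 have "cmod (x w + y w) ^ 4 <= (p + q) ^ 3 * (cmod (x w) ^ 4 / p ^ 3 + cmod (y w) ^ 4 / q ^ 3)" for w
 proof -
  let ?u = "cmod (x w) / p" and ?v = "cmod (y w) / q"
  have "cmod (x w + y w) ^ 4 <= (cmod (x w) + cmod (y w)) ^ 4"
   by (intro power_mono norm_triangle_ineq) auto
  also have "cmod (x w) + cmod (y w) = (p + q) * ((p / (p + q)) * ?u + (q / (p + q)) * ?v)"
   using add_pos_pos[OF assms(3,4)] assms(3,4) by (simp add: distrib_left)
  also have "... ^ 4 = (p + q) ^ 4 * ((p / (p + q)) * ?u + (q / (p + q)) * ?v) ^ 4"
   by (simp only: power_mult_distrib)
  also have "... <= (p + q) ^ 4 * ((p / (p + q)) * ?u ^ 4 + (q / (p + q)) * ?v ^ 4)"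
   using assms(3,4) convex_onD[OF conv, of "q / (p + q)" ?u ?v]
   by (intro mult_left_mono) (auto simp: add_divide_distrib[symmetric] field_simps)
  also have "... = (p + q) ^ 3 * (cmod (x w) ^ 4 / p ^ 3 + cmod (y w) ^ 4 / q ^ 3)"
  proof -
   have "(p + q) ^ 4 * (p / (p + q)) = (p + q) ^ 3 * p" "(p + q) ^ 4 * (q / (p + q)) = (p + q) ^ 3 * q"
    using assms(3,4) by (simp_all add: eval_nat_numeral)
   moreover have "p * ?u ^ 4 = cmod (x w) ^ 4 / p ^ 3" "q * ?v ^ 4 = cmod (y w) ^ 4 / q ^ 3"
    using assms(3,4) by (simp_all add: eval_nat_numeral)
   ultimately show ?thesis
    by (simp only: distrib_left mult.assoc[symmetric]) (simp only: mult.assoc)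
  qed
  finally show ?thesis .
 qed
 then have "\<E> (\<lambda>w. cmod (x w + y w) ^ 4)
   <= \<E> (\<lambda>w. (p + q) ^ 3 * (cmod (x w) ^ 4 / p ^ 3 + cmod (y w) ^ 4 / q ^ 3))"
  unfolding divide_inverse by (intro integral_mono bdd_rv_integrable bdd_rv_intros b) auto
 also have "... = (p + q) ^ 3 * (\<E> (\<lambda>w. cmod (x w) ^ 4) / p ^ 3 + \<E> (\<lambda>w. cmod (y w) ^ 4) / q ^ 3)"
 proof -
  have "integrable M (\<lambda>w. cmod (x w) ^ 4)" "integrable M (\<lambda>w. cmod (y w) ^ 4)"
   by (intro bdd_rv_integrable bdd_rv_intros b)+
  then show ?thesis by simp
 qed
 also have "... <= (p + q) ^ 3 * (p ^ 4 / p ^ 3 + q ^ 4 / q ^ 3)"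
  using assms(3,4) by (intro mult_left_mono add_mono divide_right_mono x y) auto
 also have "... = (p + q) ^ 4"
  using assms(3,4) by (simp add: eval_nat_numeral)
 finally show ?thesis .
qed

text \<open>Zero bounds are reached by raising p and q by 1/(n+1) and letting n tend to
  infinity.\<close>

lemma minkowski4:
 fixes x y :: "'a => complex"
 assumes b: "bdd_rv x" "bdd_rv y" and "0 <= p" "0 <= q"
  and x: "\<E> (\<lambda>w. cmod (x w) ^ 4) <= p ^ 4" and y: "\<E> (\<lambda>w. cmod (y w) ^ 4) <= q ^ 4"
 shows "\<E> (\<lambda>w. cmod (x w + y w) ^ 4) <= (p + q) ^ 4"
proof (rule LIMSEQ_le_const)
 show "(\<lambda>n. (p + inverse (real (Suc n)) + (q + inverse (real (Suc n)))) ^ 4) ----> (p + q) ^ 4"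
  by (rule tendsto_eq_intros LIMSEQ_inverse_real_of_nat refl)+ simp
 show "\<exists>N. \<forall>n\<ge>N. \<E> (\<lambda>w. cmod (x w + y w) ^ 4) <= (p + inverse (real (Suc n)) + (q + inverse (real (Suc n)))) ^ 4"
 proof (intro exI allI impI minkowski4_pos b)
  fix n
  show "\<E> (\<lambda>w. cmod (x w) ^ 4) <= (p + inverse (real (Suc n))) ^ 4"
   using x by (rule order_trans) (use assms(3) in \<open>auto intro!: power_mono\<close>)
  show "\<E> (\<lambda>w. cmod (y w) ^ 4) <= (q + inverse (real (Suc n))) ^ 4"
   using y by (rule order_trans) (use assms(4) in \<open>auto intro!: power_mono\<close>)
 qed (use assms(3,4) in \<open>auto intro!: add_nonneg_pos\<close>)
qed

lemma minkowski4_sum: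
 fixes x :: "'i => 'a => complex"
 assumes "\<And>i. i \<in> I ==> bdd_rv (x i)" "\<And>i. i \<in> I ==> 0 <= p i"
  and "\<And>i. i \<in> I ==> \<E> (\<lambda>w. cmod (x i w) ^ 4) <= p i ^ 4"
 shows "\<E> (\<lambda>w. cmod (\<Sum>i\<in>I. x i w) ^ 4) <= (\<Sum>i\<in>I. p i) ^ 4"
 using assms
proof (induction I rule: infinite_finite_induct)
 case (insert i I)
 then show ?case
  by (simp, intro minkowski4) (auto intro!: bdd_rv_sum sum_nonneg)
qed auto

end

section \<open>Innovations, independence over disjoint index sets, and a fourth-moment martingale
  bound\<close>

locale noise = prob_space M for M :: "'a measure" +
 fixes \<epsilon> :: "int => 'a => real" and \<phi> :: "real => complex" and \<gamma> c_4 :: real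
 assumes indep: "indep_vars (\<lambda>_. borel) \<epsilon> UNIV"
  and ident: "\<And>k. distr M borel (\<epsilon> k) = distr M borel (\<epsilon> 1)"
  and phi_eq: "\<phi> = char (distr M borel (\<epsilon> 1))"
  and gamma: "0 < \<gamma>" "\<gamma> <= 1"
  and phi_integrable: "integrable lborel (\<lambda>t. \<bar>t\<bar> powr (2 * \<gamma>) * (cmod (\<phi> t))^2)"
  and phi_fourth: "\<And>t. (LINT w|M. cmod (iexp (t * \<epsilon> 1 w) - \<phi> t) ^ 4)
             <= c_4 * min (\<bar>t\<bar> powr (4 * \<gamma>)) 1"
begin

lemma eps_measurable[measurable]: "\<epsilon> k \<in> borel_measurable M"
 using indep unfolding indep_vars_def by auto

text \<open>The sigma-algebra generated by the innovations with index in A. Measurability with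
  respect to it records which innovations a variable uses, so independence is reduced to
  disjointness of index sets.\<close>

definition noise_alg :: "int set => 'a measure" where
 "noise_alg A = vimage_algebra (space M) (\<lambda>w. restrict (\<lambda>k. \<epsilon> k w) A) (PiM A (\<lambda>_. borel))"

lemma space_noise_alg[simp]: "space (noise_alg A) = space M"
 by (simp add: noise_alg_def)

lemma restrict_noise_measurable: "(\<lambda>w. restrict (\<lambda>k. \<epsilon> k w) A) \<in> measurable M (PiM A (\<lambda>_. borel))"
 by (intro measurable_restrict) auto

lemma measurable_noise_algD: "V \<in> measurable (noise_alg A) N ==> V \<in> measurable M N"
proof -
 have "(\<lambda>w. w) \<in> measurable M (noise_alg A)"
  unfolding noise_alg_def
  by (rule measurable_vimage_algebra2) (use restrict_noise_measurable in auto)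
 then show "V \<in> measurable (noise_alg A) N ==> V \<in> measurable M N"
  by (drule measurable_compose) auto
qed

lemma eps_noise_alg: "k \<in> A ==> \<epsilon> k \<in> borel_measurable (noise_alg A)"
proof -
 assume k: "k \<in> A"
 have "(\<lambda>w. restrict (\<lambda>k. \<epsilon> k w) A) \<in> measurable (noise_alg A) (PiM A (\<lambda>_. borel))"
  unfolding noise_alg_def by (rule measurable_vimage_algebra1) (auto simp: space_PiM)
 from measurable_compose[OF this measurable_component_singleton[OF k]] show ?thesis
  using k by simp
qed

lemma noise_alg_mono: "A \<subseteq> B ==> V \<in> measurable (noise_alg A) N ==> V \<in> measurable (noise_alg B) N"
proof -
 assume "A \<subseteq> B"
 then have "(\<lambda>w. w) \<in> measurable (noise_alg B) (noise_alg A)"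
  unfolding noise_alg_def[of A]
  by (intro measurable_vimage_algebra2 measurable_restrict eps_noise_alg) (auto simp: noise_alg_def)
 then show "V \<in> measurable (noise_alg A) N ==> V \<in> measurable (noise_alg B) N"
  by (drule measurable_compose) auto
qed

lemma indep_noise_alg:
 assumes "A \<inter> B = {}" "V \<in> measurable (noise_alg A) N1" "U \<in> measurable (noise_alg B) N2"
 shows "indep_var N1 V N2 U"
proof -
 let ?R = "\<lambda>A w. restrict (\<lambda>k. \<epsilon> k w) A" and ?P = "\<lambda>A. PiM A (\<lambda>_::int. borel :: real measure)"
 let ?G = "\<lambda>A. sigma_sets (space M) {?R A -` S \<inter> space M |S. S \<in> sets (?P A)}"
 have "indep_var (?P A) (?R A) (?P B) (?R B)"
  by (rule indep_var_restrict[OF indep]) (use assms in auto)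
 then have ind: "indep_set (?G A) (?G B)"
  by (simp add: indep_var_eq)
 have sub: "sigma_sets (space M) {V -` S \<inter> space M |S. S \<in> sets N} \<subseteq> ?G A"
  if "V \<in> measurable (noise_alg A) N" for V :: "'a => 'z" and N A
 proof -
  have "V -` S \<inter> space M \<in> ?G A" if S: "S \<in> sets N" for S
   using measurable_sets[OF \<open>V \<in> measurable (noise_alg A) N\<close> S]
   by (simp add: noise_alg_def sets_vimage_algebra)
  then show ?thesis by (intro sigma_sets_mono) auto
 qed
 have "indep_set (sigma_sets (space M) {V -` S \<inter> space M |S. S \<in> sets N1}) (sigma_sets (space M) {U -` S \<inter> space M |S. S \<in> sets N2})"
  using ind sub[OF assms(2)] sub[OF assms(3)] unfolding indep_sets2_eq by blast
 then show ?thesis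
  using assms(2,3) by (simp add: indep_var_eq measurable_noise_algD)
qed

lemma joint_distr_noise_alg:
 assumes "A \<inter> B = {}" and V: "V \<in> measurable (noise_alg A) N1" and U: "U \<in> measurable (noise_alg B) N2"
 shows "distr M (N1 \<Otimes>\<^sub>M N2) (\<lambda>x. (V x, U x)) = distr M N1 V \<Otimes>\<^sub>M distr M N2 U"
proof -
 have [measurable]: "V \<in> measurable M N1" "U \<in> measurable M N2"
  using V U by (auto dest: measurable_noise_algD)
 interpret D1: prob_space "distr M N1 V" by (rule prob_space_distr) simp
 interpret D2: prob_space "distr M N2 U" by (rule prob_space_distr) simp
 show ?thesis
 proof (rule pair_measure_eqI[symmetric])
  fix S T assume "S \<in> sets (distr M N1 V)" "T \<in> sets (distr M N2 U)"
  then have S[measurable]: "S \<in> sets N1" and T[measurable]: "T \<in> sets N2" by auto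
  have 1: "(indicator S :: _ => real) \<in> borel_measurable N1" "(indicator T :: _ => real) \<in> borel_measurable N2"
   by measurable
  \<comment> \<open>\<open>indep_var\<close> relates variables with values in one type, whereas V
    and U may differ in type; real-valued indicators bring both to a common one.\<close>
  have "indep_var borel (\<lambda>x. indicator S (V x) :: real) borel (\<lambda>x. indicator T (U x) :: real)"
   by (rule indep_noise_alg[OF assms(1)]) (use measurable_compose[OF V 1(1)] measurable_compose[OF U 1(2)] in auto)
  from indep_varD[OF this, of "{1}" "{1}"]
  have "prob (V -` S \<inter> U -` T \<inter> space M) = prob (V -` S \<inter> space M) * prob (U -` T \<inter> space M)"
   by (simp add: vimage_def indicator_def Int_def cong: if_cong rev_conj_cong)
  then have "emeasure M (V -` S \<inter> U -` T \<inter> space M) = emeasure M (V -` S \<inter> space M) * emeasure M (U -` T \<inter> space M)"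
   by (simp add: emeasure_eq_measure ennreal_mult'')
  moreover have "(\<lambda>x. (V x, U x)) -` (S \<times> T) \<inter> space M = V -` S \<inter> U -` T \<inter> space M" by auto
  ultimately show "emeasure (distr M N1 V) S * emeasure (distr M N2 U) T = emeasure (distr M (N1 \<Otimes>\<^sub>M N2) (\<lambda>x. (V x, U x))) (S \<times> T)"
   by (simp add: emeasure_distr)
 qed (auto simp: D1.sigma_finite_measure_axioms D2.sigma_finite_measure_axioms cong: sets_pair_measure_cong)
qed

text \<open>The value of V is frozen while the independent U is integrated out. This and
  \<open>freeze\<close> play the role of conditional expectation given the innovations in A.\<close>

lemma freeze_nn:
 assumes "A \<inter> B = {}" "V \<in> measurable (noise_alg A) N1" "U \<in> measurable (noise_alg B) N2"
  and [measurable]: "(\<lambda>(v, u). F v u) \<in> borel_measurable (N1 \<Otimes>\<^sub>M N2)"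
 shows "(\<integral>\<^sup>+w. F (V w) (U w) \<partial>M) = (\<integral>\<^sup>+w. (\<integral>\<^sup>+u. F (V w) u \<partial>distr M N2 U) \<partial>M)"
proof -
 have [measurable]: "V \<in> measurable M N1" "U \<in> measurable M N2"
  using assms(2,3) by (auto dest: measurable_noise_algD)
 interpret D: prob_space "distr M N2 U" by (rule prob_space_distr) simp
 have eq: "distr M (N1 \<Otimes>\<^sub>M N2) (\<lambda>x. (V x, U x)) = distr M N1 V \<Otimes>\<^sub>M distr M N2 U"
  by (rule joint_distr_noise_alg[OF assms(1-3)])
 have "(\<integral>\<^sup>+w. F (V w) (U w) \<partial>M) = (\<integral>\<^sup>+z. F (fst z) (snd z) \<partial>distr M (N1 \<Otimes>\<^sub>M N2) (\<lambda>x. (V x, U x)))"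
  by (subst nn_integral_distr) auto
 also have "... = (\<integral>\<^sup>+v. (\<integral>\<^sup>+u. F v u \<partial>distr M N2 U) \<partial>distr M N1 V)"
  unfolding eq by (subst D.nn_integral_fst[symmetric]) (auto simp: split_beta')
 also have "... = (\<integral>\<^sup>+w. (\<integral>\<^sup>+u. F (V w) u \<partial>distr M N2 U) \<partial>M)"
  by (subst nn_integral_distr) auto
 finally show ?thesis .
qed

lemma freeze:
 fixes F :: "'v => 'u => 'b::{banach, second_countable_topology}"
 assumes "A \<inter> B = {}" "V \<in> measurable (noise_alg A) N1" "U \<in> measurable (noise_alg B) N2"
  and [measurable]: "(\<lambda>(v, u). F v u) \<in> borel_measurable (N1 \<Otimes>\<^sub>M N2)"
  and bnd: "\<And>v u. norm (F v u) <= C"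
 shows "(LINT w|M. F (V w) (U w)) = (LINT w|M. (LINT u|distr M N2 U. F (V w) u))"
proof -
 have [measurable]: "V \<in> measurable M N1" "U \<in> measurable M N2"
  using assms(2,3) by (auto dest: measurable_noise_algD)
 interpret D: prob_space "distr M N2 U" by (rule prob_space_distr) simp
 interpret D1: prob_space "distr M N1 V" by (rule prob_space_distr) simp
 interpret P: pair_prob_space "distr M N1 V" "distr M N2 U" ..
 have eq: "distr M (N1 \<Otimes>\<^sub>M N2) (\<lambda>x. (V x, U x)) = distr M N1 V \<Otimes>\<^sub>M distr M N2 U"
  by (rule joint_distr_noise_alg[OF assms(1-3)])
 have "(LINT w|M. F (V w) (U w)) = (LINT z|distr M (N1 \<Otimes>\<^sub>M N2) (\<lambda>x. (V x, U x)). F (fst z) (snd z))"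
  by (subst integral_distr) auto
 also have "... = (LINT v|distr M N1 V. (LINT u|distr M N2 U. F v u))"
  unfolding eq
 proof (subst P.integral_fst'[symmetric])
  show "integrable (distr M N1 V \<Otimes>\<^sub>M distr M N2 U) (\<lambda>z. F (fst z) (snd z))"
   by (rule P.integrable_const_bound[where B = C]) (auto simp: bnd split_beta')
 qed simp
 also have "... = (LINT w|M. (LINT u|distr M N2 U. F (V w) u))"
  by (subst integral_distr) auto
 finally show ?thesis .
qed

lemma expectation_indep_mult:
 fixes V U :: "'a => complex"
 assumes "A \<inter> B = {}" "V \<in> borel_measurable (noise_alg A)" "U \<in> borel_measurable (noise_alg B)"
  and "bdd_rv V" "bdd_rv U"
 shows "(LINT w|M. V w * U w) = (LINT w|M. V w) * (LINT w|M. U w)"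
 by (intro indep_var_lebesgue_integral indep_noise_alg[OF assms(1-3)] bdd_rv_integrable assms(4,5))

sublocale law1: real_distribution "distr M borel (\<epsilon> 1)"
 by (rule real_distribution_distr) simp

lemma phi_measurable[measurable]: "\<phi> \<in> borel_measurable borel"
 unfolding phi_eq by simp

lemma phi_le_1: "cmod (\<phi> t) <= 1"
 unfolding phi_eq by (rule law1.cmod_char_le_1)

lemma expectation_eps:
 fixes g :: "real => 'b::{banach, second_countable_topology}"
 assumes [measurable]: "g \<in> borel_measurable borel"
 shows "(LINT w|M. g (\<epsilon> k w)) = (LINT w|M. g (\<epsilon> 1 w))"
proof -
 have "(LINT w|M. g (\<epsilon> k w)) = (LINT x|distr M borel (\<epsilon> k). g x)"
  by (simp add: integral_distr)
 also have "... = (LINT w|M. g (\<epsilon> 1 w))"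
  unfolding ident[of k] by (simp add: integral_distr)
 finally show ?thesis .
qed

lemma nn_expectation_eps:
 assumes [measurable]: "g \<in> borel_measurable borel"
 shows "(\<integral>\<^sup>+w. g (\<epsilon> k w) \<partial>M) = (\<integral>\<^sup>+w. g (\<epsilon> 1 w) \<partial>M)"
proof -
 have "(\<integral>\<^sup>+w. g (\<epsilon> k w) \<partial>M) = (\<integral>\<^sup>+x. g x \<partial>distr M borel (\<epsilon> k))"
  by (simp add: nn_integral_distr)
 also have "... = (\<integral>\<^sup>+w. g (\<epsilon> 1 w) \<partial>M)"
  unfolding ident[of k] by (simp add: nn_integral_distr)
 finally show ?thesis .
qed

lemma expectation_iexp_eps: "(LINT w|M. iexp (t * \<epsilon> k w)) = \<phi> t"
 by (subst expectation_eps[where g = "\<lambda>x. iexp (t * x)"]) (simp_all add: phi_eq char_def integral_distr)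

lemma phi_fourth': "(LINT w|M. cmod (iexp (t * \<epsilon> k w) - \<phi> t) ^ 4) <= c_4 * min (\<bar>t\<bar> powr (4 * \<gamma>)) 1"
 using phi_fourth[of t] by (subst expectation_eps[where g = "\<lambda>x. cmod (iexp (t * x) - \<phi> t) ^ 4"]) auto

lemma c4_nonneg: "0 <= c_4"
proof -
 have "0 <= (LINT w|M. cmod (iexp (1 * \<epsilon> 1 w) - \<phi> 1) ^ 4)"
  by (rule integral_nonneg) auto
 from order_trans[OF this phi_fourth[of 1]] show ?thesis by simp
qed

text \<open>Indices are added in decreasing order, so the new innovation
  \<open>\<epsilon> (i - m)\<close> is older than every innovation in \<open>Y i\<close> and in the
  sum S built so far, hence independent of both. In the expansion of (S + d)^4 the term S^3 d
  therefore has mean 0, and the expectation of S^2 |\<zeta>|^2 factorises.\<close>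

lemma martingale4_real:
 fixes Y :: "int => 'a => complex" and \<zeta> :: "real => complex"
 assumes "finite I" and Y: "\<And>i. i \<in> I ==> Y i \<in> borel_measurable (noise_alg {i - m<..i})"
  and Y1: "\<And>i w. i \<in> I ==> cmod (Y i w) <= 1"
  and [measurable]: "\<zeta> \<in> borel_measurable borel" and \<zeta>B: "\<And>x. cmod (\<zeta> x) <= B"
  and mean: "(LINT w|M. \<zeta> (\<epsilon> 1 w)) = 0" and fourth: "(LINT w|M. cmod (\<zeta> (\<epsilon> 1 w)) ^ 4) <= \<beta> ^ 4"
  and "0 <= \<beta>" "0 <= m"
 shows "\<E> (\<lambda>w. (\<Sum>i\<in>I. Re (Y i w * \<zeta> (\<epsilon> (i - m) w))) ^ 4) <= 16 * (real (card I))^2 * \<beta> ^ 4"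
 using assms(1) Y Y1
proof (induction I rule: finite_linorder_min_induct)
 case (insert i I)
 note Y = insert.prems(1) and Y1 = insert.prems(2)
 define S where "S w = (\<Sum>i\<in>I. Re (Y i w * \<zeta> (\<epsilon> (i - m) w)))" for w
 define k where "k = real (card I)"
 let ?z = "\<lambda>w. \<zeta> (\<epsilon> (i - m) w)"
 let ?d = "\<lambda>w. Re (Y i w * ?z w)"
 let ?A = "{i - m<..}" and ?B = "{i - m}"
 have [measurable]: "Y j \<in> borel_measurable (noise_alg ?A)" if "j \<in> insert i I" for j
  using Y[OF that] by (rule noise_alg_mono[rotated]) (use that insert.hyps in fastforce)
 have zB[measurable]: "?z \<in> borel_measurable (noise_alg ?B)"
  using eps_noise_alg[of "i - m" ?B] by measurable
 have S_meas[measurable]: "S \<in> borel_measurable (noise_alg ?A)"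
 proof -
  have "(\<lambda>w. \<zeta> (\<epsilon> (j - m) w)) \<in> borel_measurable (noise_alg ?A)" if "j \<in> I" for j
  proof -
   have "j - m \<in> ?A" using bspec[OF insert.hyps(2) that] by simp
   from eps_noise_alg[OF this] show ?thesis by measurable
  qed
  then show ?thesis unfolding S_def by (intro borel_measurable_sum borel_measurable_Re borel_measurable_times) auto
 qed
 have bY: "bdd_rv (Y j)" if "j \<in> insert i I" for j
  using Y[OF that] Y1[OF that] by (intro bdd_rvI[where B = 1]) (auto dest: measurable_noise_algD)
 have bz: "bdd_rv (\<lambda>w. \<zeta> (\<epsilon> j w))" for j
  using \<zeta>B by (intro bdd_rvI[where B = B]) auto
 have bS: "bdd_rv S" unfolding S_def by (intro bdd_rv_intros bY bz) auto
 note b = bY[of i, simplified] bz bS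
 have IH: "\<E> (\<lambda>w. S w ^ 4) <= 16 * k^2 * \<beta> ^ 4"
  using insert.IH Y Y1 unfolding S_def k_def by simp
 have z4: "\<E> (\<lambda>w. cmod (?z w) ^ 4) <= \<beta> ^ 4"
  using fourth by (subst expectation_eps[where g = "\<lambda>x. cmod (\<zeta> x) ^ 4"]) auto
 have z2: "\<E> (\<lambda>w. (cmod (?z w))^2) <= \<beta>^2"
 proof (rule power2_le_imp_le)
  have "(\<E> (\<lambda>w. (cmod (?z w))^2))^2 <= \<E> (\<lambda>w. ((cmod (?z w))^2)^2)"
   by (intro expectation_square_le bdd_rv_intros b)
  then show "(\<E> (\<lambda>w. (cmod (?z w))^2))^2 <= (\<beta>^2)^2"
   using z4 by simp
 qed auto
 have S2: "\<E> (\<lambda>w. (S w)^2) <= 4 * k * \<beta>^2"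
 proof (rule power2_le_imp_le)
  have "(\<E> (\<lambda>w. (S w)^2))^2 <= \<E> (\<lambda>w. ((S w)^2)^2)"
   by (intro expectation_square_le bdd_rv_intros b)
  then show "(\<E> (\<lambda>w. (S w)^2))^2 <= (4 * k * \<beta>^2)^2"
   using IH by (simp add: power_mult_distrib)
 qed (simp add: k_def)
 have cross: "\<E> (\<lambda>w. S w ^ 3 * ?d w) = 0"
 proof -
  have "\<E> (\<lambda>w. S w ^ 3 * ?d w) = Re (LINT w|M. (complex_of_real (S w ^ 3) * Y i w) * ?z w)"
   by (subst integral_Re[symmetric]) (auto intro!: bdd_rv_integrable bdd_rv_intros b integral_cong simp: algebra_simps)
  also have "(LINT w|M. (complex_of_real (S w ^ 3) * Y i w) * ?z w) = (LINT w|M. (complex_of_real (S w ^ 3) * Y i w)) * (LINT w|M. ?z w)"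
   by (rule expectation_indep_mult[where A = ?A and B = ?B])
    (auto intro!: bdd_rv_intros b borel_measurable_times borel_measurable_power measurable_compose[OF _ borel_measurable_of_real] S_meas zB)
  also have "(LINT w|M. ?z w) = 0"
   using mean by (subst expectation_eps) auto
  finally show ?thesis by simp
 qed
 have sq: "\<E> (\<lambda>w. (S w)^2 * (cmod (?z w))^2) <= 4 * k * \<beta> ^ 4"
 proof -
  have "\<E> (\<lambda>w. (S w)^2 * (cmod (?z w))^2) = \<E> (\<lambda>w. (S w)^2) * \<E> (\<lambda>w. (cmod (?z w))^2)"
   by (intro indep_var_lebesgue_integral indep_noise_alg[where A = ?A and B = ?B] bdd_rv_integrable bdd_rv_intros b) measurable
  also have "... <= (4 * k * \<beta>^2) * \<beta>^2"
   by (intro mult_mono S2 z2 integral_nonneg) (auto simp: k_def)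
  finally show ?thesis by (simp add: eval_nat_numeral mult_ac)
 qed
 have pt: "(S w + ?d w) ^ 4 <= S w ^ 4 + 4 * (S w ^ 3 * ?d w) + 8 * ((S w)^2 * (cmod (?z w))^2) + 3 * cmod (?z w) ^ 4" for w
 proof -
  let ?s = "S w" and ?e = "?d w"
  have "\<bar>?e\<bar> <= cmod (Y i w * ?z w)" by (rule abs_Re_le_cmod)
  also have "... <= 1 * cmod (?z w)" unfolding norm_mult by (intro mult_right_mono Y1) auto
  finally have e: "\<bar>?e\<bar> <= cmod (?z w)" by simp
  have e2: "?e^2 <= (cmod (?z w))^2" using e by (metis abs_le_square_iff abs_norm_cancel)
  have e4: "?e ^ 4 <= cmod (?z w) ^ 4"
   using power_mono[OF e2, of 2] by simp
  \<comment> \<open>The cubic term is absorbed by its neighbours, which raises their coefficients 6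
    and 1 to 8 and 3.\<close>
  have "4 * (?s * ?e ^ 3) <= 2 * (?s^2 * ?e^2) + 2 * ?e ^ 4"
  proof -
   have "0 <= 2 * (?s * ?e - ?e^2)^2" by simp
   then show ?thesis by (simp add: power2_eq_square eval_nat_numeral algebra_simps)
  qed
  moreover have "(?s + ?e) ^ 4 = ?s ^ 4 + 4 * (?s ^ 3 * ?e) + 6 * (?s^2 * ?e^2) + 4 * (?s * ?e ^ 3) + ?e ^ 4"
   by (simp add: power2_eq_square eval_nat_numeral algebra_simps)
  moreover have "?s^2 * ?e^2 <= ?s^2 * (cmod (?z w))^2"
   by (intro mult_left_mono e2) auto
  ultimately show ?thesis using e4 by linarith
 qed
 have "\<E> (\<lambda>w. (\<Sum>i\<in>insert i I. Re (Y i w * \<zeta> (\<epsilon> (i - m) w))) ^ 4) = \<E> (\<lambda>w. (S w + ?d w) ^ 4)"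
  using insert.hyps unfolding S_def by (subst sum.insert) (auto simp: add.commute)
 also have "... <= \<E> (\<lambda>w. S w ^ 4 + 4 * (S w ^ 3 * ?d w) + 8 * ((S w)^2 * (cmod (?z w))^2) + 3 * cmod (?z w) ^ 4)"
  by (intro integral_mono pt bdd_rv_integrable bdd_rv_intros b)
 also have "... = \<E> (\<lambda>w. S w ^ 4) + 4 * \<E> (\<lambda>w. S w ^ 3 * ?d w)
   + 8 * \<E> (\<lambda>w. (S w)^2 * (cmod (?z w))^2) + 3 * \<E> (\<lambda>w. cmod (?z w) ^ 4)"
 proof -
  have "integrable M (\<lambda>w. S w ^ 4)" "integrable M (\<lambda>w. S w ^ 3 * ?d w)"
   "integrable M (\<lambda>w. (S w)^2 * (cmod (?z w))^2)" "integrable M (\<lambda>w. cmod (?z w) ^ 4)"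
   by (intro bdd_rv_integrable bdd_rv_intros b)+
  then show ?thesis by simp
 qed
 also have "... <= 16 * k^2 * \<beta> ^ 4 + 4 * 0 + 8 * (4 * k * \<beta> ^ 4) + 3 * \<beta> ^ 4"
  using IH cross sq z4 by simp
 \<comment> \<open>The induction closes because 16 k^2 + 32 k + 3 is at most 16 (k + 1)^2.\<close>
 also have "... <= 16 * (k + 1)^2 * \<beta> ^ 4"
  using zero_le_power[OF \<open>0 <= \<beta>\<close>, of 4] by (simp add: power2_eq_square algebra_simps)
 also have "k + 1 = real (card (insert i I))"
  using insert.hyps by (subst card_insert_disjoint) (auto simp: k_def)
 finally show ?case .
qed simp

text \<open>Real and imaginary parts are treated separately, with Im z = Re (- i z). The resulting
  factor 64 is rounded up to 4^4 so that the bound is a fourth power, as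
  \<open>minkowski4_sum\<close> expects.\<close>

lemma martingale4:
 fixes Y :: "int => 'a => complex" and \<zeta> :: "real => complex"
 assumes "finite I" and Y: "\<And>i. i \<in> I ==> Y i \<in> borel_measurable (noise_alg {i - m<..i})"
  and Y1: "\<And>i w. i \<in> I ==> cmod (Y i w) <= 1"
  and [measurable]: "\<zeta> \<in> borel_measurable borel" and \<zeta>B: "\<And>x. cmod (\<zeta> x) <= B"
  and mean: "(LINT w|M. \<zeta> (\<epsilon> 1 w)) = 0" and fourth: "(LINT w|M. cmod (\<zeta> (\<epsilon> 1 w)) ^ 4) <= \<beta> ^ 4"
  and "0 <= \<beta>" "0 <= m"
 shows "\<E> (\<lambda>w. cmod (\<Sum>i\<in>I. Y i w * \<zeta> (\<epsilon> (i - m) w)) ^ 4) <= (4 * sqrt (real (card I)) * \<beta>) ^ 4"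
proof -
 let ?S = "\<lambda>w. \<Sum>i\<in>I. Y i w * \<zeta> (\<epsilon> (i - m) w)"
 have bY: "bdd_rv (Y j)" if "j \<in> I" for j
  using Y[OF that] Y1[OF that] by (intro bdd_rvI[where B = 1]) (auto dest: measurable_noise_algD)
 have bz: "bdd_rv (\<lambda>w. \<zeta> (\<epsilon> j w))" for j
  using \<zeta>B by (intro bdd_rvI[where B = B]) auto
 have bS: "bdd_rv ?S" by (intro bdd_rv_intros bY bz)
 have 1: "\<E> (\<lambda>w. Re (?S w) ^ 4) <= 16 * (real (card I))^2 * \<beta> ^ 4"
  using martingale4_real[OF assms] by simp
 have "\<E> (\<lambda>w. (\<Sum>i\<in>I. Re ((- \<i> * Y i w) * \<zeta> (\<epsilon> (i - m) w))) ^ 4) <= 16 * (real (card I))^2 * \<beta> ^ 4"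
  by (rule martingale4_real[OF assms(1) _ _ assms(4-9)]) (use Y Y1 in \<open>auto simp: norm_mult\<close>)
 then have 2: "\<E> (\<lambda>w. Im (?S w) ^ 4) <= 16 * (real (card I))^2 * \<beta> ^ 4"
  by (simp add: add.commute)
 have pt: "cmod z ^ 4 <= 2 * (Re z ^ 4 + Im z ^ 4)" for z
 proof -
  have "cmod z ^ 4 = ((Re z)^2 + (Im z)^2)^2"
   by (metis cmod_power2 power2_eq_square power4_eq_xxxx mult.assoc)
  also have "... <= 2 * (((Re z)^2)^2 + ((Im z)^2)^2)"
   using sum_squares_bound[of "(Re z)^2" "(Im z)^2"] by (simp add: power2_sum)
  finally show ?thesis by simp
 qed
 have "\<E> (\<lambda>w. cmod (?S w) ^ 4) <= \<E> (\<lambda>w. 2 * (Re (?S w) ^ 4 + Im (?S w) ^ 4))"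
  by (intro integral_mono pt bdd_rv_integrable bdd_rv_intros bS)
 also have "... = 2 * (\<E> (\<lambda>w. Re (?S w) ^ 4) + \<E> (\<lambda>w. Im (?S w) ^ 4))"
 proof -
  have "integrable M (\<lambda>w. Re (?S w) ^ 4)" "integrable M (\<lambda>w. Im (?S w) ^ 4)"
   by (intro bdd_rv_integrable bdd_rv_intros bS)+
  then show ?thesis by (simp del: Re_sum Im_sum)
 qed
 also have "... <= 2 * (16 * (real (card I))^2 * \<beta> ^ 4 + 16 * (real (card I))^2 * \<beta> ^ 4)"
  by (intro mult_left_mono add_mono 1 2) auto
 also have "... <= (4 * sqrt (real (card I)) * \<beta>) ^ 4"
 proof -
  have "sqrt (real (card I)) ^ 4 = (real (card I))^2"
   by (simp add: power4_eq_xxxx power2_eq_square flip: mult.assoc)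
  then show ?thesis using \<open>0 <= \<beta>\<close> by (simp add: power_mult_distrib)
 qed
 finally show ?thesis .
qed

end

section \<open>Linear processes\<close>

lemma powr_add_le:
 fixes x y p :: real
 assumes "0 <= x" "0 <= y" "0 < p" "p <= 1"
 shows "(x + y) powr p <= x powr p + y powr p"
proof (cases "x + y = 0")
 case False
 then have s: "0 < x + y" using assms by linarith
 have frac: "z / (x + y) <= (z / (x + y)) powr p" if "0 <= z" "z <= x + y" for z
 proof (cases "z = 0")
  case False
  then have "(z / (x + y)) powr 1 <= (z / (x + y)) powr p"
   using that s assms by (intro powr_mono') auto
  then show ?thesis using that s by simp
 qed simp
 have "1 = x / (x + y) + y / (x + y)" using s by (simp add: add_divide_distrib[symmetric])
 also have "... <= (x / (x + y)) powr p + (y / (x + y)) powr p"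
  using assms by (intro add_mono frac) auto
 also have "... = (x powr p + y powr p) / (x + y) powr p"
  using assms s by (simp add: powr_divide add_divide_distrib)
 finally show ?thesis using s by (simp add: le_divide_eq)
qed (use assms in auto)

lemma powr_sum_le:
 fixes x :: "'i => real"
 assumes "finite I" "\<And>i. i \<in> I ==> 0 <= x i" "0 < p" "p <= 1"
 shows "(\<Sum>i\<in>I. x i) powr p <= (\<Sum>i\<in>I. x i powr p)"
 using assms(1,2)
proof (induction I rule: finite_induct)
 case (insert i I)
 have "(\<Sum>i\<in>insert i I. x i) powr p <= x i powr p + (\<Sum>i\<in>I. x i) powr p"
  using insert assms(3,4) by (simp, intro powr_add_le) (auto intro: sum_nonneg)
 also have "... <= (\<Sum>i\<in>insert i I. x i powr p)"
  using insert by simp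
 finally show ?case .
qed simp

lemma powr_add_le2:
 fixes x y p :: real
 assumes "0 <= x" "0 <= y" "0 <= p" "p <= 2"
 shows "(x + y) powr p <= 4 * (x powr p + y powr p)"
proof -
 have "(x + y) powr p <= (2 * max x y) powr p"
  using assms by (intro powr_mono2) auto
 also have "... = 2 powr p * max x y powr p"
  using assms by (simp add: powr_mult)
 also have "... <= 4 * max x y powr p"
  using assms powr_mono[of p 2 2] by (intro mult_right_mono) auto
 also have "... <= 4 * (x powr p + y powr p)"
  by (auto simp: max_def)
 finally show ?thesis .
qed

text \<open>The dyadic scale with \<open>2^k <= |x| < 2^(k+1)\<close> puts \<open>x / 2^k\<close> where \<open>|e^{is} - 1|\<close> is bounded below.\<close>

lemma abs_powr_le_dyadic_sum:
 fixes x p :: real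
 assumes p: "0 <= p" "p <= 2"
 shows "ennreal (\<bar>x\<bar> powr p) <= 1 + (\<Sum>k. ennreal (4 / (2 - 2 * cos 1)^2 * 2 powr (p * real k) * cmod (iexp (x / 2 ^ k) - 1) ^ 4))"
proof (cases "\<bar>x\<bar> < 1")
 case True
 then have "\<bar>x\<bar> powr p <= 1" using p by (intro powr_le1) auto
 then have "ennreal (\<bar>x\<bar> powr p) <= 1" by simp
 then show ?thesis by (rule order_trans) simp
next
 case False
 have c: "2 - 2 * cos (1::real) > 0"
  using cos_monotone_0_pi[of 0 1] pi_gt3 by simp
 define k where "k = nat \<lfloor>log 2 \<bar>x\<bar>\<rfloor>"
 have x: "1 <= \<bar>x\<bar>" using False by simp
 have k: "2 ^ k <= \<bar>x\<bar>" "\<bar>x\<bar> < 2 ^ Suc k"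
 proof -
  have l0: "0 <= log 2 \<bar>x\<bar>" using x by simp
  have "real k <= log 2 \<bar>x\<bar>" "log 2 \<bar>x\<bar> < real (Suc k)"
   unfolding k_def using l0 by (auto simp: of_nat_nat) linarith
  then have "2 powr real k <= \<bar>x\<bar>" "\<bar>x\<bar> < 2 powr real (Suc k)"
   using x by (auto simp: le_log_iff log_less_iff)
  then show "2 ^ k <= \<bar>x\<bar>" "\<bar>x\<bar> < 2 ^ Suc k"
   by (simp_all only: powr_realpow zero_less_numeral)
 qed
 let ?s = "\<bar>x\<bar> / 2 ^ k"
 have s: "1 <= ?s" "?s <= 2" using k by (auto simp: field_simps)
 have "2 - 2 * cos 1 <= 2 - 2 * cos ?s"
  using s pi_gt3 by (auto intro!: cos_monotone_0_pi_le)
 also have "... = (cmod (iexp (x / 2 ^ k) - 1))^2"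
 proof -
  have "?s = \<bar>x / 2 ^ k\<bar>" by simp
  then have "cos ?s = cos (x / 2 ^ k)" by (simp only: cos_abs_real)
  then show ?thesis
   unfolding cmod_power2 using sin_cos_squared_add[of "x / 2 ^ k"]
   by (simp add: Re_exp Im_exp power2_diff del: sin_cos_squared_add)
 qed
 finally have "(2 - 2 * cos 1)^2 <= ((cmod (iexp (x / 2 ^ k) - 1))^2)^2"
  using c by (intro power_mono) auto
 then have low: "1 <= cmod (iexp (x / 2 ^ k) - 1) ^ 4 / (2 - 2 * cos 1)^2"
  using c by simp
 have "\<bar>x\<bar> powr p <= (2 ^ Suc k) powr p"
  using k p by (intro powr_mono2) auto
 also have "... = 2 powr p * 2 powr (p * real k)"
 proof -
  have two_k: "(2::real) ^ k = 2 powr real k" by (simp only: powr_realpow zero_less_numeral)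
  show ?thesis unfolding power_Suc two_k by (simp only: powr_mult powr_powr mult.commute)
 qed
 also have "... <= 4 * 2 powr (p * real k)"
  using p powr_mono[of p 2 2] by (intro mult_right_mono) auto
 also have "... <= 4 * 2 powr (p * real k) * (cmod (iexp (x / 2 ^ k) - 1) ^ 4 / (2 - 2 * cos 1)^2)"
  using low mult_left_mono[OF low, of "4 * 2 powr (p * real k)"] by simp
 finally have le: "\<bar>x\<bar> powr p <= 4 / (2 - 2 * cos 1)^2 * 2 powr (p * real k) * cmod (iexp (x / 2 ^ k) - 1) ^ 4"
  by simp
 let ?f = "\<lambda>k. ennreal (4 / (2 - 2 * cos 1)^2 * 2 powr (p * real k) * cmod (iexp (x / 2 ^ k) - 1) ^ 4)"
 have "ennreal (\<bar>x\<bar> powr p) <= ?f k"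
  using le by (intro ennreal_leI)
 also have "... = (\<Sum>i\<in>{k}. ?f i)" by simp
 also have "... <= (\<Sum>i. ?f i)" by (intro sum_le_suminf) auto
 finally show ?thesis by (rule order_trans) simp
qed

context noise
begin

text \<open>The fourth-moment hypothesis at the frequencies 2^(-k) controls the dyadic sum: for a
  difference D of two innovations, |e^{isD} - 1| is at most the sum of two centred exponentials,
  whose fourth moments are of order 2^(-4 \<gamma> k). Against the weights 2^(2 \<gamma> k) this
  leaves a convergent geometric series.\<close>

lemma nn_expectation_diff_powr: "(\<integral>\<^sup>+w. ennreal (\<bar>\<epsilon> 1 w - \<epsilon> 2 w\<bar> powr (2 * \<gamma>)) \<partial>M) < \<infinity>"
proof -
 define K :: real where "K = 4 / (2 - 2 * cos 1)^2"
 have K: "0 <= K" by (simp add: K_def)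
 let ?D = "\<lambda>w. \<epsilon> 1 w - \<epsilon> 2 w"
 have one: "(\<integral>\<^sup>+w. ennreal (cmod (iexp (?D w / 2 ^ k) - 1) ^ 4) \<partial>M) <= ennreal (16 * c_4 * 2 powr (- 4 * \<gamma> * real k))" for k
 proof -
  let ?t = "1 / 2 ^ k :: real"
  let ?x = "\<lambda>j w. iexp (?t * \<epsilon> j w) - \<phi> ?t"
  have bx: "bdd_rv (?x j)" for j by (intro bdd_rv_intros) auto
  have pt: "cmod (iexp (?D w / 2 ^ k) - 1) ^ 4 <= 8 * (cmod (?x 1 w) ^ 4 + cmod (?x 2 w) ^ 4)" for w
  proof -
   have "cmod (iexp (?D w / 2 ^ k) - 1) = cmod (iexp (?t * \<epsilon> 2 w) * (iexp (?D w / 2 ^ k) - 1))"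
    by (simp add: norm_mult)
   also have "iexp (?t * \<epsilon> 2 w) * (iexp (?D w / 2 ^ k) - 1) = ?x 1 w - ?x 2 w"
    by (simp add: right_diff_distrib flip: exp_add) (simp add: field_simps)
   also have "cmod ... <= cmod (?x 1 w) + cmod (?x 2 w)" by (rule norm_triangle_ineq4)
   finally have "cmod (iexp (?D w / 2 ^ k) - 1) ^ 4 <= (cmod (?x 1 w) + cmod (?x 2 w)) ^ 4"
    by (intro power_mono) auto
   also have "... <= 8 * (cmod (?x 1 w) ^ 4 + cmod (?x 2 w) ^ 4)"
   proof -
    have "(u + v) ^ 4 <= 8 * (u ^ 4 + v ^ 4)" for u v :: real
    proof -
     have "(u + v) ^ 4 = ((u + v)^2)^2" by simp
     also have "... <= (2 * (u^2 + v^2))^2"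
      using sum_squares_bound[of u v] by (intro power_mono[OF _ zero_le_power2]) (simp add: power2_sum)
     also have "... = 4 * (u^2 + v^2)^2" by (simp only: power_mult_distrib) simp
     also have "... <= 4 * (2 * ((u^2)^2 + (v^2)^2))"
      using sum_squares_bound[of "u^2" "v^2"] by (intro mult_left_mono) (auto simp: power2_sum)
     finally show ?thesis by simp
    qed
    then show ?thesis .
   qed
   finally show ?thesis .
  qed
  have nn: "(\<integral>\<^sup>+w. ennreal (cmod (iexp (?D w / 2 ^ k) - 1) ^ 4) \<partial>M)
    = ennreal (\<E> (\<lambda>w. cmod (iexp (?D w / 2 ^ k) - 1) ^ 4))"
   by (intro nn_integral_eq_integral bdd_rv_integrable bdd_rv_intros) auto
  have "\<E> (\<lambda>w. cmod (iexp (?D w / 2 ^ k) - 1) ^ 4)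
    <= \<E> (\<lambda>w. 8 * (cmod (?x 1 w) ^ 4 + cmod (?x 2 w) ^ 4))"
   by (intro integral_mono pt bdd_rv_integrable bdd_rv_intros bx) auto
  also have "... = 8 * (\<E> (\<lambda>w. cmod (?x 1 w) ^ 4) + \<E> (\<lambda>w. cmod (?x 2 w) ^ 4))"
  proof -
   have "integrable M (\<lambda>w. cmod (?x j w) ^ 4)" for j by (intro bdd_rv_integrable bdd_rv_intros bx)
   from integral_add[OF this[of 1] this[of 2]] show ?thesis
    by (simp only: integral_mult_right_zero)
  qed
  also have "... <= 8 * (c_4 * \<bar>?t\<bar> powr (4 * \<gamma>) + c_4 * \<bar>?t\<bar> powr (4 * \<gamma>))"
   by (intro mult_left_mono add_mono order_trans[OF phi_fourth'] mult_left_mono c4_nonneg) auto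
  also have "\<bar>?t\<bar> powr (4 * \<gamma>) = 2 powr (- 4 * \<gamma> * real k)"
  proof -
   have two_k: "?t = 2 powr (- real k)" by (simp only: powr_minus_divide powr_realpow zero_less_numeral)
   show ?thesis unfolding two_k by (simp add: powr_powr mult_ac)
  qed
  finally show ?thesis unfolding nn by (intro ennreal_leI) simp
 qed
 have "(\<integral>\<^sup>+w. ennreal (\<bar>?D w\<bar> powr (2 * \<gamma>)) \<partial>M)
   <= (\<integral>\<^sup>+w. 1 + (\<Sum>k. ennreal (K * 2 powr (2 * \<gamma> * real k) * cmod (iexp (?D w / 2 ^ k) - 1) ^ 4)) \<partial>M)"
  using gamma by (intro nn_integral_mono abs_powr_le_dyadic_sum[folded K_def]) auto
 also have "... = 1 + (\<Sum>k. \<integral>\<^sup>+w. ennreal (K * 2 powr (2 * \<gamma> * real k) * cmod (iexp (?D w / 2 ^ k) - 1) ^ 4) \<partial>M)"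
  by (subst nn_integral_add) (auto simp: nn_integral_suminf emeasure_space_1)
 also have "... <= 1 + (\<Sum>k. ennreal (K * 16 * c_4 * (2 powr (- 2 * \<gamma>)) ^ k))"
 proof (intro add_left_mono suminf_le summableI)
  fix k
  have "(\<integral>\<^sup>+w. ennreal (K * 2 powr (2 * \<gamma> * real k) * cmod (iexp (?D w / 2 ^ k) - 1) ^ 4) \<partial>M)
    = ennreal (K * 2 powr (2 * \<gamma> * real k)) * (\<integral>\<^sup>+w. ennreal (cmod (iexp (?D w / 2 ^ k) - 1) ^ 4) \<partial>M)"
   using K by (subst nn_integral_cmult[symmetric]) (auto simp: ennreal_mult')
  also have "... <= ennreal (K * 2 powr (2 * \<gamma> * real k)) * ennreal (16 * c_4 * 2 powr (- 4 * \<gamma> * real k))"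
   by (intro mult_left_mono one) auto
  also have "... = ennreal (K * 16 * c_4 * (2 powr (2 * \<gamma> * real k) * 2 powr (- 4 * \<gamma> * real k)))"
   using c4_nonneg K by (subst ennreal_mult'[symmetric]) (auto simp: mult_ac)
  also have "2 powr (2 * \<gamma> * real k) * 2 powr (- 4 * \<gamma> * real k) = (2 powr (- 2 * \<gamma>)) ^ k"
  proof -
   have "(2 powr (- 2 * \<gamma>)) ^ k = (2 powr (- 2 * \<gamma>)) powr real k" by (simp add: powr_realpow)
   then show ?thesis by (simp only: powr_add[symmetric] powr_powr) (simp add: algebra_simps)
  qed
  finally show "(\<integral>\<^sup>+w. ennreal (K * 2 powr (2 * \<gamma> * real k) * cmod (iexp (?D w / 2 ^ k) - 1) ^ 4) \<partial>M)
    <= ennreal (K * 16 * c_4 * (2 powr (- 2 * \<gamma>)) ^ k)" .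
 qed
 also have "... < \<infinity>"
 proof -
  have "2 powr (- 2 * \<gamma>) < (1::real)" using gamma by (simp add: powr_less_one)
  then have s: "summable (\<lambda>k. K * 16 * c_4 * (2 powr (- 2 * \<gamma>)) ^ k)"
   by (intro summable_mult summable_geometric) auto
  have "(\<Sum>k. ennreal (K * 16 * c_4 * (2 powr (- 2 * \<gamma>)) ^ k)) = ennreal (\<Sum>k. K * 16 * c_4 * (2 powr (- 2 * \<gamma>)) ^ k)"
   using c4_nonneg K s by (intro suminf_ennreal2) auto
  then show ?thesis by simp
 qed
 finally show ?thesis .
qed

text \<open>Desymmetrisation: by Fubini the moment of y - \<open>\<epsilon> 2\<close> is finite for
  some fixed value y of \<open>\<epsilon> 1\<close>, and the triangle inequality removes y.\<close>

lemma eps_powr_integrable: "integrable M (\<lambda>w. \<bar>\<epsilon> k w\<bar> powr (2 * \<gamma>))"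
proof -
 let ?p = "2 * \<gamma>" and ?N = "distr M borel (\<epsilon> 2)"
 have p: "0 <= ?p" "?p <= 2" using gamma by auto
 have meas: "\<epsilon> 1 \<in> borel_measurable (noise_alg {1})" "\<epsilon> 2 \<in> borel_measurable (noise_alg {2})"
  by (auto intro: eps_noise_alg)
 interpret N: prob_space ?N by (rule prob_space_distr) simp
 have "(\<integral>\<^sup>+w. (\<integral>\<^sup>+u. ennreal (\<bar>\<epsilon> 1 w - u\<bar> powr ?p) \<partial>?N) \<partial>M) < \<infinity>"
  using nn_expectation_diff_powr freeze_nn[OF _ meas, of "\<lambda>v u. ennreal (\<bar>v - u\<bar> powr ?p)"] by simp
 then have ae: "AE w in M. (\<integral>\<^sup>+u. ennreal (\<bar>\<epsilon> 1 w - u\<bar> powr ?p) \<partial>?N) \<noteq> \<infinity>"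
  by (intro nn_integral_PInf_AE) auto
 have "\<exists>w\<in>space M. (\<integral>\<^sup>+u. ennreal (\<bar>\<epsilon> 1 w - u\<bar> powr ?p) \<partial>?N) \<noteq> \<infinity>"
 proof (rule ccontr)
  assume neg: "\<not> ?thesis"
  from ae AE_space[of M] have "AE w in M. False"
   by eventually_elim (use neg in blast)
  then show False by simp
 qed
 then obtain y where y: "(\<integral>\<^sup>+u. ennreal (\<bar>y - u\<bar> powr ?p) \<partial>?N) < \<infinity>"
  by (auto simp: top.not_eq_extremum)
 have "(\<integral>\<^sup>+w. ennreal (\<bar>\<epsilon> k w\<bar> powr ?p) \<partial>M) = (\<integral>\<^sup>+w. ennreal (\<bar>\<epsilon> 2 w\<bar> powr ?p) \<partial>M)"
  using nn_expectation_eps[of "\<lambda>x. ennreal (\<bar>x\<bar> powr ?p)" k] nn_expectation_eps[of "\<lambda>x. ennreal (\<bar>x\<bar> powr ?p)" 2] by simp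
 also have "... = (\<integral>\<^sup>+u. ennreal (\<bar>u\<bar> powr ?p) \<partial>?N)" by (simp add: nn_integral_distr)
 also have "... <= (\<integral>\<^sup>+u. ennreal (4 * \<bar>y\<bar> powr ?p) + 4 * ennreal (\<bar>y - u\<bar> powr ?p) \<partial>?N)"
 proof (intro nn_integral_mono)
  fix u
  have "\<bar>u\<bar> powr ?p <= (\<bar>y\<bar> + \<bar>y - u\<bar>) powr ?p" using p by (intro powr_mono2) auto
  also have "... <= 4 * (\<bar>y\<bar> powr ?p + \<bar>y - u\<bar> powr ?p)" using p by (intro powr_add_le2) auto
  finally have "ennreal (\<bar>u\<bar> powr ?p) <= ennreal (4 * \<bar>y\<bar> powr ?p + 4 * \<bar>y - u\<bar> powr ?p)"
   by (intro ennreal_leI) simp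
  also have "... = ennreal (4 * \<bar>y\<bar> powr ?p) + 4 * ennreal (\<bar>y - u\<bar> powr ?p)"
   by (simp add: ennreal_mult')
  finally show "ennreal (\<bar>u\<bar> powr ?p) <= ..." .
 qed
 also have "... = ennreal (4 * \<bar>y\<bar> powr ?p) * emeasure ?N UNIV + 4 * (\<integral>\<^sup>+u. ennreal (\<bar>y - u\<bar> powr ?p) \<partial>?N)"
  by (subst nn_integral_add) (auto simp: nn_integral_cmult)
 also have "... < \<infinity>"
  using y by (auto simp: emeasure_distr ennreal_mult_less_top emeasure_space_1)
 finally show ?thesis
  by (intro integrableI_bounded) auto
qed

lemma eps_powr_gamma_integrable: "integrable M (\<lambda>w. \<bar>\<epsilon> k w\<bar> powr \<gamma>)"
proof (rule integrable_bound)
 show "integrable M (\<lambda>w. 1 + \<bar>\<epsilon> k w\<bar> powr (2 * \<gamma>))"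
  using eps_powr_integrable by simp
 show "AE w in M. norm (\<bar>\<epsilon> k w\<bar> powr \<gamma>) <= norm (1 + \<bar>\<epsilon> k w\<bar> powr (2 * \<gamma>))"
 proof (rule AE_I2)
  fix w
  have "\<bar>\<epsilon> k w\<bar> powr (2 * \<gamma>) = (\<bar>\<epsilon> k w\<bar> powr \<gamma>)^2"
   by (cases "\<epsilon> k w = 0") (simp_all add: powr_powr[symmetric] mult.commute powr_numeral flip: powr_numeral)
  moreover have "z <= 1 + z^2" for z :: real
   using zero_le_power2[of "z - 1/2"] by (simp add: power2_eq_square algebra_simps)
  ultimately show "norm (\<bar>\<epsilon> k w\<bar> powr \<gamma>) <= norm (1 + \<bar>\<epsilon> k w\<bar> powr (2 * \<gamma>))" by simp
 qed
qed auto

definition m_g :: real where "m_g = (LINT w|M. \<bar>\<epsilon> 1 w\<bar> powr \<gamma>)"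

lemma m_gamma_nonneg: "0 <= m_g"
 unfolding m_g_def by (rule integral_nonneg) auto

lemma nn_expectation_eps_powr: "(\<integral>\<^sup>+w. ennreal (\<bar>\<epsilon> k w\<bar> powr \<gamma>) \<partial>M) = ennreal m_g"
proof -
 have "(\<integral>\<^sup>+w. ennreal (\<bar>\<epsilon> k w\<bar> powr \<gamma>) \<partial>M) = (\<integral>\<^sup>+w. ennreal (\<bar>\<epsilon> 1 w\<bar> powr \<gamma>) \<partial>M)"
  using nn_expectation_eps[of "\<lambda>x. ennreal (\<bar>x\<bar> powr \<gamma>)" k] by simp
 also have "... = ennreal m_g"
  unfolding m_g_def by (intro nn_integral_eq_integral eps_powr_gamma_integrable) auto
 finally show ?thesis .
qed

text \<open>Coefficients are kept arbitrary because truncations, tails and differences of the given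
  process are again of this form.\<close>

definition lin :: "(nat => real) => int => 'a => real" where
 "lin b i w = (\<Sum>l. b l * \<epsilon> (i - int l) w)"

definition summable_coeffs :: "(nat => real) => bool" where
 "summable_coeffs b \<longleftrightarrow> summable (\<lambda>l. \<bar>b l\<bar> powr \<gamma>)"

text \<open>For each i the expected series is \<open>m_g\<close> times the sum of |b l|^\<gamma>,
  hence finite; countability of the integers gives one null set for all i.\<close>

lemma AE_powr_summable:
 assumes "summable_coeffs b"
 shows "AE w in M. \<forall>i. summable (\<lambda>l. \<bar>b l * \<epsilon> (i - int l) w\<bar> powr \<gamma>)"
proof (subst AE_all_countable, rule allI)
 fix i
 have "(\<integral>\<^sup>+w. (\<Sum>l. ennreal (\<bar>b l * \<epsilon> (i - int l) w\<bar> powr \<gamma>)) \<partial>M) = (\<Sum>l. \<integral>\<^sup>+w. ennreal (\<bar>b l * \<epsilon> (i - int l) w\<bar> powr \<gamma>) \<partial>M)"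
  by (rule nn_integral_suminf) auto
 also have "... = (\<Sum>l. ennreal (\<bar>b l\<bar> powr \<gamma> * m_g))"
  by (intro suminf_cong) (auto simp: abs_mult powr_mult ennreal_mult' nn_integral_cmult nn_expectation_eps_powr)
 also have "... = ennreal (\<Sum>l. \<bar>b l\<bar> powr \<gamma> * m_g)"
  using assms m_gamma_nonneg unfolding summable_coeffs_def by (intro suminf_ennreal2 summable_mult2) auto
 finally have "AE w in M. (\<Sum>l. ennreal (\<bar>b l * \<epsilon> (i - int l) w\<bar> powr \<gamma>)) \<noteq> \<infinity>"
  by (intro nn_integral_PInf_AE) auto
 then show "AE w in M. summable (\<lambda>l. \<bar>b l * \<epsilon> (i - int l) w\<bar> powr \<gamma>)"
  by eventually_elim (auto intro!: summable_suminf_not_top)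
qed

text \<open>Terms are eventually below 1, where |x| is at most |x|^\<gamma>. The second claim is
  subadditivity of the power for exponents up to 1, passed to the limit.\<close>

lemma summable_of_powr_summable:
 fixes x :: "nat => real"
 assumes "summable (\<lambda>l. \<bar>x l\<bar> powr \<gamma>)"
 shows "summable (\<lambda>l. \<bar>x l\<bar>)" "\<bar>\<Sum>l. x l\<bar> powr \<gamma> <= (\<Sum>l. \<bar>x l\<bar> powr \<gamma>)"
proof -
 have "\<forall>\<^sub>F l in sequentially. \<bar>x l\<bar> powr \<gamma> < 1"
  using summable_LIMSEQ_zero[OF assms] by (auto dest!: order_tendstoD(2)[where a = 1])
 then have ev: "\<forall>\<^sub>F l in sequentially. norm \<bar>x l\<bar> <= \<bar>x l\<bar> powr \<gamma>"
 proof eventually_elim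
  case (elim l)
  show ?case
  proof (cases "x l = 0")
   case False
   have "\<bar>x l\<bar> < 1" using elim False gamma by (metis abs_ge_zero linorder_not_less ge_one_powr_ge_zero less_eq_real_def)
   then have "\<bar>x l\<bar> powr 1 <= \<bar>x l\<bar> powr \<gamma>" using gamma False by (intro powr_mono') auto
   then show ?thesis by simp
  qed simp
 qed
 show s: "summable (\<lambda>l. \<bar>x l\<bar>)" by (rule summable_comparison_test_ev[OF ev assms])
 have "\<bar>\<Sum>l<n. x l\<bar> powr \<gamma> <= (\<Sum>l. \<bar>x l\<bar> powr \<gamma>)" for n
 proof -
  have "\<bar>\<Sum>l<n. x l\<bar> powr \<gamma> <= (\<Sum>l<n. \<bar>x l\<bar>) powr \<gamma>" using gamma by (intro powr_mono2) (auto intro: sum_abs)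
  also have "... <= (\<Sum>l<n. \<bar>x l\<bar> powr \<gamma>)" using gamma by (intro powr_sum_le) auto
  also have "... <= (\<Sum>l. \<bar>x l\<bar> powr \<gamma>)" by (intro sum_le_suminf assms) auto
  finally show ?thesis .
 qed
 moreover have "(\<lambda>n. \<bar>\<Sum>l<n. x l\<bar> powr \<gamma>) ----> \<bar>\<Sum>l. x l\<bar> powr \<gamma>"
  by (rule tendsto_powr2[OF tendsto_rabs[OF summable_LIMSEQ[OF summable_rabs_cancel[OF s]]] tendsto_const])
   (use gamma in auto)
 ultimately show "\<bar>\<Sum>l. x l\<bar> powr \<gamma> <= (\<Sum>l. \<bar>x l\<bar> powr \<gamma>)"
  by (intro LIMSEQ_le_const2) auto
qed

lemma AE_lin_summable:
 assumes "summable_coeffs b"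
 shows "AE w in M. \<forall>i. summable (\<lambda>l. b l * \<epsilon> (i - int l) w)"
 using AE_powr_summable[OF assms] by eventually_elim (blast intro: summable_rabs_cancel[OF summable_of_powr_summable(1)])

lemma AE_lin_powr_le:
 assumes "summable_coeffs b"
 shows "AE w in M. \<forall>i. ennreal (\<bar>lin b i w\<bar> powr \<gamma>) <= (\<Sum>l. ennreal (\<bar>b l\<bar> powr \<gamma>) * ennreal (\<bar>\<epsilon> (i - int l) w\<bar> powr \<gamma>))"
 using AE_powr_summable[OF assms]
proof eventually_elim
 case (elim w)
 show ?case
 proof
  fix i
  have s: "summable (\<lambda>l. \<bar>b l * \<epsilon> (i - int l) w\<bar> powr \<gamma>)" using elim by blast
  have "ennreal (\<bar>lin b i w\<bar> powr \<gamma>) <= ennreal (\<Sum>l. \<bar>b l * \<epsilon> (i - int l) w\<bar> powr \<gamma>)"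
   unfolding lin_def by (intro ennreal_leI summable_of_powr_summable(2) s)
  also have "... = (\<Sum>l. ennreal (\<bar>b l * \<epsilon> (i - int l) w\<bar> powr \<gamma>))"
   by (intro suminf_ennreal2[symmetric] s) auto
  finally show "ennreal (\<bar>lin b i w\<bar> powr \<gamma>) <= (\<Sum>l. ennreal (\<bar>b l\<bar> powr \<gamma>) * ennreal (\<bar>\<epsilon> (i - int l) w\<bar> powr \<gamma>))"
   by (simp add: abs_mult powr_mult ennreal_mult')
 qed
qed

lemma lin_noise_alg:
 assumes "\<And>l. b l \<noteq> 0 ==> i - int l \<in> A"
 shows "lin b i \<in> borel_measurable (noise_alg A)"
proof -
 have "(\<lambda>w. b l * \<epsilon> (i - int l) w) \<in> borel_measurable (noise_alg A)" for l
  using assms[of l] by (cases "b l = 0") (auto intro!: borel_measurable_times eps_noise_alg)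
 then show ?thesis unfolding lin_def by measurable
qed

lemma lin_measurable[measurable]: "lin b i \<in> borel_measurable M"
 by (rule measurable_noise_algD[OF lin_noise_alg[where A = UNIV]]) auto

lemma lin_finite: "(\<And>l. L <= l ==> b l = 0) ==> lin b i w = (\<Sum>l<L. b l * \<epsilon> (i - int l) w)"
 unfolding lin_def by (rule suminf_finite) auto

lemma expectation_iexp_partial:
 "(LINT w|M. iexp (t * (\<Sum>l<N. b l * \<epsilon> (i - int l) w))) = (\<Prod>l<N. \<phi> (b l * t))"
proof (induction N)
 case (Suc N)
 let ?S = "\<lambda>w. \<Sum>l<N. b l * \<epsilon> (i - int l) w"
 let ?A = "{i - int N<..}" and ?B = "{i - int N}"
 have S: "?S \<in> borel_measurable (noise_alg ?A)"
  by (intro borel_measurable_sum borel_measurable_times eps_noise_alg) auto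
 have e: "\<epsilon> (i - int N) \<in> borel_measurable (noise_alg ?B)"
  by (intro eps_noise_alg) auto
 have m: "(\<lambda>w. iexp (t * ?S w)) \<in> borel_measurable (noise_alg ?A)"
   "(\<lambda>w. iexp (b N * t * \<epsilon> (i - int N) w)) \<in> borel_measurable (noise_alg ?B)"
  using measurable_compose[OF S, of "\<lambda>x. iexp (t * x)" borel] measurable_compose[OF e, of "\<lambda>x. iexp (b N * t * x)" borel] by auto
 have "(LINT w|M. iexp (t * (\<Sum>l<Suc N. b l * \<epsilon> (i - int l) w)))
   = (LINT w|M. iexp (t * ?S w) * iexp (b N * t * \<epsilon> (i - int N) w))"
  by (intro integral_cong refl) (simp add: algebra_simps flip: exp_add)
 also have "... = (LINT w|M. iexp (t * ?S w)) * (LINT w|M. iexp (b N * t * \<epsilon> (i - int N) w))"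
  by (rule expectation_indep_mult[where A = ?A and B = ?B, OF _ m]) (simp, (rule bdd_rv_iexp, measurable)+)
 finally show ?case
  by (simp only: expectation_iexp_eps Suc.IH prod.lessThan_Suc)
qed (simp add: prob_space)

definition cf :: "(nat => real) => real => complex" where
 "cf b t = (LINT w|M. iexp (t * lin b 0 w))"

lemma cf_tendsto:
 assumes "summable_coeffs b"
 shows "(\<lambda>N. \<Prod>l<N. \<phi> (b l * t)) ----> (LINT z|M. iexp (t * lin b i z))"
proof -
 have "(\<lambda>N. LINT z|M. iexp (t * (\<Sum>l<N. b l * \<epsilon> (i - int l) z))) ----> (LINT z|M. iexp (t * lin b i z))"
 proof (rule integral_dominated_convergence[where w = "\<lambda>_. 1"])
  show "AE z in M. (\<lambda>N. iexp (t * (\<Sum>l<N. b l * \<epsilon> (i - int l) z))) ----> iexp (t * lin b i z)"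
   using AE_lin_summable[OF assms] unfolding lin_def
   by eventually_elim (intro tendsto_intros summable_LIMSEQ, auto)
 qed auto
 then show ?thesis unfolding expectation_iexp_partial .
qed

lemma expectation_iexp_lin: "summable_coeffs b ==> (LINT w|M. iexp (t * lin b i w)) = cf b t"
 unfolding cf_def using LIMSEQ_unique[OF cf_tendsto cf_tendsto] .

lemma cf_eq_char: "summable_coeffs b ==> char (distr M borel (lin b i)) t = cf b t"
 using expectation_iexp_lin[of b t i] by (simp add: char_def integral_distr)

text \<open>Stationarity: at every time the characteristic function is \<open>cf b\<close>.\<close>

lemma distr_lin: "summable_coeffs b ==> distr M borel (lin b i) = distr M borel (lin b j)"
 by (intro Levy_uniqueness real_distribution_distr ext) (auto simp: cf_eq_char)

lemma cf_measurable[measurable]: "cf b \<in> borel_measurable borel"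
 unfolding cf_def by measurable

lemma cf_le_1: "cmod (cf b t) <= 1"
proof -
 have "cmod (cf b t) <= (LINT w|M. cmod (iexp (t * lin b 0 w)))" unfolding cf_def by (rule integral_norm_bound)
 then show ?thesis by (simp add: prob_space)
qed

lemma iexp_minus_cf_le: "cmod (iexp y - cf b t) <= 2"
proof -
 have "cmod (iexp y - cf b t) <= cmod (iexp y) + cmod (cf b t)" by (rule norm_triangle_ineq4)
 also have "... <= 1 + 1" by (intro add_mono cf_le_1) (simp only: norm_exp_i_times order_refl)
 finally show ?thesis by simp
qed

lemma cf_split:
 assumes "summable_coeffs b"
 shows "(\<lambda>N. \<Prod>l\<in>{s..<N}. \<phi> (b l * t)) ----> cf (\<lambda>l. b (l + s)) t"
proof -
 have sb: "summable_coeffs (\<lambda>l. b (l + s))"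
  using assms unfolding summable_coeffs_def by (subst summable_iff_shift)
 have "(\<lambda>N. \<Prod>l<N. \<phi> (b (l + s) * t)) ----> cf (\<lambda>l. b (l + s)) t"
  using cf_tendsto[OF sb, of t 0] unfolding cf_def .
 moreover have "(\<Prod>l<N. \<phi> (b (l + s) * t)) = (\<Prod>l\<in>{s..<N + s}. \<phi> (b l * t))" for N
  by (rule prod.reindex_bij_witness[of _ "\<lambda>l. l - s" "\<lambda>l. l + s"]) auto
 ultimately show ?thesis
  using LIMSEQ_offset[of "\<lambda>N. \<Prod>l\<in>{s..<N}. \<phi> (b l * t)" s] by simp
qed

text \<open>The infinite product is split at lag s. This is why replacing the innovations of lag s
  and older by their average does not change the mean of an exponential.\<close>

lemma cf_mult:
 assumes "summable_coeffs b"
 shows "cf b t = cf (\<lambda>l. if l < s then b l else 0) t * cf (\<lambda>l. b (l + s)) t"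
proof (rule LIMSEQ_unique)
 show "(\<lambda>N. \<Prod>l<N. \<phi> (b l * t)) ----> cf b t"
  using cf_tendsto[OF assms, of t 0] unfolding cf_def .
 have fin: "cf (\<lambda>l. if l < s then b l else 0) t = (\<Prod>l<s. \<phi> (b l * t))"
 proof -
  have "cf (\<lambda>l. if l < s then b l else 0) t = (LINT w|M. iexp (t * (\<Sum>l<s. b l * \<epsilon> (0 - int l) w)))"
  proof -
   have "lin (\<lambda>l. if l < s then b l else 0) 0 w = (\<Sum>l<s. b l * \<epsilon> (0 - int l) w)" for w
    by (subst lin_finite[where L = s]) (auto intro!: sum.cong)
   then show ?thesis unfolding cf_def by (simp only:)
  qed
  then show ?thesis by (simp only: expectation_iexp_partial)
 qed
 have "\<forall>\<^sub>F N in sequentially. (\<Prod>l<s. \<phi> (b l * t)) * (\<Prod>l\<in>{s..<N}. \<phi> (b l * t)) = (\<Prod>l<N. \<phi> (b l * t))"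
  using eventually_ge_at_top[of s]
 proof eventually_elim
  case (elim N)
  then show ?case by (subst prod.union_disjoint[symmetric]) (auto intro!: prod.cong)
 qed
 then show "(\<lambda>N. \<Prod>l<N. \<phi> (b l * t)) ----> cf (\<lambda>l. if l < s then b l else 0) t * cf (\<lambda>l. b (l + s)) t"
  unfolding fin by (rule Lim_transform_eventually[rotated]) (intro tendsto_intros cf_split assms)
qed

text \<open>The factors outside F have modulus at most 1.\<close>

lemma cf_le_prod:
 assumes "summable_coeffs b" "finite F"
 shows "cmod (cf b t) <= (\<Prod>l\<in>F. cmod (\<phi> (b l * t)))"
proof (rule LIMSEQ_le_const2)
 show "(\<lambda>N. cmod (\<Prod>l<N. \<phi> (b l * t))) ----> cmod (cf b t)"
  using cf_tendsto[OF assms(1), of t 0] unfolding cf_def by (rule tendsto_norm)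
 obtain N where N: "F \<subseteq> {..<N}" using assms(2) finite_nat_iff_bounded by blast
 show "\<exists>N. \<forall>n\<ge>N. cmod (\<Prod>l<n. \<phi> (b l * t)) <= (\<Prod>l\<in>F. cmod (\<phi> (b l * t)))"
 proof (intro exI allI impI)
  fix n assume n: "N <= n"
  have "cmod (\<Prod>l<n. \<phi> (b l * t)) = (\<Prod>l<n. cmod (\<phi> (b l * t)))" by (rule prod_norm[symmetric])
  also have "... = (\<Prod>l\<in>{..<n} - F. cmod (\<phi> (b l * t))) * (\<Prod>l\<in>F. cmod (\<phi> (b l * t)))"
   using N n by (subst prod.subset_diff[of F]) auto
  also have "... <= 1 * (\<Prod>l\<in>F. cmod (\<phi> (b l * t)))"
   by (intro mult_right_mono prod_le_1 prod_nonneg) (auto simp: phi_le_1)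
  finally show "cmod (\<Prod>l<n. \<phi> (b l * t)) <= (\<Prod>l\<in>F. cmod (\<phi> (b l * t)))" by simp
 qed
qed

lemma phi_weighted_integrable:
 assumes "0 <= p" "p <= 2 * \<gamma>" "c \<noteq> 0"
 shows "integrable lborel (\<lambda>t. \<bar>t\<bar> powr p * (cmod (\<phi> (c * t)))^2)"
proof -
 have base: "integrable lborel (\<lambda>t. \<bar>t\<bar> powr p * (cmod (\<phi> t))^2)"
 proof (rule integrable_bound)
  show "integrable lborel (\<lambda>t. indicator {-1..1} t + \<bar>t\<bar> powr (2 * \<gamma>) * (cmod (\<phi> t))^2 :: real)"
   by (intro integrable_add phi_integrable integrable_real_indicator) (auto simp: emeasure_lborel_Icc_eq)
  show "AE t in lborel. norm (\<bar>t\<bar> powr p * (cmod (\<phi> t))^2) <= norm (indicator {-1..1} t + \<bar>t\<bar> powr (2 * \<gamma>) * (cmod (\<phi> t))^2 :: real)"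
  proof (rule AE_I2)
   fix t :: real
   show "norm (\<bar>t\<bar> powr p * (cmod (\<phi> t))^2) <= norm (indicator {-1..1} t + \<bar>t\<bar> powr (2 * \<gamma>) * (cmod (\<phi> t))^2 :: real)"
   proof (cases "\<bar>t\<bar> <= 1")
    case True
    have "\<bar>t\<bar> powr p * (cmod (\<phi> t))^2 <= 1 * 1"
     using True assms phi_le_1[of t] by (intro mult_mono powr_le1) (auto simp: power_le_one)
    moreover have "indicator {-1..1} t = (1::real)" using True by (auto simp: indicator_def)
    moreover have "0 <= \<bar>t\<bar> powr (2 * \<gamma>) * (cmod (\<phi> t))^2" by simp
    moreover have "0 <= \<bar>t\<bar> powr p * (cmod (\<phi> t))^2" by simp
    ultimately show ?thesis unfolding real_norm_def by linarith
   next
    case False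
    have "\<bar>t\<bar> powr p * (cmod (\<phi> t))^2 <= \<bar>t\<bar> powr (2 * \<gamma>) * (cmod (\<phi> t))^2"
     using False assms by (intro mult_right_mono powr_mono) auto
    then show ?thesis by (simp add: indicator_def)
   qed
  qed
 qed auto
 have "integrable lborel (\<lambda>t. \<bar>c * t\<bar> powr p * (cmod (\<phi> (c * t)))^2)"
  using lborel_integrable_real_affine[OF base assms(3), of 0] by simp
 then have "integrable lborel (\<lambda>t. inverse (\<bar>c\<bar> powr p) * (\<bar>c * t\<bar> powr p * (cmod (\<phi> (c * t)))^2))"
  by (rule integrable_mult_right)
 moreover have "inverse (\<bar>c\<bar> powr p) * (\<bar>c * t\<bar> powr p * (cmod (\<phi> (c * t)))^2) = \<bar>t\<bar> powr p * (cmod (\<phi> (c * t)))^2" for t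
  using assms(3) by (simp add: abs_mult powr_mult field_simps)
 ultimately show ?thesis by simp
qed

text \<open>Two factors of \<open>\<phi>\<close> turn the square-integrability of \<open>\<phi>\<close> into integrability of the product.\<close>

lemma cf_integrable:
 assumes b: "summable_coeffs b" "b l \<noteq> 0" "b l' \<noteq> 0" "l \<noteq> l'" and p: "0 <= p" "p <= 2 * \<gamma>"
 shows "integrable lborel (\<lambda>t. cmod (cf b t) * \<bar>t\<bar> powr p)"
proof (rule integrable_bound)
 show "integrable lborel (\<lambda>t. \<bar>t\<bar> powr p * (cmod (\<phi> (b l * t)))^2 + \<bar>t\<bar> powr p * (cmod (\<phi> (b l' * t)))^2)"
  by (intro integrable_add phi_weighted_integrable b p)
 show "AE t in lborel. norm (cmod (cf b t) * \<bar>t\<bar> powr p)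
   <= norm (\<bar>t\<bar> powr p * (cmod (\<phi> (b l * t)))^2 + \<bar>t\<bar> powr p * (cmod (\<phi> (b l' * t)))^2)"
 proof (rule AE_I2)
  fix t
  have "cmod (cf b t) <= (\<Prod>l\<in>{l, l'}. cmod (\<phi> (b l * t)))" by (rule cf_le_prod[OF b(1)]) auto
  also have "... <= (cmod (\<phi> (b l * t)))^2 + (cmod (\<phi> (b l' * t)))^2"
  proof -
   have "u * v <= u^2 + v^2" for u v :: real
    using sum_squares_bound[of u v] zero_le_power2[of u] zero_le_power2[of v] by linarith
   then show ?thesis using b(4) by simp
  qed
  finally have "cmod (cf b t) * \<bar>t\<bar> powr p <= ((cmod (\<phi> (b l * t)))^2 + (cmod (\<phi> (b l' * t)))^2) * \<bar>t\<bar> powr p"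
   by (intro mult_right_mono) auto
  then show "norm (cmod (cf b t) * \<bar>t\<bar> powr p)
   <= norm (\<bar>t\<bar> powr p * (cmod (\<phi> (b l * t)))^2 + \<bar>t\<bar> powr p * (cmod (\<phi> (b l' * t)))^2)"
   by (simp add: algebra_simps)
 qed
qed auto

end

section \<open>Fourth moments of empirical characteristic functions\<close>

lemma cmod_iexp_diff_le_powr:
 fixes x y p :: real
 assumes "0 < p" "p <= 1"
 shows "cmod (iexp x - iexp y) <= 2 * \<bar>x - y\<bar> powr p"
proof -
 have eq: "cmod (iexp x - iexp y) = cmod (iexp (x - y) - 1)"
 proof -
  have "iexp x - iexp y = iexp y * (iexp (x - y) - 1)"
   by (simp add: right_diff_distrib flip: exp_add)
  then show ?thesis by (simp only: norm_mult norm_exp_i_times mult_1_left)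
 qed
 show ?thesis
 proof (cases "\<bar>x - y\<bar> <= 1")
  case True
  have "cmod (iexp (x - y) - 1) <= \<bar>x - y\<bar>"
   using iexp_approx1[of "x - y" 0] by simp
  also have "... <= \<bar>x - y\<bar> powr p"
  proof (cases "x = y")
   case False
   have "\<bar>x - y\<bar> powr 1 <= \<bar>x - y\<bar> powr p" using True False assms by (intro powr_mono') auto
   then show ?thesis using False by simp
  qed simp
  finally show ?thesis unfolding eq using powr_ge_zero[of "\<bar>x - y\<bar>" p] by linarith
 next
  case False
  have "cmod (iexp (x - y) - 1) <= cmod (iexp (x - y)) + cmod 1" by (rule norm_triangle_ineq4)
  also have "... = 2" by (simp only: norm_exp_i_times norm_one)
  also have "2 <= 2 * \<bar>x - y\<bar> powr p" using False assms ge_one_powr_ge_zero[of "\<bar>x - y\<bar>" p] by auto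
  finally show ?thesis unfolding eq .
 qed
qed

context noise
begin

definition psum :: "(nat => real) => nat => int => 'a => real" where
 "psum b m i w = (\<Sum>l<m. b l * \<epsilon> (i - int l) w)"

definition root_c :: real where "root_c = c_4 powr (1 / 4)"

lemma root_c_nonneg: "0 <= root_c" by (simp add: root_c_def)

lemma root_c_pow4: "root_c ^ 4 = c_4"
proof (cases "c_4 = 0")
 case False
 then show ?thesis using c4_nonneg by (simp add: root_c_def powr_powr flip: powr_numeral)
next
 case True
 have 1: "root_c = c_4 powr (1 / 4)" by (rule root_c_def)
 have 2: "c_4 powr (1 / 4) = 0" using True by simp
 show ?thesis unfolding 1 2 using True by simp
qed

definition coeff_norm :: "(nat => real) => real" where
 "coeff_norm b = (\<Sum>m. \<bar>b m\<bar> powr \<gamma>)"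

lemma psum_noise_alg': "psum b m i \<in> borel_measurable (noise_alg {i - int m<..i})"
 unfolding psum_def by (intro borel_measurable_sum borel_measurable_times eps_noise_alg) auto

lemma psum_measurable[measurable]: "psum b m i \<in> borel_measurable M"
 unfolding psum_def by measurable

lemma card_filter_le: "finite I ==> sqrt (real (card {i\<in>I. P i})) <= sqrt (real (card I))"
 by (auto intro!: card_mono)

lemma summable_weighted:
 assumes "summable_coeffs b" "finite I"
 shows "summable (\<lambda>m. \<bar>b m\<bar> powr \<gamma> * sqrt (real (card {i\<in>I. s i <= m})))"
proof (rule summable_comparison_test')
 show "summable (\<lambda>m. \<bar>b m\<bar> powr \<gamma> * sqrt (real (card I)))"
  using assms(1) unfolding summable_coeffs_def by (rule summable_mult2)
 show "norm (\<bar>b m\<bar> powr \<gamma> * sqrt (real (card {i\<in>I. s i <= m}))) <= \<bar>b m\<bar> powr \<gamma> * sqrt (real (card I))" for m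
  using card_filter_le[OF assms(2)] by (simp add: mult_left_mono del: real_sqrt_le_iff)
qed

text \<open>Telescoping over the lag m: each step reinstates the innovation of lag m in place of its
  average \<open>\<phi> (b m * t)\<close>. For fixed m the sum over i has the form of
  \<open>martingale4\<close> and L4 norm at most a multiple of |b m t|^\<gamma> times the square
  root of the number of terms; Minkowski adds up the lags. The starting lag \<open>s i\<close> may
  vary with i: 0 gives plain centring, a block position gives the approximation by independent
  blocks.\<close>

lemma psum_fourth_moment:
 assumes sb: "summable_coeffs b" and I: "finite I" "\<And>i. i \<in> I ==> s i <= N"
 shows "\<E> (\<lambda>w. cmod (\<Sum>i\<in>I. iexp (t * psum b N i w) - iexp (t * psum b (s i) i w) * (\<Prod>l\<in>{s i..<N}. \<phi> (b l * t))) ^ 4)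
  <= (4 * root_c * \<bar>t\<bar> powr \<gamma> * (\<Sum>m. \<bar>b m\<bar> powr \<gamma> * sqrt (real (card {i\<in>I. s i <= m})))) ^ 4"
proof -
 \<comment> \<open>In \<open>Y m i\<close> the innovations of lag below m are present and those of
   lag above m are averaged out; the innovation of lag m itself sits in
   \<open>\<zeta> m\<close>.\<close>
 define Y where "Y m i w = iexp (t * psum b m i w) * (\<Prod>l\<in>{Suc m..<N}. \<phi> (b l * t))" for m i w
 define \<zeta> where "\<zeta> m x = iexp (b m * t * x) - \<phi> (b m * t)" for m x
 define G where "G i w m = iexp (t * psum b m i w) * (\<Prod>l\<in>{m..<N}. \<phi> (b l * t))" for i w m
 have step: "Y m i w * \<zeta> m (\<epsilon> (i - int m) w) = G i w (Suc m) - G i w m" if "m < N" for m i w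
 proof -
  have "iexp (t * psum b (Suc m) i w) = iexp (t * psum b m i w) * iexp (b m * t * \<epsilon> (i - int m) w)"
   unfolding psum_def sum.lessThan_Suc by (simp add: algebra_simps flip: exp_add)
  moreover have "(\<Prod>l\<in>{m..<N}. \<phi> (b l * t)) = \<phi> (b m * t) * (\<Prod>l\<in>{Suc m..<N}. \<phi> (b l * t))"
   using that by (rule prod.atLeast_Suc_lessThan)
  ultimately show ?thesis
   unfolding Y_def \<zeta>_def G_def by (simp only: algebra_simps)
 qed
 have tele: "iexp (t * psum b N i w) - iexp (t * psum b (s i) i w) * (\<Prod>l\<in>{s i..<N}. \<phi> (b l * t))
   = (\<Sum>m\<in>{s i..<N}. Y m i w * \<zeta> m (\<epsilon> (i - int m) w))" if "i \<in> I" for i w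
 proof -
  have "(\<Sum>m\<in>{s i..<N}. Y m i w * \<zeta> m (\<epsilon> (i - int m) w)) = (\<Sum>m\<in>{s i..<N}. G i w (Suc m) - G i w m)"
   by (intro sum.cong step) auto
  also have "... = G i w N - G i w (s i)"
   by (rule sum_Suc_diff'[OF I(2)[OF that]])
  finally show ?thesis by (simp add: G_def)
 qed
 let ?I = "\<lambda>m. {i\<in>I. s i <= m}"
 \<comment> \<open>For a fixed lag m exactly the indices with \<open>s i <= m\<close> contribute,
   which is where the cardinality in the bound comes from.\<close>
 have swap: "(\<Sum>i\<in>I. \<Sum>m\<in>{s i..<N}. h i m) = (\<Sum>m<N. \<Sum>i\<in>?I m. h i m)" for h :: "int => nat => complex"
 proof -
  have "(\<Sum>i\<in>I. \<Sum>m\<in>{s i..<N}. h i m) = (\<Sum>i\<in>I. \<Sum>m\<in>{m\<in>{..<N}. s i <= m}. h i m)"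
   by (intro sum.cong) auto
  also have "... = (\<Sum>m<N. \<Sum>i\<in>?I m. h i m)"
   by (rule sum.swap_restrict) (use I in auto)
  finally show ?thesis .
 qed
 have Y1: "cmod (Y m i w) <= 1" for m i w
  unfolding Y_def norm_mult prod_norm[symmetric] norm_exp_i_times mult_1_left
  by (intro prod_le_1) (auto simp: phi_le_1)
 have Ym: "Y m i \<in> borel_measurable (noise_alg {i - int m<..i})" for m i
  unfolding Y_def[abs_def] using measurable_compose[OF psum_noise_alg', of "\<lambda>x. iexp (t * x) * (\<Prod>l\<in>{Suc m..<N}. \<phi> (b l * t))" borel]
  by auto
 have \<zeta>m[measurable]: "\<zeta> m \<in> borel_measurable borel" for m unfolding \<zeta>_def by measurable
 have \<zeta>B: "cmod (\<zeta> m x) <= 2" for m x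
 proof -
  have "cmod (\<zeta> m x) <= cmod (iexp (b m * t * x)) + cmod (\<phi> (b m * t))" unfolding \<zeta>_def by (rule norm_triangle_ineq4)
  also have "... <= 1 + 1" using phi_le_1 by (simp only: norm_exp_i_times) simp
  finally show ?thesis by simp
 qed
 have b\<zeta>: "bdd_rv (\<lambda>w. \<zeta> m (\<epsilon> k w))" for m k
  using \<zeta>B by (intro bdd_rvI[where B = 2]) auto
 have bY: "bdd_rv (Y m i)" for m i
  using Y1 Ym[of m i] by (intro bdd_rvI[where B = 1]) (auto dest: measurable_noise_algD)
 have E0: "(LINT w|M. \<zeta> m (\<epsilon> 1 w)) = 0" for m
 proof -
  have "integrable M (\<lambda>w. iexp (b m * t * \<epsilon> 1 w))"
   by (intro bdd_rv_integrable bdd_rv_iexp) measurable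
  then show ?thesis
   unfolding \<zeta>_def by (subst integral_diff) (simp_all only: expectation_iexp_eps integrable_const, simp add: prob_space)
 qed
 have E4: "(LINT w|M. cmod (\<zeta> m (\<epsilon> 1 w)) ^ 4) <= (root_c * (\<bar>b m\<bar> powr \<gamma> * \<bar>t\<bar> powr \<gamma>)) ^ 4" for m
 proof -
  have "(LINT w|M. cmod (\<zeta> m (\<epsilon> 1 w)) ^ 4) <= c_4 * min (\<bar>b m * t\<bar> powr (4 * \<gamma>)) 1"
   unfolding \<zeta>_def by (rule phi_fourth)
  also have "... <= c_4 * \<bar>b m * t\<bar> powr (4 * \<gamma>)"
   by (intro mult_left_mono c4_nonneg) auto
  also have "\<bar>b m * t\<bar> powr (4 * \<gamma>) = (\<bar>b m\<bar> powr \<gamma> * \<bar>t\<bar> powr \<gamma>) ^ 4"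
  proof (cases "b m * t = 0")
   case False
   then have "\<bar>b m * t\<bar> powr (4 * \<gamma>) = (\<bar>b m * t\<bar> powr \<gamma>) powr 4" by (simp add: powr_powr mult.commute)
   also have "... = (\<bar>b m * t\<bar> powr \<gamma>) ^ 4" using False by simp
   finally show ?thesis by (simp add: abs_mult powr_mult)
  qed auto
  finally show ?thesis by (simp add: power_mult_distrib root_c_pow4)
 qed
 have "\<E> (\<lambda>w. cmod (\<Sum>m<N. \<Sum>i\<in>?I m. Y m i w * \<zeta> m (\<epsilon> (i - int m) w)) ^ 4)
   <= (\<Sum>m<N. 4 * sqrt (real (card (?I m))) * (root_c * (\<bar>b m\<bar> powr \<gamma> * \<bar>t\<bar> powr \<gamma>))) ^ 4"
 proof (rule minkowski4_sum)
  fix m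
  show "bdd_rv (\<lambda>w. \<Sum>i\<in>?I m. Y m i w * \<zeta> m (\<epsilon> (i - int m) w))"
   by (intro bdd_rv_intros bY b\<zeta>)
  show "0 <= 4 * sqrt (real (card (?I m))) * (root_c * (\<bar>b m\<bar> powr \<gamma> * \<bar>t\<bar> powr \<gamma>))"
   using root_c_nonneg by (intro mult_nonneg_nonneg) auto
  show "\<E> (\<lambda>w. cmod (\<Sum>i\<in>?I m. Y m i w * \<zeta> m (\<epsilon> (i - int m) w)) ^ 4)
    <= (4 * sqrt (real (card (?I m))) * (root_c * (\<bar>b m\<bar> powr \<gamma> * \<bar>t\<bar> powr \<gamma>))) ^ 4"
   by (rule martingale4[where B = 2]) (use I Ym Y1 \<zeta>B E0 E4 root_c_nonneg in \<open>auto intro!: mult_nonneg_nonneg\<close>)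
 qed
 also have "... <= (4 * root_c * \<bar>t\<bar> powr \<gamma> * (\<Sum>m. \<bar>b m\<bar> powr \<gamma> * sqrt (real (card (?I m))))) ^ 4"
 proof (rule power_mono)
  have "(\<Sum>m<N. 4 * sqrt (real (card (?I m))) * (root_c * (\<bar>b m\<bar> powr \<gamma> * \<bar>t\<bar> powr \<gamma>)))
    = 4 * root_c * \<bar>t\<bar> powr \<gamma> * (\<Sum>m<N. \<bar>b m\<bar> powr \<gamma> * sqrt (real (card (?I m))))"
   unfolding sum_distrib_left by (intro sum.cong) auto
  also have "... <= 4 * root_c * \<bar>t\<bar> powr \<gamma> * (\<Sum>m. \<bar>b m\<bar> powr \<gamma> * sqrt (real (card (?I m))))"
   using root_c_nonneg by (intro mult_left_mono sum_le_suminf summable_weighted sb I) auto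
  finally show "(\<Sum>m<N. 4 * sqrt (real (card (?I m))) * (root_c * (\<bar>b m\<bar> powr \<gamma> * \<bar>t\<bar> powr \<gamma>))) <= ..." .
  show "0 <= (\<Sum>m<N. 4 * sqrt (real (card (?I m))) * (root_c * (\<bar>b m\<bar> powr \<gamma> * \<bar>t\<bar> powr \<gamma>)))"
   using root_c_nonneg by (intro sum_nonneg mult_nonneg_nonneg) auto
 qed
 finally show ?thesis
  unfolding swap[symmetric] using tele by (simp cong: sum.cong)
qed

lemma bdd_rv_bound_sum:
 fixes x :: "int => 'a => complex"
 assumes "\<And>i w. i \<in> I ==> cmod (x i w) <= 2"
 shows "cmod (\<Sum>i\<in>I. x i w) <= 2 * real (card I)"
 using sum_norm_bound[of I "\<lambda>i. x i w" 2] assms by (simp add: mult.commute)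

text \<open>The bound of \<open>psum_fourth_moment\<close> does not depend on N, so dominated
  convergence passes to the infinite series.\<close>

lemma lin_fourth_moment:
 assumes sb: "summable_coeffs b" and I: "finite I"
 shows "\<E> (\<lambda>z. cmod (\<Sum>i\<in>I. iexp (t * lin b i z) - iexp (t * psum b (s i) i z) * cf (\<lambda>l. b (l + s i)) t) ^ 4)
  <= (4 * root_c * \<bar>t\<bar> powr \<gamma> * (\<Sum>m. \<bar>b m\<bar> powr \<gamma> * sqrt (real (card {i\<in>I. s i <= m})))) ^ 4"
proof (rule LIMSEQ_le_const2)
 let ?f = "\<lambda>N z. cmod (\<Sum>i\<in>I. iexp (t * psum b N i z) - iexp (t * psum b (s i) i z) * (\<Prod>l\<in>{s i..<N}. \<phi> (b l * t))) ^ 4"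
 let ?g = "\<lambda>z. cmod (\<Sum>i\<in>I. iexp (t * lin b i z) - iexp (t * psum b (s i) i z) * cf (\<lambda>l. b (l + s i)) t) ^ 4"
 show "(\<lambda>N. \<E> (?f N)) ----> \<E> ?g"
 proof (rule integral_dominated_convergence[where w = "\<lambda>_. (2 * real (card I)) ^ 4"])
  show "AE z in M. (\<lambda>N. ?f N z) ----> ?g z"
   using AE_lin_summable[OF sb]
  proof eventually_elim
   case (elim z)
   have "(\<lambda>N. psum b N i z) ----> lin b i z" for i
    unfolding psum_def lin_def using elim by (intro summable_LIMSEQ) auto
   then show ?case
    by (intro tendsto_intros cf_split sb)
  qed
  have "cmod (\<Prod>l\<in>{s i..<N}. \<phi> (b l * t)) <= 1" for i N
   unfolding prod_norm[symmetric] by (intro prod_le_1) (auto simp: phi_le_1)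
  then have e2: "cmod (iexp (t * psum b N i z) - iexp (t * psum b (s i) i z) * (\<Prod>l\<in>{s i..<N}. \<phi> (b l * t))) <= 2" for i N z
   by (intro order_trans[OF norm_triangle_ineq4]) (simp only: norm_mult norm_exp_i_times, simp add: add_mono)
  show "AE z in M. norm (?f N z) <= (2 * real (card I)) ^ 4" for N
  proof (intro AE_I2)
   fix z
   have "?f N z <= (2 * real (card I)) ^ 4"
    by (intro power_mono bdd_rv_bound_sum) (use e2 in auto)
   then show "norm (?f N z) <= (2 * real (card I)) ^ 4" by simp
  qed
 qed (auto simp del: of_real_mult)
 show "\<exists>N. \<forall>n\<ge>N. \<E> (?f n) <= (4 * root_c * \<bar>t\<bar> powr \<gamma> * (\<Sum>m. \<bar>b m\<bar> powr \<gamma> * sqrt (real (card {i\<in>I. s i <= m})))) ^ 4"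
 proof (intro exI allI impI psum_fourth_moment sb I)
  fix n i assume "Max (s ` I) <= n" "i \<in> I"
  then show "s i <= n" using I by (meson Max_ge finite_imageI imageI order_trans)
 qed
qed

text \<open>The case s = 0, in which nothing is kept and the subtracted term is the mean.\<close>

lemma lin_fourth_moment_centered:
 assumes sb: "summable_coeffs b" and I: "finite I"
 shows "\<E> (\<lambda>w. cmod (\<Sum>i\<in>I. iexp (t * lin b i w) - cf b t) ^ 4)
  <= (4 * root_c * coeff_norm b * \<bar>t\<bar> powr \<gamma> * sqrt (real (card I))) ^ 4"
proof -
 have "(\<Sum>m. \<bar>b m\<bar> powr \<gamma> * sqrt (real (card I))) = coeff_norm b * sqrt (real (card I))"
  using sb unfolding coeff_norm_def summable_coeffs_def by (rule suminf_mult2[symmetric])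
 then show ?thesis
  using lin_fourth_moment[OF assms, of t "\<lambda>_. 0"] by (simp add: psum_def mult_ac)
qed

lemma expectation_square_le_of_fourth:
 fixes x :: "'a => complex"
 assumes "bdd_rv x" "\<E> (\<lambda>w. cmod (x w) ^ 4) <= p ^ 4" "0 <= p"
 shows "\<E> (\<lambda>w. (cmod (x w))^2) <= p^2"
proof (rule power2_le_imp_le)
 have "(\<E> (\<lambda>w. (cmod (x w))^2))^2 <= \<E> (\<lambda>w. ((cmod (x w))^2)^2)"
  by (intro expectation_square_le bdd_rv_intros assms)
 then show "(\<E> (\<lambda>w. (cmod (x w))^2))^2 <= (p^2)^2" using assms(2) by simp
qed auto

lemma coeff_norm_nonneg: "summable_coeffs b ==> 0 <= coeff_norm b"
 unfolding coeff_norm_def summable_coeffs_def by (rule suminf_nonneg) auto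

text \<open>The condition under which \<open>cf_integrable\<close> applies; a single nonzero
  coefficient gives only a square-integrable characteristic function.\<close>

definition two_coeffs :: "(nat => real) => bool" where
 "two_coeffs b \<longleftrightarrow> summable_coeffs b \<and> (\<exists>l l'. l \<noteq> l' \<and> b l \<noteq> 0 \<and> b l' \<noteq> 0)"

definition lin_density :: "(nat => real) => real => real" where
 "lin_density b = inv_char (distr M borel (lin b 0))"

definition density_bound :: "(nat => real) => real" where
 "density_bound b = (LINT t|lborel. cmod (cf b t)) / (2 * pi)"

definition holder_bound :: "(nat => real) => real" where
 "holder_bound b = (LINT t|lborel. cmod (cf b t) * \<bar>t\<bar> powr \<gamma>) / pi"

context
 fixes b assumes b: "two_coeffs b"
begin

lemma two_coeffs_summable: "summable_coeffs b"
 using b unfolding two_coeffs_def by blast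

lemma cf_weighted_integrable: "0 <= p ==> p <= 2 * \<gamma> ==> integrable lborel (\<lambda>t. cmod (cf b t) * \<bar>t\<bar> powr p)"
 using b cf_integrable unfolding two_coeffs_def by blast

lemma cf_abs_integrable: "integrable lborel (\<lambda>t. cmod (cf b t))"
proof -
 have "integrable lborel (\<lambda>t. cmod (cf b t) * \<bar>t\<bar> powr 0)"
  using gamma by (intro cf_weighted_integrable) auto
 then show ?thesis
 proof (rule integrable_cong_AE_imp)
  \<comment> \<open>\<open>0 powr 0\<close> is 0, so the weight with exponent 0 differs from 1 at t
    = 0.\<close>
  show "AE t in lborel. cmod (cf b t) * \<bar>t\<bar> powr 0 = cmod (cf b t)"
   using AE_lborel_singleton[of 0] by eventually_elim auto
 qed auto
qed

lemma char_lin_integrable: "integrable lborel (char (distr M borel (lin b i)))"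
proof -
 have "char (distr M borel (lin b i)) = cf b"
  using cf_eq_char[OF two_coeffs_summable] by blast
 moreover have "integrable lborel (cf b)"
  using cf_abs_integrable by (subst (asm) integrable_norm_iff) auto
 ultimately show ?thesis by simp
qed

lemma distr_lin_density: "distr M borel (lin b i) = density lborel (\<lambda>x. ennreal (lin_density b x))"
proof -
 interpret D: real_distribution "distr M borel (lin b 0)" by (rule real_distribution_distr) simp
 show ?thesis
  using D.density_inv_char[OF char_lin_integrable] distr_lin[OF two_coeffs_summable, of i 0]
  by (simp add: lin_density_def)
qed

lemma lin_density_nonneg: "0 <= lin_density b x"
proof -
 interpret D: real_distribution "distr M borel (lin b 0)" by (rule real_distribution_distr) simp
 show ?thesis unfolding lin_density_def by (rule D.inv_char_nonneg[OF char_lin_integrable])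
qed

lemma lin_density_measurable[measurable]: "lin_density b \<in> borel_measurable borel"
proof -
 interpret D: real_distribution "distr M borel (lin b 0)" by (rule real_distribution_distr) simp
 show ?thesis unfolding lin_density_def by (rule D.inv_char_measurable[OF char_lin_integrable])
qed

lemma lin_density_le: "lin_density b x <= density_bound b"
proof -
 interpret D: real_distribution "distr M borel (lin b 0)" by (rule real_distribution_distr) simp
 show ?thesis
  using D.abs_inv_char_le[OF char_lin_integrable, of x]
  by (simp add: lin_density_def density_bound_def cf_eq_char[OF two_coeffs_summable])
qed

lemma lin_density_fourier: "(LINT t|lborel. cf b t * iexp (- (t * x))) = complex_of_real (2 * pi * lin_density b x)"
proof -
 interpret D: real_distribution "distr M borel (lin b 0)" by (rule real_distribution_distr) simp
 show ?thesis
  using D.inv_char_complex[of x] unfolding cf_eq_char[OF two_coeffs_summable] lin_density_def .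
qed

lemma cf_iexp_integrable: "integrable lborel (\<lambda>t. cf b t * iexp (- (t * x)))"
 by (rule integrable_bound[OF cf_abs_integrable]) (auto simp: norm_mult)

lemma lin_density_holder: "\<bar>lin_density b x - lin_density b y\<bar> <= holder_bound b * \<bar>x - y\<bar> powr \<gamma>"
proof -
 have "complex_of_real (2 * pi * (lin_density b x - lin_density b y)) = (LINT t|lborel. cf b t * iexp (- (t * x)) - cf b t * iexp (- (t * y)))"
  unfolding integral_diff[OF cf_iexp_integrable cf_iexp_integrable] lin_density_fourier
  by (simp add: right_diff_distrib)
 from arg_cong[OF this, of cmod] have "2 * pi * \<bar>lin_density b x - lin_density b y\<bar> = cmod (LINT t|lborel. cf b t * iexp (- (t * x)) - cf b t * iexp (- (t * y)))"
  by (simp only: norm_of_real abs_mult) simp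
 also have "... <= (LINT t|lborel. cmod (cf b t * iexp (- (t * x)) - cf b t * iexp (- (t * y))))"
  by (rule integral_norm_bound)
 also have "... <= (LINT t|lborel. 2 * \<bar>x - y\<bar> powr \<gamma> * (cmod (cf b t) * \<bar>t\<bar> powr \<gamma>))"
 proof (rule integral_mono')
  fix t
  have "cmod (cf b t * iexp (- (t * x)) - cf b t * iexp (- (t * y))) = cmod (cf b t) * cmod (iexp (- (t * x)) - iexp (- (t * y)))"
   by (simp only: right_diff_distrib[symmetric] norm_mult)
  also have "... <= cmod (cf b t) * (2 * \<bar>- (t * x) - - (t * y)\<bar> powr \<gamma>)"
   by (intro mult_left_mono cmod_iexp_diff_le_powr gamma) auto
  also have "\<bar>- (t * x) - - (t * y)\<bar> = \<bar>t\<bar> * \<bar>x - y\<bar>"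
   by (simp add: abs_mult[symmetric] algebra_simps abs_minus_commute)
  finally show "cmod (cf b t * iexp (- (t * x)) - cf b t * iexp (- (t * y))) <= 2 * \<bar>x - y\<bar> powr \<gamma> * (cmod (cf b t) * \<bar>t\<bar> powr \<gamma>)"
   by (simp add: powr_mult mult_ac)
 qed (use gamma in \<open>auto intro!: cf_weighted_integrable\<close>)
 also have "... = 2 * pi * (holder_bound b * \<bar>x - y\<bar> powr \<gamma>)"
  by (simp add: holder_bound_def)
 finally show ?thesis by simp
qed

lemma density_bound_nonneg: "0 <= density_bound b"
 unfolding density_bound_def by (intro divide_nonneg_pos integral_nonneg) auto

end

text \<open>Having a density bounded by C, stated through integrals. In this form it covers the
  density obtained by inversion as well as the assumed density f, and it can be applied directly
  under a nonnegative integral.\<close>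

definition bdd_law :: "real measure => real => bool" where
 "bdd_law N C \<longleftrightarrow> 0 <= C \<and> (\<forall>\<kappa>\<in>borel_measurable borel. (\<integral>\<^sup>+x. \<kappa> x \<partial>N) <= ennreal C * (\<integral>\<^sup>+x. \<kappa> x \<partial>lborel))"

lemma bdd_lawD: "bdd_law N C ==> \<kappa> \<in> borel_measurable borel ==> (\<integral>\<^sup>+x. \<kappa> x \<partial>N) <= ennreal C * (\<integral>\<^sup>+x. \<kappa> x \<partial>lborel)"
 unfolding bdd_law_def by blast

lemma bdd_law_density:
 assumes [measurable]: "f \<in> borel_measurable borel" and "\<And>x. f x <= C" "0 <= C"
 shows "bdd_law (density lborel (\<lambda>x. ennreal (f x))) C"
 unfolding bdd_law_def
proof (intro conjI ballI)
 fix \<kappa> :: "real => ennreal" assume [measurable]: "\<kappa> \<in> borel_measurable borel"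
 have "(\<integral>\<^sup>+x. \<kappa> x \<partial>density lborel (\<lambda>x. ennreal (f x))) = (\<integral>\<^sup>+x. ennreal (f x) * \<kappa> x \<partial>lborel)"
  by (rule nn_integral_density) auto
 also have "... <= (\<integral>\<^sup>+x. ennreal C * \<kappa> x \<partial>lborel)"
  using assms by (intro nn_integral_mono mult_right_mono ennreal_leI) auto
 finally show "(\<integral>\<^sup>+x. \<kappa> x \<partial>density lborel (\<lambda>x. ennreal (f x))) <= ennreal C * (\<integral>\<^sup>+x. \<kappa> x \<partial>lborel)"
  by (simp add: nn_integral_cmult)
qed (use assms in auto)

lemma bdd_law_lin: "two_coeffs b ==> bdd_law (distr M borel (lin b i)) (density_bound b)"
 by (simp add: distr_lin_density bdd_law_density lin_density_le density_bound_nonneg)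

lemma AE_lin_split:
 assumes "summable_coeffs b"
 shows "AE w in M. \<forall>i. lin b i w = psum b s i w + lin (\<lambda>l. b (l + s)) (i - int s) w"
 using AE_lin_summable[OF assms]
proof eventually_elim
 case (elim w)
 show ?case
 proof
  fix i
  have "lin b i w = (\<Sum>l. b (l + s) * \<epsilon> (i - int (l + s)) w) + psum b s i w"
   unfolding lin_def psum_def using elim by (intro suminf_split_initial_segment) auto
  then show "lin b i w = psum b s i w + lin (\<lambda>l. b (l + s)) (i - int s) w"
   unfolding lin_def by (simp add: algebra_simps)
 qed
qed

lemma psum_eq_lin: "psum b s i w = lin (\<lambda>l. if l < s then b l else 0) i w"
 by (subst lin_finite[where L = s]) (auto simp: psum_def intro!: sum.cong)

lemma summable_coeffs_shift: "summable_coeffs b ==> summable_coeffs (\<lambda>l. b (l + s))"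
 unfolding summable_coeffs_def by (subst summable_iff_shift)

lemma summable_coeffs_finite: "(\<And>l. L <= l ==> b l = 0) ==> summable_coeffs b"
 unfolding summable_coeffs_def by (rule summable_finite[of "{..<L}"]) (auto simp: not_less)

lemma summable_coeffs_diff:
 assumes "summable_coeffs a" "summable_coeffs b"
 shows "summable_coeffs (\<lambda>l. a l - b l)"
 unfolding summable_coeffs_def
proof (rule summable_comparison_test')
 show "summable (\<lambda>l. \<bar>a l\<bar> powr \<gamma> + \<bar>b l\<bar> powr \<gamma>)"
  using assms unfolding summable_coeffs_def by (rule summable_add)
 fix l
 have "\<bar>a l - b l\<bar> powr \<gamma> <= (\<bar>a l\<bar> + \<bar>b l\<bar>) powr \<gamma>" using gamma by (intro powr_mono2) auto
 also have "... <= \<bar>a l\<bar> powr \<gamma> + \<bar>b l\<bar> powr \<gamma>" using gamma by (intro powr_add_le) auto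
 finally show "norm (\<bar>a l - b l\<bar> powr \<gamma>) <= \<bar>a l\<bar> powr \<gamma> + \<bar>b l\<bar> powr \<gamma>" by simp
qed

text \<open>The coefficients of \<open>lin b j\<close> minus \<open>lin b (j - k)\<close>, viewed as
  a linear process at time j (\<open>AE_lin_diff\<close>).\<close>

definition diff_coeffs :: "(nat => real) => nat => nat => real" where
 "diff_coeffs b k l = b l - (if l < k then 0 else b (l - k))"

lemma summable_delay: "summable_coeffs b ==> summable_coeffs (\<lambda>l. if l < k then 0 else b (l - k))"
 unfolding summable_coeffs_def
 by (subst summable_iff_shift[of _ k, symmetric]) simp

lemma AE_lin_diff:
 assumes sb: "summable_coeffs b"
 shows "AE w in M. \<forall>j. lin b j w - lin b (j - int k) w = lin (diff_coeffs b k) j w"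
 using AE_lin_summable[OF sb] AE_lin_summable[OF summable_delay[OF sb, of k]] AE_lin_split[OF summable_delay[OF sb, of k], of k]
proof eventually_elim
 case (elim w)
 show ?case
 proof
  fix j
  have "lin (\<lambda>l. if l < k then 0 else b (l - k)) j w = lin b (j - int k) w"
   using elim(3) by (simp add: psum_def)
  moreover have "lin (diff_coeffs b k) j w = lin b j w - lin (\<lambda>l. if l < k then 0 else b (l - k)) j w"
   unfolding lin_def diff_coeffs_def left_diff_distrib using elim(1,2) by (intro suminf_diff[symmetric]) auto
  ultimately show "lin b j w - lin b (j - int k) w = lin (diff_coeffs b k) j w" by simp
 qed
qed

text \<open>The first nonzero coefficient \<open>b p\<close> survives the subtraction. If no other
  coefficient did, b would be constant along p, p + k, p + 2k, and so on, against summability. Hence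
  differences of the process at two times have a bounded density even if the process has a single
  nonzero coefficient.\<close>

lemma two_coeffs_diff:
 assumes sb: "summable_coeffs b" and nz: "b l_0 \<noteq> 0" and k: "0 < k"
 shows "two_coeffs (diff_coeffs b k)"
proof -
 have sd: "summable_coeffs (diff_coeffs b k)"
  unfolding diff_coeffs_def[abs_def] by (intro summable_coeffs_diff summable_delay sb)
 define p where "p = (LEAST l. b l \<noteq> 0)"
 have p: "b p \<noteq> 0" unfolding p_def by (rule LeastI[of "\<lambda>l. b l \<noteq> 0", OF nz])
 have below: "b l = 0" if "l < p" for l
  using that not_less_Least unfolding p_def by blast
 have dp: "diff_coeffs b k p \<noteq> 0"
  using p below[of "p - k"] k by (auto simp: diff_coeffs_def)
 have "\<exists>l. l \<noteq> p \<and> diff_coeffs b k l \<noteq> 0"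
 proof (rule ccontr)
  assume "\<not> ?thesis"
  then have z: "diff_coeffs b k l = 0" if "l \<noteq> p" for l using that by blast
  have eq: "b (p + n * k) = b p" for n
  proof (induction n)
   case (Suc n)
   have "diff_coeffs b k (p + Suc n * k) = 0" using k by (intro z) auto
   then show ?case using Suc k by (simp add: diff_coeffs_def split: if_splits)
  qed simp
  have "(\<lambda>l. \<bar>b l\<bar> powr \<gamma>) ----> 0"
   using sb unfolding summable_coeffs_def by (rule summable_LIMSEQ_zero)
  moreover have "strict_mono (\<lambda>n. p + n * k)" using k by (auto simp: strict_mono_def)
  ultimately have "((\<lambda>l. \<bar>b l\<bar> powr \<gamma>) \<circ> (\<lambda>n. p + n * k)) ----> 0" by (rule LIMSEQ_subseq_LIMSEQ)
  then have "\<bar>b p\<bar> powr \<gamma> = 0" by (simp add: comp_def eq LIMSEQ_const_iff)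
  then show False using p by simp
 qed
 with sd dp show ?thesis unfolding two_coeffs_def by blast
qed

end

section \<open>The doubly centred part of the kernel sum\<close>

text \<open>
  With infinitely many coefficients, \<open>L\<close> can be chosen such that \<open>U i\<close> keeps an integrable characteristic function
  after deleting any one innovation; with finitely many, \<open>L\<close> exceeds all of them and \<open>U i\<close> is the whole process.
\<close>

locale split_process = noise M \<epsilon> \<phi> \<gamma> c_4
 for M :: "'a measure" and \<epsilon> :: "int => 'a => real" and \<phi> :: "real => complex" and \<gamma> c_4 :: real +
 fixes a :: "nat => real" and L :: nat and C_U :: real
 assumes sa: "summable_coeffs a" and a_nonzero: "\<exists>l. a l \<noteq> 0" and L_pos: "0 < L"
  and bdd_U: "bdd_law (distr M borel (psum a L 0)) C_U"
  and finite_or_smooth: "(\<forall>l\<ge>L. a l = 0) \<or> (\<forall>s. two_coeffs (\<lambda>l. if l < L \<and> l \<noteq> s then a l else 0))"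
begin

definition U :: "int => 'a => real" where "U = psum a L"
definition W :: "int => 'a => real" where "W i = lin (\<lambda>l. a (l + L)) (i - int L)"
definition X :: "int => 'a => real" where "X i w = U i w + W i w"
definition \<mu> :: "real measure" where "\<mu> = distr M borel (U 0)"

lemma U_noise_alg: "U i \<in> borel_measurable (noise_alg {i - int L<..i})"
 unfolding U_def by (rule psum_noise_alg')

lemma W_noise_alg: "W i \<in> borel_measurable (noise_alg {..i - int L})"
 unfolding W_def by (rule lin_noise_alg) auto

lemma X_noise_alg: "X i \<in> borel_measurable (noise_alg {..i})"
 unfolding X_def[abs_def]
 by (intro borel_measurable_add noise_alg_mono[OF _ U_noise_alg] noise_alg_mono[OF _ W_noise_alg]) auto

lemma U_measurable[measurable]: "U i \<in> borel_measurable M"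
 and W_measurable[measurable]: "W i \<in> borel_measurable M"
 and X_measurable[measurable]: "X i \<in> borel_measurable M"
 using U_noise_alg W_noise_alg X_noise_alg by (auto dest: measurable_noise_algD)

lemma AE_X_eq_lin: "AE w in M. \<forall>i. X i w = lin a i w"
 using AE_lin_split[OF sa, of L] by eventually_elim (simp add: X_def U_def W_def)

lemma distr_U: "distr M borel (U i) = \<mu>"
proof -
 have "U i = lin (\<lambda>l. if l < L then a l else 0) i" for i
  unfolding U_def by (rule ext) (rule psum_eq_lin)
 moreover have "summable_coeffs (\<lambda>l. if l < L then a l else 0)"
  by (rule summable_coeffs_finite[where L = L]) auto
 ultimately show ?thesis unfolding \<mu>_def using distr_lin by simp
qed

sublocale \<mu>: real_distribution \<mu>
 unfolding \<mu>_def by (rule real_distribution_distr) simp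

lemma bdd_mu: "bdd_law \<mu> C_U"
 using bdd_U unfolding \<mu>_def U_def .

lemma C_mu_nonneg: "0 <= C_U"
 using bdd_U unfolding bdd_law_def by blast

lemma lborel_shift:
 fixes g :: "real => ennreal"
 assumes [measurable]: "g \<in> borel_measurable borel"
 shows "(\<integral>\<^sup>+x. g (c + x) \<partial>lborel) = (\<integral>\<^sup>+x. g x \<partial>lborel)" "(\<integral>\<^sup>+x. g (x + c) \<partial>lborel) = (\<integral>\<^sup>+x. g x \<partial>lborel)"
  "(\<integral>\<^sup>+x. g (c - x) \<partial>lborel) = (\<integral>\<^sup>+x. g x \<partial>lborel)" "(\<integral>\<^sup>+x. g (x - c) \<partial>lborel) = (\<integral>\<^sup>+x. g x \<partial>lborel)"
 using nn_integral_real_affine[OF assms, of 1 c] nn_integral_real_affine[OF assms, of "-1" c] nn_integral_real_affine[OF assms, of 1 "-c"]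
 by (simp_all add: add.commute)

lemma mu_shift_le:
 fixes g :: "real => ennreal"
 assumes [measurable]: "g \<in> borel_measurable borel"
 shows "(\<integral>\<^sup>+u. g (c + u) \<partial>\<mu>) <= ennreal C_U * (\<integral>\<^sup>+x. g x \<partial>lborel)"
 using bdd_lawD[OF bdd_mu, of "\<lambda>u. g (c + u)"] by (simp add: lborel_shift)

definition C_d :: real where
 "C_d = C_U + (\<Sum>k\<in>{1..<L}. density_bound (diff_coeffs a k))"

lemma two_coeffs_diff_a: "0 < k ==> two_coeffs (diff_coeffs a k)"
 using a_nonzero two_coeffs_diff[OF sa] by blast

lemma C_delta: "C_U <= C_d" "\<And>k. 0 < k ==> k < L ==> density_bound (diff_coeffs a k) <= C_d" "0 <= C_d"
proof -
 have nn: "0 <= density_bound (diff_coeffs a k)" if "k \<in> {1..<L}" for k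
  using that by (intro density_bound_nonneg two_coeffs_diff_a) auto
 then have "0 <= (\<Sum>k\<in>{1..<L}. density_bound (diff_coeffs a k))" by (rule sum_nonneg)
 then show "C_U <= C_d" "0 <= C_d" using C_mu_nonneg unfolding C_d_def by auto
 fix k assume "0 < k" "k < L"
 then have "density_bound (diff_coeffs a k) <= (\<Sum>k\<in>{1..<L}. density_bound (diff_coeffs a k))"
  by (intro member_le_sum nn) auto
 then show "density_bound (diff_coeffs a k) <= C_d" using C_mu_nonneg unfolding C_d_def by simp
qed

text \<open>For a gap of at least L, \<open>U j\<close> is independent of the rest of the difference
  and has a bounded law. The finitely many shorter gaps are linear processes with coefficients
  \<open>diff_coeffs a k\<close>, and \<open>C_d\<close> exceeds the bounds of all these
  cases.\<close>

lemma difference_density: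
 assumes ij: "i < j" and [measurable]: "g \<in> borel_measurable borel"
 shows "(\<integral>\<^sup>+w. g (X j w - X i w) \<partial>M) <= ennreal C_d * (\<integral>\<^sup>+x. g x \<partial>lborel)"
proof (cases "i + int L <= j")
 case True
 have V: "(\<lambda>w. W j w - X i w) \<in> borel_measurable (noise_alg {..j - int L})"
  by (intro borel_measurable_diff W_noise_alg noise_alg_mono[OF _ X_noise_alg]) (use True in auto)
 have "(\<integral>\<^sup>+w. g (X j w - X i w) \<partial>M) = (\<integral>\<^sup>+w. g ((W j w - X i w) + U j w) \<partial>M)"
  unfolding X_def by (simp add: algebra_simps)
 also have "... = (\<integral>\<^sup>+w. (\<integral>\<^sup>+u. g ((W j w - X i w) + u) \<partial>distr M borel (U j)) \<partial>M)"
  by (rule freeze_nn[OF _ V U_noise_alg]) auto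
 also have "... <= (\<integral>\<^sup>+w. ennreal C_U * (\<integral>\<^sup>+x. g x \<partial>lborel) \<partial>M)"
  unfolding distr_U by (intro nn_integral_mono mu_shift_le) auto
 also have "... = ennreal C_U * (\<integral>\<^sup>+x. g x \<partial>lborel)" by (simp add: emeasure_space_1)
 also have "... <= ennreal C_d * (\<integral>\<^sup>+x. g x \<partial>lborel)"
  by (intro mult_right_mono ennreal_leI C_delta) auto
 finally show ?thesis .
next
 case False
 define k where "k = nat (j - i)"
 have k: "0 < k" "k < L" "j - int k = i" using ij False by (auto simp: k_def)
 have "(\<integral>\<^sup>+w. g (X j w - X i w) \<partial>M) = (\<integral>\<^sup>+w. g (lin (diff_coeffs a k) j w) \<partial>M)"
 proof (rule nn_integral_cong_AE)
  show "AE w in M. g (X j w - X i w) = g (lin (diff_coeffs a k) j w)"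
   using AE_X_eq_lin AE_lin_diff[OF sa, of k]
  proof eventually_elim
   case (elim w)
   show ?case using elim(1) elim(2)[rule_format, of j] k(3) by simp
  qed
 qed
 also have "... = (\<integral>\<^sup>+x. g x \<partial>distr M borel (lin (diff_coeffs a k) j))"
  by (simp add: nn_integral_distr)
 also have "... <= ennreal (density_bound (diff_coeffs a k)) * (\<integral>\<^sup>+x. g x \<partial>lborel)"
  using bdd_law_lin[OF two_coeffs_diff_a[OF k(1)]] by (rule bdd_lawD) simp
 also have "... <= ennreal C_d * (\<integral>\<^sup>+x. g x \<partial>lborel)"
  using k by (intro mult_right_mono ennreal_leI C_delta) auto
 finally show ?thesis .
qed

definition tail_norm :: "nat => real" where
 "tail_norm m = coeff_norm (\<lambda>l. a (l + m))"

lemma tail_norm_nonneg: "0 <= tail_norm m"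
 unfolding tail_norm_def by (intro coeff_norm_nonneg summable_coeffs_shift sa)

text \<open>At most 2 m indices lie within distance m of a given one; for those pairs xy is at most
  (x^2 + y^2)/2, and all other pairs vanish.\<close>

lemma expectation_lag_orthogonal:
 fixes s :: "nat => 'a => real"
 assumes "finite J" and b: "\<And>j. j \<in> J ==> bdd_rv (s j)"
  and orth: "\<And>i j. i \<in> J ==> j \<in> J ==> i + m <= j ==> \<E> (\<lambda>w. s i w * s j w) = 0"
 shows "\<E> (\<lambda>w. (\<Sum>j\<in>J. s j w)^2) <= 2 * real m * (\<Sum>j\<in>J. \<E> (\<lambda>w. (s j w)^2))"
proof -
 let ?e = "\<lambda>j. \<E> (\<lambda>w. (s j w)^2)" and ?n = "\<lambda>i j. i < j + m \<and> j < i + m"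
 have e0: "0 <= ?e j" for j by (rule integral_nonneg) auto
 have pair: "\<E> (\<lambda>w. s i w * s j w) <= (if ?n i j then ?e i / 2 + ?e j / 2 else 0)" if "i \<in> J" "j \<in> J" for i j
 proof (cases "?n i j")
  case True
  have "\<E> (\<lambda>w. s i w * s j w) <= \<E> (\<lambda>w. (s i w)^2 * (1/2) + (s j w)^2 * (1/2))"
   using sum_squares_bound[of "s i w" "s j w" for w]
   by (intro integral_mono bdd_rv_integrable bdd_rv_intros b that) (auto simp: field_simps)
  also have "... = ?e i / 2 + ?e j / 2"
  proof -
   have "integrable M (\<lambda>w. (s i w)^2)" "integrable M (\<lambda>w. (s j w)^2)"
    by (intro bdd_rv_integrable bdd_rv_intros b that)+
   then show ?thesis by simp
  qed
  finally show ?thesis using True by simp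
 next
  case False
  then have "i + m <= j \<or> j + m <= i" by auto
  then have "\<E> (\<lambda>w. s i w * s j w) = 0"
   using orth[OF that] orth[OF that(2,1)] by (auto simp: mult.commute)
  then show ?thesis using False by simp
 qed
 have cnt: "real (card {j\<in>J. ?n i j}) <= 2 * real m" for i
 proof -
  have "card {j\<in>J. ?n i j} <= card {i + 1 - m..<i + m}"
   by (intro card_mono) auto
  also have "... <= 2 * m" by simp
  finally show ?thesis by linarith
 qed
 have "\<E> (\<lambda>w. (\<Sum>j\<in>J. s j w)^2) = \<E> (\<lambda>w. \<Sum>i\<in>J. \<Sum>j\<in>J. s i w * s j w)"
  by (simp add: power2_eq_square sum_product)
 also have "... = (\<Sum>i\<in>J. \<Sum>j\<in>J. \<E> (\<lambda>w. s i w * s j w))"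
  by (simp add: integral_sum bdd_rv_integrable bdd_rv_sum bdd_rv_mult b)
 also have "... <= (\<Sum>i\<in>J. \<Sum>j\<in>J. if ?n i j then ?e i / 2 + ?e j / 2 else 0)"
  by (intro sum_mono pair)
 also have "... = (\<Sum>i\<in>J. \<Sum>j\<in>J. if ?n i j then ?e i / 2 else 0) + (\<Sum>i\<in>J. \<Sum>j\<in>J. if ?n i j then ?e j / 2 else 0)"
  by (simp add: sum.distrib[symmetric] if_distrib cong: if_cong)
 also have "(\<Sum>i\<in>J. \<Sum>j\<in>J. if ?n i j then ?e j / 2 else 0) = (\<Sum>i\<in>J. \<Sum>j\<in>J. if ?n i j then ?e i / 2 else 0)"
  by (subst sum.swap) (intro sum.cong refl, auto)
 also have "(\<Sum>i\<in>J. \<Sum>j\<in>J. if ?n i j then ?e i / 2 else 0) + (\<Sum>i\<in>J. \<Sum>j\<in>J. if ?n i j then ?e i / 2 else 0)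
   = (\<Sum>i\<in>J. real (card {j\<in>J. ?n i j}) * ?e i)"
  by (simp add: sum.inter_filter[OF \<open>finite J\<close>, symmetric] sum.distrib[symmetric] mult.commute)
 also have "... <= (\<Sum>i\<in>J. 2 * real m * ?e i)"
  by (intro sum_mono mult_right_mono cnt e0)
 finally show ?thesis by (simp add: sum_distrib_left)
qed

end

text \<open>The instance in view is K(x/h)/h. Its L1 bound \<open>\<kappa>\<close> is free of h
  while its sup bound B is of order 1/h, so the two are kept apart in all estimates.\<close>

locale kernel_process = split_process M \<epsilon> \<phi> \<gamma> c_4 a L C_U
 for M :: "'a measure" and \<epsilon> :: "int => 'a => real" and \<phi> :: "real => complex" and \<gamma> c_4 :: real
  and a :: "nat => real" and L :: nat and C_U :: real +
 fixes k :: "real => real" and \<kappa> B :: real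
 assumes k_even: "\<And>x. k (- x) = k x" and k_bounded: "\<And>x. \<bar>k x\<bar> <= B"
  and k_integrable: "integrable lborel k" and k_L1: "(LINT x|lborel. \<bar>k x\<bar>) <= \<kappa>"
begin

lemma k_measurable[measurable]: "k \<in> borel_measurable borel"
 using k_integrable by auto

lemma kappa_nonneg: "0 <= \<kappa>"
 by (rule order_trans[OF _ k_L1]) (rule integral_nonneg, auto)

lemma B_nonneg: "0 <= B" using k_bounded[of 0] by linarith

lemma nn_k_L1: "(\<integral>\<^sup>+x. ennreal \<bar>k x\<bar> \<partial>lborel) <= ennreal \<kappa>"
 using k_integrable k_L1 by (subst nn_integral_eq_integral) (auto intro: ennreal_leI)

text \<open>\<open>k_1\<close> averages k over one copy of U, and \<open>k_2\<close> averages it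
  over the difference of two independent copies.\<close>

definition k_1 :: "real => real" where "k_1 y = (LINT u|\<mu>. k (y - u))"
definition k_2 :: "real => real" where "k_2 y = (LINT u|\<mu>. k_1 (y + u))"

lemma k1_measurable[measurable]: "k_1 \<in> borel_measurable borel"
 unfolding k_1_def by measurable

lemma k2_measurable[measurable]: "k_2 \<in> borel_measurable borel"
 unfolding k_2_def by measurable

lemma mu_integrable:
 assumes [measurable]: "g \<in> borel_measurable borel" and "\<And>u. \<bar>g u\<bar> <= (c::real)"
 shows "integrable \<mu> g"
 using assms(2) by (intro \<mu>.integrable_const_bound[where B = c]) auto

lemma mu_integral_abs_le:
 fixes g :: "real => real"
 assumes [measurable]: "g \<in> borel_measurable borel" and "\<And>u. \<bar>g u\<bar> <= c"
 shows "\<bar>LINT u|\<mu>. g u\<bar> <= c"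
proof -
 have "\<bar>LINT u|\<mu>. g u\<bar> <= (LINT u|\<mu>. \<bar>g u\<bar>)" using integral_norm_bound[of \<mu> g] by simp
 also have "... <= (LINT u|\<mu>. c)"
  using assms order_trans[OF abs_ge_zero assms(2)] by (intro integral_mono mu_integrable[where c = c]) auto
 finally show ?thesis using \<mu>.prob_space by simp
qed

lemma k1_bounded: "\<bar>k_1 y\<bar> <= B"
 unfolding k_1_def by (rule mu_integral_abs_le) (auto simp: k_bounded)

lemma k2_bounded: "\<bar>k_2 y\<bar> <= B"
 unfolding k_2_def by (rule mu_integral_abs_le) (auto simp: k1_bounded)

text \<open>Averaging over U turns the L1 norm of k into a sup bound, so unlike B this bound stays
  fixed as h tends to 0.\<close>

definition c_1 :: real where "c_1 = C_U * \<kappa>"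

lemma c1_nonneg: "0 <= c_1"
 unfolding c_1_def using C_mu_nonneg kappa_nonneg by simp

lemma k1_le: "\<bar>k_1 y\<bar> <= c_1"
proof -
 have "integrable \<mu> (\<lambda>u. k (y - u))"
  by (rule mu_integrable[where c = B]) (auto simp: k_bounded)
 from integral_norm_bound_ennreal[OF this]
 have "ennreal \<bar>k_1 y\<bar> <= (\<integral>\<^sup>+u. ennreal \<bar>k (y - u)\<bar> \<partial>\<mu>)"
  unfolding k_1_def by simp
 also have "... <= ennreal C_U * (\<integral>\<^sup>+u. ennreal \<bar>k (y - u)\<bar> \<partial>lborel)"
  by (rule bdd_lawD[OF bdd_mu]) auto
 also have "(\<integral>\<^sup>+u. ennreal \<bar>k (y - u)\<bar> \<partial>lborel) = (\<integral>\<^sup>+u. ennreal \<bar>k u\<bar> \<partial>lborel)"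
  using lborel_shift(3)[of "\<lambda>u. ennreal \<bar>k u\<bar>" y] by simp
 also have "ennreal C_U * ... <= ennreal C_U * ennreal \<kappa>" by (intro mult_left_mono nn_k_L1) auto
 finally show ?thesis using C_mu_nonneg kappa_nonneg unfolding c_1_def by (simp flip: ennreal_mult)
qed

lemma k2_le: "\<bar>k_2 y\<bar> <= c_1"
 unfolding k_2_def by (rule mu_integral_abs_le) (auto simp: k1_le)

lemma k1_eq: "(LINT u|\<mu>. k (u + w - x)) = k_1 (x - w)"
proof -
 have "k (u + w - x) = k (x - w - u)" for u using k_even[of "u + w - x"] by (simp add: algebra_simps)
 then show ?thesis by (simp add: k_1_def)
qed

lemma k2_eq: "(LINT u|\<mu>. k_1 (u + w - v)) = k_2 (w - v)"
 unfolding k_2_def by (simp add: algebra_simps)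

lemma k2_even: "k_2 (- y) = k_2 y"
proof -
 interpret P: pair_prob_space \<mu> \<mu> ..
 have "k_2 (- y) = (LINT u|\<mu>. LINT v|\<mu>. k (- y + u - v))"
  unfolding k_2_def k_1_def by simp
 also have "... = (LINT v|\<mu>. LINT u|\<mu>. k (- y + u - v))"
 proof (rule P.Fubini_integral)
  show "integrable (\<mu> \<Otimes>\<^sub>M \<mu>) (\<lambda>(v, u). k (- y + u - v))"
   by (rule P.integrable_const_bound[where B = B]) (auto simp: k_bounded)
 qed
 also have "... = (LINT v|\<mu>. LINT u|\<mu>. k (y + v - u))"
 proof -
  have "k (- y + u - v) = k (y + v - u)" for u v using k_even[of "y + v - u"] by (simp add: algebra_simps)
  then show ?thesis by simp
 qed
 finally show ?thesis unfolding k_2_def k_1_def .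
qed

text \<open>Inclusion-exclusion over the two averages. The second term is the average over
  \<open>U i\<close>, the third the average over \<open>U j\<close> (by evenness of k), the fourth
  the average over both. With the \<open>W\<close> parts held fixed, either average of the whole
  vanishes; but \<open>W j\<close> may itself involve innovations of \<open>U i\<close>.\<close>

definition DD :: "int => int => 'a => real" where
 "DD i j w = k (X j w - X i w) - k_1 (X j w - W i w) - k_1 (X i w - W j w) + k_2 (W j w - W i w)"

lemma DD_noise_alg: "i <= j ==> DD i j \<in> borel_measurable (noise_alg {..j})"
proof -
 assume "i <= j"
 have [measurable]: "X i \<in> borel_measurable (noise_alg {..j})" "X j \<in> borel_measurable (noise_alg {..j})"
  "W i \<in> borel_measurable (noise_alg {..j})" "W j \<in> borel_measurable (noise_alg {..j})"
  using \<open>i <= j\<close> by (auto intro!: noise_alg_mono[OF _ X_noise_alg] noise_alg_mono[OF _ W_noise_alg])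
 show ?thesis unfolding DD_def[abs_def] by measurable
qed

lemma DD_measurable[measurable]: "DD i j \<in> borel_measurable M"
 unfolding DD_def[abs_def] by measurable

lemma DD_bounded: "\<bar>DD i j w\<bar> <= 4 * B"
 unfolding DD_def
 using k_bounded[of "X j w - X i w"] k1_bounded[of "X j w - W i w"] k1_bounded[of "X i w - W j w"] k2_bounded[of "W j w - W i w"]
 by linarith

lemma bdd_rv_DD: "bdd_rv (DD i j)"
 by (rule bdd_rvI[where B = "4 * B"]) (auto simp: DD_bounded)

text \<open>Everything except \<open>U j\<close> is determined by innovations up to j - L and can be
  frozen; the average over \<open>U j\<close> alone then vanishes.\<close>

lemma DD_orthogonal:
 assumes ij: "i + int L <= j" and V: "V \<in> borel_measurable (noise_alg {..j - int L})" and bV: "\<And>z. \<bar>V z\<bar> <= c"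
 shows "\<E> (\<lambda>z. DD i j z * V z) = 0"
proof -
 define D where "D = (\<lambda>x w w' u. k (u + w' - x) - k_1 (u + w' - w) - k_1 (x - w') + k_2 (w' - w))"
 \<comment> \<open>The last coordinate is cut off at c because \<open>freeze\<close> needs a bound
   for all arguments; on the actual values of V nothing changes.\<close>
 define F where "F v u = D (fst v) (fst (snd v)) (fst (snd (snd v))) u
  * (if \<bar>snd (snd (snd v))\<bar> <= c then snd (snd (snd v)) else 0)" for v :: "real \<times> real \<times> real \<times> real" and u
 let ?V = "\<lambda>z. (X i z, W i z, W j z, V z)"
 have m: "?V \<in> measurable (noise_alg {..j - int L}) (borel \<Otimes>\<^sub>M borel \<Otimes>\<^sub>M borel \<Otimes>\<^sub>M borel)"
  using ij by (intro measurable_Pair V W_noise_alg noise_alg_mono[OF _ X_noise_alg] noise_alg_mono[OF _ W_noise_alg[of i]]) auto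
 have c: "0 <= c" using bV[of undefined] by linarith
 have D_bound: "\<bar>D x w w' u\<bar> <= 4 * B" for x w w' u
  unfolding D_def using k_bounded[of "u + w' - x"] k1_bounded[of "u + w' - w"] k1_bounded[of "x - w'"] k2_bounded[of "w' - w"]
  by linarith
 have "\<E> (\<lambda>z. DD i j z * V z) = (LINT z|M. F (?V z) (U j z))"
  unfolding F_def D_def DD_def X_def[of j] using bV by (intro integral_cong) auto
 also have "... = (LINT z|M. (LINT u|distr M borel (U j). F (?V z) u))"
 proof (rule freeze[OF _ m U_noise_alg, where C = "4 * B * c"])
  show "(\<lambda>(v, u). F v u) \<in> borel_measurable ((borel \<Otimes>\<^sub>M borel \<Otimes>\<^sub>M borel \<Otimes>\<^sub>M borel) \<Otimes>\<^sub>M borel)"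
   unfolding F_def D_def split_beta' by measurable
  show "norm (F v u) <= 4 * B * c" for v u
  proof (cases v)
   case (fields x w w' s)
   show ?thesis unfolding F_def fields fst_conv snd_conv
    using mult_mono[OF D_bound[of x w w' u], of "\<bar>if \<bar>s\<bar> <= c then s else 0\<bar>" c] B_nonneg c by (auto simp: abs_mult)
  qed
 qed auto
 also have "... = (LINT z|M. 0)"
 proof (intro integral_cong refl)
  fix z
  have "(LINT u|\<mu>. D x w w' u) = 0" for x w w'
  proof -
   have "integrable \<mu> (\<lambda>u. k (u + w' - x))" "integrable \<mu> (\<lambda>u. k_1 (u + w' - w))"
    by (auto intro!: mu_integrable[where c = B] simp: k_bounded k1_bounded)
   then have "(LINT u|\<mu>. D x w w' u) = (LINT u|\<mu>. k (u + w' - x)) - (LINT u|\<mu>. k_1 (u + w' - w)) - k_1 (x - w') + k_2 (w' - w)"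
    unfolding D_def using \<mu>.prob_space by simp
   then show ?thesis by (simp add: k1_eq k2_eq)
  qed
  then show "(LINT u|distr M borel (U j). F (?V z) u) = 0"
   unfolding distr_U F_def by simp
 qed
 finally show ?thesis by simp
qed

definition k_sq :: real where "k_sq = (LINT x|lborel. (k x)^2)"

lemma k_sq_integrable: "integrable lborel (\<lambda>x. (k x)^2)"
proof (rule integrable_bound)
 show "integrable lborel (\<lambda>x. B * k x)" using k_integrable by simp
 show "AE x in lborel. norm ((k x)^2) <= norm (B * k x)"
 proof (rule AE_I2)
  fix x
  have "\<bar>k x\<bar> * \<bar>k x\<bar> <= B * \<bar>k x\<bar>" by (intro mult_right_mono k_bounded) auto
  then show "norm ((k x)^2) <= norm (B * k x)" using B_nonneg by (simp add: power2_eq_square abs_mult)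
 qed
qed auto

lemma k_sq_nonneg: "0 <= k_sq"
 unfolding k_sq_def by (rule integral_nonneg) auto

lemma expectation_k_sq: "i < j ==> \<E> (\<lambda>w. (k (X j w - X i w))^2) <= C_d * k_sq"
proof -
 assume ij: "i < j"
 have b: "bdd_rv (\<lambda>w. k (X j w - X i w))"
  by (rule bdd_rvI[where B = B]) (auto simp: k_bounded)
 have "ennreal (\<E> (\<lambda>w. (k (X j w - X i w))^2)) = (\<integral>\<^sup>+w. ennreal ((k (X j w - X i w))^2) \<partial>M)"
  by (intro nn_integral_eq_integral[symmetric] bdd_rv_integrable bdd_rv_intros b) auto
 also have "... <= ennreal C_d * (\<integral>\<^sup>+x. ennreal ((k x)^2) \<partial>lborel)"
  by (rule difference_density[OF ij]) auto
 also have "... = ennreal (C_d * k_sq)"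
  using C_delta k_sq_nonneg by (subst nn_integral_eq_integral[OF k_sq_integrable]) (auto simp: k_sq_def ennreal_mult)
 finally show ?thesis using C_delta k_sq_nonneg by simp
qed

lemma expectation_k_abs: "i < j ==> \<E> (\<lambda>w. \<bar>k (X j w - X i w)\<bar>) <= C_d * \<kappa>"
proof -
 assume ij: "i < j"
 have b: "bdd_rv (\<lambda>w. k (X j w - X i w))"
  by (rule bdd_rvI[where B = B]) (auto simp: k_bounded)
 have "ennreal (\<E> (\<lambda>w. \<bar>k (X j w - X i w)\<bar>)) = (\<integral>\<^sup>+w. ennreal \<bar>k (X j w - X i w)\<bar> \<partial>M)"
  by (intro nn_integral_eq_integral[symmetric] bdd_rv_integrable bdd_rv_intros b) auto
 also have "... <= ennreal C_d * (\<integral>\<^sup>+x. ennreal \<bar>k x\<bar> \<partial>lborel)"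
  by (rule difference_density[OF ij]) auto
 also have "... <= ennreal C_d * ennreal \<kappa>" by (intro mult_left_mono nn_k_L1) auto
 finally show ?thesis using C_delta kappa_nonneg by (simp flip: ennreal_mult)
qed

definition q :: real where "q = 4 * (C_d * k_sq + 3 * c_1^2)"

lemma q_nonneg: "0 <= q"
 unfolding q_def using C_delta k_sq_nonneg by simp

lemma expectation_DD_sq: "i < j ==> \<E> (\<lambda>w. (DD i j w)^2) <= q"
proof -
 assume ij: "i < j"
 have b: "bdd_rv (\<lambda>w. k (X j w - X i w))"
  by (rule bdd_rvI[where B = B]) (auto simp: k_bounded)
 have "\<E> (\<lambda>w. (DD i j w)^2) <= \<E> (\<lambda>w. 4 * ((k (X j w - X i w))^2 + 3 * c_1^2))"
 proof (intro integral_mono bdd_rv_integrable bdd_rv_intros b bdd_rv_DD)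
  fix w
  have four: "(x - y - z + v)^2 <= 4 * (x^2 + y^2 + z^2 + v^2)" for x y z v :: real
  proof -
   have "0 <= (x + y)^2 + (x + z)^2 + (x - v)^2 + (y - z)^2 + (y + v)^2 + (z + v)^2" by simp
   then show ?thesis by (simp add: power2_eq_square algebra_simps)
  qed
  have sq: "y^2 <= c_1^2" if "\<bar>y\<bar> <= c_1" for y
   using that c1_nonneg by (metis abs_le_square_iff abs_of_nonneg)
  have comb: "p <= 4 * (r + (e + 2 * e))" if "p <= 4 * (r + y + z + v)" "y <= e" "z <= e" "v <= e" for p r y z v e :: real
  proof -
   have "4 * (r + y + z + v) <= 4 * (r + e + e + e)" using that by (intro mult_left_mono add_mono) auto
   then show ?thesis using that(1) by (simp add: algebra_simps)
  qed
  show "(DD i j w)^2 <= 4 * ((k (X j w - X i w))^2 + 3 * c_1^2)"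
   unfolding DD_def using comb[OF four sq[OF k1_le] sq[OF k1_le] sq[OF k2_le]] by simp
 qed
 also have "... = 4 * (\<E> (\<lambda>w. (k (X j w - X i w))^2) + 3 * c_1^2)"
 proof -
  have "integrable M (\<lambda>w. (k (X j w - X i w))^2)" by (intro bdd_rv_integrable bdd_rv_intros b)
  then show ?thesis by (simp add: prob_space)
 qed
 also have "... <= q" unfolding q_def using expectation_k_sq[OF ij] by simp
 finally show ?thesis .
qed

lemma expectation_DD_abs: "i < j ==> \<bar>\<E> (DD i j)\<bar> <= C_d * \<kappa> + 3 * c_1"
proof -
 assume ij: "i < j"
 have b: "bdd_rv (\<lambda>w. k (X j w - X i w))"
  by (rule bdd_rvI[where B = B]) (auto simp: k_bounded)
 have "\<bar>\<E> (DD i j)\<bar> <= \<E> (\<lambda>w. \<bar>DD i j w\<bar>)"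
  using integral_norm_bound[of M "DD i j"] by simp
 also have "... <= \<E> (\<lambda>w. \<bar>k (X j w - X i w)\<bar> + 3 * c_1)"
 proof (intro integral_mono bdd_rv_integrable bdd_rv_intros b bdd_rv_DD)
  fix w show "\<bar>DD i j w\<bar> <= \<bar>k (X j w - X i w)\<bar> + 3 * c_1"
   unfolding DD_def using k1_le[of "X j w - W i w"] k1_le[of "X i w - W j w"] k2_le[of "W j w - W i w"] by linarith
 qed
 also have "... = \<E> (\<lambda>w. \<bar>k (X j w - X i w)\<bar>) + 3 * c_1"
 proof -
  have "integrable M (\<lambda>w. \<bar>k (X j w - X i w)\<bar>)" by (intro bdd_rv_integrable bdd_rv_intros b)
  then show ?thesis by (simp add: prob_space)
 qed
 also have "... <= C_d * \<kappa> + 3 * c_1" using expectation_k_abs[OF ij] by simp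
 finally show ?thesis .
qed

end

section \<open>Dependence on the remote past and the covariance of two doubly centred terms\<close>

context split_process
begin

text \<open>The coefficients of U with the innovation of lag s deleted. For s at least L nothing is
  deleted, so \<open>trunc L\<close> belongs to U itself.\<close>

definition trunc :: "nat => nat => real" where
 "trunc s l = (if l < L \<and> l \<noteq> s then a l else 0)"

definition H :: real where "H = holder_bound (trunc L)"
text \<open>All \<open>trunc s\<close> with s beyond L equal \<open>trunc L\<close>, so this finite
  sum bounds the density for a deletion at any lag.\<close>

definition D :: real where "D = (\<Sum>s\<le>L. density_bound (trunc s))"

lemma H_nonneg: "0 <= H"
 unfolding H_def holder_bound_def by (intro divide_nonneg_pos integral_nonneg) auto

lemma density_bound_nonneg': "0 <= density_bound b"
 unfolding density_bound_def by (intro divide_nonneg_pos integral_nonneg) auto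

lemma D_nonneg: "0 <= D"
 unfolding D_def by (intro sum_nonneg density_bound_nonneg')

lemma trunc_ge: "L <= s ==> trunc s = trunc L"
 by (rule ext) (auto simp: trunc_def)

lemma U_eq_lin: "U i = lin (trunc L) i"
 unfolding U_def by (rule ext, subst psum_eq_lin) (auto simp: trunc_def intro!: arg_cong2[where f = "\<lambda>b i. lin b i _"])

text \<open>The part of \<open>W j\<close> that comes from innovations with index above j - m. For m
  = j - i' it avoids every innovation used by \<open>U i'\<close>.\<close>

definition W_0 :: "nat => int => 'a => real" where
 "W_0 m j = psum (\<lambda>l. a (l + L)) (m - L) (j - int L)"

lemma W0_noise_alg: "L <= m ==> W_0 m j \<in> borel_measurable (noise_alg {j - int m<..j - int L})"
 unfolding W_0_def using psum_noise_alg'[of "\<lambda>l. a (l + L)" "m - L" "j - int L"] by (simp add: of_nat_diff)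

lemma W0_measurable[measurable]: "W_0 m j \<in> borel_measurable M"
 unfolding W_0_def by simp

lemma AE_W_split:
 assumes "L <= m"
 shows "AE w in M. W j w - W_0 m j w = lin (\<lambda>l. a (l + m)) (j - int m) w"
 using AE_lin_split[OF summable_coeffs_shift[OF sa, of L], of "m - L"]
proof eventually_elim
 case (elim w)
 from elim[rule_format, of "j - int L"] show ?case
  using assms by (simp add: W_def W_0_def of_nat_diff algebra_simps)
qed

context
 assumes smooth: "\<And>s. two_coeffs (trunc s)"
begin

lemma mu_density: "\<mu> = density lborel (\<lambda>x. ennreal (lin_density (trunc L) x))"
 unfolding \<mu>_def U_eq_lin by (rule distr_lin_density[OF smooth])

lemma mu_integral_density:
 fixes g :: "real => real"
 assumes [measurable]: "g \<in> borel_measurable borel"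
 shows "(LINT u|\<mu>. g (u + w)) = (LINT x|lborel. lin_density (trunc L) (x - w) * g x)"
proof -
 have [measurable]: "lin_density (trunc L) \<in> borel_measurable borel"
  by (rule lin_density_measurable[OF smooth])
 have "(LINT u|\<mu>. g (u + w)) = (LINT u|lborel. lin_density (trunc L) u * g (u + w))"
  unfolding mu_density by (subst integral_real_density) (auto simp: lin_density_nonneg[OF smooth])
 also have "... = (LINT x|lborel. lin_density (trunc L) (x - w) * g x)"
  by (subst lborel_integral_real_affine[where c = 1 and t = w]) (auto simp: add.commute)
 finally show ?thesis .
qed

text \<open>A shift of the argument of g is moved onto the density of U, which is \<gamma>-Hoelder.
  Only the L1 norm of g enters, so g may be as rough as the rescaled kernel.\<close>

lemma mu_holder:
 fixes g :: "real => real"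
 assumes g: "integrable lborel g"
 shows "\<bar>(LINT u|\<mu>. g (u + w)) - (LINT u|\<mu>. g (u + w'))\<bar> <= H * \<bar>w - w'\<bar> powr \<gamma> * (LINT x|lborel. \<bar>g x\<bar>)"
proof -
 have [measurable]: "g \<in> borel_measurable borel" using g by auto
 let ?p = "lin_density (trunc L)"
 have [measurable]: "?p \<in> borel_measurable borel"
  by (rule lin_density_measurable[OF smooth])
 have p: "\<bar>?p x\<bar> <= density_bound (trunc L)" for x
  using lin_density_nonneg[OF smooth, of L x] lin_density_le[OF smooth, of L x] by simp
 have int: "integrable lborel (\<lambda>x. ?p (x - w) * g x)" for w
 proof (rule integrable_bound)
  show "integrable lborel (\<lambda>x. density_bound (trunc L) * g x)" using g by simp
  show "AE x in lborel. norm (?p (x - w) * g x) <= norm (density_bound (trunc L) * g x)"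
   using p density_bound_nonneg' by (intro AE_I2) (auto simp: abs_mult intro!: mult_right_mono)
 qed auto
 have eq: "(LINT u|\<mu>. g (u + w)) - (LINT u|\<mu>. g (u + w')) = (LINT x|lborel. ?p (x - w) * g x - ?p (x - w') * g x)"
  by (simp only: mu_integral_density[OF \<open>g \<in> borel_measurable borel\<close>] integral_diff[OF int int])
 have "\<bar>(LINT u|\<mu>. g (u + w)) - (LINT u|\<mu>. g (u + w'))\<bar> <= (LINT x|lborel. \<bar>?p (x - w) * g x - ?p (x - w') * g x\<bar>)"
  unfolding eq using integral_norm_bound[of lborel "\<lambda>x. ?p (x - w) * g x - ?p (x - w') * g x"] by simp
 also have "... <= (LINT x|lborel. H * \<bar>w - w'\<bar> powr \<gamma> * \<bar>g x\<bar>)"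
 proof (rule integral_mono)
  fix x
  have "\<bar>?p (x - w) * g x - ?p (x - w') * g x\<bar> = \<bar>?p (x - w) - ?p (x - w')\<bar> * \<bar>g x\<bar>"
   by (simp only: left_diff_distrib[symmetric] abs_mult)
  also have "... <= (H * \<bar>(x - w) - (x - w')\<bar> powr \<gamma>) * \<bar>g x\<bar>"
   unfolding H_def by (intro mult_right_mono lin_density_holder smooth) auto
  finally show "\<bar>?p (x - w) * g x - ?p (x - w') * g x\<bar> <= H * \<bar>w - w'\<bar> powr \<gamma> * \<bar>g x\<bar>"
   by (simp add: abs_minus_commute)
 qed (use int g in auto)
 finally show ?thesis using g by simp
qed

text \<open>The weight is an innovation that may itself occur in \<open>U i'\<close>. The rest of
  \<open>U i'\<close> after deleting it still has a bounded law and is independent of the weight, of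
  \<open>W i'\<close> and of \<open>X i\<close>; integrating it out leaves the integral of g times
  the moment of the weight. This is why a bounded law is required after deleting any one
  innovation.\<close>

lemma leave_one_out:
 assumes ij: "i + int L <= i'" and [measurable]: "g \<in> borel_measurable borel"
 shows "(\<integral>\<^sup>+w. ennreal (\<bar>\<epsilon> (i' - int m) w\<bar> powr \<gamma>) * g (X i' w - X i w) \<partial>M) <= ennreal (m_g * D) * (\<integral>\<^sup>+x. g x \<partial>lborel)"
proof -
 let ?n = "i' - int m"
 let ?A = "{..i' - int L} \<union> {?n}" and ?B = "{i' - int L<..i'} - {?n}"
 \<comment> \<open>An innovation of lag L or more does not occur in \<open>U i'\<close>, hence the
   coefficient 0.\<close>
 define am where "am = (if m < L then a m else 0)"
 define V where "V w = (\<epsilon> ?n w, am * \<epsilon> ?n w + W i' w - X i w)" for w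
 have am: "trunc L l = (if l = m then am else trunc m l)" for l
  by (auto simp: trunc_def am_def)
 have U: "U i' w = am * \<epsilon> ?n w + lin (trunc m) i' w" for w
 proof -
  have fin: "l \<ge> max L (Suc m) ==> trunc s l = 0" for l s by (auto simp: trunc_def)
  have "U i' w = (\<Sum>l<max L (Suc m). trunc L l * \<epsilon> (i' - int l) w)"
   unfolding U_eq_lin by (rule lin_finite) (rule fin)
  also have "... = (\<Sum>l<max L (Suc m). (if l = m then am * \<epsilon> (i' - int l) w else 0) + trunc m l * \<epsilon> (i' - int l) w)"
  proof (intro sum.cong refl)
   fix l show "trunc L l * \<epsilon> (i' - int l) w = (if l = m then am * \<epsilon> (i' - int l) w else 0) + trunc m l * \<epsilon> (i' - int l) w"
    unfolding am by (auto simp: trunc_def)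
  qed
  also have "... = am * \<epsilon> ?n w + (\<Sum>l<max L (Suc m). trunc m l * \<epsilon> (i' - int l) w)"
   unfolding sum.distrib by (subst sum.delta) auto
  also have "(\<Sum>l<max L (Suc m). trunc m l * \<epsilon> (i' - int l) w) = lin (trunc m) i' w"
   by (rule lin_finite[symmetric]) (rule fin)
  finally show ?thesis .
 qed
 have e: "\<epsilon> ?n \<in> borel_measurable (noise_alg ?A)" by (rule eps_noise_alg) auto
 have Vm: "V \<in> measurable (noise_alg ?A) (borel \<Otimes>\<^sub>M borel)"
  unfolding V_def[abs_def] using ij
  by (intro measurable_Pair borel_measurable_add borel_measurable_diff borel_measurable_times borel_measurable_const e
    noise_alg_mono[OF _ W_noise_alg] noise_alg_mono[OF _ X_noise_alg]) auto
 have lm: "lin (trunc m) i' \<in> borel_measurable (noise_alg ?B)"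
  by (rule lin_noise_alg) (auto simp: trunc_def split: if_splits)
 have bd: "bdd_law (distr M borel (lin (trunc m) i')) (density_bound (trunc m))"
  by (rule bdd_law_lin[OF smooth])
 have bD: "density_bound (trunc m) <= D"
 proof -
  have "trunc m = trunc (min m L)" using trunc_ge[of m] by (auto simp: min_def)
  moreover have "density_bound (trunc (min m L)) <= D"
   unfolding D_def by (intro member_le_sum density_bound_nonneg') auto
  ultimately show ?thesis by simp
 qed
 have "(\<integral>\<^sup>+w. ennreal (\<bar>\<epsilon> ?n w\<bar> powr \<gamma>) * g (X i' w - X i w) \<partial>M)
   = (\<integral>\<^sup>+w. ennreal (\<bar>fst (V w)\<bar> powr \<gamma>) * g (snd (V w) + lin (trunc m) i' w) \<partial>M)"
  unfolding V_def X_def[of i'] U by (simp add: algebra_simps)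
 also have "... = (\<integral>\<^sup>+w. (\<integral>\<^sup>+u. ennreal (\<bar>fst (V w)\<bar> powr \<gamma>) * g (snd (V w) + u) \<partial>distr M borel (lin (trunc m) i')) \<partial>M)"
  by (rule freeze_nn[OF _ Vm lm, of "\<lambda>v u. ennreal (\<bar>fst v\<bar> powr \<gamma>) * g (snd v + u)"]) auto
 also have "... <= (\<integral>\<^sup>+w. ennreal (\<bar>\<epsilon> ?n w\<bar> powr \<gamma>) * (ennreal D * (\<integral>\<^sup>+x. g x \<partial>lborel)) \<partial>M)"
 proof (intro nn_integral_mono)
  fix w
  have "(\<integral>\<^sup>+u. g (snd (V w) + u) \<partial>distr M borel (lin (trunc m) i')) <= ennreal (density_bound (trunc m)) * (\<integral>\<^sup>+u. g (snd (V w) + u) \<partial>lborel)"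
   by (rule bdd_lawD[OF bd]) auto
  also have "... <= ennreal D * (\<integral>\<^sup>+x. g x \<partial>lborel)"
   unfolding lborel_shift(1)[OF \<open>g \<in> borel_measurable borel\<close>] by (intro mult_right_mono ennreal_leI bD) auto
  finally show "(\<integral>\<^sup>+u. ennreal (\<bar>fst (V w)\<bar> powr \<gamma>) * g (snd (V w) + u) \<partial>distr M borel (lin (trunc m) i'))
    <= ennreal (\<bar>\<epsilon> ?n w\<bar> powr \<gamma>) * (ennreal D * (\<integral>\<^sup>+x. g x \<partial>lborel))"
   by (subst nn_integral_cmult) (auto simp: V_def intro!: mult_left_mono)
 qed
 also have "... = ennreal m_g * (ennreal D * (\<integral>\<^sup>+x. g x \<partial>lborel))"
  by (subst nn_integral_multc) (auto simp: nn_expectation_eps_powr)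
 finally show ?thesis
  using D_nonneg m_gamma_nonneg by (simp add: ennreal_mult mult.assoc)
qed

end

end

context kernel_process
begin

text \<open>\<open>vv\<close> is the kernel centred over \<open>U i\<close>, evaluated at x = X j,
  and \<open>vb\<close> is its average over \<open>U j\<close> given w = W j; \<open>DD\<close> is
  their difference (\<open>DD_eq\<close>).\<close>

definition vv :: "real => real => real => real" where "vv x xi wi = k (x - xi) - k_1 (x - wi)"
definition vb :: "real => real => real => real" where "vb w xi wi = k_1 (xi - w) - k_2 (w - wi)"

lemma vv_measurable[measurable (raw)]:
 assumes "f \<in> borel_measurable N" "g \<in> borel_measurable N" "h \<in> borel_measurable N"
 shows "(\<lambda>x. vv (f x) (g x) (h x)) \<in> borel_measurable N"
 using assms unfolding vv_def by measurable

lemma vb_measurable[measurable (raw)]: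
 assumes "f \<in> borel_measurable N" "g \<in> borel_measurable N" "h \<in> borel_measurable N"
 shows "(\<lambda>x. vb (f x) (g x) (h x)) \<in> borel_measurable N"
 using assms unfolding vb_def by measurable

lemma vv_bounded: "\<bar>vv x xi wi\<bar> <= 2 * B"
 unfolding vv_def using k_bounded[of "x - xi"] k1_bounded[of "x - wi"] by linarith

lemma vb_bounded: "\<bar>vb w xi wi\<bar> <= 2 * B"
 unfolding vb_def using k1_bounded[of "xi - w"] k2_bounded[of "w - wi"] by linarith

lemma vb_le: "\<bar>vb w xi wi\<bar> <= 2 * c_1"
 unfolding vb_def using k1_le[of "xi - w"] k2_le[of "w - wi"] by linarith

lemma vv_integrable_mu: "integrable \<mu> (\<lambda>u. vv (u + w) xi wi)"
 by (rule mu_integrable[where c = "2 * B"]) (auto simp: vv_bounded)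

lemma mu_vv: "(LINT u|\<mu>. vv (u + w) xi wi) = vb w xi wi"
proof -
 have "integrable \<mu> (\<lambda>u. k (u + w - xi))" "integrable \<mu> (\<lambda>u. k_1 (u + w - wi))"
  by (auto intro!: mu_integrable[where c = B] simp: k_bounded k1_bounded)
 then show ?thesis unfolding vv_def vb_def by (simp add: k1_eq k2_eq)
qed

lemma DD_eq: "DD i j w = vv (U j w + W j w) (X i w) (W i w) - vb (W j w) (X i w) (W i w)"
 unfolding DD_def vv_def vb_def X_def[of j] by simp

text \<open>The conditional covariance of \<open>DD i j\<close> and \<open>DD i' j\<close> when only
  \<open>U j\<close> is integrated out and \<open>W j\<close> has the value w.\<close>

definition \<Psi> :: "real => real => real => real => real => real" where
 "\<Psi> xi wi xi' wi' w = (LINT u|\<mu>. (vv (u + w) xi wi - vb w xi wi) * (vv (u + w) xi' wi' - vb w xi' wi'))"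

lemma Psi_measurable[measurable (raw)]:
 assumes [measurable]: "f1 \<in> borel_measurable N" "f2 \<in> borel_measurable N" "f3 \<in> borel_measurable N" "f4 \<in> borel_measurable N" "f5 \<in> borel_measurable N"
 shows "(\<lambda>x. \<Psi> (f1 x) (f2 x) (f3 x) (f4 x) (f5 x)) \<in> borel_measurable N"
 unfolding \<Psi>_def by measurable

lemma vvb_bounded: "\<bar>vv x xi wi - vb w xj wj\<bar> <= 4 * B"
 using vv_bounded[of x xi wi] vb_bounded[of w xj wj] by linarith

lemma vvb_mult_bounded: "\<bar>(vv x xi wi - vb w xj wj) * (vv x' xi' wi' - vb w' xj' wj')\<bar> <= (4 * B) * (4 * B)"
 unfolding abs_mult using B_nonneg by (intro mult_mono vvb_bounded) auto

lemma Psi_bounded: "\<bar>\<Psi> xi wi xi' wi' w\<bar> <= (4 * B) * (4 * B)"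
 unfolding \<Psi>_def by (rule mu_integral_abs_le[OF _ vvb_mult_bounded]) measurable

lemma Psi_eq: "\<Psi> xi wi xi' wi' w = (LINT u|\<mu>. vv (u + w) xi wi * vv (u + w) xi' wi') - vb w xi wi * vb w xi' wi'"
proof -
 have i1: "integrable \<mu> (\<lambda>u. vv (u + w) xi wi * vv (u + w) xi' wi')"
 proof (rule mu_integrable[where c = "(2 * B) * (2 * B)"])
  show "\<bar>vv (u + w) xi wi * vv (u + w) xi' wi'\<bar> <= (2 * B) * (2 * B)" for u
   unfolding abs_mult by (intro mult_mono vv_bounded) (use B_nonneg in auto)
 qed measurable
 have "\<Psi> xi wi xi' wi' w = (LINT u|\<mu>. vv (u + w) xi wi * vv (u + w) xi' wi' - vb w xi' wi' * vv (u + w) xi wi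
   - vb w xi wi * vv (u + w) xi' wi' + vb w xi wi * vb w xi' wi')"
  unfolding \<Psi>_def by (intro integral_cong) (auto simp: algebra_simps)
 also have "... = (LINT u|\<mu>. vv (u + w) xi wi * vv (u + w) xi' wi') - vb w xi' wi' * vb w xi wi
   - vb w xi wi * vb w xi' wi' + vb w xi wi * vb w xi' wi'"
  using i1 vv_integrable_mu \<mu>.prob_space by (simp add: mu_vv)
 finally show ?thesis by simp
qed

text \<open>Stated for a general Y so that both \<open>W j\<close> and its truncation
  \<open>W_0 m j\<close> can be inserted.\<close>

lemma pair_freeze:
 assumes ij: "i + int L <= j" "i' + int L <= j" and Y: "Y \<in> borel_measurable (noise_alg {..j - int L})"
 shows "(LINT z|M. (vv (U j z + Y z) (X i z) (W i z) - vb (Y z) (X i z) (W i z))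
    * (vv (U j z + Y z) (X i' z) (W i' z) - vb (Y z) (X i' z) (W i' z)))
   = (LINT z|M. \<Psi> (X i z) (W i z) (X i' z) (W i' z) (Y z))"
proof -
 let ?V = "\<lambda>z. (X i z, W i z, X i' z, W i' z, Y z)"
 define F where "F v u = (case v of (xi, wi, xi', wi', w) =>
  (vv (u + w) xi wi - vb w xi wi) * (vv (u + w) xi' wi' - vb w xi' wi'))" for v :: "real \<times> real \<times> real \<times> real \<times> real" and u
 have m: "?V \<in> measurable (noise_alg {..j - int L}) (borel \<Otimes>\<^sub>M borel \<Otimes>\<^sub>M borel \<Otimes>\<^sub>M borel \<Otimes>\<^sub>M borel)"
  using ij by (intro measurable_Pair Y noise_alg_mono[OF _ X_noise_alg[of i]] noise_alg_mono[OF _ W_noise_alg[of i]]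
    noise_alg_mono[OF _ X_noise_alg[of i']] noise_alg_mono[OF _ W_noise_alg[of i']]) auto
 have "(LINT z|M. F (?V z) (U j z)) = (LINT z|M. (LINT u|distr M borel (U j). F (?V z) u))"
 proof (rule freeze[OF _ m U_noise_alg, where C = "(4 * B) * (4 * B)"])
  show "(\<lambda>(v, u). F v u) \<in> borel_measurable ((borel \<Otimes>\<^sub>M borel \<Otimes>\<^sub>M borel \<Otimes>\<^sub>M borel \<Otimes>\<^sub>M borel) \<Otimes>\<^sub>M borel)"
   unfolding F_def split_beta' by measurable
  show "norm (F v u) <= (4 * B) * (4 * B)" for v u
   unfolding F_def using vvb_mult_bounded by (simp split: prod.split)
 qed auto
 then show ?thesis
  unfolding distr_U F_def \<Psi>_def by simp
qed

text \<open>For m = j - i' the truncation \<open>W_0 m j\<close> uses only innovations after i'.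
  Then \<open>U i'\<close> enters only through \<open>X i'\<close>, and averaging over it
  annihilates the second factor. With \<open>W j\<close> in place of \<open>W_0 m j\<close> this
  would fail, since \<open>W j\<close> contains innovations of \<open>U i'\<close>.\<close>

lemma DD_pair_zero:
 assumes ij: "i + int L <= i'" "i' + int L <= j" and m: "m = nat (j - i')"
 shows "(LINT z|M. \<Psi> (X i z) (W i z) (X i' z) (W i' z) (W_0 m j z)) = 0"
proof -
 let ?A = "{..i' - int L} \<union> {i'<..}" and ?B = "{i' - int L<..i'}"
 have Lm: "L <= m" and mj: "int m = j - i'" using ij m by auto
 let ?V = "\<lambda>z. (U j z + W_0 m j z, W_0 m j z, X i z, W i z, W i' z)"
 define F where "F v u = (case v of (y, w, xi, wi, wi') =>
  (vv y xi wi - vb w xi wi) * (vv y (u + wi') wi' - vb w (u + wi') wi'))" for v :: "real \<times> real \<times> real \<times> real \<times> real" and u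
 have W0: "W_0 m j \<in> borel_measurable (noise_alg {..j - int L})" "W_0 m j \<in> borel_measurable (noise_alg ?A)"
  using W0_noise_alg[OF Lm] mj by (auto intro!: noise_alg_mono[OF _ W0_noise_alg[OF Lm]])
 have m: "?V \<in> measurable (noise_alg ?A) (borel \<Otimes>\<^sub>M borel \<Otimes>\<^sub>M borel \<Otimes>\<^sub>M borel \<Otimes>\<^sub>M borel)"
  using ij by (intro measurable_Pair borel_measurable_add W0(2) noise_alg_mono[OF _ U_noise_alg[of j]] noise_alg_mono[OF _ X_noise_alg[of i]] noise_alg_mono[OF _ W_noise_alg[of i]]
    noise_alg_mono[OF _ W_noise_alg[of i']]) auto
 have "(LINT z|M. \<Psi> (X i z) (W i z) (X i' z) (W i' z) (W_0 m j z)) = (LINT z|M. F (?V z) (U i' z))"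
  using pair_freeze[of i j i', OF _ ij(2) W0(1)] ij by (simp add: F_def X_def[of i'])
 also have "... = (LINT z|M. (LINT u|distr M borel (U i'). F (?V z) u))"
 proof (rule freeze[OF _ m U_noise_alg, where C = "(4 * B) * (4 * B)"])
  show "(\<lambda>(v, u). F v u) \<in> borel_measurable ((borel \<Otimes>\<^sub>M borel \<Otimes>\<^sub>M borel \<Otimes>\<^sub>M borel \<Otimes>\<^sub>M borel) \<Otimes>\<^sub>M borel)"
   unfolding F_def split_beta' by measurable
  show "norm (F v u) <= (4 * B) * (4 * B)" for v u
   unfolding F_def using vvb_mult_bounded by (simp split: prod.split)
 qed auto
 also have "... = (LINT z|M. 0)"
 proof (intro integral_cong refl)
  fix z
  have "(LINT u|\<mu>. vv y (u + wi') wi' - vb w (u + wi') wi') = 0" for y w wi'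
  proof -
   have i: "integrable \<mu> (\<lambda>u. k ((y - wi') - u))" "integrable \<mu> (\<lambda>u. k_1 (u + wi' - w))"
    by (auto intro!: mu_integrable[where c = B] simp: k_bounded k1_bounded)
   have "(LINT u|\<mu>. vv y (u + wi') wi' - vb w (u + wi') wi')
     = (LINT u|\<mu>. k ((y - wi') - u) - k_1 (y - wi') - (k_1 (u + wi' - w) - k_2 (w - wi')))"
    unfolding vv_def vb_def by (simp add: algebra_simps)
   also have "... = k_1 (y - wi') - k_1 (y - wi') - (k_2 (wi' - w) - k_2 (w - wi'))"
    using i \<mu>.prob_space by (simp add: k2_eq) (simp add: k_1_def)
   also have "... = 0" using k2_even[of "w - wi'"] by simp
   finally show ?thesis .
  qed
  then show "(LINT u|distr M borel (U i'). F (?V z) u) = 0"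
   unfolding distr_U F_def by simp
 qed
 finally show ?thesis by simp
qed

text \<open>The autocorrelation of |k|, with total integral at most \<open>\<kappa>^2\<close>. Its
  values can be of order 1/h, but averaged over a variable with bounded density it is controlled by
  L1 norms.\<close>

definition \<kappa>\<^sub>2 :: "real => ennreal" where
 "\<kappa>\<^sub>2 d = (\<integral>\<^sup>+x. ennreal \<bar>k x\<bar> * ennreal \<bar>k (x - d)\<bar> \<partial>lborel)"

lemma kappa2_measurable[measurable]: "\<kappa>\<^sub>2 \<in> borel_measurable borel"
 unfolding \<kappa>\<^sub>2_def by measurable

lemma kappa2_integral: "(\<integral>\<^sup>+d. \<kappa>\<^sub>2 d \<partial>lborel) <= ennreal (\<kappa>^2)"
proof -
 have "(\<integral>\<^sup>+d. \<kappa>\<^sub>2 d \<partial>lborel) = (\<integral>\<^sup>+x. \<integral>\<^sup>+d. ennreal \<bar>k x\<bar> * ennreal \<bar>k (x - d)\<bar> \<partial>lborel \<partial>lborel)"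
  unfolding \<kappa>\<^sub>2_def by (rule lborel_pair.Fubini') measurable
 also have "... = (\<integral>\<^sup>+x. ennreal \<bar>k x\<bar> * (\<integral>\<^sup>+d. ennreal \<bar>k d\<bar> \<partial>lborel) \<partial>lborel)"
  using lborel_shift(3)[of "\<lambda>d. ennreal \<bar>k d\<bar>"] by (intro nn_integral_cong) (simp add: nn_integral_cmult)
 also have "... = (\<integral>\<^sup>+x. ennreal \<bar>k x\<bar> \<partial>lborel) * (\<integral>\<^sup>+x. ennreal \<bar>k x\<bar> \<partial>lborel)"
  by (rule nn_integral_multc) auto
 also have "... <= ennreal \<kappa> * ennreal \<kappa>" by (intro mult_mono nn_k_L1) auto
 finally show ?thesis using kappa_nonneg by (simp add: power2_eq_square ennreal_mult)
qed

lemma k1_L1: "(\<integral>\<^sup>+y. ennreal \<bar>k_1 y\<bar> \<partial>lborel) <= ennreal \<kappa>"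
proof -
 interpret P: pair_sigma_finite lborel \<mu> ..
 have "(\<integral>\<^sup>+y. ennreal \<bar>k_1 y\<bar> \<partial>lborel) <= (\<integral>\<^sup>+y. \<integral>\<^sup>+u. ennreal \<bar>k (y - u)\<bar> \<partial>\<mu> \<partial>lborel)"
 proof (intro nn_integral_mono)
  fix y
  have "integrable \<mu> (\<lambda>u. k (y - u))" by (rule mu_integrable[where c = B]) (auto simp: k_bounded)
  from integral_norm_bound_ennreal[OF this] show "ennreal \<bar>k_1 y\<bar> <= (\<integral>\<^sup>+u. ennreal \<bar>k (y - u)\<bar> \<partial>\<mu>)"
   unfolding k_1_def by simp
 qed
 also have "... = (\<integral>\<^sup>+u. \<integral>\<^sup>+y. ennreal \<bar>k (y - u)\<bar> \<partial>lborel \<partial>\<mu>)"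
  by (rule P.Fubini'[symmetric]) measurable
 also have "... = (\<integral>\<^sup>+y. ennreal \<bar>k y\<bar> \<partial>lborel)"
  using lborel_shift(4)[of "\<lambda>d. ennreal \<bar>k d\<bar>"] \<mu>.emeasure_space_1 by simp
 also have "... <= ennreal \<kappa>" by (rule nn_k_L1)
 finally show ?thesis .
qed

lemma k1_integrable: "integrable lborel k_1"
 using k1_L1 by (intro integrableI_bounded) (auto intro: order.strict_trans1)

lemma vv_integrable: "integrable lborel (\<lambda>x. vv x xi wi)"
 unfolding vv_def using lborel_integrable_real_affine[OF k_integrable, of 1 "- xi"] lborel_integrable_real_affine[OF k1_integrable, of 1 "- wi"]
 by (intro integrable_diff) simp_all

lemma vv_L1: "(LINT x|lborel. \<bar>vv x xi wi\<bar>) <= 2 * \<kappa>"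
proof -
 have "ennreal (LINT x|lborel. \<bar>vv x xi wi\<bar>) = (\<integral>\<^sup>+x. ennreal \<bar>vv x xi wi\<bar> \<partial>lborel)"
  using vv_integrable by (intro nn_integral_eq_integral[symmetric]) auto
 also have "... <= (\<integral>\<^sup>+x. ennreal \<bar>k (x - xi)\<bar> + ennreal \<bar>k_1 (x - wi)\<bar> \<partial>lborel)"
  unfolding vv_def by (intro nn_integral_mono) (simp flip: ennreal_plus)
 also have "... = (\<integral>\<^sup>+x. ennreal \<bar>k x\<bar> \<partial>lborel) + (\<integral>\<^sup>+x. ennreal \<bar>k_1 x\<bar> \<partial>lborel)"
  using lborel_shift(4)[of "\<lambda>d. ennreal \<bar>k d\<bar>"] lborel_shift(4)[of "\<lambda>d. ennreal \<bar>k_1 d\<bar>"] by (simp add: nn_integral_add)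
 also have "... <= ennreal \<kappa> + ennreal \<kappa>" by (intro add_mono nn_k_L1 k1_L1)
 finally show ?thesis using kappa_nonneg by (simp flip: ennreal_plus)
qed

lemma vv_mult_integrable: "integrable lborel (\<lambda>x. vv x xi wi * vv x xi' wi')"
proof (rule integrable_bound)
 show "integrable lborel (\<lambda>x. (2 * B) * vv x xi' wi')" using vv_integrable by simp
 show "AE x in lborel. norm (vv x xi wi * vv x xi' wi') <= norm ((2 * B) * vv x xi' wi')"
 proof (rule AE_I2)
  fix x
  have "\<bar>vv x xi wi\<bar> * \<bar>vv x xi' wi'\<bar> <= (2 * B) * \<bar>vv x xi' wi'\<bar>" by (intro mult_right_mono vv_bounded) auto
  then show "norm (vv x xi wi * vv x xi' wi') <= norm ((2 * B) * vv x xi' wi')" using B_nonneg by (simp add: abs_mult)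
 qed
qed auto

text \<open>Of the four products, the one of two kernels is the autocorrelation of |k| at the
  difference of the centres; each of the other three has a smoothed factor bounded by
  \<open>c_1\<close> and costs \<open>c_1 * \<kappa>\<close>.\<close>

lemma vv_mult_L1: "ennreal (LINT x|lborel. \<bar>vv x xi wi * vv x xi' wi'\<bar>) <= \<kappa>\<^sub>2 (xi' - xi) + ennreal (3 * (c_1 * \<kappa>))"
proof -
 have "ennreal (LINT x|lborel. \<bar>vv x xi wi * vv x xi' wi'\<bar>) = (\<integral>\<^sup>+x. ennreal \<bar>vv x xi wi * vv x xi' wi'\<bar> \<partial>lborel)"
  using vv_mult_integrable by (intro nn_integral_eq_integral[symmetric]) auto
 also have "... <= (\<integral>\<^sup>+x. ennreal \<bar>k (x - xi)\<bar> * ennreal \<bar>k (x - xi')\<bar>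
   + (ennreal c_1 * ennreal \<bar>k (x - xi)\<bar> + ennreal c_1 * ennreal \<bar>k (x - xi')\<bar> + ennreal c_1 * ennreal \<bar>k_1 (x - wi)\<bar>) \<partial>lborel)"
 proof (intro nn_integral_mono)
  fix x
  let ?a = "\<bar>k (x - xi)\<bar>" and ?b = "\<bar>k (x - xi')\<bar>" and ?c = "\<bar>k_1 (x - wi)\<bar>" and ?d = "\<bar>k_1 (x - wi')\<bar>"
  have "\<bar>vv x xi wi * vv x xi' wi'\<bar> <= (?a + ?c) * (?b + ?d)"
   unfolding abs_mult vv_def by (intro mult_mono abs_triangle_ineq4) auto
  also have "... = ?a * ?b + (?d * ?a + ?c * ?b + ?d * ?c)" by (simp add: algebra_simps)
  also have "... <= ?a * ?b + (c_1 * ?a + c_1 * ?b + c_1 * ?c)"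
   by (intro add_mono order_refl mult_right_mono k1_le) auto
  finally have "ennreal \<bar>vv x xi wi * vv x xi' wi'\<bar> <= ennreal (?a * ?b + (c_1 * ?a + c_1 * ?b + c_1 * ?c))"
   by (rule ennreal_leI)
  also have "... = ennreal ?a * ennreal ?b + (ennreal c_1 * ennreal ?a + ennreal c_1 * ennreal ?b + ennreal c_1 * ennreal ?c)"
   using c1_nonneg by (simp add: ennreal_mult)
  finally show "ennreal \<bar>vv x xi wi * vv x xi' wi'\<bar> <= ..." .
 qed
 also have "... = (\<integral>\<^sup>+x. ennreal \<bar>k (x - xi)\<bar> * ennreal \<bar>k (x - xi')\<bar> \<partial>lborel)
   + (ennreal c_1 * (\<integral>\<^sup>+x. ennreal \<bar>k x\<bar> \<partial>lborel) + ennreal c_1 * (\<integral>\<^sup>+x. ennreal \<bar>k x\<bar> \<partial>lborel) + ennreal c_1 * (\<integral>\<^sup>+x. ennreal \<bar>k_1 x\<bar> \<partial>lborel))"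
  using lborel_shift(4)[of "\<lambda>d. ennreal \<bar>k d\<bar>"] lborel_shift(4)[of "\<lambda>d. ennreal \<bar>k_1 d\<bar>"]
  by (simp add: nn_integral_add nn_integral_cmult)
 also have "(\<integral>\<^sup>+x. ennreal \<bar>k (x - xi)\<bar> * ennreal \<bar>k (x - xi')\<bar> \<partial>lborel) = \<kappa>\<^sub>2 (xi' - xi)"
  unfolding \<kappa>\<^sub>2_def using lborel_shift(4)[of "\<lambda>x. ennreal \<bar>k x\<bar> * ennreal \<bar>k (x - (xi' - xi))\<bar>" xi] by (simp add: algebra_simps)
 also have "\<kappa>\<^sub>2 (xi' - xi) + (ennreal c_1 * (\<integral>\<^sup>+x. ennreal \<bar>k x\<bar> \<partial>lborel) + ennreal c_1 * (\<integral>\<^sup>+x. ennreal \<bar>k x\<bar> \<partial>lborel) + ennreal c_1 * (\<integral>\<^sup>+x. ennreal \<bar>k_1 x\<bar> \<partial>lborel))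
   <= \<kappa>\<^sub>2 (xi' - xi) + (ennreal c_1 * ennreal \<kappa> + ennreal c_1 * ennreal \<kappa> + ennreal c_1 * ennreal \<kappa>)"
  by (intro add_mono order_refl mult_left_mono nn_k_L1 k1_L1) auto
 also have "ennreal c_1 * ennreal \<kappa> + ennreal c_1 * ennreal \<kappa> + ennreal c_1 * ennreal \<kappa> = ennreal (3 * (c_1 * \<kappa>))"
  using c1_nonneg kappa_nonneg by (simp flip: ennreal_mult ennreal_plus)
 finally show ?thesis .
qed

text \<open>H comes from the Hoelder bound, \<open>m_g\<close> from the innovations in the tail of
  \<open>W j\<close>, and \<open>D * \<kappa>^2\<close> from \<open>leave_one_out\<close> applied to
  the autocorrelation of |k|. The 11 is 3 from \<open>vv_mult_L1\<close> plus 8 from the product of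
  the two means \<open>vb\<close>.\<close>

definition C_off :: real where "C_off = H * m_g * (D * \<kappa>^2 + 11 * (c_1 * \<kappa>))"

lemma C_off_nonneg: "0 <= C_off"
 unfolding C_off_def using H_nonneg m_gamma_nonneg D_nonneg c1_nonneg kappa_nonneg by (intro mult_nonneg_nonneg add_nonneg_nonneg) auto

text \<open>By \<open>Psi_eq\<close> the covariance is a mean of a product minus a product of means.
  All of these are averages over U of L1 functions shifted by w, so \<open>mu_holder\<close> applies
  to each.\<close>

lemma Psi_diff_le:
 assumes smooth: "\<And>s. two_coeffs (trunc s)"
 shows "ennreal \<bar>\<Psi> xi wi xi' wi' w - \<Psi> xi wi xi' wi' w'\<bar>
  <= ennreal (H * \<bar>w - w'\<bar> powr \<gamma>) * (\<kappa>\<^sub>2 (xi' - xi) + ennreal (11 * (c_1 * \<kappa>)))"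
proof -
 let ?h = "H * \<bar>w - w'\<bar> powr \<gamma>" and ?N = "LINT x|lborel. \<bar>vv x xi wi * vv x xi' wi'\<bar>"
 have h0: "0 <= ?h" using H_nonneg by simp
 have vb: "\<bar>vb w xi wi - vb w' xi wi\<bar> <= ?h * (2 * \<kappa>)" for xi wi
  using mu_holder[OF smooth vv_integrable[of xi wi], of w w'] mult_left_mono[OF vv_L1[of xi wi] h0] unfolding mu_vv by linarith
 have "\<bar>vb w xi wi * vb w xi' wi' - vb w' xi wi * vb w' xi' wi'\<bar> <= ?h * (8 * (c_1 * \<kappa>))"
 proof -
  have eq: "vb w xi wi * vb w xi' wi' - vb w' xi wi * vb w' xi' wi'
    = (vb w xi wi - vb w' xi wi) * vb w xi' wi' + (vb w xi' wi' - vb w' xi' wi') * vb w' xi wi" by (simp add: algebra_simps)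
  have "\<bar>vb w xi wi * vb w xi' wi' - vb w' xi wi * vb w' xi' wi'\<bar> <= \<bar>vb w xi wi - vb w' xi wi\<bar> * \<bar>vb w xi' wi'\<bar> + \<bar>vb w xi' wi' - vb w' xi' wi'\<bar> * \<bar>vb w' xi wi\<bar>"
   unfolding eq abs_mult[symmetric] by (rule abs_triangle_ineq)
  also have "... <= (?h * (2 * \<kappa>)) * (2 * c_1) + (?h * (2 * \<kappa>)) * (2 * c_1)"
   using h0 kappa_nonneg H_nonneg by (intro add_mono mult_mono vb vb_le mult_nonneg_nonneg) auto
  also have "... = ?h * (8 * (c_1 * \<kappa>))" by simp
  finally show ?thesis .
 qed
 moreover have "\<bar>(LINT u|\<mu>. vv (u + w) xi wi * vv (u + w) xi' wi') - (LINT u|\<mu>. vv (u + w') xi wi * vv (u + w') xi' wi')\<bar> <= ?h * ?N"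
  by (rule mu_holder[OF smooth vv_mult_integrable])
 ultimately have "\<bar>\<Psi> xi wi xi' wi' w - \<Psi> xi wi xi' wi' w'\<bar> <= ?h * ?N + ?h * (8 * (c_1 * \<kappa>))"
  unfolding Psi_eq by linarith
 then have "\<bar>\<Psi> xi wi xi' wi' w - \<Psi> xi wi xi' wi' w'\<bar> <= ?h * (?N + 8 * (c_1 * \<kappa>))"
  by (simp add: distrib_left)
 then have "ennreal \<bar>\<Psi> xi wi xi' wi' w - \<Psi> xi wi xi' wi' w'\<bar> <= ennreal (?h * (?N + 8 * (c_1 * \<kappa>)))"
  by (rule ennreal_leI)
 also have "... = ennreal ?h * (ennreal ?N + ennreal (8 * (c_1 * \<kappa>)))"
  using h0 c1_nonneg kappa_nonneg by (subst ennreal_mult) (auto intro!: add_nonneg_nonneg integral_nonneg simp flip: ennreal_plus)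
 also have "... <= ennreal ?h * ((\<kappa>\<^sub>2 (xi' - xi) + ennreal (3 * (c_1 * \<kappa>))) + ennreal (8 * (c_1 * \<kappa>)))"
  by (intro mult_left_mono add_right_mono vv_mult_L1) auto
 also have "(\<kappa>\<^sub>2 (xi' - xi) + ennreal (3 * (c_1 * \<kappa>))) + ennreal (8 * (c_1 * \<kappa>)) = \<kappa>\<^sub>2 (xi' - xi) + ennreal (11 * (c_1 * \<kappa>))"
  unfolding add.assoc using c1_nonneg kappa_nonneg by (subst ennreal_plus[symmetric]) auto
 finally show ?thesis .
qed

text \<open>The expectation vanishes when \<open>W j\<close> is replaced by \<open>W_0 m j\<close>.
  The discarded part is the tail of the process from lag m on, and Hoelder continuity of the
  conditional covariance converts its \<gamma>-th power into \<open>tail_norm m\<close>. With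
  finitely many coefficients nothing is discarded.\<close>

lemma DD_pair_le:
 assumes ij: "i + int L <= i'" "i' + int L <= j"
 shows "\<bar>\<E> (\<lambda>w. DD i j w * DD i' j w)\<bar> <= C_off * tail_norm (nat (j - i'))"
proof -
 define m where "m = nat (j - i')"
 have Lm: "L <= m" and mj: "j - int m = i'" using ij by (auto simp: m_def)
 have E: "\<E> (\<lambda>w. DD i j w * DD i' j w) = (LINT w|M. \<Psi> (X i w) (W i w) (X i' w) (W i' w) (W j w))"
  unfolding DD_eq using ij by (intro pair_freeze W_noise_alg) auto
 have E0: "(LINT w|M. \<Psi> (X i w) (W i w) (X i' w) (W i' w) (W_0 m j w)) = 0"
  by (rule DD_pair_zero[OF ij m_def])
 have bPsi: "bdd_rv (\<lambda>w. \<Psi> (X i w) (W i w) (X i' w) (W i' w) (Y w))" if "Y \<in> borel_measurable M" for Y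
 proof (rule bdd_rvI)
  show "norm (\<Psi> (X i w) (W i w) (X i' w) (W i' w) (Y w)) <= (4 * B) * (4 * B)" for w
   unfolding real_norm_def by (rule Psi_bounded)
 qed (use that in measurable)
 consider (fin) "\<forall>l\<ge>L. a l = 0" | (smooth) "\<And>s. two_coeffs (trunc s)"
  using finite_or_smooth unfolding trunc_def[abs_def] by blast
 then show ?thesis
 proof cases
  case fin
  have "W j w = W_0 m j w" for w
   using fin by (simp add: W_def W_0_def lin_def psum_def)
  then have "\<E> (\<lambda>w. DD i j w * DD i' j w) = 0" using E E0 by simp
  then show ?thesis using C_off_nonneg tail_norm_nonneg by simp
 next
  case smooth
  let ?P = "\<lambda>Y w. \<Psi> (X i w) (W i w) (X i' w) (W i' w) (Y w)"
  let ?K = "ennreal (11 * (c_1 * \<kappa>))"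
  let ?e = "\<lambda>l w. ennreal (\<bar>\<epsilon> (i' - int l) w\<bar> powr \<gamma>)"
  have "\<E> (\<lambda>w. DD i j w * DD i' j w) = \<E> (\<lambda>w. ?P (W j) w - ?P (W_0 m j) w)"
   unfolding E using E0 by (subst integral_diff) (auto intro!: bdd_rv_integrable bPsi)
  moreover have "integrable M (\<lambda>w. ?P (W j) w - ?P (W_0 m j) w)"
   by (intro bdd_rv_integrable bdd_rv_diff bPsi) measurable
  ultimately have "ennreal \<bar>\<E> (\<lambda>w. DD i j w * DD i' j w)\<bar> <= (\<integral>\<^sup>+w. ennreal \<bar>?P (W j) w - ?P (W_0 m j) w\<bar> \<partial>M)"
   using integral_norm_bound_ennreal[of M "\<lambda>w. ?P (W j) w - ?P (W_0 m j) w"] by (simp only: real_norm_def)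
  \<comment> \<open>The \<gamma>-th power of the tail is split into single innovations before taking
    expectations, because each may be dependent on X i' and must be handled by
    \<open>leave_one_out\<close> separately.\<close>
  also have "... <= (\<integral>\<^sup>+w. ennreal H * (\<Sum>l. ennreal (\<bar>a (l + m)\<bar> powr \<gamma>) * (?e l w * \<kappa>\<^sub>2 (X i' w - X i w) + ?e l w * ?K)) \<partial>M)"
  proof (rule nn_integral_mono_AE)
   show "AE w in M. ennreal \<bar>?P (W j) w - ?P (W_0 m j) w\<bar>
     <= ennreal H * (\<Sum>l. ennreal (\<bar>a (l + m)\<bar> powr \<gamma>) * (?e l w * \<kappa>\<^sub>2 (X i' w - X i w) + ?e l w * ?K))"
    using AE_W_split[OF Lm, of j] AE_lin_powr_le[OF summable_coeffs_shift[OF sa, of m]]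
   proof eventually_elim
    case (elim w)
    let ?\<Delta> = "W j w - W_0 m j w" and ?G = "\<kappa>\<^sub>2 (X i' w - X i w) + ?K"
    have "ennreal \<bar>?P (W j) w - ?P (W_0 m j) w\<bar> <= ennreal (H * \<bar>?\<Delta>\<bar> powr \<gamma>) * ?G"
     by (rule Psi_diff_le[OF smooth])
    also have "... = ennreal H * (ennreal (\<bar>?\<Delta>\<bar> powr \<gamma>) * ?G)"
     using H_nonneg by (simp add: ennreal_mult mult.assoc)
    also have "... <= ennreal H * ((\<Sum>l. ennreal (\<bar>a (l + m)\<bar> powr \<gamma>) * ?e l w) * ?G)"
     using elim(2)[rule_format, of i'] unfolding elim(1) mj by (intro mult_left_mono mult_right_mono) auto
    also have "... = ennreal H * (\<Sum>l. ennreal (\<bar>a (l + m)\<bar> powr \<gamma>) * (?e l w * \<kappa>\<^sub>2 (X i' w - X i w) + ?e l w * ?K))"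
     by (subst ennreal_suminf_multc[symmetric]) (simp add: mult.assoc distrib_left)
    finally show ?case .
   qed
  qed
  also have "... = ennreal H * (\<Sum>l. ennreal (\<bar>a (l + m)\<bar> powr \<gamma>) * ((\<integral>\<^sup>+w. ?e l w * \<kappa>\<^sub>2 (X i' w - X i w) \<partial>M) + (\<integral>\<^sup>+w. ?e l w * ?K \<partial>M)))"
   by (simp add: nn_integral_cmult nn_integral_suminf nn_integral_add)
  also have "... <= ennreal H * (\<Sum>l. ennreal (\<bar>a (l + m)\<bar> powr \<gamma>) * (ennreal (m_g * D) * ennreal (\<kappa>^2) + ennreal m_g * ?K))"
  proof (intro mult_left_mono suminf_le add_mono)
   fix l
   have "(\<integral>\<^sup>+w. ?e l w * \<kappa>\<^sub>2 (X i' w - X i w) \<partial>M) <= ennreal (m_g * D) * (\<integral>\<^sup>+x. \<kappa>\<^sub>2 x \<partial>lborel)"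
    by (rule leave_one_out[OF smooth ij(1)]) auto
   also have "... <= ennreal (m_g * D) * ennreal (\<kappa>^2)" by (intro mult_left_mono kappa2_integral) auto
   finally show "(\<integral>\<^sup>+w. ?e l w * \<kappa>\<^sub>2 (X i' w - X i w) \<partial>M) <= ennreal (m_g * D) * ennreal (\<kappa>^2)" .
   show "(\<integral>\<^sup>+w. ?e l w * ?K \<partial>M) <= ennreal m_g * ?K"
    by (subst nn_integral_multc) (auto simp: nn_expectation_eps_powr)
  qed auto
  also have "ennreal (m_g * D) * ennreal (\<kappa>^2) + ennreal m_g * ?K = ennreal (m_g * (D * \<kappa>^2 + 11 * (c_1 * \<kappa>)))"
   using m_gamma_nonneg D_nonneg c1_nonneg kappa_nonneg
   by (simp add: distrib_left mult.assoc flip: ennreal_mult ennreal_plus)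
  also have "ennreal H * (\<Sum>l. ennreal (\<bar>a (l + m)\<bar> powr \<gamma>) * ennreal (m_g * (D * \<kappa>^2 + 11 * (c_1 * \<kappa>))))
    = ennreal H * (ennreal (tail_norm m) * ennreal (m_g * (D * \<kappa>^2 + 11 * (c_1 * \<kappa>))))"
  proof -
   have "(\<Sum>l. ennreal (\<bar>a (l + m)\<bar> powr \<gamma>)) = ennreal (tail_norm m)"
    unfolding tail_norm_def coeff_norm_def using summable_coeffs_shift[OF sa, of m] unfolding summable_coeffs_def
    by (intro suminf_ennreal2) auto
   then show ?thesis by (simp add: ennreal_suminf_multc)
  qed
  also have "... = ennreal (C_off * tail_norm m)"
   using m_gamma_nonneg D_nonneg c1_nonneg kappa_nonneg H_nonneg tail_norm_nonneg
   by (simp add: C_off_def mult_ac flip: ennreal_mult)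
  finally show ?thesis
   using C_off_nonneg tail_norm_nonneg by (simp add: m_def)
 qed
qed

end

lemma sum_pair_add:
 fixes t :: "'i => real"
 shows "(\<Sum>i\<in>I. \<Sum>j\<in>I. c * (t i + t j)) = 2 * c * real (card I) * (\<Sum>i\<in>I. t i)"
proof -
 have "(\<Sum>i\<in>I. \<Sum>j\<in>I. c * (t i + t j)) = c * (\<Sum>i\<in>I. real (card I) * t i + (\<Sum>j\<in>I. t j))"
  by (simp only: sum_distrib_left[symmetric] sum.distrib sum_constant)
 also have "... = 2 * c * real (card I) * (\<Sum>i\<in>I. t i)"
  by (simp only: sum_distrib_left[symmetric] sum.distrib sum_constant) (simp add: algebra_simps)
 finally show ?thesis .
qed

lemma power2_sum_le: "(x + y)^2 <= 2 * x^2 + 2 * (y::real)^2"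
 using sum_squares_bound[of x y] by (simp add: power2_sum)

section \<open>Second moment and mean of the double sum of DD\<close>

context kernel_process
begin

definition \<eta> :: "nat => real" where "\<eta> n = (\<Sum>l=0..n. tail_norm l)"

lemma eta_nonneg: "0 <= \<eta> n"
 unfolding \<eta>_def by (intro sum_nonneg tail_norm_nonneg)

text \<open>The terms with a gap of at least L, for which \<open>U j\<close> is independent of the
  innovations up to i.\<close>

definition far :: "nat => 'a => real" where
 "far j w = (\<Sum>i\<in>{i. 1 <= i \<and> i + L <= j}. DD (int i) (int j) w)"

lemma finite_far: "finite {i::nat. 1 <= i \<and> i + L <= j}" "card {i::nat. 1 <= i \<and> i + L <= j} <= j"
proof -
 have sub: "{i::nat. 1 <= i \<and> i + L <= j} \<subseteq> {1..j}" by auto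
 then show "finite {i::nat. 1 <= i \<and> i + L <= j}" by (rule finite_subset) auto
 show "card {i::nat. 1 <= i \<and> i + L <= j} <= j" using card_mono[OF _ sub] by simp
qed

lemma bdd_rv_far: "bdd_rv (far j)"
 unfolding far_def[abs_def] by (intro bdd_rv_intros bdd_rv_DD)

lemma far_abs_le: "\<bar>far j w\<bar> <= real j * (4 * B)"
proof -
 have "\<bar>far j w\<bar> <= (\<Sum>i\<in>{i. 1 <= i \<and> i + L <= j}. \<bar>DD (int i) (int j) w\<bar>)" unfolding far_def by (rule sum_abs)
 also have "... <= (\<Sum>i\<in>{i. 1 <= i \<and> i + L <= j}. 4 * B)" by (intro sum_mono DD_bounded)
 also have "... <= real j * (4 * B)" using finite_far(2)[of j] B_nonneg by (simp add: mult_right_mono)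
 finally show ?thesis .
qed

lemma far_noise_alg: "far j \<in> borel_measurable (noise_alg {..int j})"
 unfolding far_def[abs_def] by (intro borel_measurable_sum DD_noise_alg) auto

text \<open>\<open>far j\<close> depends on innovations up to j only, hence up to j' - L, so
  \<open>DD_orthogonal\<close> applies to every summand of \<open>far j'\<close>.\<close>

lemma far_orthogonal:
 assumes "j + L <= j'"
 shows "\<E> (\<lambda>w. far j w * far j' w) = 0"
proof -
 have m: "far j \<in> borel_measurable (noise_alg {..int j' - int L})"
  by (rule noise_alg_mono[OF _ far_noise_alg]) (use assms in auto)
 have "\<E> (\<lambda>w. far j w * far j' w) = \<E> (\<lambda>w. \<Sum>i\<in>{i. 1 <= i \<and> i + L <= j'}. DD (int i) (int j') w * far j w)"
  unfolding far_def[of j'] by (simp add: sum_distrib_left mult.commute)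
 also have "... = (\<Sum>i\<in>{i. 1 <= i \<and> i + L <= j'}. \<E> (\<lambda>w. DD (int i) (int j') w * far j w))"
  by (intro integral_sum bdd_rv_integrable bdd_rv_mult bdd_rv_DD bdd_rv_far)
 also have "... = 0"
  by (intro sum.neutral ballI DD_orthogonal[OF _ m far_abs_le]) auto
 finally show ?thesis .
qed

text \<open>Indices at distance below L are handled by xy at most (x^2 + y^2)/2; otherwise the later
  index decides the tail in \<open>DD_pair_le\<close>. Charging both tails makes the bound symmetric
  in i and i'.\<close>

lemma DD_pair_bound:
 assumes "1 <= i" "i + L <= j" "1 <= i'" "i' + L <= j"
 shows "\<E> (\<lambda>w. DD (int i) (int j) w * DD (int i') (int j) w)
  <= (if i < i' + L \<and> i' < i + L then q else 0) + C_off * (tail_norm (j - i) + tail_norm (j - i'))"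
proof -
 let ?E = "\<E> (\<lambda>w. DD (int i) (int j) w * DD (int i') (int j) w)"
 have t0: "0 <= C_off * tail_norm l" for l using C_off_nonneg tail_norm_nonneg by simp
 consider "i < i' + L \<and> i' < i + L" | "i + L <= i'" | "i' + L <= i" by linarith
 then show ?thesis
 proof cases
  case 1
  have "?E <= \<E> (\<lambda>w. (DD (int i) (int j) w)^2 * (1/2) + (DD (int i') (int j) w)^2 * (1/2))"
   using sum_squares_bound[of "DD (int i) (int j) w" "DD (int i') (int j) w" for w]
   by (intro integral_mono bdd_rv_integrable bdd_rv_intros bdd_rv_DD) (auto simp: field_simps)
  also have "... = \<E> (\<lambda>w. (DD (int i) (int j) w)^2) / 2 + \<E> (\<lambda>w. (DD (int i') (int j) w)^2) / 2"
  proof -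
   have "integrable M (\<lambda>w. (DD (int i) (int j) w)^2)" for i
    by (intro bdd_rv_integrable bdd_rv_intros bdd_rv_DD)
   then show ?thesis by simp
  qed
  also have "... <= q"
   using expectation_DD_sq[of "int i" "int j"] expectation_DD_sq[of "int i'" "int j"] assms L_pos by simp
  finally show ?thesis using 1 t0[of "j - i"] t0[of "j - i'"] by (simp add: distrib_left)
 next
  case 2
  have "nat (int j - int i') = j - i'" using assms by simp
  moreover have "int i + int L <= int i'" "int i' + int L <= int j" using 2 assms by auto
  ultimately have "\<bar>?E\<bar> <= C_off * tail_norm (j - i')" using DD_pair_le[of "int i" "int i'" "int j"] by simp
  then show ?thesis using 2 t0[of "j - i"] L_pos by (simp add: distrib_left abs_le_iff)
 next
  case 3
  have "nat (int j - int i) = j - i" using assms by simp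
  moreover have "int i' + int L <= int i" "int i + int L <= int j" using 3 assms by auto
  ultimately have "\<bar>?E\<bar> <= C_off * tail_norm (j - i)" using DD_pair_le[of "int i'" "int i" "int j"] by (simp add: mult.commute)
  then show ?thesis using 3 t0[of "j - i'"] L_pos by (simp add: distrib_left abs_le_iff)
 qed
qed

text \<open>The gaps j - i are distinct numbers up to n, so their tails add up to at most
  \<open>\<eta> n\<close>; each i has at most 2 L neighbours that are charged q.\<close>

lemma far_sq:
 assumes "j <= n"
 shows "\<E> (\<lambda>w. (far j w)^2) <= real n * (2 * real L * q + 2 * C_off * \<eta> n)"
proof -
 let ?I = "{i::nat. 1 <= i \<and> i + L <= j}"
 let ?n = "\<lambda>i i'. i < i' + L \<and> i' < i + L"
 have cardI: "real (card ?I) <= real n" using finite_far(2)[of j] assms by linarith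
 have tails: "(\<Sum>i\<in>?I. tail_norm (j - i)) <= \<eta> n"
 proof -
  have "(\<Sum>i\<in>?I. tail_norm (j - i)) = (\<Sum>l\<in>(\<lambda>i. j - i) ` ?I. tail_norm l)"
   by (subst sum.reindex) (auto simp: inj_on_def)
  also have "... <= \<eta> n"
   unfolding \<eta>_def using assms by (intro sum_mono2 tail_norm_nonneg) auto
  finally show ?thesis .
 qed
 have cnt: "real (card {i'\<in>?I. ?n i i'}) <= 2 * real L" for i
 proof -
  have "card {i'\<in>?I. ?n i i'} <= card {i + 1 - L..<i + L}" by (intro card_mono) auto
  also have "... <= 2 * L" by simp
  finally show ?thesis by linarith
 qed
 have "\<E> (\<lambda>w. (far j w)^2) = \<E> (\<lambda>w. \<Sum>i\<in>?I. \<Sum>i'\<in>?I. DD (int i) (int j) w * DD (int i') (int j) w)"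
  unfolding far_def by (simp add: power2_eq_square sum_product)
 also have "... = (\<Sum>i\<in>?I. \<Sum>i'\<in>?I. \<E> (\<lambda>w. DD (int i) (int j) w * DD (int i') (int j) w))"
  by (simp add: integral_sum bdd_rv_integrable bdd_rv_sum bdd_rv_mult bdd_rv_DD)
 also have "... <= (\<Sum>i\<in>?I. \<Sum>i'\<in>?I. (if ?n i i' then q else 0) + C_off * (tail_norm (j - i) + tail_norm (j - i')))"
  by (intro sum_mono DD_pair_bound) auto
 also have "... = (\<Sum>i\<in>?I. real (card {i'\<in>?I. ?n i i'}) * q) + (\<Sum>i\<in>?I. \<Sum>i'\<in>?I. C_off * (tail_norm (j - i) + tail_norm (j - i')))"
 proof -
  have "(\<Sum>i'\<in>?I. if ?n i i' then q else 0) = real (card {i'\<in>?I. ?n i i'}) * q" for i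
   by (subst sum.inter_filter[OF finite_far(1), symmetric]) simp
  then show ?thesis by (simp only: sum.distrib)
 qed
 also have "(\<Sum>i\<in>?I. \<Sum>i'\<in>?I. C_off * (tail_norm (j - i) + tail_norm (j - i')))
   = 2 * C_off * real (card ?I) * (\<Sum>i\<in>?I. tail_norm (j - i))"
  by (rule sum_pair_add)
 also have "(\<Sum>i\<in>?I. real (card {i'\<in>?I. ?n i i'}) * q) + 2 * C_off * real (card ?I) * (\<Sum>i\<in>?I. tail_norm (j - i))
   <= real (card ?I) * (2 * real L * q) + 2 * C_off * real (card ?I) * \<eta> n"
 proof (intro add_mono mult_left_mono tails)
  have "(\<Sum>i\<in>?I. real (card {i'\<in>?I. ?n i i'}) * q) <= (\<Sum>i\<in>?I. 2 * real L * q)"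
   by (intro sum_mono mult_right_mono cnt q_nonneg)
  then show "(\<Sum>i\<in>?I. real (card {i'\<in>?I. ?n i i'}) * q) <= real (card ?I) * (2 * real L * q)" by simp
 qed (use C_off_nonneg in auto)
 also have "... = real (card ?I) * (2 * real L * q + 2 * C_off * \<eta> n)" by (simp add: algebra_simps)
 also have "... <= real n * (2 * real L * q + 2 * C_off * \<eta> n)"
  using q_nonneg C_off_nonneg eta_nonneg cardI by (intro mult_right_mono add_nonneg_nonneg mult_nonneg_nonneg) auto
 finally show ?thesis .
qed

text \<open>Pairs with a gap below L. There are only of order n of them, so they need no
  orthogonality.\<close>

definition near_pairs :: "nat => (nat \<times> nat) set" where
 "near_pairs n = {(j, i). 1 <= i \<and> i < j \<and> j <= n \<and> j < i + L}"

lemma near_pairs: "finite (near_pairs n)" "card (near_pairs n) <= n * L"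
proof -
 have sub: "near_pairs n \<subseteq> (\<lambda>(j, d). (j, j - d)) ` ({1..n} \<times> {..<L})"
 proof
  fix p assume "p \<in> near_pairs n"
  then obtain j i where p: "p = (j, i)" "1 <= i" "i < j" "j <= n" "j < i + L" unfolding near_pairs_def by auto
  then have "p = (\<lambda>(j, d). (j, j - d)) (j, j - i)" "(j, j - i) \<in> {1..n} \<times> {..<L}" by auto
  then show "p \<in> (\<lambda>(j, d). (j, j - d)) ` ({1..n} \<times> {..<L})" by blast
 qed
 then show "finite (near_pairs n)" by (rule finite_subset) auto
 have "card (near_pairs n) <= card ((\<lambda>(j, d). (j, j - d)) ` ({1..n} \<times> {..<L}))" by (intro card_mono sub) auto
 also have "... <= card ({1..n} \<times> {..<L})" by (rule card_image_le) auto
 finally show "card (near_pairs n) <= n * L" by simp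
qed

lemma DD_split:
 "(\<Sum>j=1..n. \<Sum>i=1..<j. DD (int i) (int j) w)
  = (\<Sum>j\<in>{1..n}. far j w) + (\<Sum>p\<in>near_pairs n. DD (int (snd p)) (int (fst p)) w)"
proof -
 have "(\<Sum>i=1..<j. DD (int i) (int j) w) = far j w + (\<Sum>i\<in>{i. 1 <= i \<and> i < j \<and> j < i + L}. DD (int i) (int j) w)" for j
  unfolding far_def using L_pos by (subst sum.union_disjoint[symmetric]) (auto intro!: sum.cong finite_subset[of _ "{1..j}"])
 then have "(\<Sum>j=1..n. \<Sum>i=1..<j. DD (int i) (int j) w)
   = (\<Sum>j\<in>{1..n}. far j w) + (\<Sum>j\<in>{1..n}. \<Sum>i\<in>{i. 1 <= i \<and> i < j \<and> j < i + L}. DD (int i) (int j) w)"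
  by (simp add: sum.distrib)
 also have "(\<Sum>j\<in>{1..n}. \<Sum>i\<in>{i. 1 <= i \<and> i < j \<and> j < i + L}. DD (int i) (int j) w)
   = (\<Sum>p\<in>Sigma {1..n} (\<lambda>j. {i. 1 <= i \<and> i < j \<and> j < i + L}). DD (int (snd p)) (int (fst p)) w)"
  by (subst sum.Sigma) (auto simp: split_beta' intro: finite_subset[of _ "{1..j}" for j])
 also have "Sigma {1..n} (\<lambda>j. {i. 1 <= i \<and> i < j \<and> j < i + L}) = near_pairs n"
  unfolding near_pairs_def by auto
 finally show ?thesis .
qed

text \<open>The far part is lag-orthogonal in j, the near part is bounded by Cauchy-Schwarz over at
  most n L terms. Doubling both contributions gives 10 = 8 + 2 copies of L^2 q.\<close>

theorem DD_total_sq: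
 "\<E> (\<lambda>w. (\<Sum>j=1..n. \<Sum>i=1..<j. DD (int i) (int j) w)^2)
  <= (real n)^2 * (10 * (real L)^2 * q + 8 * real L * C_off * \<eta> n)"
proof -
 let ?F = "\<lambda>w. \<Sum>j\<in>{1..n}. far j w" and ?N = "\<lambda>w. \<Sum>p\<in>near_pairs n. DD (int (snd p)) (int (fst p)) w"
 have bF: "bdd_rv ?F" by (intro bdd_rv_intros bdd_rv_far)
 have bN: "bdd_rv ?N" by (intro bdd_rv_intros bdd_rv_DD)
 have F: "\<E> (\<lambda>w. (?F w)^2) <= 2 * real L * (real n * (real n * (2 * real L * q + 2 * C_off * \<eta> n)))"
 proof -
  have "\<E> (\<lambda>w. (?F w)^2) <= 2 * real L * (\<Sum>j\<in>{1..n}. \<E> (\<lambda>w. (far j w)^2))"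
   by (rule expectation_lag_orthogonal) (auto intro: bdd_rv_far far_orthogonal)
  also have "... <= 2 * real L * (\<Sum>j\<in>{1..n}. real n * (2 * real L * q + 2 * C_off * \<eta> n))"
   by (intro mult_left_mono sum_mono far_sq) auto
  finally show ?thesis by simp
 qed
 have N: "\<E> (\<lambda>w. (?N w)^2) <= (real n * real L)^2 * q"
 proof -
  let ?c = "real (card (near_pairs n))"
  have "\<E> (\<lambda>w. (?N w)^2) <= \<E> (\<lambda>w. ?c * (\<Sum>p\<in>near_pairs n. (DD (int (snd p)) (int (fst p)) w)^2))"
  proof (intro integral_mono bdd_rv_integrable bdd_rv_intros bdd_rv_DD)
   show "(?N w)^2 <= ?c * (\<Sum>p\<in>near_pairs n. (DD (int (snd p)) (int (fst p)) w)^2)" for w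
    using sum_squared_le_sum_of_squares[of "\<lambda>p. DD (int (snd p)) (int (fst p)) w" "near_pairs n"] by (simp only: mult.commute)
  qed
  also have "... = ?c * (\<Sum>p\<in>near_pairs n. \<E> (\<lambda>w. (DD (int (snd p)) (int (fst p)) w)^2))"
   by (subst integral_mult_right_zero, subst integral_sum)
    (auto intro!: bdd_rv_integrable bdd_rv_intros bdd_rv_DD)
  also have "... <= ?c * (\<Sum>p\<in>near_pairs n. q)"
   by (intro mult_left_mono sum_mono expectation_DD_sq) (auto simp: near_pairs_def)
  also have "... = ?c^2 * q" by (simp add: power2_eq_square)
  also have "... <= (real n * real L)^2 * q"
   using near_pairs(2)[of n] q_nonneg by (intro mult_right_mono power_mono) (auto simp flip: of_nat_mult)
  finally show ?thesis .
 qed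
 have "\<E> (\<lambda>w. (?F w + ?N w)^2) <= \<E> (\<lambda>w. 2 * (?F w)^2 + 2 * (?N w)^2)"
  by (intro integral_mono power2_sum_le bdd_rv_integrable bdd_rv_intros bdd_rv_DD bdd_rv_far)
 also have "... = 2 * \<E> (\<lambda>w. (?F w)^2) + 2 * \<E> (\<lambda>w. (?N w)^2)"
 proof -
  have "integrable M (\<lambda>w. (?F w)^2)" "integrable M (\<lambda>w. (?N w)^2)"
   by (intro bdd_rv_integrable bdd_rv_power bF bN)+
  then show ?thesis by simp
 qed
 also have "... <= 2 * (2 * real L * (real n * (real n * (2 * real L * q + 2 * C_off * \<eta> n)))) + 2 * ((real n * real L)^2 * q)"
  by (intro add_mono mult_left_mono F N) auto
 also have "... = (real n)^2 * (10 * (real L)^2 * q + 8 * real L * C_off * \<eta> n)"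
  by (simp add: power2_eq_square algebra_simps)
 finally show ?thesis unfolding DD_split .
qed

text \<open>Far terms have mean 0 by \<open>DD_orthogonal\<close> with V = 1; the near terms are
  bounded one by one, in L1 and hence free of B.\<close>

theorem DD_total_mean:
 "\<bar>\<E> (\<lambda>w. \<Sum>j=1..n. \<Sum>i=1..<j. DD (int i) (int j) w)\<bar> <= real n * (real L * (C_d * \<kappa> + 3 * c_1))"
proof -
 have far0: "\<E> (far j) = 0" for j
 proof -
  have "\<E> (far j) = (\<Sum>i\<in>{i. 1 <= i \<and> i + L <= j}. \<E> (DD (int i) (int j)))"
   unfolding far_def[abs_def] by (intro integral_sum bdd_rv_integrable bdd_rv_DD)
  also have "... = 0"
  proof (intro sum.neutral ballI)
   fix i assume "i \<in> {i. 1 <= i \<and> i + L <= j}"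
   then have "\<E> (\<lambda>w. DD (int i) (int j) w * 1) = 0" by (intro DD_orthogonal[where c = 1]) auto
   then show "\<E> (DD (int i) (int j)) = 0" by simp
  qed
  finally show ?thesis .
 qed
 have "\<E> (\<lambda>w. \<Sum>j=1..n. \<Sum>i=1..<j. DD (int i) (int j) w)
   = (\<Sum>j\<in>{1..n}. \<E> (far j)) + (\<Sum>p\<in>near_pairs n. \<E> (DD (int (snd p)) (int (fst p))))"
  unfolding DD_split
  by (subst integral_add) (auto intro!: bdd_rv_integrable bdd_rv_intros bdd_rv_DD bdd_rv_far
   simp: integral_sum bdd_rv_integrable bdd_rv_DD bdd_rv_far)
 also have "... = (\<Sum>p\<in>near_pairs n. \<E> (DD (int (snd p)) (int (fst p))))" by (simp add: far0)
 finally have eq: "\<E> (\<lambda>w. \<Sum>j=1..n. \<Sum>i=1..<j. DD (int i) (int j) w) = (\<Sum>p\<in>near_pairs n. \<E> (DD (int (snd p)) (int (fst p))))" .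
 have "\<bar>\<Sum>p\<in>near_pairs n. \<E> (DD (int (snd p)) (int (fst p)))\<bar> <= (\<Sum>p\<in>near_pairs n. C_d * \<kappa> + 3 * c_1)"
  by (rule order_trans[OF sum_abs]) (intro sum_mono expectation_DD_abs, auto simp: near_pairs_def)
 also have "... = real (card (near_pairs n)) * (C_d * \<kappa> + 3 * c_1)" by simp
 also have "... <= (real n * real L) * (C_d * \<kappa> + 3 * c_1)"
  using near_pairs(2)[of n] C_delta kappa_nonneg c1_nonneg by (intro mult_right_mono) (auto simp flip: of_nat_mult)
 finally show ?thesis unfolding eq by (simp add: mult.assoc)
qed

end

section \<open>Fourier representation of doubly centred kernels\<close>

context prob_space
begin

text \<open>Cauchy-Schwarz for the squares: second moments of a product cost fourth moments of its
  factors.\<close>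

lemma nn_expectation_mult_sq_le:
 fixes x y :: "'a => complex"
 assumes b: "bdd_rv x" "bdd_rv y" and pq: "0 <= p" "0 <= q"
  and x: "\<E> (\<lambda>w. cmod (x w) ^ 4) <= p ^ 4" and y: "\<E> (\<lambda>w. cmod (y w) ^ 4) <= q ^ 4"
 shows "(\<integral>\<^sup>+w. ennreal ((cmod (cnj (x w) * y w))^2) \<partial>M) <= ennreal ((p * q)^2)"
proof (rule ennreal_power2_le_imp_le)
 note [measurable] = bdd_rv_measurable[OF b(1)] bdd_rv_measurable[OF b(2)]
 have four: "(\<integral>\<^sup>+w. (ennreal ((cmod (z w))^2))^2 \<partial>M) <= ennreal (r ^ 4)"
  if "bdd_rv z" "\<E> (\<lambda>w. cmod (z w) ^ 4) <= r ^ 4" for z :: "'a => complex" and r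
 proof -
  have "(\<integral>\<^sup>+w. (ennreal ((cmod (z w))^2))^2 \<partial>M) = (\<integral>\<^sup>+w. ennreal (cmod (z w) ^ 4) \<partial>M)"
   by (intro nn_integral_cong) (simp add: ennreal_power)
  also have "... = ennreal (\<E> (\<lambda>w. cmod (z w) ^ 4))"
   by (intro nn_integral_eq_integral bdd_rv_integrable bdd_rv_power bdd_rv_norm that) auto
  finally show ?thesis using that(2) by (simp add: ennreal_leI)
 qed
 have "(\<integral>\<^sup>+w. ennreal ((cmod (cnj (x w) * y w))^2) \<partial>M) = (\<integral>\<^sup>+w. ennreal ((cmod (x w))^2) * ennreal ((cmod (y w))^2) \<partial>M)"
  by (intro nn_integral_cong) (simp add: norm_mult power_mult_distrib ennreal_mult)
 then have "(\<integral>\<^sup>+w. ennreal ((cmod (cnj (x w) * y w))^2) \<partial>M)^2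
   <= (\<integral>\<^sup>+w. (ennreal ((cmod (x w))^2))^2 \<partial>M) * (\<integral>\<^sup>+w. (ennreal ((cmod (y w))^2))^2 \<partial>M)"
  by (simp only:) (rule Cauchy_Schwarz_nn_integral, auto)
 also have "... <= ennreal (p ^ 4) * ennreal (q ^ 4)" by (intro mult_mono four b x y) auto
 also have "... = (ennreal ((p * q)^2))^2"
  using pq by (simp add: ennreal_power power_mult_distrib flip: ennreal_mult)
 finally show "(\<integral>\<^sup>+w. ennreal ((cmod (cnj (x w) * y w))^2) \<partial>M)^2 <= (ennreal ((p * q)^2))^2" .
qed

text \<open>Subtracting an independent variable inside the kernel and averaging multiplies the
  Fourier weight by the characteristic function of that variable.\<close>

lemma fourier_expectation:
 fixes A :: "real => complex" and Q :: "'a => real"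
 assumes A: "integrable lborel A" and [measurable]: "Q \<in> borel_measurable M"
  and kap: "\<And>y. complex_of_real (kap y) = (LINT t|lborel. A t * iexp (- (t * y)))"
  and q: "\<And>t. (LINT w|M. iexp (t * Q w)) = q t"
 shows "complex_of_real (LINT w|M. kap (x - Q w)) = (LINT t|lborel. A t * iexp (- (t * x)) * q t)"
proof -
 interpret P: pair_sigma_finite lborel M ..
 have [measurable]: "A \<in> borel_measurable borel" using A by auto
 have "complex_of_real (LINT w|M. kap (x - Q w)) = (LINT w|M. complex_of_real (kap (x - Q w)))"
  by simp
 also have "... = (LINT w|M. LINT t|lborel. A t * iexp (- (t * (x - Q w))))" by (simp only: kap)
 also have "... = (LINT t|lborel. LINT w|M. A t * iexp (- (t * (x - Q w))))"
 proof (rule P.Fubini_integral)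
  show "integrable (lborel \<Otimes>\<^sub>M M) (\<lambda>(t, w). A t * iexp (- (t * (x - Q w))))"
  proof (rule integrable_bound)
   show "integrable (lborel \<Otimes>\<^sub>M M) (\<lambda>(t, w). cmod (A t) * 1)"
    using A by (intro P.integrable_times) auto
  qed (auto simp: norm_mult split_beta')
 qed
 also have "... = (LINT t|lborel. A t * iexp (- (t * x)) * q t)"
 proof (intro integral_cong refl)
  fix t
  have "(LINT w|M. A t * iexp (- (t * (x - Q w)))) = (LINT w|M. (A t * iexp (- (t * x))) * iexp (t * Q w))"
   by (intro integral_cong refl) (simp add: algebra_simps flip: exp_add)
  also have "... = (A t * iexp (- (t * x))) * q t"
   by (simp only: integral_mult_right_zero q)
  finally show "(LINT w|M. A t * iexp (- (t * (x - Q w)))) = A t * iexp (- (t * x)) * q t" .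
 qed
 finally show ?thesis .
qed

text \<open>Double centring of kap (P - Q) under the product law factorises frequency by frequency:
  each exponential is replaced by its centred version.\<close>

lemma fourier_centered:
 fixes A :: "real => complex" and P Q :: "'a => real" and x w :: real
 assumes A: "integrable lborel A" and [measurable]: "P \<in> borel_measurable M" "Q \<in> borel_measurable M"
  and kap: "\<And>y. complex_of_real (kap y) = (LINT t|lborel. A t * iexp (- (t * y)))" and kb: "\<And>y. \<bar>kap y\<bar> <= c" "kap \<in> borel_measurable borel"
  and p: "\<And>t. (LINT z|M. iexp (t * P z)) = p t" "p \<in> borel_measurable borel"
  and q: "\<And>t. (LINT z|M. iexp (t * Q z)) = q t" "q \<in> borel_measurable borel"
 shows "complex_of_real (kap (x - w) - (LINT z|M. kap (x - Q z)) - (LINT z|M. kap (P z - w)) + (LINT z|M. LINT z'|M. kap (P z - Q z')))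
  = (LINT t|lborel. A t * (cnj (iexp (t * x) - p t) * (iexp (t * w) - q t)))"
proof -
 note [measurable] = p(2) q(2) kb(2)
 have [measurable]: "A \<in> borel_measurable borel" using A by auto
 have q1: "cmod (q t) <= 1" for t
 proof -
  have "cmod (q t) <= (LINT z|M. cmod (iexp (t * Q z)))" unfolding q(1)[symmetric] by (rule integral_norm_bound)
  then show ?thesis by (simp add: prob_space)
 qed
 have p1: "cmod (p t) <= 1" for t
 proof -
  have "cmod (p t) <= (LINT z|M. cmod (iexp (t * P z)))" unfolding p(1)[symmetric] by (rule integral_norm_bound)
  then show ?thesis by (simp add: prob_space)
 qed
 have intb: "integrable lborel (\<lambda>t. A t * g t)" if [measurable]: "g \<in> borel_measurable borel" and "\<And>t. cmod (g t) <= 1" for g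
 proof (rule integrable_bound[OF A])
  show "AE t in lborel. norm (A t * g t) <= norm (A t)"
   using that(2) by (intro AE_I2) (auto simp: norm_mult intro: mult_left_le)
 qed auto
 have cnj_iexp: "cnj (iexp y) = iexp (- y)" for y by (simp add: exp_cnj)
 have cnj_p: "(LINT z|M. iexp (t * - P z)) = cnj (p t)" for t
 proof -
  have "(LINT z|M. iexp (t * - P z)) = (LINT z|M. cnj (iexp (t * P z)))"
   by (intro integral_cong refl) (simp add: exp_cnj)
  then show ?thesis by (simp only: integral_cnj p(1))
 qed
 have a: "complex_of_real (LINT z|M. kap (x - Q z)) = (LINT t|lborel. A t * (iexp (- (t * x)) * q t))" for x
  using fourier_expectation[OF A _ kap q(1), of x] by (simp add: mult.assoc)
 have b: "complex_of_real (LINT z|M. kap (P z - w)) = (LINT t|lborel. A t * (iexp (t * w) * cnj (p t)))" for w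
  using fourier_expectation[OF A _ kap cnj_p, of "- w"] by (simp add: mult.assoc add.commute)
 have c: "complex_of_real (LINT z|M. LINT z'|M. kap (P z - Q z')) = (LINT t|lborel. A t * (cnj (p t) * q t))"
 proof -
  define kap2 where "kap2 y = (LINT z'|M. kap (y - Q z'))" for y
  have "complex_of_real (LINT z|M. kap2 (0 - - P z)) = (LINT t|lborel. (A t * q t) * iexp (- (t * 0)) * cnj (p t))"
  proof (rule fourier_expectation[OF _ _ _ cnj_p])
   show "integrable lborel (\<lambda>t. A t * q t)" by (intro intb q1) measurable
   show "complex_of_real (kap2 y) = (LINT t|lborel. A t * q t * iexp (- (t * y)))" for y
    unfolding kap2_def a by (intro integral_cong refl) (simp only: mult_ac)
  qed measurable
  then show ?thesis by (simp add: kap2_def mult_ac)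
 qed
 have e: "complex_of_real (kap (x - w)) = (LINT t|lborel. A t * (iexp (- (t * x)) * iexp (t * w)))"
  unfolding kap by (intro integral_cong refl) (simp add: algebra_simps flip: exp_add)
 have ints: "integrable lborel (\<lambda>t. A t * (iexp (- (t * x)) * iexp (t * w)))" "integrable lborel (\<lambda>t. A t * (iexp (- (t * x)) * q t))"
  "integrable lborel (\<lambda>t. A t * (iexp (t * w) * cnj (p t)))" "integrable lborel (\<lambda>t. A t * (cnj (p t) * q t))"
  using p1 q1 by (intro intb; auto simp: norm_mult intro: mult_le_one; fail)+
 have "(LINT t|lborel. A t * (cnj (iexp (t * x) - p t) * (iexp (t * w) - q t)))
   = (LINT t|lborel. A t * (iexp (- (t * x)) * iexp (t * w)) - A t * (iexp (- (t * x)) * q t) - A t * (iexp (t * w) * cnj (p t)) + A t * (cnj (p t) * q t))"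
 proof (intro integral_cong refl)
  fix t
  show "A t * (cnj (iexp (t * x) - p t) * (iexp (t * w) - q t)) = A t * (iexp (- (t * x)) * iexp (t * w)) - A t * (iexp (- (t * x)) * q t) - A t * (iexp (t * w) * cnj (p t)) + A t * (cnj (p t) * q t)"
   unfolding complex_cnj_diff cnj_iexp by (simp only: algebra_simps)
 qed
 also have "... = (LINT t|lborel. A t * (iexp (- (t * x)) * iexp (t * w))) - (LINT t|lborel. A t * (iexp (- (t * x)) * q t))
   - (LINT t|lborel. A t * (iexp (t * w) * cnj (p t))) + (LINT t|lborel. A t * (cnj (p t) * q t))"
  by (simp only: integral_add integral_diff ints integrable_diff)
 finally show ?thesis by (simp only: of_real_add of_real_diff a b c e)
qed

end

section \<open>The smooth part of the kernel sum\<close>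

lemma sum_lower_triangle:
 fixes T :: "nat => nat => real"
 assumes sym: "\<And>i j. T i j = T j i"
 shows "2 * (\<Sum>j=1..n. \<Sum>i=1..<j. T i j) = (\<Sum>j=1..n. \<Sum>i=1..n. T i j) - (\<Sum>i=1..n. T i i)"
proof (induction n)
 case (Suc n)
 have "(\<Sum>j=1..Suc n. \<Sum>i=1..Suc n. T i j) = (\<Sum>j=1..n. \<Sum>i=1..n. T i j) + (\<Sum>j=1..n. T (Suc n) j) + (\<Sum>i=1..n. T i (Suc n)) + T (Suc n) (Suc n)"
  by (simp add: sum.distrib)
 moreover have "(\<Sum>j=1..n. T (Suc n) j) = (\<Sum>i=1..n. T i (Suc n))"
  by (intro sum.cong sym refl)
 moreover have "{1..<Suc n} = {1..n}" by auto
 ultimately show ?case using Suc by (simp add: algebra_simps)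
qed simp

context noise
begin

lemma lin_fourth_moment_nat:
 assumes sb: "summable_coeffs b"
 shows "\<E> (\<lambda>w. cmod (\<Sum>i=1..n. iexp (t * lin b (int i - c) w) - cf b t) ^ 4)
  <= (4 * root_c * coeff_norm b * sqrt (real n) * \<bar>t\<bar> powr \<gamma>) ^ 4"
proof -
 have inj: "inj_on (\<lambda>i. int i - c) {1..n}" by (auto simp: inj_on_def)
 have card: "card ((\<lambda>i. int i - c) ` {1..n}) = n" unfolding card_image[OF inj] by simp
 show ?thesis
  using lin_fourth_moment_centered[OF sb, of "(\<lambda>i. int i - c) ` {1..n}" t]
  unfolding sum.reindex[OF inj] card by (simp add: comp_def mult_ac)
qed

text \<open>Each empirical factor contributes |t|^\<gamma> in L4, so their product needs the weight
  |t|^(2 \<gamma>), the highest power for which the Fourier weights are known to be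
  integrable.\<close>

lemma bilinear_bound:
 fixes A :: "real => complex" and x y :: "real => 'a => complex" and S :: "'a => real"
 assumes [measurable]: "A \<in> borel_measurable borel" "(\<lambda>(t, w). x t w) \<in> borel_measurable (borel \<Otimes>\<^sub>M M)"
   "(\<lambda>(t, w). y t w) \<in> borel_measurable (borel \<Otimes>\<^sub>M M)" "S \<in> borel_measurable M"
  and b: "\<And>t. bdd_rv (x t)" "\<And>t. bdd_rv (y t)"
  and pq: "0 <= p" "0 <= q" and x: "\<And>t. \<E> (\<lambda>w. cmod (x t w) ^ 4) <= (p * \<bar>t\<bar> powr \<gamma>) ^ 4"
  and y: "\<And>t. \<E> (\<lambda>w. cmod (y t w) ^ 4) <= (q * \<bar>t\<bar> powr \<gamma>) ^ 4"
  and int: "integrable lborel (\<lambda>t. cmod (A t) * \<bar>t\<bar> powr (2 * \<gamma>))"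
  and S: "AE w in M. complex_of_real (S w) = (LINT t|lborel. A t * (cnj (x t w) * y t w))"
 shows "(\<integral>\<^sup>+w. ennreal ((S w)^2) \<partial>M) <= ennreal (((LINT t|lborel. cmod (A t) * \<bar>t\<bar> powr (2 * \<gamma>)) * (p * q))^2)"
proof -
 let ?b = "\<lambda>t. (p * q) * \<bar>t\<bar> powr (2 * \<gamma>)"
 have pw: "\<bar>t\<bar> powr (2 * \<gamma>) = \<bar>t\<bar> powr \<gamma> * \<bar>t\<bar> powr \<gamma>" for t :: real
  by (simp add: powr_add[symmetric])
 have "(\<integral>\<^sup>+w. ennreal ((S w)^2) \<partial>M) = (\<integral>\<^sup>+w. ennreal ((cmod (LINT t|lborel. A t * (cnj (x t w) * y t w)))^2) \<partial>M)"
 proof (rule nn_integral_cong_AE)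
  show "AE w in M. ennreal ((S w)^2) = ennreal ((cmod (LINT t|lborel. A t * (cnj (x t w) * y t w)))^2)"
   using S
  proof eventually_elim
   case (elim w)
   show ?case unfolding elim[symmetric] by simp
  qed
 qed
 also have "... <= ennreal ((LINT t|lborel. cmod (A t) * ?b t)^2)"
 proof (rule minkowski_integral)
  show "(\<lambda>(t, w). cnj (x t w) * y t w) \<in> borel_measurable (borel \<Otimes>\<^sub>M M)"
  proof -
   have "(\<lambda>z. cnj ((\<lambda>(t, w). x t w) z) * (\<lambda>(t, w). y t w) z) \<in> borel_measurable (borel \<Otimes>\<^sub>M M)" by measurable
   then show ?thesis by (simp add: split_beta')
  qed
  show "(\<integral>\<^sup>+w. ennreal ((cmod (cnj (x t w) * y t w))^2) \<partial>M) <= ennreal ((?b t)^2)" for t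
  proof -
   have eq: "?b t = (p * \<bar>t\<bar> powr \<gamma>) * (q * \<bar>t\<bar> powr \<gamma>)" unfolding pw by (simp only: mult_ac)
   show ?thesis unfolding eq
    by (rule nn_expectation_mult_sq_le[OF b(1)[of t] b(2)[of t] _ _ x[of t] y[of t]]) (use pq in auto)
  qed
  have "integrable lborel (\<lambda>t. (p * q) * (cmod (A t) * \<bar>t\<bar> powr (2 * \<gamma>)))" using int by (rule integrable_mult_right)
  then show "integrable lborel (\<lambda>t. cmod (A t) * ?b t)" by (simp add: mult_ac)
 qed (use pq in auto)
 also have "(LINT t|lborel. cmod (A t) * ?b t) = (LINT t|lborel. cmod (A t) * \<bar>t\<bar> powr (2 * \<gamma>)) * (p * q)"
  by (subst integral_mult_left_zero[symmetric]) (simp add: mult_ac)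
 finally show ?thesis .
qed

end

context kernel_process
begin

definition fk :: "real => real" where "fk x = (LINT w|M. k_1 (x - W 0 w))"
text \<open>\<open>mk w\<close> is also the mean of \<open>k_1 (X 0 - w)\<close>, by
  \<open>expectation_k1_X\<close>; so it centres both \<open>k_1\<close> in its X argument and
  \<open>k_2\<close> in its W argument.\<close>

definition mk :: "real => real" where "mk w = (LINT z|M. k_2 (w - W 0 z))"
definition \<theta> :: real where "\<theta> = (LINT w|M. fk (X 0 w))"
definition T :: "int => int => 'a => real" where
 "T i j w = k (X j w - X i w) - DD i j w - fk (X i w) - fk (X j w) + \<theta>"

lemma fk_measurable[measurable]: "fk \<in> borel_measurable borel"
 unfolding fk_def by measurable

lemma mk_measurable[measurable]: "mk \<in> borel_measurable borel"
 unfolding mk_def by measurable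

lemma expectation_abs_le:
 fixes f :: "'a => real"
 assumes [measurable]: "f \<in> borel_measurable M" and "\<And>w. \<bar>f w\<bar> <= c"
 shows "\<bar>LINT w|M. f w\<bar> <= c"
proof -
 have b: "bdd_rv f" using assms by (intro bdd_rvI[where B = c]) auto
 have "\<bar>LINT w|M. f w\<bar> <= (LINT w|M. \<bar>f w\<bar>)" using integral_norm_bound[of M f] by simp
 also have "... <= (LINT w|M. c)"
  by (intro integral_mono bdd_rv_integrable bdd_rv_intros b assms)
 finally show ?thesis by (simp add: prob_space)
qed

lemma fk_le: "\<bar>fk x\<bar> <= c_1"
 unfolding fk_def by (rule expectation_abs_le) (auto simp: k1_le)

lemma mk_le: "\<bar>mk x\<bar> <= c_1"
 unfolding mk_def by (rule expectation_abs_le) (auto simp: k2_le)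

lemma theta_le: "\<bar>\<theta>\<bar> <= c_1"
 unfolding \<theta>_def by (rule expectation_abs_le) (auto simp: fk_le)

lemma expectation_k1_X: "(LINT z|M. k_1 (X 0 z - w)) = mk w"
proof -
 have "(LINT z|M. k_1 (X 0 z - w)) = (LINT z|M. (\<lambda>v u. k_1 (u + v - w)) (W 0 z) (U 0 z))"
  unfolding X_def by simp
 also have "... = (LINT z|M. (LINT u|distr M borel (U 0). (\<lambda>v u. k_1 (u + v - w)) (W 0 z) u))"
  by (rule freeze[OF _ W_noise_alg U_noise_alg, where C = B]) (auto simp: k1_bounded)
 also have "... = (LINT z|M. k_2 (W 0 z - w))" unfolding distr_U by (simp add: k2_eq)
 also have "... = mk w"
 proof -
  have "k_2 (W 0 z - w) = k_2 (w - W 0 z)" for z using k2_even[of "w - W 0 z"] by simp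
  then show ?thesis by (simp add: mk_def)
 qed
 finally show ?thesis .
qed

lemma theta_eq: "\<theta> = (LINT w|M. mk (W 0 w))"
proof -
 interpret P: pair_prob_space M M ..
 have "\<theta> = (LINT w|M. LINT w'|M. k_1 (X 0 w - W 0 w'))"
  unfolding \<theta>_def fk_def by simp
 also have "... = (LINT w'|M. LINT w|M. k_1 (X 0 w - W 0 w'))"
 proof (rule P.Fubini_integral)
  show "integrable (M \<Otimes>\<^sub>M M) (\<lambda>(w', w). k_1 (X 0 w - W 0 w'))"
   by (rule P.integrable_const_bound[where B = B]) (auto simp: k1_bounded)
 qed
 finally show ?thesis by (simp only: expectation_k1_X)
qed

text \<open>The smoothed kernels \<open>k_1 (X i - W j)\<close> and \<open>k_2 (W j - W i)\<close>,
  each centred in both arguments under the product of the marginal laws. By \<open>T_eq\<close> they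
  make up T, so T involves only kernels that have an integrable Fourier weight in the smooth
  case.\<close>

definition B1 :: "int => int => 'a => real" where
 "B1 i j w = k_1 (X i w - W j w) - fk (X i w) - mk (W j w) + \<theta>"
definition B3 :: "int => int => 'a => real" where
 "B3 i j w = k_2 (W j w - W i w) - mk (W j w) - mk (W i w) + \<theta>"

lemma T_eq: "T i j w = B1 i j w + B1 j i w - B3 i j w"
 unfolding T_def DD_def B1_def B3_def by simp

lemma T_sym: "T i j w = T j i w"
 unfolding T_eq B3_def using k2_even[of "W i w - W j w"] by simp

lemma T_diag: "\<bar>T i i w\<bar> <= 6 * c_1"
proof -
 have "T i i w = 2 * k_1 (X i w - W i w) - k_2 0 - 2 * fk (X i w) + \<theta>"
  unfolding T_eq B1_def B3_def by simp
 then show ?thesis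
  using k1_le[of "X i w - W i w"] k2_le[of 0] fk_le[of "X i w"] theta_le by linarith
qed

lemma expectation_iexp_X: "(LINT w|M. iexp (t * X i w)) = cf a t"
proof -
 have "(LINT w|M. iexp (t * X i w)) = (LINT w|M. iexp (t * lin a i w))"
  by (rule integral_cong_AE) (use AE_X_eq_lin in auto)
 then show ?thesis using expectation_iexp_lin[OF sa] by simp
qed

lemma expectation_iexp_W: "(LINT w|M. iexp (t * W i w)) = cf (\<lambda>l. a (l + L)) t"
 unfolding W_def by (rule expectation_iexp_lin[OF summable_coeffs_shift[OF sa]])

definition Khat :: "real => complex" where "Khat t = (LINT x|lborel. complex_of_real (k x) * iexp (t * x))"

lemma Khat_measurable[measurable]: "Khat \<in> borel_measurable borel"
 unfolding Khat_def by measurable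

lemma Khat_le: "cmod (Khat t) <= \<kappa>"
proof -
 have "cmod (Khat t) <= (LINT x|lborel. cmod (complex_of_real (k x) * iexp (t * x)))"
  unfolding Khat_def by (rule integral_norm_bound)
 also have "... = (LINT x|lborel. \<bar>k x\<bar>)" by (simp add: norm_mult)
 finally show ?thesis using k_L1 by simp
qed

text \<open>The Fourier weight of \<open>k_1\<close>; that of \<open>k_2\<close> is
  \<open>A_3\<close>. The transform \<open>Khat\<close> of k is merely bounded by the L1 norm, and
  the characteristic function of U supplies the integrability.\<close>

definition A_1 :: "real => complex" where "A_1 t = Khat t * cf (trunc L) t / (2 * pi)"
definition A_3 :: "real => complex" where "A_3 t = A_1 t * cnj (cf (trunc L) t)"

lemma A1_measurable[measurable]: "A_1 \<in> borel_measurable borel"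
 unfolding A_1_def by measurable

lemma A3_measurable[measurable]: "A_3 \<in> borel_measurable borel"
proof -
 show ?thesis unfolding A_3_def by measurable
qed

lemma A1_le: "cmod (A_1 t) <= \<kappa> / (2 * pi) * cmod (cf (trunc L) t)"
 unfolding A_1_def norm_divide norm_mult
 using mult_right_mono[OF Khat_le[of t], of "cmod (cf (trunc L) t)"] by (simp add: norm_mult divide_right_mono)

lemma A3_le: "cmod (A_3 t) <= \<kappa> / (2 * pi) * cmod (cf (trunc L) t)"
proof -
 have "cmod (A_3 t) = cmod (A_1 t) * cmod (cf (trunc L) t)" unfolding A_3_def by (simp add: norm_mult)
 also have "... <= cmod (A_1 t) * 1" by (intro mult_left_mono cf_le_1) auto
 finally show ?thesis using A1_le[of t] by simp
qed

definition I_2 :: real where "I_2 = (LINT t|lborel. cmod (cf (trunc L) t) * \<bar>t\<bar> powr (2 * \<gamma>))"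

context
 assumes smooth: "\<And>s. two_coeffs (trunc s)"
begin

lemma weighted_A:
 assumes [measurable]: "A \<in> borel_measurable borel" and le: "\<And>t. cmod (A t) <= \<kappa> / (2 * pi) * cmod (cf (trunc L) t)"
 shows "integrable lborel A" "integrable lborel (\<lambda>t. cmod (A t) * \<bar>t\<bar> powr (2 * \<gamma>))"
  "(LINT t|lborel. cmod (A t) * \<bar>t\<bar> powr (2 * \<gamma>)) <= \<kappa> / (2 * pi) * I_2"
proof -
 have i0: "integrable lborel (\<lambda>t. \<kappa> / (2 * pi) * cmod (cf (trunc L) t))"
  by (intro integrable_mult_right cf_abs_integrable smooth)
 show "integrable lborel A"
  by (rule integrable_bound[OF i0 _ AE_I2])
   (simp, unfold real_norm_def, rule order_trans[OF le abs_ge_self])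
 have i2: "integrable lborel (\<lambda>t. \<kappa> / (2 * pi) * (cmod (cf (trunc L) t) * \<bar>t\<bar> powr (2 * \<gamma>)))"
  using gamma by (intro integrable_mult_right cf_weighted_integrable smooth) auto
 have le2: "cmod (A t) * \<bar>t\<bar> powr (2 * \<gamma>) <= \<kappa> / (2 * pi) * (cmod (cf (trunc L) t) * \<bar>t\<bar> powr (2 * \<gamma>))" for t
  using mult_right_mono[OF le[of t], of "\<bar>t\<bar> powr (2 * \<gamma>)"] by (simp add: mult.assoc)
 show i1: "integrable lborel (\<lambda>t. cmod (A t) * \<bar>t\<bar> powr (2 * \<gamma>))"
 proof (rule integrable_bound[OF i2 _ AE_I2])
  fix t
  have "norm (cmod (A t) * \<bar>t\<bar> powr (2 * \<gamma>)) = cmod (A t) * \<bar>t\<bar> powr (2 * \<gamma>)" by simp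
  then show "norm (cmod (A t) * \<bar>t\<bar> powr (2 * \<gamma>)) <= norm (\<kappa> / (2 * pi) * (cmod (cf (trunc L) t) * \<bar>t\<bar> powr (2 * \<gamma>)))"
   using order_trans[OF le2[of t] abs_ge_self] by (simp only: real_norm_def)
 qed simp
 have "(LINT t|lborel. cmod (A t) * \<bar>t\<bar> powr (2 * \<gamma>)) <= (LINT t|lborel. \<kappa> / (2 * pi) * (cmod (cf (trunc L) t) * \<bar>t\<bar> powr (2 * \<gamma>)))"
  by (intro integral_mono i1 i2 le2)
 also have "... = \<kappa> / (2 * pi) * I_2" unfolding I_2_def by (rule integral_mult_right_zero)
 finally show "(LINT t|lborel. cmod (A t) * \<bar>t\<bar> powr (2 * \<gamma>)) <= \<kappa> / (2 * pi) * I_2" .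
qed

text \<open>Inversion is applied to the density of U, not to k; integrating the result against k
  produces the factor \<open>Khat\<close>.\<close>

lemma k1_fourier: "complex_of_real (k_1 y) = (LINT t|lborel. A_1 t * iexp (- (t * y)))"
proof -
 let ?p = "lin_density (trunc L)"
 note [measurable] = lin_density_measurable[OF smooth, of L]
 have "k_1 y = (LINT u|lborel. ?p u * k (y - u))"
  unfolding k_1_def mu_density[OF smooth] by (subst integral_real_density) (auto simp: lin_density_nonneg[OF smooth])
 also have "... = (LINT z|lborel. ?p (y - z) * k z)"
  by (subst lborel_integral_real_affine[where c = "-1" and t = y]) auto
 finally have "complex_of_real (k_1 y) = (LINT z|lborel. complex_of_real (?p (y - z)) * complex_of_real (k z))"
  by (simp flip: of_real_mult)
 also have "... = (LINT z|lborel. LINT t|lborel. cf (trunc L) t / (2 * pi) * iexp (- (t * y)) * (complex_of_real (k z) * iexp (t * z)))"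
 proof (intro integral_cong refl)
  fix z
  have "complex_of_real (?p (y - z)) = (LINT t|lborel. cf (trunc L) t * iexp (- (t * (y - z)))) / (2 * pi)"
   unfolding lin_density_fourier[OF smooth] by simp
  then have "complex_of_real (?p (y - z)) * complex_of_real (k z) = (complex_of_real (k z) / (2 * pi)) * (LINT t|lborel. cf (trunc L) t * iexp (- (t * (y - z))))"
   by simp
  also have "... = (LINT t|lborel. (complex_of_real (k z) / (2 * pi)) * (cf (trunc L) t * iexp (- (t * (y - z)))))"
   by (rule integral_mult_right_zero[symmetric])
  also have "... = (LINT t|lborel. cf (trunc L) t / (2 * pi) * iexp (- (t * y)) * (complex_of_real (k z) * iexp (t * z)))"
  proof (intro integral_cong refl)
   fix t
   have "iexp (- (t * (y - z))) = iexp (- (t * y)) * iexp (t * z)"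
    by (simp add: algebra_simps flip: exp_add)
   then show "(complex_of_real (k z) / (2 * pi)) * (cf (trunc L) t * iexp (- (t * (y - z)))) = cf (trunc L) t / (2 * pi) * iexp (- (t * y)) * (complex_of_real (k z) * iexp (t * z))"
    by (simp only: times_divide_eq_left times_divide_eq_right mult_ac)
  qed
  finally show "complex_of_real (?p (y - z)) * complex_of_real (k z) = ..." .
 qed
 also have "... = (LINT t|lborel. LINT z|lborel. cf (trunc L) t / (2 * pi) * iexp (- (t * y)) * (complex_of_real (k z) * iexp (t * z)))"
 proof (rule lborel_pair.Fubini_integral)
  show "integrable (lborel \<Otimes>\<^sub>M lborel) (\<lambda>(t, z). cf (trunc L) t / (2 * pi) * iexp (- (t * y)) * (complex_of_real (k z) * iexp (t * z)))"
  proof (rule integrable_bound)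
   show "integrable (lborel \<Otimes>\<^sub>M lborel) (\<lambda>(t, z). cmod (cf (trunc L) t) * k z)"
    by (intro lborel_pair.integrable_times cf_abs_integrable smooth k_integrable)
   have "cmod (cf (trunc L) t / (2 * pi) * iexp (- (t * y)) * (complex_of_real (k z) * iexp (t * z))) <= cmod (cf (trunc L) t) * \<bar>k z\<bar>" for t z
   proof -
    have "cmod (cf (trunc L) t / (2 * pi) * iexp (- (t * y)) * (complex_of_real (k z) * iexp (t * z))) = cmod (cf (trunc L) t) / (2 * pi) * \<bar>k z\<bar>"
     by (simp only: norm_mult norm_divide norm_exp_i_times norm_of_real) simp
    also have "... <= cmod (cf (trunc L) t) * \<bar>k z\<bar>"
     using pi_gt3 by (intro mult_right_mono) (auto simp: divide_le_eq intro: mult_left_le_imp_le mult_left_le order_trans[OF _ mult_left_mono[of 1 "2 * pi"]])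
    finally show ?thesis .
   qed
   then show "AE z in lborel \<Otimes>\<^sub>M lborel. norm (case z of (t, z) => cf (trunc L) t / (2 * pi) * iexp (- (t * y)) * (complex_of_real (k z) * iexp (t * z)))
     <= norm (case z of (t, z) => cmod (cf (trunc L) t) * k z)"
    by (intro AE_I2) (simp add: split_beta' abs_mult)
  qed measurable
 qed
 also have "... = (LINT t|lborel. A_1 t * iexp (- (t * y)))"
  unfolding A_1_def Khat_def by (intro integral_cong refl) (simp only: integral_mult_right_zero, simp add: mult_ac)
 finally show ?thesis .
qed

lemma k2_fourier: "complex_of_real (k_2 y) = (LINT t|lborel. A_3 t * iexp (- (t * y)))"
proof -
 have q: "(LINT w|M. iexp (t * - U 0 w)) = cnj (cf (trunc L) t)" for t
 proof -
  have "(LINT w|M. iexp (t * - U 0 w)) = (LINT w|M. cnj (iexp (t * U 0 w)))"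
   by (intro integral_cong refl) (simp add: exp_cnj)
  then show ?thesis by (simp only: integral_cnj U_eq_lin cf_def)
 qed
 have "k_2 y = (LINT w|M. k_1 (y - - U 0 w))"
  unfolding k_2_def \<mu>_def by (subst integral_distr) auto
 then have "complex_of_real (k_2 y) = (LINT t|lborel. A_1 t * iexp (- (t * y)) * cnj (cf (trunc L) t))"
  using fourier_expectation[OF weighted_A(1)[OF A1_measurable A1_le] _ k1_fourier q, of y] by simp
 then show ?thesis unfolding A_3_def by (simp only: mult_ac)
qed

definition Ehat :: "nat => real => 'a => complex" where "Ehat n t w = (\<Sum>i=1..n. iexp (t * X (int i) w) - cf a t)"
definition What :: "nat => real => 'a => complex" where "What n t w = (\<Sum>i=1..n. iexp (t * W (int i) w) - cf (\<lambda>l. a (l + L)) t)"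

lemma Ehat_fourth: "\<E> (\<lambda>w. cmod (Ehat n t w) ^ 4) <= (4 * root_c * coeff_norm a * sqrt (real n) * \<bar>t\<bar> powr \<gamma>) ^ 4"
proof -
 have "\<E> (\<lambda>w. cmod (Ehat n t w) ^ 4) = \<E> (\<lambda>w. cmod (\<Sum>i=1..n. iexp (t * lin a (int i - 0) w) - cf a t) ^ 4)"
  unfolding Ehat_def by (rule integral_cong_AE) (use AE_X_eq_lin in auto)
 also have "... <= (4 * root_c * coeff_norm a * sqrt (real n) * \<bar>t\<bar> powr \<gamma>) ^ 4" by (rule lin_fourth_moment_nat[OF sa])
 finally show ?thesis .
qed

lemma What_fourth: "\<E> (\<lambda>w. cmod (What n t w) ^ 4) <= (4 * root_c * tail_norm L * sqrt (real n) * \<bar>t\<bar> powr \<gamma>) ^ 4"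
 unfolding What_def W_def tail_norm_def by (rule lin_fourth_moment_nat[OF summable_coeffs_shift[OF sa]])

lemma hat_measurable: "(\<lambda>(t, w). Ehat n t w) \<in> borel_measurable (borel \<Otimes>\<^sub>M M)" "(\<lambda>(t, w). What n t w) \<in> borel_measurable (borel \<Otimes>\<^sub>M M)"
 unfolding Ehat_def What_def split_beta' by measurable

lemma hat_bounded: "bdd_rv (Ehat n t)" "bdd_rv (What n t)"
 unfolding Ehat_def[abs_def] What_def[abs_def] by (intro bdd_rv_intros; simp)+

lemma hat_integrable:
 assumes A: "integrable lborel A"
 shows "integrable lborel (\<lambda>t. A t * (cnj (iexp (t * x) - cf b t) * (iexp (t * w) - cf b' t)))"
proof -
 have [measurable]: "A \<in> borel_measurable borel" using A by auto
 show ?thesis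
 proof (rule integrable_bound)
  show "integrable lborel (\<lambda>t. 4 * A t)" using A by simp
  show "AE t in lborel. norm (A t * (cnj (iexp (t * x) - cf b t) * (iexp (t * w) - cf b' t))) <= norm (4 * A t)"
  proof (rule AE_I2)
   fix t
   have "cmod (cnj (iexp (t * x) - cf b t) * (iexp (t * w) - cf b' t)) <= 2 * 2"
    unfolding norm_mult complex_mod_cnj by (intro mult_mono iexp_minus_cf_le) auto
   then have "cmod (A t) * cmod (cnj (iexp (t * x) - cf b t) * (iexp (t * w) - cf b' t)) <= cmod (A t) * 4"
    by (intro mult_left_mono) auto
   then show "norm (A t * (cnj (iexp (t * x) - cf b t) * (iexp (t * w) - cf b' t))) <= norm (4 * A t)"
    by (simp only: norm_mult) (simp add: mult.commute)
  qed
 qed measurable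
qed

text \<open>Over the full square of indices the double sum factorises into a product of two
  empirical characteristic functions. The sum over i < j is recovered from the square by symmetry in
  \<open>T_total_sq\<close>.\<close>

lemma B1_fourier: "complex_of_real (\<Sum>j=1..n. \<Sum>i=1..n. B1 (int i) (int j) w) = (LINT t|lborel. A_1 t * (cnj (Ehat n t w) * What n t w))"
proof -
 have one: "complex_of_real (B1 i j w) = (LINT t|lborel. A_1 t * (cnj (iexp (t * X i w) - cf a t) * (iexp (t * W j w) - cf (\<lambda>l. a (l + L)) t)))" for i j
  using fourier_centered[OF weighted_A(1)[OF A1_measurable A1_le] X_measurable[of 0] W_measurable[of 0] k1_fourier k1_bounded k1_measurable
    expectation_iexp_X cf_measurable expectation_iexp_W cf_measurable, of "X i w" "W j w"]
  unfolding B1_def \<theta>_def fk_def expectation_k1_X .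
 have "complex_of_real (\<Sum>j=1..n. \<Sum>i=1..n. B1 (int i) (int j) w)
   = (LINT t|lborel. (\<Sum>j=1..n. \<Sum>i=1..n. A_1 t * (cnj (iexp (t * X (int i) w) - cf a t) * (iexp (t * W (int j) w) - cf (\<lambda>l. a (l + L)) t))))"
  unfolding of_real_sum one
  by (simp only: integral_sum hat_integrable[OF weighted_A(1)[OF A1_measurable A1_le]] integrable_sum)
 also have "... = (LINT t|lborel. A_1 t * (cnj (Ehat n t w) * What n t w))"
  unfolding Ehat_def What_def cnj_sum
  by (intro integral_cong refl, subst sum.swap, subst sum_product) (simp only: sum_distrib_left)
 finally show ?thesis .
qed

lemma B3_fourier: "complex_of_real (\<Sum>j=1..n. \<Sum>i=1..n. B3 (int i) (int j) z) = (LINT t|lborel. A_3 t * (cnj (What n t z) * What n t z))"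
proof -
 have mk': "(LINT z|M. k_2 (W 0 z - w)) = mk w" for w
 proof -
  have "k_2 (W 0 z - w) = k_2 (w - W 0 z)" for z using k2_even[of "w - W 0 z"] by simp
  then show ?thesis by (simp add: mk_def)
 qed
 have one: "complex_of_real (B3 i j z) = (LINT t|lborel. A_3 t * (cnj (iexp (t * W j z) - cf (\<lambda>l. a (l + L)) t) * (iexp (t * W i z) - cf (\<lambda>l. a (l + L)) t)))" for i j
  using fourier_centered[OF weighted_A(1)[OF A3_measurable A3_le] W_measurable[of 0] W_measurable[of 0] k2_fourier k2_bounded k2_measurable
    expectation_iexp_W cf_measurable expectation_iexp_W cf_measurable, of "W j z" "W i z"]
  unfolding B3_def theta_eq mk_def[symmetric] mk' .
 have "complex_of_real (\<Sum>j=1..n. \<Sum>i=1..n. B3 (int i) (int j) z)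
   = (LINT t|lborel. (\<Sum>j=1..n. \<Sum>i=1..n. A_3 t * (cnj (iexp (t * W (int j) z) - cf (\<lambda>l. a (l + L)) t) * (iexp (t * W (int i) z) - cf (\<lambda>l. a (l + L)) t))))"
  unfolding of_real_sum one
  by (simp only: integral_sum hat_integrable[OF weighted_A(1)[OF A3_measurable A3_le]] integrable_sum)
 also have "... = (LINT t|lborel. A_3 t * (cnj (What n t z) * What n t z))"
  unfolding What_def cnj_sum
  by (intro integral_cong refl, subst sum_product) (simp only: sum_distrib_left)
 finally show ?thesis .
qed

end

definition C_T :: real where
 "C_T = 3 * ((\<kappa> / (2 * pi) * I_2 * (16 * root_c^2 * coeff_norm a * tail_norm L))^2
  + (\<kappa> / (2 * pi) * I_2 * (16 * root_c^2 * (tail_norm L)^2))^2 + 9 * c_1^2)"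

lemma B_bounded: "bdd_rv (B1 i j)" "bdd_rv (B3 i j)" "bdd_rv (T i j)"
proof -
 show B1: "bdd_rv (B1 i j)" for i j
 proof (rule bdd_rvI[where B = "4 * c_1"])
  show "norm (B1 i j w) <= 4 * c_1" for w
   unfolding B1_def real_norm_def using k1_le[of "X i w - W j w"] fk_le[of "X i w"] mk_le[of "W j w"] theta_le by linarith
 qed (unfold B1_def[abs_def], measurable)
 show B3: "bdd_rv (B3 i j)"
 proof (rule bdd_rvI[where B = "4 * c_1"])
  show "norm (B3 i j w) <= 4 * c_1" for w
   unfolding B3_def real_norm_def using k2_le[of "W j w - W i w"] mk_le[of "W i w"] mk_le[of "W j w"] theta_le by linarith
 qed (unfold B3_def[abs_def], measurable)
 show "bdd_rv (T i j)"
  unfolding T_eq[abs_def] by (intro bdd_rv_intros B1 B3)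
qed

text \<open>Each empirical factor is of order the square root of n in L4, so the full double sum is
  of order n in L2; the diagonal has n bounded terms.\<close>

lemma T_total_sq: "\<E> (\<lambda>v. (\<Sum>j=1..n. \<Sum>i=1..<j. T (int i) (int j) v)^2) <= (real n)^2 * C_T"
proof -
 consider (fin) "\<forall>l\<ge>L. a l = 0" | (smooth) "\<And>s. two_coeffs (trunc s)"
  using finite_or_smooth unfolding trunc_def[abs_def] by blast
 then show ?thesis
 proof cases
  case fin
  \<comment> \<open>Without older innovations the W arguments are constant, centring over them
    removes everything, and T vanishes identically.\<close>
  have W: "W i v = 0" for i v using fin by (simp add: W_def lin_def)
  have fk: "fk x = k_1 x" for x unfolding fk_def W by (simp add: prob_space)
  have "\<theta> = mk 0" unfolding theta_eq W by (simp add: prob_space)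
  also have "mk 0 = k_2 0" unfolding mk_def W by (simp add: prob_space)
  finally have "T i j v = 0" for i j v unfolding T_def DD_def fk W by simp
  then show ?thesis by (simp add: C_T_def)
 next
  case smooth
  define S1 where "S1 v = (\<Sum>j=1..n. \<Sum>i=1..n. B1 (int i) (int j) v)" for v
  define S3 where "S3 v = (\<Sum>j=1..n. \<Sum>i=1..n. B3 (int i) (int j) v)" for v
  define S where "S v = (\<Sum>j=1..n. \<Sum>i=1..<j. T (int i) (int j) v)" for v
  have b: "bdd_rv S1" "bdd_rv S3" "bdd_rv S"
   unfolding S1_def[abs_def] S3_def[abs_def] S_def[abs_def] by (intro bdd_rv_sum B_bounded)+
  have to_real: "\<E> (\<lambda>v. (R v)^2) <= c^2"
   if bR: "bdd_rv R" and "(\<integral>\<^sup>+v. ennreal ((R v)^2) \<partial>M) <= ennreal (c'^2)" "0 <= c'" "c' <= c" for R and c c' :: real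
  proof -
   have "ennreal (\<E> (\<lambda>v. (R v)^2)) = (\<integral>\<^sup>+v. ennreal ((R v)^2) \<partial>M)"
    by (intro nn_integral_eq_integral[symmetric] bdd_rv_integrable bdd_rv_intros bR) auto
   then have "ennreal (\<E> (\<lambda>v. (R v)^2)) <= ennreal (c'^2)" using that(2) by (simp only:)
   then have "\<E> (\<lambda>v. (R v)^2) <= c'^2" by (rule ennreal_le_iff[OF zero_le_power2, THEN iffD1])
   also have "... <= c^2" using that by (intro power_mono) auto
   finally show ?thesis .
  qed
  let ?x = "4 * root_c * coeff_norm a * sqrt (real n)" and ?w = "4 * root_c * tail_norm L * sqrt (real n)"
  have x0: "0 <= ?x" and w0: "0 <= ?w"
   using root_c_nonneg coeff_norm_nonneg[OF sa] tail_norm_nonneg by (auto intro!: mult_nonneg_nonneg)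
  have I0: "0 <= (LINT t|lborel. cmod (A t) * \<bar>t\<bar> powr (2 * \<gamma>))" for A :: "real => complex"
   by (rule integral_nonneg) auto
  note wA1 = weighted_A[OF smooth A1_measurable A1_le] and wA3 = weighted_A[OF smooth A3_measurable A3_le]
  have ae1: "AE v in M. complex_of_real (S1 v) = (LINT t|lborel. A_1 t * (cnj (Ehat n t v) * What n t v))"
   unfolding S1_def B1_fourier[OF smooth] by simp
  have ae3: "AE v in M. complex_of_real (S3 v) = (LINT t|lborel. A_3 t * (cnj (What n t v) * What n t v))"
   unfolding S3_def B3_fourier[OF smooth] by simp
  have S1: "\<E> (\<lambda>v. (S1 v)^2) <= (\<kappa> / (2 * pi) * I_2 * (?x * ?w))^2"
  proof (rule to_real[OF b(1)])
   show "(\<integral>\<^sup>+v. ennreal ((S1 v)^2) \<partial>M) <= ennreal (((LINT t|lborel. cmod (A_1 t) * \<bar>t\<bar> powr (2 * \<gamma>)) * (?x * ?w))^2)"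
    by (rule bilinear_bound[OF A1_measurable hat_measurable(1)[OF smooth] hat_measurable(2)[OF smooth] bdd_rv_measurable[OF b(1)] hat_bounded(1)[OF smooth] hat_bounded(2)[OF smooth] x0 w0
       Ehat_fourth[OF smooth] What_fourth[OF smooth] wA1(2) ae1])
  qed (intro mult_nonneg_nonneg I0 x0 w0, intro mult_right_mono wA1(3) mult_nonneg_nonneg x0 w0)
  have S3: "\<E> (\<lambda>v. (S3 v)^2) <= (\<kappa> / (2 * pi) * I_2 * (?w * ?w))^2"
  proof (rule to_real[OF b(2)])
   show "(\<integral>\<^sup>+v. ennreal ((S3 v)^2) \<partial>M) <= ennreal (((LINT t|lborel. cmod (A_3 t) * \<bar>t\<bar> powr (2 * \<gamma>)) * (?w * ?w))^2)"
    by (rule bilinear_bound[OF A3_measurable hat_measurable(2)[OF smooth] hat_measurable(2)[OF smooth] bdd_rv_measurable[OF b(2)] hat_bounded(2)[OF smooth] hat_bounded(2)[OF smooth] w0 w0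
       What_fourth[OF smooth] What_fourth[OF smooth] wA3(2) ae3])
  qed (intro mult_nonneg_nonneg I0 w0, intro mult_right_mono wA3(3) mult_nonneg_nonneg w0)
  \<comment> \<open>Twice the triangle sum is the square sum minus the diagonal R. Both orders of
    \<open>B1\<close> add up to S1, so S = S1 - S3/2 - R/2.\<close>
  have pt: "(S v)^2 <= 3 * (S1 v)^2 + 3 * (S3 v)^2 + 27 * (real n * c_1)^2" for v
  proof -
   define R where "R = (\<Sum>i=1..n. T (int i) (int i) v)"
   have "2 * S v = (\<Sum>j=1..n. \<Sum>i=1..n. T (int i) (int j) v) - R"
    unfolding S_def R_def by (rule sum_lower_triangle) (rule T_sym)
   also have "(\<Sum>j=1..n. \<Sum>i=1..n. T (int i) (int j) v) = S1 v + (\<Sum>j=1..n. \<Sum>i=1..n. B1 (int j) (int i) v) - S3 v"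
    unfolding T_eq S1_def S3_def by (simp add: sum.distrib sum_subtractf)
   also have "(\<Sum>j=1..n. \<Sum>i=1..n. B1 (int j) (int i) v) = S1 v"
    unfolding S1_def by (rule sum.swap)
   finally have S: "S v = S1 v - S3 v / 2 - R / 2" by simp
   have "\<bar>R\<bar> <= (\<Sum>i=1..n. 6 * c_1)"
    unfolding R_def by (rule order_trans[OF sum_abs]) (intro sum_mono T_diag)
   then have R: "\<bar>R / 2\<bar> <= 3 * (real n * c_1)" by simp
   have R2: "(R / 2)^2 <= (3 * (real n * c_1))^2" using R by (metis abs_le_square_iff abs_ge_zero abs_of_nonneg order_trans)
   have three: "(x - y - z)^2 <= 3 * x^2 + 3 * y^2 + 3 * z^2" for x y z :: real
   proof -
    have "0 <= (x + y)^2 + (x + z)^2 + (y - z)^2" by simp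
    then show ?thesis by (simp add: power2_eq_square algebra_simps)
   qed
   have "(S v)^2 <= 3 * (S1 v)^2 + 3 * (S3 v / 2)^2 + 3 * (R / 2)^2" unfolding S by (rule three)
   moreover have "(S3 v / 2)^2 <= (S3 v)^2" by (simp add: power_divide)
   moreover have "(3 * (real n * c_1))^2 = 9 * (real n * c_1)^2" by (simp add: power_mult_distrib)
   ultimately show ?thesis using R2 by linarith
  qed
  have "\<E> (\<lambda>v. (S v)^2) <= \<E> (\<lambda>v. 3 * (S1 v)^2 + 3 * (S3 v)^2 + 27 * (real n * c_1)^2)"
   by (intro integral_mono pt bdd_rv_integrable bdd_rv_intros b)
  also have "... = 3 * \<E> (\<lambda>v. (S1 v)^2) + 3 * \<E> (\<lambda>v. (S3 v)^2) + 27 * (real n * c_1)^2"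
  proof -
   have "integrable M (\<lambda>v. (S1 v)^2)" "integrable M (\<lambda>v. (S3 v)^2)"
    by (intro bdd_rv_integrable bdd_rv_intros b)+
   then show ?thesis by (simp add: prob_space)
  qed
  also have "... <= 3 * (\<kappa> / (2 * pi) * I_2 * (?x * ?w))^2 + 3 * (\<kappa> / (2 * pi) * I_2 * (?w * ?w))^2 + 27 * (real n * c_1)^2"
   using S1 S3 by linarith
  also have "... = (real n)^2 * C_T"
  proof -
   have xw: "?x * ?w = real n * (16 * root_c^2 * coeff_norm a * tail_norm L)" "?w * ?w = real n * (16 * root_c^2 * (tail_norm L)^2)"
    using real_sqrt_mult_self[of "real n"] by (simp_all add: power2_eq_square)
   have "3 * (p * (m * u))^2 + 3 * (p * (m * w))^2 + 27 * (m * c)^2 = m^2 * (3 * ((p * u)^2 + (p * w)^2 + 9 * c^2))"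
    for p m u w c :: real by (simp add: power_mult_distrib algebra_simps)
   then show ?thesis unfolding xw C_T_def by (simp only:)
  qed
  finally show ?thesis unfolding S_def .
 qed
qed

end

section \<open>Central limit theorem by independent blocks\<close>

lemma lim_const_over_sqrt: "(\<lambda>n. c / sqrt (real n)) ----> 0" for c :: real
 by (intro tendsto_divide_0[OF tendsto_const] filterlim_at_top_imp_at_infinity
   filterlim_compose[OF sqrt_at_top filterlim_real_sequentially])

lemma div_over_tendsto:
 assumes B: "0 < B"
 shows "(\<lambda>n. real (n div B) / real n) ----> 1 / real B"
proof (rule tendsto_sandwich)
 show "\<forall>\<^sub>F n in sequentially. 1 / real B - 1 / real n <= real (n div B) / real n"
  using eventually_gt_at_top[of 0]
 proof eventually_elim
  case (elim n)
  have "n < B * (n div B) + B" using B by (metis add.commute add_less_cancel_left mod_less_divisor mult_div_mod_eq)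
  then have le: "real n <= real B * real (n div B) + real B" by (simp flip: of_nat_mult of_nat_add)
  show ?case using mult_left_mono[OF le, of "real n"] elim B by (simp add: field_simps)
 qed
 show "\<forall>\<^sub>F n in sequentially. real (n div B) / real n <= 1 / real B"
  using eventually_gt_at_top[of 0]
 proof eventually_elim
  case (elim n)
  have "B * (n div B) <= n" by (rule times_div_less_eq_dividend)
  then have "real B * real (n div B) <= real n" by (simp flip: of_nat_mult)
  then show ?case using elim B by (simp add: field_simps)
 qed
 show "(\<lambda>n. 1 / real B - 1 / real n) ----> 1 / real B"
  using tendsto_diff[OF tendsto_const lim_const_over_n[of 1]] by simp
qed simp

lemma exp_minus_approx: "\<bar>exp (- y) - (1 - y)\<bar> <= y^2" if "0 <= y" for y :: real
proof -
 have lower: "1 - y <= exp (- y)" using exp_ge_add_one_self[of "- y"] by simp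
 have "exp (- y) <= 1 / (1 + y)"
  using exp_ge_add_one_self[of y] that by (simp add: exp_minus inverse_eq_divide frac_le)
 also have "... <= 1 - y + y^2"
 proof -
  have "1 <= (1 - y + y^2) * (1 + y)"
   using that by (simp add: power2_eq_square algebra_simps)
  then show ?thesis using that by (simp add: divide_le_eq)
 qed
 finally show ?thesis using lower by simp
qed

context prob_space
begin

definition l2 :: "('a => real) => real" where "l2 f = sqrt (\<E> (\<lambda>w. (f w)^2))"

lemma l2_nonneg: "0 <= l2 f"
 unfolding l2_def by (intro real_sqrt_ge_zero integral_nonneg) auto

lemma l2_sq: "(l2 f)^2 = \<E> (\<lambda>w. (f w)^2)"
 unfolding l2_def by (rule real_sqrt_pow2) (rule integral_nonneg, simp)

lemma expectation_abs_mult_le_l2: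
 assumes b: "bdd_rv f" "bdd_rv g"
 shows "\<E> (\<lambda>w. \<bar>f w * g w\<bar>) <= l2 f * l2 g"
proof -
 note [measurable] = bdd_rv_measurable[OF b(1)] bdd_rv_measurable[OF b(2)]
 have n: "(\<integral>\<^sup>+w. (ennreal \<bar>h w\<bar>)^2 \<partial>M) = ennreal ((l2 h)^2)" if "bdd_rv h" for h :: "'a => real"
 proof -
  have "(\<integral>\<^sup>+w. (ennreal \<bar>h w\<bar>)^2 \<partial>M) = (\<integral>\<^sup>+w. ennreal ((h w)^2) \<partial>M)"
   by (intro nn_integral_cong) (simp add: ennreal_power)
  also have "... = ennreal ((l2 h)^2)"
   unfolding l2_sq by (intro nn_integral_eq_integral bdd_rv_integrable bdd_rv_intros that) auto
  finally show ?thesis .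
 qed
 have e: "(\<integral>\<^sup>+w. ennreal \<bar>f w\<bar> * ennreal \<bar>g w\<bar> \<partial>M) = ennreal (\<E> (\<lambda>w. \<bar>f w * g w\<bar>))"
 proof -
  have "(\<integral>\<^sup>+w. ennreal \<bar>f w\<bar> * ennreal \<bar>g w\<bar> \<partial>M) = (\<integral>\<^sup>+w. ennreal \<bar>f w * g w\<bar> \<partial>M)"
   by (intro nn_integral_cong) (simp add: abs_mult ennreal_mult)
  also have "... = ennreal (\<E> (\<lambda>w. \<bar>f w * g w\<bar>))"
   by (intro nn_integral_eq_integral bdd_rv_integrable bdd_rv_intros b) auto
  finally show ?thesis .
 qed
 have "(ennreal (\<E> (\<lambda>w. \<bar>f w * g w\<bar>)))^2 <= ennreal ((l2 f)^2) * ennreal ((l2 g)^2)"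
  using Cauchy_Schwarz_nn_integral[of "\<lambda>w. ennreal \<bar>f w\<bar>" M "\<lambda>w. ennreal \<bar>g w\<bar>"] unfolding e n[OF b(1)] n[OF b(2)] by simp
 also have "... = (ennreal (l2 f * l2 g))^2"
  using l2_nonneg by (simp add: ennreal_power power_mult_distrib flip: ennreal_mult)
 finally have "ennreal (\<E> (\<lambda>w. \<bar>f w * g w\<bar>)) <= ennreal (l2 f * l2 g)"
  by (rule ennreal_power2_le_imp_le)
 then show ?thesis using l2_nonneg by (subst (asm) ennreal_le_iff) auto
qed

lemma expectation_abs_le_l2: "bdd_rv f ==> \<E> (\<lambda>w. \<bar>f w\<bar>) <= l2 f"
 using expectation_abs_mult_le_l2[of f "\<lambda>_. 1"] by (simp add: l2_def prob_space)

lemma l2_triangle: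
 assumes b: "bdd_rv f" "bdd_rv g"
 shows "l2 (\<lambda>w. f w + g w) <= l2 f + l2 g"
proof (rule power2_le_imp_le)
 have "(l2 (\<lambda>w. f w + g w))^2 = \<E> (\<lambda>w. (f w)^2 + (g w)^2 + 2 * (f w * g w))"
  unfolding l2_sq by (simp add: power2_sum mult.assoc)
 also have "... <= \<E> (\<lambda>w. (f w)^2 + (g w)^2 + 2 * \<bar>f w * g w\<bar>)"
  by (intro integral_mono bdd_rv_integrable bdd_rv_intros b) simp
 also have "... = (l2 f)^2 + (l2 g)^2 + 2 * \<E> (\<lambda>w. \<bar>f w * g w\<bar>)"
 proof -
  have "integrable M (\<lambda>w. (f w)^2)" "integrable M (\<lambda>w. (g w)^2)" "integrable M (\<lambda>w. \<bar>f w * g w\<bar>)"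
   by (intro bdd_rv_integrable bdd_rv_intros b)+
  then show ?thesis unfolding l2_sq by simp
 qed
 also have "... <= (l2 f + l2 g)^2"
  using expectation_abs_mult_le_l2[OF b] by (simp add: power2_sum)
 finally show "(l2 (\<lambda>w. f w + g w))^2 <= (l2 f + l2 g)^2" .
qed (simp add: l2_nonneg)

lemma l2_diff_abs:
 assumes b: "bdd_rv f" "bdd_rv g"
 shows "\<bar>l2 f - l2 g\<bar> <= l2 (\<lambda>w. f w - g w)"
proof -
 have "l2 f <= l2 (\<lambda>w. f w - g w) + l2 g"
  using l2_triangle[of "\<lambda>w. f w - g w" g] b by (simp add: bdd_rv_diff)
 moreover have "l2 g <= l2 (\<lambda>w. g w - f w) + l2 f"
  using l2_triangle[of "\<lambda>w. g w - f w" f] b by (simp add: bdd_rv_diff)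
 moreover have "l2 (\<lambda>w. g w - f w) = l2 (\<lambda>w. f w - g w)"
  unfolding l2_def by (simp add: power2_commute)
 ultimately show ?thesis by linarith
qed

lemma char_diff_le_l2:
 assumes b: "bdd_rv f" "bdd_rv g"
 shows "cmod ((LINT w|M. iexp (t * f w)) - (LINT w|M. iexp (t * g w))) <= 2 * \<bar>t\<bar> * l2 (\<lambda>w. f w - g w)"
proof -
 note [measurable] = bdd_rv_measurable[OF b(1)] bdd_rv_measurable[OF b(2)]
 have i: "integrable M (\<lambda>w. iexp (t * f w))" "integrable M (\<lambda>w. iexp (t * g w))"
  by (intro bdd_rv_integrable bdd_rv_iexp; measurable)+
 have "cmod ((LINT w|M. iexp (t * f w)) - (LINT w|M. iexp (t * g w))) = cmod (LINT w|M. iexp (t * f w) - iexp (t * g w))"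
  by (simp only: integral_diff i)
 also have "... <= (LINT w|M. cmod (iexp (t * f w) - iexp (t * g w)))" by (rule integral_norm_bound)
 also have "... <= (LINT w|M. 2 * \<bar>t\<bar> * \<bar>f w - g w\<bar>)"
 proof (rule integral_mono)
  show "integrable M (\<lambda>w. cmod (iexp (t * f w) - iexp (t * g w)))"
   by (intro integrable_norm integrable_diff i)
  show "integrable M (\<lambda>w. 2 * \<bar>t\<bar> * \<bar>f w - g w\<bar>)"
   by (intro bdd_rv_integrable bdd_rv_intros b)
  show "cmod (iexp (t * f w) - iexp (t * g w)) <= 2 * \<bar>t\<bar> * \<bar>f w - g w\<bar>" for w
   using cmod_iexp_diff_le_powr[of 1 "t * f w" "t * g w"] by (simp add: abs_mult flip: right_diff_distrib)
 qed
 also have "... = 2 * \<bar>t\<bar> * \<E> (\<lambda>w. \<bar>f w - g w\<bar>)" by (rule integral_mult_right_zero)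
 also have "... <= 2 * \<bar>t\<bar> * l2 (\<lambda>w. f w - g w)"
  by (intro mult_left_mono expectation_abs_le_l2 bdd_rv_diff b) auto
 finally show ?thesis .
qed

text \<open>Taylor expansion puts the characteristic function at t / sqrt n within order n^(-3/2) of
  1 - y n, and exp (- y n) is within (y n)^2 of the same value. Raising to the power n div B of
  numbers of modulus at most 1 multiplies the error by at most n.\<close>

lemma block_char_tendsto:
 fixes V :: "'a => real"
 assumes [measurable]: "V \<in> borel_measurable M" and V: "\<And>w. \<bar>V w\<bar> <= c" and mean: "\<E> V = 0" and B: "0 < (B::nat)"
 shows "(\<lambda>n. (LINT w|M. iexp (t / sqrt (real n) * V w)) ^ (n div B)) ----> complex_of_real (exp (- (t^2 * (\<E> (\<lambda>w. (V w)^2) / real B) / 2)))"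
proof -
 let ?v = "\<E> (\<lambda>w. (V w)^2)"
 define y where "y n = t^2 * ?v / (2 * real n)" for n :: nat
 define \<psi> where "\<psi> n = (LINT w|M. iexp (t / sqrt (real n) * V w))" for n :: nat
 have bV: "bdd_rv V" using V by (intro bdd_rvI[where B = c]) auto
 have c: "0 <= c" using V[of undefined] by linarith
 have v: "0 <= ?v" by (rule integral_nonneg) auto
 have y0: "0 <= y n" for n unfolding y_def using v by simp
 have psi1: "cmod (\<psi> n) <= 1" for n
 proof -
  have "cmod (\<psi> n) <= (LINT w|M. cmod (iexp (t / sqrt (real n) * V w)))" unfolding \<psi>_def by (rule integral_norm_bound)
  then show ?thesis by (simp add: prob_space)
 qed
 have close: "cmod (\<psi> n - complex_of_real (exp (- y n))) <= \<bar>t\<bar> ^ 3 * c ^ 3 / (real n * sqrt (real n)) + (y n)^2" if "0 < n" for n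
 proof -
  let ?t = "t / sqrt (real n)"
  have e1: "\<psi> n = char (distr M borel V) ?t"
   unfolding \<psi>_def char_def by (rule integral_distr[symmetric]) (use bdd_rv_measurable[OF bV] in auto)
  have e2: "complex_of_real (y n) = complex_of_real (?t^2 * ?v / 2)" using that by (simp add: y_def power_divide)
  have "cmod (char (distr M borel V) ?t - (1 - ?t^2 * ?v / 2)) <= (?t^2 / 6) * \<E> (\<lambda>w. min (6 * (V w)^2) (\<bar>?t\<bar> * \<bar>V w\<bar> ^ 3))"
  proof (rule char_approx3')
   show "variance V = ?v" by (simp add: mean)
  qed (auto intro!: bdd_rv_integrable bdd_rv_intros bV simp: mean)
  also have "... <= (?t^2 / 6) * (\<bar>?t\<bar> * c ^ 3)"
  proof (intro mult_left_mono)
   have "\<E> (\<lambda>w. min (6 * (V w)^2) (\<bar>?t\<bar> * \<bar>V w\<bar> ^ 3)) <= \<E> (\<lambda>w. \<bar>?t\<bar> * c ^ 3)"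
   proof (rule integral_mono')
    show "min (6 * (V w)^2) (\<bar>?t\<bar> * \<bar>V w\<bar> ^ 3) <= \<bar>?t\<bar> * c ^ 3" for w
     by (intro min.coboundedI2 mult_left_mono power_mono V) auto
   qed (use c in auto)
   then show "\<E> (\<lambda>w. min (6 * (V w)^2) (\<bar>?t\<bar> * \<bar>V w\<bar> ^ 3)) <= \<bar>?t\<bar> * c ^ 3" by (simp add: prob_space)
  qed simp
  also have "... <= \<bar>t\<bar> ^ 3 * c ^ 3 / (real n * sqrt (real n))"
  proof -
   have "?t^2 * \<bar>?t\<bar> = \<bar>t\<bar> ^ 3 / (real n * sqrt (real n))"
    using that by (simp add: power_divide eval_nat_numeral abs_divide)
   moreover have "(?t^2 / 6) * (\<bar>?t\<bar> * c ^ 3) = (?t^2 * \<bar>?t\<bar>) * c ^ 3 / 6"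
    by (simp only: times_divide_eq_left times_divide_eq_right mult.assoc)
   ultimately have "(?t^2 / 6) * (\<bar>?t\<bar> * c ^ 3) = (\<bar>t\<bar> ^ 3 * c ^ 3 / (real n * sqrt (real n))) / 6"
    by (simp only: times_divide_eq_left)
   also have "... <= \<bar>t\<bar> ^ 3 * c ^ 3 / (real n * sqrt (real n))"
   proof -
    have "0 <= \<bar>t\<bar> ^ 3 * c ^ 3 / (real n * sqrt (real n))" using c by (intro divide_nonneg_nonneg mult_nonneg_nonneg) auto
    moreover have "x / 6 <= x" if "0 <= x" for x :: real using that by simp
    ultimately show ?thesis by blast
   qed
   finally show ?thesis .
  qed
  finally have 1: "cmod (\<psi> n - (1 - complex_of_real (y n))) <= \<bar>t\<bar> ^ 3 * c ^ 3 / (real n * sqrt (real n))"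
   unfolding e1 by (simp add: e2)
  have "cmod ((1 - complex_of_real (y n)) - complex_of_real (exp (- y n))) = \<bar>exp (- y n) - (1 - y n)\<bar>"
   by (metis norm_minus_commute norm_of_real of_real_1 of_real_diff)
  also have "... <= (y n)^2" by (rule exp_minus_approx[OF y0])
  finally have 2: "cmod ((1 - complex_of_real (y n)) - complex_of_real (exp (- y n))) <= (y n)^2" .
  show ?thesis
   using norm_triangle_mono[OF 1 2] by simp
 qed
 have lim1: "(\<lambda>n. \<psi> n ^ (n div B) - complex_of_real (exp (- y n)) ^ (n div B)) ----> 0"
 proof (rule Lim_null_comparison)
  show "\<forall>\<^sub>F n in sequentially. norm (\<psi> n ^ (n div B) - complex_of_real (exp (- y n)) ^ (n div B))
    <= \<bar>t\<bar> ^ 3 * c ^ 3 / sqrt (real n) + (t^2 * ?v / 2)^2 / real n"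
   using eventually_gt_at_top[of 0]
  proof eventually_elim
   case (elim n)
   have "norm (\<psi> n ^ (n div B) - complex_of_real (exp (- y n)) ^ (n div B)) <= real (n div B) * cmod (\<psi> n - complex_of_real (exp (- y n)))"
    using psi1 y0 by (intro norm_power_diff) auto
   also have "... <= real n * (\<bar>t\<bar> ^ 3 * c ^ 3 / (real n * sqrt (real n)) + (y n)^2)"
    by (intro mult_mono close elim) (auto simp: div_le_dividend)
   also have "... = \<bar>t\<bar> ^ 3 * c ^ 3 / sqrt (real n) + (t^2 * ?v / 2)^2 / real n"
    using elim by (simp add: y_def power2_eq_square field_simps)
   finally show ?case .
  qed
  show "(\<lambda>n. \<bar>t\<bar> ^ 3 * c ^ 3 / sqrt (real n) + (t^2 * ?v / 2)^2 / real n) ----> 0"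
   using tendsto_add[OF lim_const_over_sqrt lim_const_over_n] by simp
 qed
 have lim2: "(\<lambda>n. complex_of_real (exp (- y n)) ^ (n div B)) ----> complex_of_real (exp (- (t^2 * (?v / real B) / 2)))"
 proof -
  note q = div_over_tendsto[OF B]
  have "(\<lambda>n. exp (- (t^2 * ?v / 2 * (real (n div B) / real n)))) ----> exp (- (t^2 * ?v / 2 * (1 / real B)))"
   by (intro tendsto_exp tendsto_minus tendsto_mult tendsto_const q)
  moreover have "complex_of_real (exp (- y n)) ^ (n div B) = complex_of_real (exp (- (t^2 * ?v / 2 * (real (n div B) / real n))))" for n
   by (simp add: y_def exp_of_nat_mult[symmetric] mult_ac flip: of_real_power)
  ultimately show ?thesis by (simp add: mult_ac tendsto_of_real_iff)
 qed
 from tendsto_add[OF lim1 lim2] show ?thesis unfolding \<psi>_def by simp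
qed

text \<open>A double limit: after division by sqrt n the term d B disappears for fixed B, and
  \<open>\<rho> B\<close> disappears as B grows. The normalised norms of S are thus Cauchy, v B
  converges to the same limit, and characteristic functions follow because they are Lipschitz in
  L2.\<close>

lemma clt_by_approximation:
 fixes S :: "nat => 'a => real" and R :: "nat => nat => 'a => real" and v d \<rho> :: "nat => real"
 assumes bS: "\<And>n. bdd_rv (S n)" and bR: "\<And>B n. bdd_rv (R B n)"
  and approx: "\<And>B n. 0 < B ==> 0 < n ==> l2 (\<lambda>w. S n w - R B n w) <= d B + \<rho> B * sqrt (real n)"
  and \<rho>: "\<rho> ----> 0"
  and var: "\<And>B. 0 < B ==> (\<lambda>n. l2 (R B n) / sqrt (real n)) ----> v B"
  and clt: "\<And>B t. 0 < B ==> (\<lambda>n. LINT w|M. iexp (t * (R B n w / sqrt (real n)))) ----> complex_of_real (exp (- (t^2 * (v B)^2 / 2)))"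
 obtains \<sigma> where "(\<lambda>n. l2 (S n) / sqrt (real n)) ----> \<sigma>"
  "\<And>t. (\<lambda>n. LINT w|M. iexp (t * (S n w / sqrt (real n)))) ----> complex_of_real (exp (- (t^2 * \<sigma>^2 / 2)))"
proof -
 define s where "s n = l2 (S n) / sqrt (real n)" for n
 have close: "\<bar>s n - l2 (R B n) / sqrt (real n)\<bar> <= d B / sqrt (real n) + \<rho> B" if "0 < B" "0 < n" for B n
 proof -
  have "\<bar>s n - l2 (R B n) / sqrt (real n)\<bar> = \<bar>l2 (S n) - l2 (R B n)\<bar> / sqrt (real n)"
   unfolding s_def by (simp add: diff_divide_distrib[symmetric] abs_divide)
  also have "... <= (d B + \<rho> B * sqrt (real n)) / sqrt (real n)"
   by (intro divide_right_mono order_trans[OF l2_diff_abs[OF bS bR] approx] that) auto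
  also have "... = d B / sqrt (real n) + \<rho> B" using that by (simp add: add_divide_distrib)
  finally show ?thesis .
 qed
 have ev: "\<forall>\<^sub>F n in sequentially. \<bar>s n - v B\<bar> < \<rho> B + e" if "0 < B" "0 < e" for B e
 proof -
  have "(\<lambda>n. d B / sqrt (real n)) ----> 0" by (rule lim_const_over_sqrt)
  then have "\<forall>\<^sub>F n in sequentially. d B / sqrt (real n) < e / 2"
   using that by (auto dest!: order_tendstoD(2)[where a = "e / 2"])
  moreover have "\<forall>\<^sub>F n in sequentially. \<bar>l2 (R B n) / sqrt (real n) - v B\<bar> < e / 2"
   using tendstoD[OF var[OF that(1)], of "e / 2"] that(2) by (simp add: dist_real_def)
  ultimately show ?thesis
   using eventually_gt_at_top[of 0]
  proof eventually_elim
   case (elim n)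
   then show ?case using close[OF that(1) elim(3)] by linarith
  qed
 qed
 have small: "\<exists>B>0. \<rho> B < e \<and> (\<forall>B'\<ge>B. \<rho> B' < e)" if "0 < e" for e
 proof -
  have "\<forall>\<^sub>F B in sequentially. \<rho> B < e" using \<rho> that by (auto dest!: order_tendstoD(2)[where a = e])
  then obtain N where "\<And>B. N <= B ==> \<rho> B < e" by (auto simp: eventually_sequentially)
  then show ?thesis by (intro exI[of _ "Suc N"]) auto
 qed
 have "Cauchy s"
 proof (rule CauchyI)
  fix e :: real assume e: "0 < e"
  obtain B where B: "0 < B" "\<rho> B < e / 4" using small[of "e / 4"] e by auto
  obtain N where N: "\<And>n. N <= n ==> \<bar>s n - v B\<bar> < \<rho> B + e / 4"
   using ev[OF B(1), of "e / 4"] e by (auto simp: eventually_sequentially)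
  show "\<exists>M. \<forall>m\<ge>M. \<forall>n\<ge>M. norm (s m - s n) < e"
  proof (intro exI allI impI)
   fix m n assume "N <= m" "N <= n"
   then show "norm (s m - s n) < e" using N[of m] N[of n] B(2) unfolding real_norm_def by linarith
  qed
 qed
 then obtain \<sigma> where \<sigma>: "s ----> \<sigma>" using Cauchy_convergent_iff convergent_def by blast
 have v\<sigma>: "\<bar>\<sigma> - v B\<bar> <= \<rho> B" if "0 < B" for B
 proof (rule field_le_epsilon)
  fix e :: real assume e: "0 < e"
  have "(\<lambda>n. \<bar>s n - v B\<bar>) ----> \<bar>\<sigma> - v B\<bar>" by (intro tendsto_intros \<sigma>)
  then show "\<bar>\<sigma> - v B\<bar> <= \<rho> B + e"
   by (rule tendsto_upperbound) (use ev[OF that e] in \<open>auto elim!: eventually_mono\<close>)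
 qed
 have vlim: "v ----> \<sigma>"
 proof (rule LIM_zero_cancel, rule Lim_null_comparison)
  show "\<forall>\<^sub>F B in sequentially. norm (v B - \<sigma>) <= \<rho> B"
   using eventually_gt_at_top[of 0]
  proof eventually_elim
   case (elim B)
   then show ?case using v\<sigma>[OF elim] by simp
  qed
 qed (rule \<rho>)
 have "(\<lambda>n. LINT w|M. iexp (t * (S n w / sqrt (real n)))) ----> complex_of_real (exp (- (t^2 * \<sigma>^2 / 2)))" for t
 proof (rule tendstoI)
  fix e :: real assume e: "0 < e"
  let ?\<psi> = "\<lambda>u. complex_of_real (exp (- (t^2 * u^2 / 2)))"
  have "(\<lambda>B. ?\<psi> (v B)) ----> ?\<psi> \<sigma>" by (intro tendsto_intros vlim) auto
  then have "\<forall>\<^sub>F B in sequentially. dist (?\<psi> (v B)) (?\<psi> \<sigma>) < e / 4" using e by (intro tendstoD) auto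
  moreover have "\<forall>\<^sub>F B in sequentially. 2 * \<bar>t\<bar> * \<rho> B < e / 4"
  proof -
   have "(\<lambda>B. 2 * \<bar>t\<bar> * \<rho> B) ----> 2 * \<bar>t\<bar> * 0" by (intro tendsto_intros \<rho>)
   then show ?thesis using e by (auto dest!: order_tendstoD(2)[where a = "e / 4"])
  qed
  ultimately have "\<forall>\<^sub>F B in sequentially. 0 < B \<and> dist (?\<psi> (v B)) (?\<psi> \<sigma>) < e / 4 \<and> 2 * \<bar>t\<bar> * \<rho> B < e / 4"
   using eventually_gt_at_top[of 0] by eventually_elim auto
  then obtain B where B: "0 < B" "dist (?\<psi> (v B)) (?\<psi> \<sigma>) < e / 4" "2 * \<bar>t\<bar> * \<rho> B < e / 4"
   using eventually_happens'[OF sequentially_bot] by blast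
  have "\<forall>\<^sub>F n in sequentially. 2 * \<bar>t\<bar> * (d B / sqrt (real n)) < e / 4"
  proof -
   have "(\<lambda>n. 2 * \<bar>t\<bar> * (d B / sqrt (real n))) ----> 0"
    using lim_const_over_sqrt[of "2 * \<bar>t\<bar> * d B"] by simp
   then show ?thesis using e by (auto dest!: order_tendstoD(2)[where a = "e / 4"])
  qed
  moreover have "\<forall>\<^sub>F n in sequentially. dist (LINT w|M. iexp (t * (R B n w / sqrt (real n)))) (?\<psi> (v B)) < e / 4"
   using e by (intro tendstoD[OF clt[OF B(1)]]) auto
  ultimately show "\<forall>\<^sub>F n in sequentially. dist (LINT w|M. iexp (t * (S n w / sqrt (real n)))) (?\<psi> \<sigma>) < e"
   using eventually_gt_at_top[of 0]
  proof eventually_elim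
   case (elim n)
   let ?S = "\<lambda>w. S n w / sqrt (real n)" and ?R = "\<lambda>w. R B n w / sqrt (real n)"
   have bd: "bdd_rv ?S" "bdd_rv ?R"
    unfolding divide_inverse by (intro bdd_rv_mult bdd_rv_const bS bR)+
   have "l2 (\<lambda>w. ?S w - ?R w) = l2 (\<lambda>w. S n w - R B n w) / sqrt (real n)"
    unfolding l2_def by (simp add: diff_divide_distrib[symmetric] power_divide real_sqrt_divide)
   also have "... <= (d B + \<rho> B * sqrt (real n)) / sqrt (real n)"
    by (intro divide_right_mono approx B elim) auto
   also have "... = d B / sqrt (real n) + \<rho> B" using elim by (simp add: add_divide_distrib)
   finally have l: "l2 (\<lambda>w. ?S w - ?R w) <= d B / sqrt (real n) + \<rho> B" .
   have "dist (LINT w|M. iexp (t * ?S w)) (LINT w|M. iexp (t * ?R w)) <= 2 * \<bar>t\<bar> * (d B / sqrt (real n) + \<rho> B)"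
    unfolding dist_norm by (rule order_trans[OF char_diff_le_l2[OF bd]]) (intro mult_left_mono l, simp)
   also have "... < e / 2" using elim(1) B(3) by (simp add: distrib_left)
   finally have 1: "dist (LINT w|M. iexp (t * ?S w)) (LINT w|M. iexp (t * ?R w)) < e / 2" .
   show ?case
    using 1 elim(2) B(2) dist_triangle[of "LINT w|M. iexp (t * ?S w)" "?\<psi> \<sigma>" "LINT w|M. iexp (t * ?R w)"]
     dist_triangle[of "LINT w|M. iexp (t * ?R w)" "?\<psi> \<sigma>" "?\<psi> (v B)"]
    by linarith
  qed
 qed
 with \<sigma> show ?thesis unfolding s_def by (rule that)
qed

end

lemma sum_blocks:
 fixes g :: "nat => 'b::comm_monoid_add"
 shows "(\<Sum>i=1..B * N. g i) = (\<Sum>k<N. \<Sum>j=1..B. g (B * k + j))"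
proof (induction N)
 case (Suc N)
 have "(\<Sum>i=1..B * N + B. g i) = (\<Sum>i=1..B * N. g i) + (\<Sum>i=B * N + 1..B * N + B. g i)"
  by (rule sum.ub_add_nat) simp
 also have "(\<Sum>i=B * N + 1..B * N + B. g i) = (\<Sum>j=1..B. g (B * N + j))"
  using sum.shift_bounds_cl_nat_ivl[of g 1 "B * N" B] by (simp add: add.commute)
 finally show ?case using Suc by (simp add: add.commute)
qed simp

text \<open>Index 0 marks the terms after the last complete block, which are dropped from the block sums.\<close>

definition block_index :: "nat => nat => nat => nat" where
 "block_index B n i = (if i <= B * (n div B) then (i - 1) mod B + 1 else 0)"

lemma sum_block_index:
 fixes g :: "nat => nat => 'b::comm_monoid_add"
 assumes B: "0 < B"
 shows "(\<Sum>i=1..n. g (block_index B n i) i)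
  = (\<Sum>k<n div B. \<Sum>j=1..B. g j (B * k + j)) + (\<Sum>i=B * (n div B) + 1..n. g 0 i)"
proof -
 let ?m = "B * (n div B)"
 have m: "?m <= n" by (rule times_div_less_eq_dividend)
 have "(\<Sum>i=1..n. g (block_index B n i) i) = (\<Sum>i=1..?m. g (block_index B n i) i) + (\<Sum>i=?m + 1..n. g (block_index B n i) i)"
  using sum.ub_add_nat[of 1 ?m "\<lambda>i. g (block_index B n i) i" "n - ?m"] m by simp
 also have "(\<Sum>i=?m + 1..n. g (block_index B n i) i) = (\<Sum>i=?m + 1..n. g 0 i)"
  by (intro sum.cong) (auto simp: block_index_def)
 also have "(\<Sum>i=1..?m. g (block_index B n i) i) = (\<Sum>k<n div B. \<Sum>j=1..B. g (block_index B n (B * k + j)) (B * k + j))"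
  by (rule sum_blocks)
 also have "... = (\<Sum>k<n div B. \<Sum>j=1..B. g j (B * k + j))"
 proof (intro sum.cong refl)
  fix k j assume k: "k \<in> {..<n div B}" and j: "j \<in> {1..B}"
  have "Suc k * B <= (n div B) * B" using k by (intro mult_le_mono1) auto
  then have "B * k + j <= ?m" using j by (simp add: mult.commute)
  moreover have "(B * k + j - 1) mod B = j - 1"
  proof -
   have "B * k + j - 1 = (j - 1) + B * k" using j by auto
   moreover have "((j - 1) + B * k) mod B = j - 1" using j by (simp only: mod_mult_self2) auto
   ultimately show ?thesis by (simp only:)
  qed
  ultimately have "block_index B n (B * k + j) = j" using j by (simp add: block_index_def)
  then show "g (block_index B n (B * k + j)) (B * k + j) = g j (B * k + j)" by simp
 qed
 finally show ?thesis .
qed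

lemma block_remainder_le: "card {B * (n div B) + 1..n} <= B" if "0 < B" for B n :: nat
proof -
 have "n - B * (n div B) = n mod B" by (rule minus_mult_div_eq_mod)
 then show ?thesis using mod_less_divisor[OF that, of n] by simp
qed

text \<open>Each complete block has min m B positions with index at most m; at most B terms are left
  over, all with index 0.\<close>

lemma card_block_index_le:
 assumes B: "0 < B"
 shows "real (card {i\<in>{1..n}. block_index B n i <= m}) <= real B + real n * (real (min m B) / real B)"
proof -
 have "card {i\<in>{1..n}. block_index B n i <= m} = (\<Sum>i=1..n. of_bool (block_index B n i <= m))"
  by (simp add: sum.If_cases of_bool_def Int_def conj_commute)
 also have "... = (\<Sum>k<n div B. \<Sum>j=1..B. of_bool (j <= m)) + (\<Sum>i=B * (n div B) + 1..n. of_bool (0 <= m))"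
  by (rule sum_block_index[OF B, of "\<lambda>s _. of_bool (s <= m)"])
 also have "(\<Sum>j=1..B. of_bool (j <= m)) = min m B"
 proof -
  have "{j\<in>{1..B}. j <= m} = {1..min m B}" by auto
  then show ?thesis by (simp add: sum.If_cases of_bool_def Int_def)
 qed
 finally have "card {i\<in>{1..n}. block_index B n i <= m} <= (n div B) * min m B + B"
  using block_remainder_le[OF B, of n] by simp
 then have "real (card {i\<in>{1..n}. block_index B n i <= m}) <= real (n div B) * real (min m B) + real B"
  by (metis of_nat_add of_nat_le_iff of_nat_mult)
 also have "real (n div B) * real (min m B) <= (real n / real B) * real (min m B)"
  by (intro mult_right_mono of_nat_div_le_of_nat) auto
 finally show ?thesis by (simp add: mult_ac)
qed

lemma (in prob_space) indep_sets_reindex: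
 assumes F: "indep_sets F K" and inj: "inj_on e I" and sub: "e ` I \<subseteq> K"
 shows "indep_sets (\<lambda>i. F (e i)) I"
proof (rule indep_setsI)
 show "F (e i) \<subseteq> events" if "i \<in> I" for i
  using F sub that unfolding indep_sets_def by blast
 fix A J assume J: "J \<noteq> {}" "J \<subseteq> I" "finite J" "\<forall>j\<in>J. A j \<in> F (e j)"
 then have inj: "inj_on e J" using inj inj_on_subset by blast
 have "prob (\<Inter>k\<in>e ` J. A (the_inv_into J e k)) = (\<Prod>k\<in>e ` J. prob (A (the_inv_into J e k)))"
  by (rule indep_setsD[OF F]) (use J sub in \<open>auto simp: the_inv_into_f_f[OF inj]\<close>)
 then show "prob (\<Inter>j\<in>J. A j) = (\<Prod>j\<in>J. prob (A j))"
  by (simp add: prod.reindex[OF inj] the_inv_into_f_f[OF inj] cong: INF_cong_simp prod.cong_simp)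
qed

lemma (in prob_space) indep_vars_reindex:
 assumes "indep_vars M' X K" "inj_on e I" "e ` I \<subseteq> K"
 shows "indep_vars (\<lambda>i. M' (e i)) (\<lambda>i. X (e i)) I"
 using assms(1) assms(3) indep_sets_reindex[OF _ assms(2,3)] unfolding indep_vars_def2 by blast

context noise
begin

lemma distr_window:
 fixes c :: int
 assumes B: "0 < B"
 shows "distr M (PiM {1..B} (\<lambda>_::nat. borel)) (\<lambda>w. \<lambda>j\<in>{1..B}. \<epsilon> (c + int j) w) = PiM {1..B} (\<lambda>_. distr M borel (\<epsilon> 1))"
proof -
 have "indep_vars (\<lambda>_. borel) (\<lambda>j. \<epsilon> (c + int j)) {1..B}"
  using indep_vars_reindex[OF indep, of "\<lambda>j. c + int j" "{1..B}"] by (auto simp: inj_on_def)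
 then have "distr M (PiM {1..B} (\<lambda>_::nat. borel)) (\<lambda>w. \<lambda>j\<in>{1..B}. \<epsilon> (c + int j) w) = PiM {1..B} (\<lambda>j. distr M borel (\<epsilon> (c + int j)))"
  using B indep_vars_iff_distr_eq_PiM[where I = "{1..B}" and M' = "\<lambda>_. borel" and X = "\<lambda>j. \<epsilon> (c + int j)"] by auto
 then show ?thesis unfolding ident[of "c + int _"] .
qed

text \<open>At position j of block k only the j most recent innovations are used, all inside the
  block. The block sums V k are therefore the same function of disjoint windows of innovations,
  hence independent and identically distributed, and leftover terms contribute F 0 0 = 0.\<close>

lemma block_clt:
 fixes F :: "nat => real => real" and a :: "nat => real"
 assumes B: "0 < B" and Fm[measurable]: "\<And>s. F s \<in> borel_measurable borel" and Fb: "\<And>s u. \<bar>F s u\<bar> <= c"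
  and F0: "F 0 0 = 0" and mean: "\<And>s i. (LINT w|M. F s (psum a s i w)) = 0"
 defines "R \<equiv> \<lambda>n w. \<Sum>i=1..n. F (block_index B n i) (psum a (block_index B n i) (int i) w)"
 obtains v where "(\<lambda>n. l2 (R n) / sqrt (real n)) ----> v"
  "\<And>t. (\<lambda>n. LINT w|M. iexp (t * (R n w / sqrt (real n)))) ----> complex_of_real (exp (- (t^2 * v^2 / 2)))"
proof -
 define V where "V k w = (\<Sum>j=1..B. F j (psum a j (int (B * k + j)) w))" for k w
 define P where "P N w = (\<Sum>k<N. V k w)" for N w
 define G where "G x = (\<Sum>j=1..B. F j (\<Sum>l<j. a l * x (j - l)))" for x :: "nat => real"
 have R_eq: "R n w = P (n div B) w" for n w
 proof -
  have "R n w = P (n div B) w + (\<Sum>i=B * (n div B) + 1..n. F 0 (psum a 0 (int i) w))"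
   unfolding R_def P_def V_def
   using sum_block_index[OF B, of "\<lambda>s i. F s (psum a s (int i) w)" n] .
  then show ?thesis by (simp add: psum_def F0)
 qed
 have VG: "V k w = G (\<lambda>j\<in>{1..B}. \<epsilon> (int (B * k) + int j) w)" for k w
  unfolding V_def G_def psum_def
 proof (intro sum.cong refl arg_cong[where f = "F _"])
  fix j l assume "j \<in> {1..B}" "l \<in> {..<j}"
  then have "j - l \<in> {1..B}" "int (B * k) + int (j - l) = int (B * k + j) - int l" by auto
  then show "a l * \<epsilon> (int (B * k + j) - int l) w = a l * (\<lambda>j\<in>{1..B}. \<epsilon> (int (B * k) + int j) w) (j - l)"
   by (simp only: restrict_apply if_True)
 qed
 have Gm[measurable]: "G \<in> borel_measurable (PiM {1..B} (\<lambda>_. borel))"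
  unfolding G_def
 proof (intro borel_measurable_sum measurable_compose[OF _ Fm] borel_measurable_times borel_measurable_const)
  fix j l assume "j \<in> {1..B}" "l \<in> {..<j}"
  then show "(\<lambda>x. x (j - l)) \<in> borel_measurable (PiM {1..B} (\<lambda>_. borel))"
   by (intro measurable_component_singleton) auto
 qed
 have Wm: "(\<lambda>w. \<lambda>j\<in>{1..B}. \<epsilon> (z + int j) w) \<in> measurable M (PiM {1..B} (\<lambda>_. borel))" for z
  by (intro measurable_restrict) auto
 have dV: "distr M borel (V k) = distr (PiM {1..B} (\<lambda>_. distr M borel (\<epsilon> 1))) borel G" for k
 proof -
  have Ve: "V k = G \<circ> (\<lambda>w. \<lambda>j\<in>{1..B}. \<epsilon> (int (B * k) + int j) w)"
   by (rule ext) (simp only: VG comp_def)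
  have "distr M borel (V k) = distr (distr M (PiM {1..B} (\<lambda>_. borel)) (\<lambda>w. \<lambda>j\<in>{1..B}. \<epsilon> (int (B * k) + int j) w)) borel G"
   unfolding Ve by (rule distr_distr[OF Gm Wm, symmetric])
  then show ?thesis unfolding distr_window[OF B] .
 qed
 have psum_V: "V k \<in> borel_measurable (noise_alg {int (B * k)<..int (B * Suc k)})" for k
  unfolding V_def
 proof (intro borel_measurable_sum measurable_compose[OF _ Fm])
  fix j assume "j \<in> {1..B}"
  then show "psum a j (int (B * k + j)) \<in> borel_measurable (noise_alg {int (B * k)<..int (B * Suc k)})"
   by (intro noise_alg_mono[OF _ psum_noise_alg']) auto
 qed
 have P_alg: "P N \<in> borel_measurable (noise_alg {0<..int (B * N)})" for N
  unfolding P_def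
 proof (intro borel_measurable_sum)
  fix k assume "k \<in> {..<N}"
  then have "B * Suc k <= B * N" by (intro mult_le_mono2) auto
  then have le: "int (B * Suc k) <= int (B * N)" by (simp only: of_nat_le_iff)
  have "{int (B * k)<..int (B * Suc k)} \<subseteq> {0<..int (B * N)}"
  proof
   fix x assume "x \<in> {int (B * k)<..int (B * Suc k)}"
   then show "x \<in> {0<..int (B * N)}" using le of_nat_0_le_iff[of "B * k"] unfolding greaterThanAtMost_iff by linarith
  qed
  then show "V k \<in> borel_measurable (noise_alg {0<..int (B * N)})"
   by (rule noise_alg_mono[OF _ psum_V])
 qed
 have Vm[measurable]: "V k \<in> borel_measurable M" for k by (rule measurable_noise_algD[OF psum_V])
 have Vb: "\<bar>V k w\<bar> <= real B * c" for k w
 proof -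
  have "\<bar>V k w\<bar> <= (\<Sum>j=1..B. c)" unfolding V_def by (rule order_trans[OF sum_abs]) (intro sum_mono Fb)
  then show ?thesis by simp
 qed
 have bV: "bdd_rv (V k)" for k using Vb by (intro bdd_rvI[where B = "real B * c"]) auto
 have bP: "bdd_rv (P N)" for N unfolding P_def by (intro bdd_rv_sum bV)
 have Pm[measurable]: "P N \<in> borel_measurable M" for N by (rule measurable_noise_algD[OF P_alg])
 have EV: "(LINT w|M. g (V k w)) = (LINT w|M. g (V 0 w))" if [measurable]: "g \<in> borel_measurable borel" for g :: "real => 'b::{banach, second_countable_topology}" and k
 proof -
  have "(LINT w|M. g (V k w)) = (LINT x|distr M borel (V k). g x)" for k by (simp add: integral_distr)
  then show ?thesis unfolding dV by simp
 qed
 have mV: "(LINT w|M. V k w) = 0" for k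
 proof -
  have "(LINT w|M. V k w) = (\<Sum>j=1..B. LINT w|M. F j (psum a j (int (B * k + j)) w))"
   unfolding V_def
   by (intro integral_sum bdd_rv_integrable bdd_rvI[where B = c]) (auto simp: Fb)
  then show ?thesis by (simp add: mean)
 qed
 have disj: "{0<..int (B * N)} \<inter> {int (B * N)<..int (B * Suc N)} = {}" for N by auto
 have char: "(LINT w|M. iexp (u * P N w)) = (LINT w|M. iexp (u * V 0 w)) ^ N" for u N
 proof (induction N)
  case 0
  show ?case by (simp add: P_def prob_space)
 next
  case (Suc N)
  have "iexp (u * P (Suc N) w) = iexp (u * P N w) * iexp (u * V N w)" for w
   unfolding P_def by (simp add: distrib_left exp_add)
  then have "(LINT w|M. iexp (u * P (Suc N) w)) = (LINT w|M. iexp (u * P N w) * iexp (u * V N w))" by (simp only:)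
  also have "... = (LINT w|M. iexp (u * P N w)) * (LINT w|M. iexp (u * V N w))"
  proof (rule expectation_indep_mult[OF disj])
   show "(\<lambda>w. iexp (u * P N w)) \<in> borel_measurable (noise_alg {0<..int (B * N)})"
    by (rule measurable_compose[OF P_alg]) measurable
   show "(\<lambda>w. iexp (u * V N w)) \<in> borel_measurable (noise_alg {int (B * N)<..int (B * Suc N)})"
    by (rule measurable_compose[OF psum_V]) measurable
  qed (intro bdd_rv_iexp; measurable)+
  also have "(LINT w|M. iexp (u * V N w)) = (LINT w|M. iexp (u * V 0 w))" by (rule EV) measurable
  finally show ?case unfolding Suc by simp
 qed
 have var: "(LINT w|M. (P N w)^2) = real N * (LINT w|M. (V 0 w)^2)" for N
 proof (induction N)
  case 0
  show ?case by (simp add: P_def)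
 next
  case (Suc N)
  have "(LINT w|M. P N w * V N w) = (LINT w|M. P N w) * (LINT w|M. V N w)"
   by (intro indep_var_lebesgue_integral indep_noise_alg[OF disj P_alg psum_V] bdd_rv_integrable bV bP)
  then have z: "(LINT w|M. P N w * V N w) = 0" by (simp add: mV)
  have "(P (Suc N) w)^2 = (P N w)^2 + (V N w)^2 + 2 * (P N w * V N w)" for w
   unfolding P_def by (simp add: power2_sum)
  moreover have "integrable M (\<lambda>w. (P N w)^2)" "integrable M (\<lambda>w. (V N w)^2)" "integrable M (\<lambda>w. P N w * V N w)"
   by (intro bdd_rv_integrable bdd_rv_intros bV bP)+
  ultimately have "(LINT w|M. (P (Suc N) w)^2) = (LINT w|M. (P N w)^2) + (LINT w|M. (V N w)^2)"
   by (simp add: z)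
  also have "(LINT w|M. (V N w)^2) = (LINT w|M. (V 0 w)^2)" by (rule EV) measurable
  finally show ?case unfolding Suc by (simp add: algebra_simps)
 qed
 let ?v = "sqrt ((LINT w|M. (V 0 w)^2) / real B)"
 have v2: "?v^2 = (LINT w|M. (V 0 w)^2) / real B"
  by (intro real_sqrt_pow2 divide_nonneg_nonneg integral_nonneg) auto
 have "l2 (R n) / sqrt (real n) = sqrt (real (n div B) / real n * (LINT w|M. (V 0 w)^2))" for n
  unfolding l2_def R_eq var by (simp flip: real_sqrt_divide)
 moreover have "(\<lambda>n. sqrt (real (n div B) / real n * (LINT w|M. (V 0 w)^2))) ----> sqrt (1 / real B * (LINT w|M. (V 0 w)^2))"
  by (intro tendsto_real_sqrt tendsto_mult tendsto_const div_over_tendsto B)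
 ultimately have 1: "(\<lambda>n. l2 (R n) / sqrt (real n)) ----> ?v" by simp
 have "(LINT w|M. iexp (t * (R n w / sqrt (real n)))) = (LINT w|M. iexp (t / sqrt (real n) * V 0 w)) ^ (n div B)" for t n
  unfolding R_eq char[symmetric] by (simp only: times_divide_eq_left times_divide_eq_right)
 moreover have "(\<lambda>n. (LINT w|M. iexp (t / sqrt (real n) * V 0 w)) ^ (n div B)) ----> complex_of_real (exp (- (t^2 * ?v^2 / 2)))" for t
  unfolding v2 by (rule block_char_tendsto) (use B Vb mV in auto)
 ultimately have 2: "(\<lambda>n. LINT w|M. iexp (t * (R n w / sqrt (real n)))) ----> complex_of_real (exp (- (t^2 * ?v^2 / 2)))" for t
  by (simp only:)
 show ?thesis by (rule that[OF 1 2])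
qed

text \<open>In the applications \<open>F s\<close> approximates the centred summand using only its s
  most recent innovations: in the smooth case the older ones are averaged out, in the finite case
  short histories are dropped.\<close>

lemma clt_by_blocks:
 fixes F :: "nat => real => real" and S :: "nat => 'a => real" and d \<rho> :: "nat => real"
 assumes Fm: "\<And>s. F s \<in> borel_measurable borel" and Fb: "\<And>s u. \<bar>F s u\<bar> <= c"
  and F0: "F 0 0 = 0" and mean: "\<And>s i. (LINT w|M. F s (psum a s i w)) = 0"
  and bS: "\<And>n. bdd_rv (S n)" and \<rho>: "\<rho> ----> 0"
  and approx: "\<And>B n. 0 < B ==> l2 (\<lambda>w. S n w - (\<Sum>i=1..n. F (block_index B n i) (psum a (block_index B n i) (int i) w)))
   <= d B + \<rho> B * sqrt (real n)"
 obtains \<sigma> where "(\<lambda>n. l2 (S n) / sqrt (real n)) ----> \<sigma>"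
  "\<And>t. (\<lambda>n. LINT w|M. iexp (t * (S n w / sqrt (real n)))) ----> complex_of_real (exp (- (t^2 * \<sigma>^2 / 2)))"
proof -
 define R where "R B n w = (\<Sum>i=1..n. F (block_index B n i) (psum a (block_index B n i) (int i) w))" for B n w
 define good where "good B v \<longleftrightarrow> ((\<lambda>n. l2 (R B n) / sqrt (real n)) ----> v \<and>
  (\<forall>t. (\<lambda>n. LINT w|M. iexp (t * (R B n w / sqrt (real n)))) ----> complex_of_real (exp (- (t^2 * v^2 / 2)))))" for B v
 have "\<exists>v. 0 < B --> good B v" for B
 proof (cases "0 < B")
  case True
  show ?thesis
  proof (rule block_clt[OF True Fm Fb F0 mean], goal_cases)
   case (1 v)
   show ?case unfolding good_def R_def[abs_def] by (intro exI[of _ v] impI conjI allI 1)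
  qed
 qed blast
 then obtain v where "\<And>B. 0 < B ==> good B (v B)" by metis
 then have v: "\<And>B. 0 < B ==> (\<lambda>n. l2 (R B n) / sqrt (real n)) ----> v B"
  "\<And>B t. 0 < B ==> (\<lambda>n. LINT w|M. iexp (t * (R B n w / sqrt (real n)))) ----> complex_of_real (exp (- (t^2 * (v B)^2 / 2)))"
  unfolding good_def by (blast, blast)
 have bR: "bdd_rv (R B n)" for B n
  unfolding R_def[abs_def]
  by (intro bdd_rv_sum bdd_rvI[OF measurable_compose[OF psum_measurable Fm]]) (unfold real_norm_def, rule Fb)
 show ?thesis
  by (rule clt_by_approximation[where S = S and R = R and v = v and d = d and \<rho> = \<rho>, OF bS bR approx[folded R_def] \<rho> v that])
qed

end

lemma (in prob_space) expectation_fourier: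
 fixes A :: "real => complex" and Z :: "real => 'a => complex"
 assumes A: "integrable lborel A" and Z[measurable]: "(\<lambda>(t, w). Z t w) \<in> borel_measurable (borel \<Otimes>\<^sub>M M)"
  and c: "\<And>t w. cmod (Z t w) <= c"
 shows "(LINT w|M. LINT t|lborel. A t * Z t w) = (LINT t|lborel. A t * (LINT w|M. Z t w))"
  "\<And>w. w \<in> space M ==> integrable lborel (\<lambda>t. A t * Z t w)"
  "integrable M (\<lambda>w. LINT t|lborel. A t * Z t w)"
proof -
 interpret P: pair_sigma_finite lborel M ..
 have [measurable]: "A \<in> borel_measurable borel" using A by auto
 have [measurable]: "(\<lambda>x. Z (f x) (g x)) \<in> borel_measurable N"
  if "f \<in> borel_measurable N" "g \<in> measurable N M" for f g N
  using measurable_compose[OF measurable_Pair[OF that] Z] by simp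
 have le: "cmod (A t * Z t w) <= \<bar>cmod (A t) * c\<bar>" for t w
  using mult_left_mono[OF c[of t w] norm_ge_zero[of "A t"]] by (simp add: norm_mult)
 have int: "integrable (lborel \<Otimes>\<^sub>M M) (\<lambda>(t, w). A t * Z t w)"
 proof (rule integrable_bound)
  show "integrable (lborel \<Otimes>\<^sub>M M) (\<lambda>(t, w). cmod (A t) * c)"
   by (rule P.integrable_times[of "\<lambda>t. cmod (A t)" "\<lambda>_. c"]) (use A in auto)
 qed (use le in \<open>auto simp: split_beta'\<close>)
 show "(LINT w|M. LINT t|lborel. A t * Z t w) = (LINT t|lborel. A t * (LINT w|M. Z t w))"
  using P.Fubini_integral[OF int] by simp
 show "integrable M (\<lambda>w. LINT t|lborel. A t * Z t w)" by (rule P.integrable_snd[OF int])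
 show "integrable lborel (\<lambda>t. A t * Z t w)" if "w \<in> space M" for w
 proof (rule integrable_bound)
  show "integrable lborel (\<lambda>t. cmod (A t) * c)" using A by simp
 qed (use le that in auto)
qed

lemma (in prob_space) l2_cong_AE:
 assumes "AE w in M. f w = g w" and [measurable]: "f \<in> borel_measurable M" "g \<in> borel_measurable M"
 shows "l2 f = l2 g"
 unfolding l2_def using assms by (intro arg_cong[where f = sqrt] integral_cong_AE) auto

text \<open>The integral form of Minkowski's inequality for \<open>l2\<close>. Besides a Fourier
  weight, A can also be the kernel itself, as in \<open>smoothing_error_le\<close>.\<close>

lemma (in prob_space) l2_Re_fourier_le:
 fixes A :: "real => complex" and Z :: "real => 'a => complex"
 assumes A: "A \<in> borel_measurable borel" and Z: "(\<lambda>(t, w). Z t w) \<in> borel_measurable (borel \<Otimes>\<^sub>M M)"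
  and bm: "b \<in> borel_measurable borel" and b: "\<And>t. 0 <= b t"
  and Zb: "\<And>t. bdd_rv (Z t)" and le: "\<And>t. \<E> (\<lambda>w. (cmod (Z t w))^2) <= (b t)^2"
  and int: "integrable lborel (\<lambda>t. cmod (A t) * b t)"
  and S: "bdd_rv S" "AE w in M. S w = Re (LINT t|lborel. A t * Z t w)"
 shows "l2 S <= (LINT t|lborel. cmod (A t) * b t)"
proof -
 have I0: "0 <= (LINT t|lborel. cmod (A t) * b t)"
  by (intro integral_nonneg mult_nonneg_nonneg b) auto
 have "ennreal (\<E> (\<lambda>w. (S w)^2)) = (\<integral>\<^sup>+w. ennreal ((S w)^2) \<partial>M)"
  by (intro nn_integral_eq_integral[symmetric] bdd_rv_integrable bdd_rv_intros S) auto
 moreover have "(\<integral>\<^sup>+w. ennreal ((S w)^2) \<partial>M) <= (\<integral>\<^sup>+w. ennreal ((cmod (LINT t|lborel. A t * Z t w))^2) \<partial>M)"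
 proof (rule nn_integral_mono_AE)
  show "AE w in M. ennreal ((S w)^2) <= ennreal ((cmod (LINT t|lborel. A t * Z t w))^2)"
   using S(2)
  proof eventually_elim
   case (elim w)
   have "\<bar>S w\<bar> <= cmod (LINT t|lborel. A t * Z t w)" unfolding elim by (rule abs_Re_le_cmod)
   then have "(S w)^2 <= (cmod (LINT t|lborel. A t * Z t w))^2" by (rule power2_le_iff_abs_le[OF norm_ge_zero, THEN iffD2])
   then show ?case by (rule ennreal_leI)
  qed
 qed
 moreover have "(\<integral>\<^sup>+w. ennreal ((cmod (LINT t|lborel. A t * Z t w))^2) \<partial>M) <= ennreal ((LINT t|lborel. cmod (A t) * b t)^2)"
 proof (rule minkowski_integral[OF A Z bm b _ int])
  show "(\<integral>\<^sup>+w. ennreal ((cmod (Z t w))^2) \<partial>M) <= ennreal ((b t)^2)" for t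
  proof -
   have "(\<integral>\<^sup>+w. ennreal ((cmod (Z t w))^2) \<partial>M) = ennreal (\<E> (\<lambda>w. (cmod (Z t w))^2))"
    by (intro nn_integral_eq_integral bdd_rv_integrable bdd_rv_intros Zb) auto
   then show ?thesis using ennreal_leI[OF le[of t]] by (simp only:)
  qed
 qed
 ultimately have "ennreal (\<E> (\<lambda>w. (S w)^2)) <= ennreal ((LINT t|lborel. cmod (A t) * b t)^2)"
  by (metis (no_types, lifting) order_trans)
 then have "\<E> (\<lambda>w. (S w)^2) <= (LINT t|lborel. cmod (A t) * b t)^2"
  by (rule ennreal_le_iff[OF zero_le_power2, THEN iffD1])
 then show ?thesis
  unfolding l2_def using real_sqrt_le_mono[of _ "(LINT t|lborel. cmod (A t) * b t)^2"] I0 by (metis real_sqrt_abs abs_of_nonneg)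
qed

context noise
begin

text \<open>The ratio is the share of block positions that lack the innovation of lag m. It vanishes
  for each fixed m and is at most 1, so Tannery's theorem applies with the summable |a
  m|^\<gamma>.\<close>

lemma truncation_rate_tendsto:
 assumes "summable_coeffs a"
 shows "(\<lambda>B. \<Sum>m. \<bar>a m\<bar> powr \<gamma> * sqrt (real (min m B) / real B)) ----> 0"
proof -
 have "(\<lambda>B. \<bar>a m\<bar> powr \<gamma> * sqrt (real (min m B) / real B)) ----> 0" for m
 proof (rule Lim_null_comparison)
  show "\<forall>\<^sub>F B in sequentially. norm (\<bar>a m\<bar> powr \<gamma> * sqrt (real (min m B) / real B)) <= \<bar>a m\<bar> powr \<gamma> * sqrt (real m / real B)"
   by (intro always_eventually allI) (auto intro!: mult_left_mono divide_right_mono simp: abs_mult)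
  have "(\<lambda>B. \<bar>a m\<bar> powr \<gamma> * sqrt (real m / real B)) ----> \<bar>a m\<bar> powr \<gamma> * sqrt 0"
   by (intro tendsto_mult tendsto_const tendsto_real_sqrt lim_const_over_n)
  then show "(\<lambda>B. \<bar>a m\<bar> powr \<gamma> * sqrt (real m / real B)) ----> 0" by simp
 qed
 moreover have "eventually (\<lambda>(k, n). norm (\<bar>a k\<bar> powr \<gamma> * sqrt (real (min k n) / real n)) <= \<bar>a k\<bar> powr \<gamma>) (at_top \<times>\<^sub>F sequentially)"
 proof (intro always_eventually allI)
  fix x :: "nat \<times> nat"
  obtain k n where x: "x = (k, n)" by (cases x)
  have "sqrt (real (min k n) / real n) <= sqrt 1" by (intro real_sqrt_le_mono) (auto simp: divide_le_eq)
  then have "\<bar>a k\<bar> powr \<gamma> * sqrt (real (min k n) / real n) <= \<bar>a k\<bar> powr \<gamma> * 1" by (intro mult_left_mono) auto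
  then show "case x of (k, n) => norm (\<bar>a k\<bar> powr \<gamma> * sqrt (real (min k n) / real n)) <= \<bar>a k\<bar> powr \<gamma>"
   unfolding x by (simp add: abs_mult)
 qed
 ultimately show ?thesis
  using tannerys_theorem[of "\<lambda>k n. \<bar>a k\<bar> powr \<gamma> * sqrt (real (min k n) / real n)" "\<lambda>_. 0" sequentially "\<lambda>k. \<bar>a k\<bar> powr \<gamma>"] assms
  unfolding summable_coeffs_def by simp
qed

text \<open>Conjugated so that inversion uses e^{itx}, the same sign as the empirical characteristic
  functions.\<close>

definition fourier_weight :: "(nat => real) => real => complex" where
 "fourier_weight b t = cnj (cf b t) / (2 * pi)"

lemma fourier_weight_measurable[measurable]: "fourier_weight b \<in> borel_measurable borel"
proof -
 show ?thesis unfolding fourier_weight_def by measurable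
qed

lemma cmod_fourier_weight: "cmod (fourier_weight b t) = cmod (cf b t) / (2 * pi)"
 unfolding fourier_weight_def by (simp add: norm_divide norm_mult)

context
 fixes b :: "nat => real"
 assumes b: "two_coeffs b"
begin

lemma fourier_weight_powr_integrable:
 assumes "0 <= p" "p <= 2 * \<gamma>"
 shows "integrable lborel (\<lambda>t. cmod (fourier_weight b t) * \<bar>t\<bar> powr p)"
proof -
 have "integrable lborel (\<lambda>t. (cmod (cf b t) * \<bar>t\<bar> powr p) / (2 * pi))"
  using assms by (intro integrable_divide cf_weighted_integrable[OF b]) auto
 then show ?thesis unfolding cmod_fourier_weight by (simp only: times_divide_eq_left)
qed

lemma fourier_weight_integrable: "integrable lborel (fourier_weight b)"
proof (rule integrable_bound)
 show "integrable lborel (\<lambda>t. cmod (cf b t) / (2 * pi))" using cf_abs_integrable[OF b] by (rule integrable_divide)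
qed (use cmod_fourier_weight in \<open>auto simp: abs_mult\<close>)

lemma fourier_weight_mult_integrable:
 assumes [measurable]: "z \<in> borel_measurable borel" and "\<And>t. cmod (z t) <= c"
 shows "integrable lborel (\<lambda>t. fourier_weight b t * z t)"
proof (rule integrable_bound)
 show "integrable lborel (\<lambda>t. cmod (fourier_weight b t) * c)" using fourier_weight_integrable by simp
 have "cmod (fourier_weight b t * z t) <= \<bar>cmod (fourier_weight b t) * c\<bar>" for t
  using mult_left_mono[OF assms(2)[of t] norm_ge_zero[of "fourier_weight b t"]] by (simp add: norm_mult)
 then show "AE t in lborel. norm (fourier_weight b t * z t) <= norm (cmod (fourier_weight b t) * c)" by auto
qed measurable

lemma lin_density_eq: "lin_density b x = Re (LINT t|lborel. fourier_weight b t * iexp (t * x))"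
proof -
 have "(LINT t|lborel. fourier_weight b t * iexp (t * x)) = (LINT t|lborel. cnj (cf b t * iexp (- (t * x)))) / (2 * pi)"
  unfolding fourier_weight_def by (subst integral_divide_zero[symmetric], intro integral_cong refl) (simp add: exp_cnj)
 also have "... = cnj (complex_of_real (2 * pi * lin_density b x)) / (2 * pi)"
  unfolding integral_cnj lin_density_fourier[OF b] ..
 finally show ?thesis by simp
qed

lemma lin_density_centered:
 "lin_density b (x - u) - (LINT w|M. lin_density b (lin b 0 w - u))
  = Re (LINT t|lborel. fourier_weight b t * (iexp (- (t * u)) * (iexp (t * x) - cf b t)))"
proof -
 note [measurable] = lin_density_measurable[OF b]
 have iexp1: "cmod (iexp y) = 1" for y by (simp only: norm_exp_i_times)
 have shift: "iexp (t * (y - u)) = iexp (- (t * u)) * iexp (t * y)" for t y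
  by (simp add: algebra_simps flip: exp_add)
 have lm: "(\<lambda>(t, w). iexp (t * (lin b 0 w - u))) \<in> borel_measurable (borel \<Otimes>\<^sub>M M)"
  unfolding split_beta' by measurable
 have bd: "cmod (iexp (t * (lin b 0 w - u))) <= 1" for t w unfolding iexp1 by simp
 have "(LINT w|M. lin_density b (lin b 0 w - u)) = Re (LINT w|M. LINT t|lborel. fourier_weight b t * iexp (t * (lin b 0 w - u)))"
  unfolding lin_density_eq by (rule integral_Re[OF expectation_fourier(3)[OF fourier_weight_integrable lm bd]])
 also have "(LINT w|M. LINT t|lborel. fourier_weight b t * iexp (t * (lin b 0 w - u)))
   = (LINT t|lborel. fourier_weight b t * (LINT w|M. iexp (t * (lin b 0 w - u))))"
  by (rule expectation_fourier(1)[OF fourier_weight_integrable lm bd])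
 also have "... = (LINT t|lborel. fourier_weight b t * (iexp (- (t * u)) * cf b t))"
  unfolding shift cf_def by (simp only: integral_mult_right_zero)
 finally have E: "(LINT w|M. lin_density b (lin b 0 w - u)) = Re (LINT t|lborel. fourier_weight b t * (iexp (- (t * u)) * cf b t))" .
 have i1: "integrable lborel (\<lambda>t. fourier_weight b t * (iexp (- (t * u)) * iexp (t * x)))"
  by (rule fourier_weight_mult_integrable[where c = 1]) (measurable, simp only: norm_mult iexp1)
 have i2: "integrable lborel (\<lambda>t. fourier_weight b t * (iexp (- (t * u)) * cf b t))"
  by (rule fourier_weight_mult_integrable[where c = 1]) (measurable, simp only: norm_mult iexp1 mult_1 cf_le_1)
 have d: "lin_density b (x - u) = Re (LINT t|lborel. fourier_weight b t * (iexp (- (t * u)) * iexp (t * x)))"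
  unfolding lin_density_eq shift ..
 show ?thesis
  unfolding E d right_diff_distrib integral_diff[OF i1 i2] by simp
qed

end

text \<open>Inversion writes the centred f (X i) as an integral of centred exponentials. Replacing
  each by its conditional mean given the innovations in its block leaves a difference that
  \<open>lin_fourth_moment\<close> bounds at every frequency, with block positions as starting
  lags.\<close>

lemma clt_smooth:
 assumes a: "two_coeffs a"
 defines "S \<equiv> \<lambda>n v. \<Sum>i=1..n. lin_density a (lin a (int i) v) - (LINT v|M. lin_density a (lin a 0 v))"
 obtains \<sigma> where "(\<lambda>n. l2 (S n) / sqrt (real n)) ----> \<sigma>"
  "\<And>t. (\<lambda>n. LINT v|M. iexp (t * (S n v / sqrt (real n)))) ----> complex_of_real (exp (- (t^2 * \<sigma>^2 / 2)))"
proof -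
 note sa = two_coeffs_summable[OF a]
 note [measurable] = lin_density_measurable[OF a]
 define A where "A = fourier_weight a"
 have Am[measurable]: "A \<in> borel_measurable borel" unfolding A_def by measurable
 have Ai: "integrable lborel A" unfolding A_def by (rule fourier_weight_integrable[OF a])
 have Ag: "integrable lborel (\<lambda>t. cmod (A t) * \<bar>t\<bar> powr \<gamma>)"
  unfolding A_def using gamma by (intro fourier_weight_powr_integrable a) auto
 have iexp1: "cmod (iexp y) = 1" for y by (simp only: norm_exp_i_times)
 \<comment> \<open>The conditional mean, given that the s most recent innovations contribute u, of
   the exponential minus its mean. For s = 0 and u = 0 it vanishes, which gives F 0 0 = 0.\<close>
 define z where "z s u t = iexp (t * u) * cf (\<lambda>l. a (l + s)) t - cf a t" for s u t
 have zb: "cmod (z s u t) <= 2" for s u t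
 proof -
  have "cmod (z s u t) <= cmod (iexp (t * u) * cf (\<lambda>l. a (l + s)) t) + cmod (cf a t)" unfolding z_def by (rule norm_triangle_ineq4)
  also have "... <= 1 + 1" unfolding norm_mult iexp1 by (intro add_mono cf_le_1) (simp add: cf_le_1)
  finally show ?thesis by simp
 qed
 have zm: "(\<lambda>(t, u). z s u t) \<in> borel_measurable (borel \<Otimes>\<^sub>M borel)" for s
  unfolding z_def split_beta' by measurable
 define F where "F s u = Re (LINT t|lborel. A t * z s u t)" for s u
 have Fm: "F s \<in> borel_measurable borel" for s
 proof -
  have [measurable]: "(\<lambda>(u, t). z s u t) \<in> borel_measurable (borel \<Otimes>\<^sub>M borel)"
   unfolding z_def split_beta' by measurable
  show ?thesis unfolding F_def by measurable
 qed
 have Azi: "integrable lborel (\<lambda>t. A t * z s u t)" for s u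
  unfolding A_def by (rule fourier_weight_mult_integrable[OF a _ zb]) (unfold z_def, measurable)
 have Fb: "\<bar>F s u\<bar> <= (LINT t|lborel. cmod (A t) * 2)" for s u
 proof -
  have "\<bar>F s u\<bar> <= cmod (LINT t|lborel. A t * z s u t)" unfolding F_def by (rule abs_Re_le_cmod)
  also have "... <= (LINT t|lborel. cmod (A t * z s u t))" by (rule integral_norm_bound)
  also have "... <= (LINT t|lborel. cmod (A t) * 2)"
   using Ai Azi[of s u] by (intro integral_mono integrable_norm) (auto simp: norm_mult intro!: mult_left_mono zb)
  finally show ?thesis .
 qed
 have F0: "F 0 0 = 0" unfolding F_def z_def by simp
 have zQ: "(\<lambda>(t, v). z s (Q v) t) \<in> borel_measurable (borel \<Otimes>\<^sub>M M)" if [measurable]: "Q \<in> borel_measurable M" for s Q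
  unfolding z_def split_beta' by measurable
 have EF: "(LINT v|M. F s (Q v)) = Re (LINT t|lborel. A t * (LINT v|M. z s (Q v) t))" if Q: "Q \<in> borel_measurable M" for s Q
  unfolding F_def using expectation_fourier[OF Ai zQ[OF Q] zb] by (simp only: integral_Re)
 have Ez: "(LINT v|M. z s (Q v) t) = (LINT v|M. iexp (t * Q v)) * cf (\<lambda>l. a (l + s)) t - cf a t" if [measurable]: "Q \<in> borel_measurable M" for s Q t
 proof -
  have "bdd_rv (\<lambda>v. iexp (t * Q v))" by (intro bdd_rv_iexp) measurable
  then have "integrable M (\<lambda>v. iexp (t * Q v))" by (rule bdd_rv_integrable)
  then have i2: "integrable M (\<lambda>v. iexp (t * Q v) * cf (\<lambda>l. a (l + s)) t)" by (rule integrable_mult_left)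
  show ?thesis
   unfolding z_def integral_diff[OF i2 integrable_const] integral_mult_left_zero
   by (simp only: lebesgue_integral_const prob_space scaleR_one)
 qed
 have mean: "(LINT v|M. F s (psum a s i v)) = 0" for s i
 proof -
  have "(LINT v|M. z s (psum a s i v) t) = 0" for t
  proof -
   have "(LINT v|M. iexp (t * psum a s i v)) = cf (\<lambda>l. if l < s then a l else 0) t"
    unfolding psum_eq_lin by (intro expectation_iexp_lin summable_coeffs_finite[of s]) auto
   then show ?thesis unfolding Ez[OF psum_measurable] using cf_mult[OF sa, of t s] by simp
  qed
  then show ?thesis unfolding EF[OF psum_measurable] by simp
 qed
 define R where "R B n v = (\<Sum>i=1..n. F (block_index B n i) (psum a (block_index B n i) (int i) v))" for B n v
 have S_term: "lin_density a x - (LINT v|M. lin_density a (lin a 0 v)) = Re (LINT t|lborel. A t * (iexp (t * x) - cf a t))" for x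
  using lin_density_centered[OF a, of x 0] unfolding A_def by simp
 have bS: "bdd_rv (S n)" for n
  unfolding S_def
 proof (intro bdd_rv_sum bdd_rv_diff bdd_rv_const)
  show "bdd_rv (\<lambda>v. lin_density a (lin a (int i) v))" for i
   by (rule bdd_rvI[where B = "density_bound a"]) (auto simp: lin_density_le[OF a] lin_density_nonneg[OF a])
 qed
 have bR: "bdd_rv (R B n)" for B n
  unfolding R_def[abs_def]
  by (intro bdd_rv_sum bdd_rvI[OF measurable_compose[OF psum_measurable Fm]]) (unfold real_norm_def, rule Fb)
 define K where "K = (LINT t|lborel. cmod (A t) * \<bar>t\<bar> powr \<gamma>) * (4 * root_c)"
 \<comment> \<open>By \<open>card_block_index_le\<close> and subadditivity of the square root, the
   bound for lag m splits into a part sqrt B, collected in d, and a part proportional to sqrt n,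
   collected here.\<close>
 define \<rho> where "\<rho> B = K * (\<Sum>m. \<bar>a m\<bar> powr \<gamma> * sqrt (real (min m B) / real B))" for B
 define d where "d B = K * (sqrt (real B) * coeff_norm a)" for B
 have K0: "0 <= K" unfolding K_def using root_c_nonneg
  by (intro mult_nonneg_nonneg integral_nonneg) auto
 have \<rho>: "\<rho> ----> 0"
  unfolding \<rho>_def[abs_def] using tendsto_mult[OF tendsto_const[of K] truncation_rate_tendsto[OF sa]] by simp
 have approx: "l2 (\<lambda>v. S n v - R B n v) <= d B + \<rho> B * sqrt (real n)" if B: "0 < B" for B n
 proof -
  let ?s = "\<lambda>i. block_index B n (nat i)"
  let ?I = "int ` {1..n}"
  define Z where "Z t v = (\<Sum>i\<in>?I. iexp (t * lin a i v) - iexp (t * psum a (?s i) i v) * cf (\<lambda>l. a (l + ?s i)) t)" for t v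
  define Q where "Q = (\<Sum>m. \<bar>a m\<bar> powr \<gamma> * sqrt (real (card {i\<in>?I. ?s i <= m})))"
  have s1: "summable (\<lambda>m. \<bar>a m\<bar> powr \<gamma> * sqrt (real (min m B) / real B))"
  proof (rule summable_comparison_test')
   show "summable (\<lambda>m. \<bar>a m\<bar> powr \<gamma>)" using sa by (simp add: summable_coeffs_def)
   fix m :: nat
   have "sqrt (real (min m B) / real B) <= sqrt 1" using B by (intro real_sqrt_le_mono) auto
   then have "\<bar>a m\<bar> powr \<gamma> * sqrt (real (min m B) / real B) <= \<bar>a m\<bar> powr \<gamma> * 1" by (intro mult_left_mono) auto
   then show "norm (\<bar>a m\<bar> powr \<gamma> * sqrt (real (min m B) / real B)) <= \<bar>a m\<bar> powr \<gamma>" by (simp add: abs_mult)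
  qed
  have s2: "summable (\<lambda>m. \<bar>a m\<bar> powr \<gamma>)" using sa by (simp add: summable_coeffs_def)
  have card: "sqrt (real (card {i\<in>?I. ?s i <= m})) <= sqrt (real B) + sqrt (real n) * sqrt (real (min m B) / real B)" for m
  proof -
   have "{i\<in>?I. ?s i <= m} = int ` {i\<in>{1..n}. block_index B n i <= m}" by auto
   then have "card {i\<in>?I. ?s i <= m} = card {i\<in>{1..n}. block_index B n i <= m}" by (simp add: card_image)
   then have "sqrt (real (card {i\<in>?I. ?s i <= m})) <= sqrt (real B + real n * (real (min m B) / real B))"
    using card_block_index_le[OF B, of n m] by (intro real_sqrt_le_mono) (simp only:)
   also have "... <= sqrt (real B) + sqrt (real n * (real (min m B) / real B))" by (intro sqrt_add_le_add_sqrt) auto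
   finally show ?thesis by (simp only: real_sqrt_mult)
  qed
  have tm: "\<bar>a m\<bar> powr \<gamma> * sqrt (real (card {i\<in>?I. ?s i <= m}))
    <= \<bar>a m\<bar> powr \<gamma> * sqrt (real B) + sqrt (real n) * (\<bar>a m\<bar> powr \<gamma> * sqrt (real (min m B) / real B))" for m
   using mult_left_mono[OF card[of m], of "\<bar>a m\<bar> powr \<gamma>"] by (simp add: distrib_left mult_ac)
  have s3: "summable (\<lambda>m. \<bar>a m\<bar> powr \<gamma> * sqrt (real B) + sqrt (real n) * (\<bar>a m\<bar> powr \<gamma> * sqrt (real (min m B) / real B)))"
   by (intro summable_add summable_mult summable_mult2 s1 s2)
  have s4: "summable (\<lambda>m. \<bar>a m\<bar> powr \<gamma> * sqrt (real (card {i\<in>?I. ?s i <= m})))"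
   by (rule summable_comparison_test'[OF s3]) (use tm in \<open>simp add: abs_mult\<close>)
  have "Q <= (\<Sum>m. \<bar>a m\<bar> powr \<gamma> * sqrt (real B) + sqrt (real n) * (\<bar>a m\<bar> powr \<gamma> * sqrt (real (min m B) / real B)))"
   unfolding Q_def by (intro suminf_le tm s3 s4)
  also have "... = coeff_norm a * sqrt (real B) + sqrt (real n) * (\<Sum>m. \<bar>a m\<bar> powr \<gamma> * sqrt (real (min m B) / real B))"
   unfolding coeff_norm_def
   by (subst suminf_add[symmetric]) (simp_all only: summable_mult summable_mult2 s1 s2 suminf_mult suminf_mult2)
  finally have Q_le: "Q <= coeff_norm a * sqrt (real B) + sqrt (real n) * (\<Sum>m. \<bar>a m\<bar> powr \<gamma> * sqrt (real (min m B) / real B))" .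
  have QK: "K * Q <= d B + \<rho> B * sqrt (real n)"
   using mult_left_mono[OF Q_le K0] unfolding d_def \<rho>_def by (simp only: distrib_left mult_ac)
  have Q0: "0 <= Q" unfolding Q_def by (intro suminf_nonneg s4) auto
  have "l2 (\<lambda>v. S n v - R B n v) <= (LINT t|lborel. cmod (A t) * (4 * root_c * \<bar>t\<bar> powr \<gamma> * Q))"
  proof (rule l2_Re_fourier_le[OF Am])
   show "(\<lambda>(t, v). Z t v) \<in> borel_measurable (borel \<Otimes>\<^sub>M M)" unfolding Z_def split_beta' by measurable
   show bZ: "bdd_rv (Z t)" for t unfolding Z_def[abs_def] by (intro bdd_rv_intros; simp)
   show "0 <= 4 * root_c * \<bar>t\<bar> powr \<gamma> * Q" for t using root_c_nonneg Q0 by simp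
   then show "\<E> (\<lambda>v. (cmod (Z t v))^2) <= (4 * root_c * \<bar>t\<bar> powr \<gamma> * Q)^2" for t
    using lin_fourth_moment[OF sa, of ?I t ?s] unfolding Q_def Z_def
    by (intro expectation_square_le_of_fourth bZ[unfolded Z_def[abs_def]]) auto
   have "integrable lborel (\<lambda>t. (cmod (A t) * \<bar>t\<bar> powr \<gamma>) * (4 * root_c * Q))" using Ag by (rule integrable_mult_left)
   then show "integrable lborel (\<lambda>t. cmod (A t) * (4 * root_c * \<bar>t\<bar> powr \<gamma> * Q))" by (simp add: mult_ac)
   show "bdd_rv (\<lambda>v. S n v - R B n v)" by (intro bdd_rv_diff bS bR)
   show "AE v in M. S n v - R B n v = Re (LINT t|lborel. A t * Z t v)"
   proof (rule AE_I2)
    fix v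
    let ?u = "\<lambda>i. psum a (block_index B n i) (int i) v"
    let ?w = "\<lambda>i t. A t * (iexp (t * lin a (int i) v) - cf a t) - A t * z (block_index B n i) (?u i) t"
    have wi: "integrable lborel (\<lambda>t. A t * (iexp (t * lin a (int i) v) - cf a t))" for i
     unfolding A_def
     by (intro fourier_weight_mult_integrable[OF a, where c = 2]) (measurable, rule iexp_minus_cf_le)
    have "S n v - R B n v = (\<Sum>i=1..n. Re (LINT t|lborel. ?w i t))"
     unfolding S_def R_def sum_subtractf[symmetric] S_term F_def integral_diff[OF wi Azi] by simp
    also have "... = Re (LINT t|lborel. (\<Sum>i=1..n. ?w i t))"
     by (subst integral_sum) (intro integrable_diff wi Azi, simp)
    also have "(\<lambda>t. \<Sum>i=1..n. ?w i t) = (\<lambda>t. A t * Z t v)"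
    proof
     fix t
     have "Z t v = (\<Sum>i=1..n. iexp (t * lin a (int i) v) - iexp (t * ?u i) * cf (\<lambda>l. a (l + block_index B n i)) t)"
      unfolding Z_def by (subst sum.reindex) (auto simp: comp_def)
     then show "(\<Sum>i=1..n. ?w i t) = A t * Z t v"
      unfolding z_def by (simp only: sum_distrib_left) (intro sum.cong refl, simp only: right_diff_distrib, simp)
    qed
    finally show "S n v - R B n v = Re (LINT t|lborel. A t * Z t v)" .
   qed
  qed measurable
  also have "(LINT t|lborel. cmod (A t) * (4 * root_c * \<bar>t\<bar> powr \<gamma> * Q)) = K * Q"
  proof -
   have "(LINT t|lborel. cmod (A t) * (4 * root_c * \<bar>t\<bar> powr \<gamma> * Q)) = (LINT t|lborel. (cmod (A t) * \<bar>t\<bar> powr \<gamma>) * (4 * root_c * Q))"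
    by (simp add: mult_ac)
   then show ?thesis unfolding K_def by simp
  qed
  finally show ?thesis using QK by linarith
 qed
 show ?thesis
  by (rule clt_by_blocks[where d = d and \<rho> = \<rho>, OF Fm Fb F0 mean bS \<rho> approx[unfolded R_def] that])
qed

end

lemma density_real_unique:
 fixes f g :: "real => real"
 assumes [measurable]: "f \<in> borel_measurable borel" "g \<in> borel_measurable borel"
  and "\<And>x. 0 <= f x" "\<And>x. 0 <= g x"
  and "density lborel (\<lambda>x. ennreal (f x)) = density lborel (\<lambda>x. ennreal (g x))"
 shows "AE x in lborel. f x = g x"
proof -
 have "AE x in lborel. ennreal (f x) = ennreal (g x)"
  using assms(5) by (subst (asm) sigma_finite_measure.density_unique_iff[OF lborel.sigma_finite_measure_axioms]) auto
 then show ?thesis by eventually_elim (use assms(3,4) in \<open>simp add: ennreal_inj\<close>)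
qed

context split_process
begin

lemma distr_X: "distr M borel (X i) = distr M borel (lin a 0)"
proof -
 have "distr M borel (X i) = distr M borel (lin a i)"
  by (rule distr_cong_AE) (use AE_X_eq_lin in \<open>auto intro: lin_measurable\<close>)
 then show ?thesis using distr_lin[OF sa] by metis
qed

lemma expectation_X:
 fixes g :: "real => 'b::{banach, second_countable_topology}"
 assumes [measurable]: "g \<in> borel_measurable borel"
 shows "(LINT w|M. g (X i w)) = (LINT x|distr M borel (lin a 0). g x)"
 unfolding distr_X[of i, symmetric] by (rule integral_distr[symmetric]) auto

lemma finite_lag_orthogonal:
 assumes fin: "\<forall>l\<ge>L. a l = 0" and [measurable]: "g \<in> borel_measurable borel" and gb: "\<And>x. \<bar>g x\<bar> <= c"
  and mean: "(LINT w|M. g (X 0 w)) = 0" and ij: "i + L <= j"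
 shows "(LINT w|M. g (X (int i) w) * g (X (int j) w)) = (0::real)"
proof -
 have X: "X (int j) = U (int j)" using fin by (auto simp: X_def W_def lin_def)
 have b: "integrable M (\<lambda>w. g (X z w))" for z
  by (intro bdd_rv_integrable bdd_rvI[where B = c]) (auto simp: gb)
 have "indep_var borel (\<lambda>w. g (X (int i) w)) borel (\<lambda>w. g (X (int j) w))"
 proof (rule indep_noise_alg)
  show "{..int i} \<inter> {int j - int L<..int j} = {}" using ij by auto
  show "(\<lambda>w. g (X (int i) w)) \<in> borel_measurable (noise_alg {..int i})"
   by (rule measurable_compose[OF X_noise_alg]) measurable
  show "(\<lambda>w. g (X (int j) w)) \<in> borel_measurable (noise_alg {int j - int L<..int j})"
   unfolding X by (rule measurable_compose[OF U_noise_alg]) measurable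
 qed
 then have "(LINT w|M. g (X (int i) w) * g (X (int j) w)) = (LINT w|M. g (X (int i) w)) * (LINT w|M. g (X (int j) w))"
  by (rule indep_var_lebesgue_integral[OF _ b b])
 also have "(LINT w|M. g (X (int j) w)) = (LINT w|M. g (X 0 w))" unfolding expectation_X[OF assms(2)] ..
 finally show ?thesis by (simp add: mean)
qed

text \<open>Here g is merely bounded and measurable, so no Fourier argument is available. Instead a
  term whose block position is at least L is already a function of its block, and the others, about
  n L / B + B in number, are dropped; orthogonality beyond lag L bounds the second moment of their
  sum.\<close>

lemma clt_finite:
 assumes fin: "\<forall>l\<ge>L. a l = 0" and gm[measurable]: "g \<in> borel_measurable borel" and gb: "\<And>x. \<bar>g x\<bar> <= c"
  and mean: "(LINT w|M. g (X 0 w)) = 0"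
 defines "S \<equiv> \<lambda>n w. \<Sum>i=1..n. g (X (int i) w)"
 obtains \<sigma> :: real where "(\<lambda>n. l2 (S n) / sqrt (real n)) ----> \<sigma>"
  "\<And>t. (\<lambda>n. LINT w|M. iexp (t * (S n w / sqrt (real n)))) ----> complex_of_real (exp (- (t^2 * \<sigma>^2 / 2)))"
proof -
 \<comment> \<open>For s at least L the partial sum is all of X, so g can be evaluated exactly;
   smaller block positions, including the index 0 of leftover terms, are set to 0.\<close>
 define F where "F s u = (if L <= s then g u else 0)" for s u
 have Fm: "F s \<in> borel_measurable borel" for s unfolding F_def by measurable
 have c0: "0 <= c" using gb[of 0] by linarith
 have Fb: "\<bar>F s u\<bar> <= c" for s u unfolding F_def using gb c0 by simp
 have F0: "F 0 0 = 0" unfolding F_def using L_pos by simp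
 have psum_X: "psum a s i w = X i w" if "L <= s" for s i w
 proof -
  have "psum a s i w = psum a L i w"
   unfolding psum_def using fin that by (intro sum.mono_neutral_right) auto
  then show ?thesis using fin by (simp add: X_def U_def W_def lin_def)
 qed
 have mean': "(LINT w|M. F s (psum a s i w)) = 0" for s i
 proof (cases "L <= s")
  case True
  have "(LINT w|M. g (X i w)) = (LINT w|M. g (X 0 w))" unfolding expectation_X[OF gm] ..
  then show ?thesis using True by (simp add: F_def psum_X mean)
 qed (simp add: F_def)
 define R where "R B n w = (\<Sum>i=1..n. F (block_index B n i) (psum a (block_index B n i) (int i) w))" for B n w
 have bg: "bdd_rv (\<lambda>w. g (X z w))" for z
  by (rule bdd_rvI[where B = c]) (auto simp: gb)
 have bS: "bdd_rv (S n)" for n unfolding S_def by (intro bdd_rv_sum bg)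
 have bR: "bdd_rv (R B n)" for B n
  unfolding R_def[abs_def]
  by (intro bdd_rv_sum bdd_rvI[OF measurable_compose[OF psum_measurable Fm]]) (unfold real_norm_def, rule Fb)
 define q where "q = 2 * real L * c^2"
 have q0: "0 <= q" unfolding q_def by simp
 define d where "d B = sqrt (q * real B)" for B
 define \<rho> where "\<rho> B = sqrt (q * real L / real B)" for B
 have \<rho>: "\<rho> ----> 0"
  unfolding \<rho>_def[abs_def] using tendsto_real_sqrt[OF lim_const_over_n[of "q * real L"]] by simp
 have approx: "l2 (\<lambda>w. S n w - R B n w) <= d B + \<rho> B * sqrt (real n)" if B: "0 < B" for B n
 proof -
  let ?J = "{i\<in>{1..n}. block_index B n i < L}"
  have eq: "S n w - R B n w = (\<Sum>i\<in>?J. g (X (int i) w))" for w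
  proof -
   have "S n w - R B n w = (\<Sum>i=1..n. if block_index B n i < L then g (X (int i) w) else 0)"
    unfolding S_def R_def sum_subtractf[symmetric] F_def by (intro sum.cong) (auto simp: psum_X)
   also have "... = (\<Sum>i\<in>?J. g (X (int i) w))" by (rule sum.inter_filter[symmetric]) simp
   finally show ?thesis .
  qed
  have "{i\<in>{1..n}. block_index B n i < L} = {i\<in>{1..n}. block_index B n i <= L - 1}" using L_pos by auto
  then have card: "real (card ?J) <= real B + real n * (real L / real B)"
  proof -
   assume J: "{i\<in>{1..n}. block_index B n i < L} = {i\<in>{1..n}. block_index B n i <= L - 1}"
   have "real (card ?J) <= real B + real n * (real (min (L - 1) B) / real B)"
    unfolding J by (rule card_block_index_le[OF B])
   also have "... <= real B + real n * (real L / real B)"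
    by (intro add_left_mono mult_left_mono divide_right_mono) auto
   finally show ?thesis .
  qed
  have "\<E> (\<lambda>w. (\<Sum>i\<in>?J. g (X (int i) w))^2) <= 2 * real L * (\<Sum>i\<in>?J. \<E> (\<lambda>w. (g (X (int i) w))^2))"
   by (rule expectation_lag_orthogonal) (auto intro!: bg finite_lag_orthogonal[OF fin gm gb mean])
  also have "... <= 2 * real L * (\<Sum>i\<in>?J. c^2)"
  proof (intro mult_left_mono sum_mono)
   fix i
   have "\<E> (\<lambda>w. (g (X (int i) w))^2) <= \<E> (\<lambda>w. c^2)"
    by (intro integral_mono bdd_rv_integrable bdd_rv_intros bg abs_le_square_iff[THEN iffD1]) (use gb c0 in auto)
   then show "\<E> (\<lambda>w. (g (X (int i) w))^2) <= c^2" by (simp add: prob_space)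
  qed auto
  also have "... = q * real (card ?J)" unfolding q_def by simp
  also have "... <= q * (real B + real n * (real L / real B))" by (intro mult_left_mono card q0)
  also have "... = q * real B + q * real L / real B * real n" by (simp add: distrib_left)
  finally have "l2 (\<lambda>w. S n w - R B n w) <= sqrt (q * real B + q * real L / real B * real n)"
   unfolding l2_def eq by (rule real_sqrt_le_mono)
  also have "... <= sqrt (q * real B) + sqrt (q * real L / real B * real n)"
   using q0 by (intro sqrt_add_le_add_sqrt) auto
  finally show ?thesis unfolding d_def \<rho>_def real_sqrt_mult[of "q * real L / real B"] .
 qed
 show ?thesis
  by (rule clt_by_blocks[where d = d and \<rho> = \<rho>, OF Fm Fb F0 mean' bS \<rho> approx[unfolded R_def] that])
qed

lemma smooth_two_coeffs: "two_coeffs (\<lambda>l. if l < L \<and> l \<noteq> s then a l else 0) ==> two_coeffs a"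
 using sa unfolding two_coeffs_def by metis

text \<open>In the smooth case f is replaced by the density obtained from inversion, which agrees
  with it almost everywhere and hence along the process almost surely.\<close>

theorem clt_density:
 assumes fm[measurable]: "f \<in> borel_measurable borel" and f0: "\<And>x. 0 <= f x" and fb: "\<And>x. f x <= C"
  and dens: "distr M borel (lin a 0) = density lborel (\<lambda>x. ennreal (f x))"
 defines "S \<equiv> \<lambda>n w. \<Sum>i=1..n. f (X (int i) w) - (LINT w|M. f (X 0 w))"
 obtains \<sigma> :: real where "(\<lambda>n. l2 (S n) / sqrt (real n)) ----> \<sigma>"
  "\<And>t. (\<lambda>n. LINT w|M. iexp (t * (S n w / sqrt (real n)))) ----> complex_of_real (exp (- (t^2 * \<sigma>^2 / 2)))"
proof -
 consider (fin) "\<forall>l\<ge>L. a l = 0" | (smooth) "two_coeffs a"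
  using finite_or_smooth smooth_two_coeffs by blast
 then show ?thesis
 proof cases
  case fin
  have C: "0 <= C" using f0[of 0] fb[of 0] by linarith
  have E: "\<bar>LINT w|M. f (X 0 w)\<bar> <= C"
  proof -
   have "\<bar>LINT w|M. f (X 0 w)\<bar> <= (LINT w|M. \<bar>f (X 0 w)\<bar>)" using integral_norm_bound[of M "\<lambda>w. f (X 0 w)"] by simp
   also have "... <= (LINT w|M. C)"
    by (intro integral_mono bdd_rv_integrable bdd_rvI[where B = C]) (auto simp: f0 fb C)
   finally show ?thesis by (simp add: prob_space)
  qed
  have i: "integrable M (\<lambda>w. f (X 0 w))"
   by (intro bdd_rv_integrable bdd_rvI[where B = C]) (auto simp: f0 fb)
  show ?thesis
  proof (rule clt_finite[OF fin, of "\<lambda>x. f x - (LINT w|M. f (X 0 w))" "C + C"])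
   show "\<bar>f x - (LINT w|M. f (X 0 w))\<bar> <= C + C" for x
    using E f0[of x] fb[of x] by linarith
   show "(LINT w|M. f (X 0 w) - (LINT w|M. f (X 0 w))) = 0"
    using i by (simp add: prob_space)
  qed (use that in \<open>simp_all add: S_def\<close>)
 next
  case smooth
  note [measurable] = lin_density_measurable[OF smooth]
  have "AE x in lborel. f x = lin_density a x"
   using dens unfolding distr_lin_density[OF smooth]
   by (intro density_real_unique) (auto simp: f0 lin_density_nonneg[OF smooth])
  then have ae: "AE x in distr M borel (lin a 0). f x = lin_density a x"
   unfolding dens by (subst AE_density) auto
  have aeX: "AE w in M. f (X i w) = lin_density a (lin a i w)" for i
  proof -
   have "AE w in M. f (lin a i w) = lin_density a (lin a i w)"
    using ae unfolding distr_lin[OF sa, of 0 i] by (subst (asm) AE_distr_iff) (auto intro: lin_measurable)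
   then show ?thesis using AE_X_eq_lin by eventually_elim simp
  qed
  let ?S = "\<lambda>n w. \<Sum>i=1..n. lin_density a (lin a (int i) w) - (LINT w|M. lin_density a (lin a 0 w))"
  have mean: "(LINT w|M. f (X 0 w)) = (LINT w|M. lin_density a (lin a 0 w))"
   by (rule integral_cong_AE) (use aeX[of 0] in auto)
  have S: "AE w in M. S n w = ?S n w" for n
  proof -
   have "AE w in M. \<forall>i\<in>{1..n}. f (X (int i) w) = lin_density a (lin a (int i) w)"
    by (rule AE_finite_allI) (use aeX in auto)
   then show ?thesis unfolding S_def mean by eventually_elim (intro sum.cong; simp)
  qed
  have Sm[measurable]: "S n \<in> borel_measurable M" "?S n \<in> borel_measurable M" for n unfolding S_def by measurable
  have 1: "l2 (S n) = l2 (?S n)" for n by (rule l2_cong_AE[OF S Sm])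
  have 2: "(LINT w|M. iexp (t * (S n w / sqrt (real n)))) = (LINT w|M. iexp (t * (?S n w / sqrt (real n))))" for t n
   by (rule integral_cong_AE) (use S[of n] in auto)
  show ?thesis
  proof (rule clt_smooth[OF smooth], goal_cases)
   case (1 \<sigma>)
   show ?case by (rule that[of \<sigma>]) (unfold \<open>\<And>n. l2 (S n) = l2 (?S n)\<close> 2, fact 1, fact 1)
  qed
 qed
qed

end

section \<open>Smoothing error\<close>

lemma (in bounded_density) increment_square:
 shows "(LINT x|lborel. (f (x - u) - f x)^2) = 2 * (autocorr f 0 - autocorr f (- u))"
  "integrable lborel (\<lambda>x. (f (x - u) - f x)^2)"
proof -
 have e: "(f (x - u) - f x)^2 = f (x - u) * f (x - u + 0) + f x * f (x + 0) - 2 * (f x * f (x + - u))" for x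
  by (simp add: power2_eq_square algebra_simps)
 have i1: "integrable lborel (\<lambda>x. f (x - u) * f (x - u + 0))"
  using lborel_integrable_real_affine[OF integrable_autocorr[of 0], of 1 "- u"] by (simp add: add.commute)
 have l1: "(LINT x|lborel. f (x - u) * f (x - u + 0)) = autocorr f 0"
  unfolding autocorr_def
  by (subst (2) lborel_integral_real_affine[where c = 1 and t = "- u"]) (simp_all add: add.commute)
 note i2 = integrable_autocorr[of 0] and i3 = integrable_mult_right[OF integrable_autocorr[of "- u"], of 2]
 show "integrable lborel (\<lambda>x. (f (x - u) - f x)^2)"
  unfolding e by (intro integrable_add integrable_diff i1 i2 i3)
 show "(LINT x|lborel. (f (x - u) - f x)^2) = 2 * (autocorr f 0 - autocorr f (- u))"
  unfolding e integral_diff[OF integrable_add[OF i1 i2] i3]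
   integral_add[OF i1 i2] l1 integral_mult_right_zero by (simp add: autocorr_def)
qed

lemma AE_lborel_uminus:
 fixes P :: "real => bool"
 assumes "AE v in lborel. P v"
 shows "AE v in lborel. P (- v)"
proof -
 have "AE v in distr lborel borel uminus. P v" unfolding lborel_distr_uminus by (rule assms)
 then show ?thesis by (intro AE_distrD[of uminus lborel borel]) auto
qed

lemma (in noise) cf_square_weighted_integrable:
 assumes b: "summable_coeffs b" "b l \<noteq> 0" and p: "0 <= p" "p <= 2 * \<gamma>"
 shows "integrable lborel (\<lambda>t. \<bar>t\<bar> powr p * (cmod (cf b t))^2)"
proof (rule integrable_bound)
 show "integrable lborel (\<lambda>t. \<bar>t\<bar> powr p * (cmod (\<phi> (b l * t)))^2)"
  by (rule phi_weighted_integrable[OF p b(2)])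
 have "cmod (cf b t) <= cmod (\<phi> (b l * t))" for t
  using cf_le_prod[OF b(1), of "{l}" t] by simp
 then have "\<bar>t\<bar> powr p * (cmod (cf b t))^2 <= \<bar>t\<bar> powr p * (cmod (\<phi> (b l * t)))^2" for t
  by (intro mult_left_mono power_mono) auto
 then show "AE t in lborel. norm (\<bar>t\<bar> powr p * (cmod (cf b t))^2) <= norm (\<bar>t\<bar> powr p * (cmod (\<phi> (b l * t)))^2)"
  by (intro AE_I2) (simp add: abs_mult)
qed measurable

locale density_process = split_process M \<epsilon> \<phi> \<gamma> c_4 a L C_U + bounded_density f C
 for M :: "'a measure" and \<epsilon> :: "int => 'a => real" and \<phi> :: "real => complex" and \<gamma> c_4 :: real
  and a :: "nat => real" and L :: nat and C_U :: real and f :: "real => real" and C :: real +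
 assumes law_X: "distr M borel (lin a 0) = law"
begin

lemma abs_f_le: "\<bar>f x\<bar> <= C" using f_nonneg[of x] f_le[of x] by simp

lemma bounded_f: "Y \<in> borel_measurable M ==> bdd_rv (\<lambda>w. f (Y w))"
 using abs_f_le by (intro bdd_rvI[where B = C] measurable_compose[OF _ f_measurable]) auto

lemma expectation_X_density:
 fixes g :: "real => real"
 assumes [measurable]: "g \<in> borel_measurable borel"
 shows "(LINT w|M. g (X i w)) = (LINT x|lborel. f x * g x)"
 unfolding expectation_X[OF assms] law_X
 by (subst integral_real_density) (auto simp: f_nonneg)

definition holder_const :: real where
 "holder_const = (LINT t|lborel. \<bar>t\<bar> powr (2 * \<gamma>) * (cmod (cf a t))^2) / pi"

lemma holder_const_nonneg: "0 <= holder_const"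
 unfolding holder_const_def by (intro divide_nonneg_nonneg integral_nonneg) auto

lemma AE_autocorr_le: "AE v in lborel. \<bar>autocorr f v - autocorr f 0\<bar> <= holder_const * \<bar>v\<bar> powr (2 * \<gamma>)"
proof -
 obtain l where l: "a l \<noteq> 0" using a_nonzero by blast
 have char: "char law t = cf a t" for t unfolding law_X[symmetric] by (rule cf_eq_char[OF sa])
 have "integrable lborel (\<lambda>t. \<bar>t\<bar> powr 0 * (cmod (cf a t))^2)"
  using gamma by (intro cf_square_weighted_integrable[OF sa l]) auto
 then have i0: "integrable lborel (\<lambda>t. (cmod (cf a t))^2)"
 proof (rule integrable_cong_AE_imp)
  show "AE t in lborel. \<bar>t\<bar> powr 0 * (cmod (cf a t))^2 = (cmod (cf a t))^2"
   using AE_lborel_singleton[of 0] by eventually_elim auto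
 qed auto
 show ?thesis
  unfolding holder_const_def char[symmetric]
  by (rule autocorr_holder) (use gamma i0 cf_square_weighted_integrable[OF sa l, of "2 * \<gamma>"] in \<open>auto simp: char\<close>)
qed

definition increment :: "nat => real => 'a => real" where
 "increment n u w = (\<Sum>i=1..n. f (X (int i) w - u) - f (X (int i) w) - (LINT w|M. f (X 0 w - u) - f (X 0 w)))"

lemma increment_measurable: "(\<lambda>(u, w). increment n u w) \<in> borel_measurable (borel \<Otimes>\<^sub>M M)"
proof -
 have [measurable]: "(\<lambda>u. LINT w|M. f (X 0 w - u) - f (X 0 w)) \<in> borel_measurable borel" by measurable
 show ?thesis unfolding increment_def split_beta' by measurable
qed

lemma increment_bounded: "bdd_rv (increment n u)"
 unfolding increment_def by (intro bdd_rv_sum bdd_rv_diff bdd_rv_const bounded_f) measurable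

text \<open>Finite dependence reduces the variance of the sum to single terms. The bound on f
  compares the second moment of a single increment with its L2 norm over the line, which is an
  increment of the autocorrelation at 0 and hence of order |u|^(2 \<gamma>).\<close>

lemma increment_finite:
 assumes fin: "\<forall>l\<ge>L. a l = 0" and u: "\<bar>autocorr f (- u) - autocorr f 0\<bar> <= holder_const * \<bar>u\<bar> powr (2 * \<gamma>)"
 shows "l2 (increment n u) <= (2 * sqrt (real L * C * holder_const)) * sqrt (real n) * \<bar>u\<bar> powr \<gamma>"
proof -
 define m where "m = (LINT w|M. f (X 0 w - u) - f (X 0 w))"
 define g where "g x = f (x - u) - f x - m" for x
 have gm[measurable]: "g \<in> borel_measurable borel" unfolding g_def by measurable
 have gb: "\<bar>g x\<bar> <= 2 * C + \<bar>m\<bar>" for x unfolding g_def using abs_f_le[of x] abs_f_le[of "x - u"] by linarith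
 have bd: "bdd_rv (\<lambda>w. f (X i w - u) - f (X i w))" for i
  by (intro bdd_rv_diff bounded_f) measurable
 have bg: "bdd_rv (\<lambda>w. g (X i w))" for i
  unfolding g_def by (intro bdd_rv_diff bd bdd_rv_const)
 have mean: "(LINT w|M. g (X 0 w)) = 0"
  unfolding g_def using bdd_rv_integrable[OF bd[of 0]] by (simp add: m_def[symmetric] prob_space)
 have le1: "\<E> (\<lambda>w. (g (X i w))^2) <= C * (2 * (holder_const * \<bar>u\<bar> powr (2 * \<gamma>)))" for i
 proof -
  have Em: "(LINT w|M. f (X i w - u) - f (X i w)) = m"
   unfolding m_def using expectation_X[of "\<lambda>x. f (x - u) - f x"] by simp
  have "\<E> (\<lambda>w. (g (X i w))^2) = \<E> (\<lambda>w. (f (X i w - u) - f (X i w))^2) - m^2"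
   unfolding g_def
   using variance_eq[OF bdd_rv_integrable[OF bd[of i]] bdd_rv_integrable[OF bdd_rv_power[OF bd[of i], of 2]]]
   unfolding Em .
  also have "... <= \<E> (\<lambda>w. (f (X i w - u) - f (X i w))^2)" by simp
  also have "... = (LINT x|lborel. f x * (f (x - u) - f x)^2)" by (rule expectation_X_density) measurable
  also have "... <= (LINT x|lborel. C * (f (x - u) - f x)^2)"
  proof (rule integral_mono')
   show "integrable lborel (\<lambda>x. C * (f (x - u) - f x)^2)" by (intro integrable_mult_right increment_square)
  qed (auto intro!: mult_right_mono f_le mult_nonneg_nonneg C_nonneg)
  also have "... = C * (2 * (autocorr f 0 - autocorr f (- u)))" by (simp add: increment_square)
  also have "... <= C * (2 * (holder_const * \<bar>u\<bar> powr (2 * \<gamma>)))"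
   using u C_nonneg by (intro mult_left_mono) auto
  finally show ?thesis .
 qed
 have inc: "increment n u = (\<lambda>w. \<Sum>i=1..n. g (X (int i) w))" unfolding increment_def g_def m_def by simp
 have "\<E> (\<lambda>w. (increment n u w)^2) <= 2 * real L * (\<Sum>i=1..n. \<E> (\<lambda>w. (g (X (int i) w))^2))"
  unfolding inc by (rule expectation_lag_orthogonal) (auto intro!: bg finite_lag_orthogonal[OF fin gm gb mean])
 also have "... <= 2 * real L * (\<Sum>i=1..n. C * (2 * (holder_const * \<bar>u\<bar> powr (2 * \<gamma>))))"
  by (intro mult_left_mono sum_mono le1) auto
 also have "... = ((2 * sqrt (real L * C * holder_const)) * sqrt (real n) * \<bar>u\<bar> powr \<gamma>)^2"
 proof -
  have "\<bar>u\<bar> powr (2 * \<gamma>) = (\<bar>u\<bar> powr \<gamma>)^2" by (simp add: power2_eq_square powr_add[symmetric])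
  moreover have "0 <= real L * C * holder_const" using C_nonneg holder_const_nonneg by auto
  ultimately show ?thesis by (simp add: power_mult_distrib)
 qed
 finally have "l2 (increment n u) <= sqrt (((2 * sqrt (real L * C * holder_const)) * sqrt (real n) * \<bar>u\<bar> powr \<gamma>)^2)"
  unfolding l2_def by (rule real_sqrt_le_mono)
 also have "... = (2 * sqrt (real L * C * holder_const)) * sqrt (real n) * \<bar>u\<bar> powr \<gamma>"
  using C_nonneg holder_const_nonneg by (simp add: mult_nonneg_nonneg)
 finally show ?thesis .
qed

text \<open>Shifting by u inserts the factor e^{-itu} - 1 into the Fourier weight, worth 2 |t
  u|^\<gamma>. Together with |t|^\<gamma> from the empirical characteristic function this uses up
  the integrable weight |t|^(2 \<gamma>); the constant 8 is 2 times 4.\<close>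

lemma increment_smooth:
 assumes smooth: "two_coeffs a"
 shows "l2 (increment n u) <= ((LINT t|lborel. cmod (fourier_weight a t) * \<bar>t\<bar> powr (2 * \<gamma>)) * (8 * root_c * coeff_norm a)) * sqrt (real n) * \<bar>u\<bar> powr \<gamma>"
proof -
 note [measurable] = lin_density_measurable[OF smooth]
 let ?p = "lin_density a" and ?w = "fourier_weight a"
 define A where "A t = ?w t * (iexp (- (t * u)) - 1)" for t
 define Z where "Z t z = (\<Sum>i=1..n. iexp (t * lin a (int i) z) - cf a t)" for t z
 define b where "b t = 4 * root_c * coeff_norm a * sqrt (real n) * \<bar>t\<bar> powr \<gamma>" for t
 have aep: "AE x in lborel. f x = ?p x"
  using law_X unfolding distr_lin_density[OF smooth]
  by (intro density_real_unique) (auto simp: f_nonneg lin_density_nonneg[OF smooth])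
 have aeX: "AE z in M. f (X i z - c) = ?p (lin a i z - c)" for i c
 proof -
  have "AE x in lborel. f (x - c) = ?p (x - c)"
   using AE_borel_affine[of 1 "\<lambda>x. f x = ?p x" "- c"] aep by (simp add: add.commute)
  then have "AE x in distr M borel (lin a i). f (x - c) = ?p (x - c)"
   unfolding distr_lin[OF sa, of i 0] law_X by (subst AE_density) auto
  then have "AE z in M. f (lin a i z - c) = ?p (lin a i z - c)"
   by (subst (asm) AE_distr_iff) (auto intro: lin_measurable)
  then show ?thesis using AE_X_eq_lin by eventually_elim simp
 qed
 have bp: "bdd_rv (\<lambda>z. ?p (lin a 0 z - c))" for c
  by (rule bdd_rvI[where B = "density_bound a"]) (auto simp: lin_density_le[OF smooth] lin_density_nonneg[OF smooth])
 have mean: "(LINT z|M. f (X 0 z - u) - f (X 0 z)) = (LINT z|M. ?p (lin a 0 z - u)) - (LINT z|M. ?p (lin a 0 z - 0))"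
 proof -
  have "AE z in M. f (X 0 z - u) - f (X 0 z) = ?p (lin a 0 z - u) - ?p (lin a 0 z - 0)"
   using aeX[of 0 u] aeX[of 0 0] by eventually_elim simp
  then have "(LINT z|M. f (X 0 z - u) - f (X 0 z)) = (LINT z|M. ?p (lin a 0 z - u) - ?p (lin a 0 z - 0))"
   by (intro integral_cong_AE) auto
  then show ?thesis
   unfolding integral_diff[OF bdd_rv_integrable[OF bp] bdd_rv_integrable[OF bp]] .
 qed
 have mz: "(\<lambda>t. iexp (- (t * c)) * (iexp (t * x) - cf a t)) \<in> borel_measurable borel" for c x by measurable
 have iexp1: "cmod (iexp y) = 1" for y by (simp only: norm_exp_i_times)
 have bz: "cmod (iexp (- (t * c)) * (iexp (t * x) - cf a t)) <= 2" for t c x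
  unfolding norm_mult iexp1 using iexp_minus_cf_le[of "t * x" a t] by simp
 note int = fourier_weight_mult_integrable[OF smooth mz bz]
 have one: "(?p (x - u) - (LINT z|M. ?p (lin a 0 z - u))) - (?p (x - 0) - (LINT z|M. ?p (lin a 0 z - 0)))
   = Re (LINT t|lborel. A t * (iexp (t * x) - cf a t))" for x
 proof -
  have "A t * (iexp (t * x) - cf a t) = ?w t * (iexp (- (t * u)) * (iexp (t * x) - cf a t)) - ?w t * (iexp (- (t * 0)) * (iexp (t * x) - cf a t))" for t
   unfolding A_def by (simp add: algebra_simps)
  then have "(LINT t|lborel. A t * (iexp (t * x) - cf a t)) = (LINT t|lborel. ?w t * (iexp (- (t * u)) * (iexp (t * x) - cf a t))) - (LINT t|lborel. ?w t * (iexp (- (t * 0)) * (iexp (t * x) - cf a t)))"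
   by (simp only: integral_diff[OF int int])
  then show ?thesis unfolding lin_density_centered[OF smooth] by (simp only: minus_complex.simps)
 qed
 have intA: "integrable lborel (\<lambda>t. A t * (iexp (t * x) - cf a t))" for x
  unfolding A_def mult.assoc
 proof (rule fourier_weight_mult_integrable[OF smooth, where c = "2 * 2"])
  fix t
  have "cmod (iexp (- (t * u)) - 1) <= 2"
   using norm_triangle_ineq4[of "iexp (- (t * u))" 1] unfolding iexp1 by simp
  then show "cmod ((iexp (- (t * u)) - 1) * (iexp (t * x) - cf a t)) <= 2 * 2"
   unfolding norm_mult by (intro mult_mono iexp_minus_cf_le) auto
 qed measurable
 have Aw: "cmod (A t) * b t <= (cmod (?w t) * \<bar>t\<bar> powr (2 * \<gamma>)) * ((8 * root_c * coeff_norm a) * sqrt (real n) * \<bar>u\<bar> powr \<gamma>)" for t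
 proof -
  have "cmod (iexp (- (t * u)) - iexp 0) <= 2 * \<bar>- (t * u) - 0\<bar> powr \<gamma>"
   using gamma by (intro cmod_iexp_diff_le_powr) auto
  then have "cmod (iexp (- (t * u)) - 1) <= 2 * (\<bar>t\<bar> powr \<gamma> * \<bar>u\<bar> powr \<gamma>)"
   by (simp add: abs_mult powr_mult)
  then have "cmod (A t) <= cmod (?w t) * (2 * (\<bar>t\<bar> powr \<gamma> * \<bar>u\<bar> powr \<gamma>))"
   unfolding A_def norm_mult by (intro mult_left_mono) auto
  then have "cmod (A t) * b t <= cmod (?w t) * (2 * (\<bar>t\<bar> powr \<gamma> * \<bar>u\<bar> powr \<gamma>)) * b t"
   using root_c_nonneg coeff_norm_nonneg[OF sa] by (intro mult_right_mono) (auto simp: b_def)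
  moreover have "\<bar>t\<bar> powr (2 * \<gamma>) = \<bar>t\<bar> powr \<gamma> * \<bar>t\<bar> powr \<gamma>" by (simp add: powr_add[symmetric])
  ultimately show ?thesis unfolding b_def by (simp add: mult_ac)
 qed
 have Aw0: "0 <= cmod (A t) * b t" for t
  using root_c_nonneg coeff_norm_nonneg[OF sa] by (simp add: b_def)
 have Awi: "integrable lborel (\<lambda>t. (cmod (?w t) * \<bar>t\<bar> powr (2 * \<gamma>)) * ((8 * root_c * coeff_norm a) * sqrt (real n) * \<bar>u\<bar> powr \<gamma>))"
  using gamma by (intro integrable_mult_left fourier_weight_powr_integrable[OF smooth]) auto
 have Am: "A \<in> borel_measurable borel" unfolding A_def by measurable
 have bm: "b \<in> borel_measurable borel" unfolding b_def by measurable
 have "l2 (increment n u) <= (LINT t|lborel. cmod (A t) * b t)"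
 proof (rule l2_Re_fourier_le[OF Am _ bm])
  show "(\<lambda>(t, z). Z t z) \<in> borel_measurable (borel \<Otimes>\<^sub>M M)" unfolding Z_def split_beta' by measurable
  show bZ: "bdd_rv (Z t)" for t unfolding Z_def[abs_def] by (intro bdd_rv_intros; simp)
  show b0: "0 <= b t" for t using root_c_nonneg coeff_norm_nonneg[OF sa] by (simp add: b_def)
  show "\<E> (\<lambda>z. (cmod (Z t z))^2) <= (b t)^2" for t
   using lin_fourth_moment_nat[OF sa, where n = n and t = t and c = 0] unfolding b_def Z_def
   by (intro expectation_square_le_of_fourth bZ[unfolded Z_def[abs_def]]) (use b0[of t] in \<open>auto simp: b_def\<close>)
  show "integrable lborel (\<lambda>t. cmod (A t) * b t)"
   by (rule integrable_bound[OF Awi]) (use Am bm order_trans[OF Aw abs_ge_self] Aw0 in auto)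
  show "bdd_rv (increment n u)" by (rule increment_bounded)
  have "AE z in M. \<forall>i\<in>{1..n}. f (X (int i) z - u) = ?p (lin a (int i) z - u) \<and> f (X (int i) z - 0) = ?p (lin a (int i) z - 0)"
   by (rule AE_finite_allI, simp, rule AE_conjI[OF aeX aeX])
  then show "AE z in M. increment n u z = Re (LINT t|lborel. A t * Z t z)"
  proof eventually_elim
   case (elim z)
   have "increment n u z = (\<Sum>i=1..n. Re (LINT t|lborel. A t * (iexp (t * lin a (int i) z) - cf a t)))"
    unfolding increment_def mean
   proof (intro sum.cong refl)
    fix i assume "i \<in> {1..n}"
    then show "f (X (int i) z - u) - f (X (int i) z) - ((LINT z|M. ?p (lin a 0 z - u)) - (LINT z|M. ?p (lin a 0 z - 0)))
     = Re (LINT t|lborel. A t * (iexp (t * lin a (int i) z) - cf a t))"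
     using elim unfolding one[symmetric] by simp
   qed
   also have "... = Re (LINT t|lborel. (\<Sum>i=1..n. A t * (iexp (t * lin a (int i) z) - cf a t)))"
    by (subst integral_sum) (rule intA, simp)
   finally show ?case unfolding Z_def sum_distrib_left .
  qed
 qed
 also have "... <= (LINT t|lborel. (cmod (?w t) * \<bar>t\<bar> powr (2 * \<gamma>)) * ((8 * root_c * coeff_norm a) * sqrt (real n) * \<bar>u\<bar> powr \<gamma>))"
  by (rule integral_mono'[OF Awi Aw]) (use Aw Aw0 order_trans in blast)
 also have "... = (LINT t|lborel. cmod (?w t) * \<bar>t\<bar> powr (2 * \<gamma>)) * ((8 * root_c * coeff_norm a) * sqrt (real n) * \<bar>u\<bar> powr \<gamma>)"
  by (rule integral_mult_left_zero)
 finally show ?thesis by (simp only: mult.assoc)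
qed

lemma increment_bound:
 obtains D where "0 <= D" "AE u in lborel. \<forall>n. l2 (increment n u) <= D * sqrt (real n) * \<bar>u\<bar> powr \<gamma>"
proof -
 consider (fin) "\<forall>l\<ge>L. a l = 0" | (smooth) "two_coeffs a"
  using finite_or_smooth smooth_two_coeffs by blast
 then show ?thesis
 proof cases
  case fin
  have "AE u in lborel. \<forall>n. l2 (increment n u) <= (2 * sqrt (real L * C * holder_const)) * sqrt (real n) * \<bar>u\<bar> powr \<gamma>"
   using AE_lborel_uminus[OF AE_autocorr_le]
  proof eventually_elim
   case (elim u)
   then show ?case by (intro allI increment_finite[OF fin]) simp
  qed
  then show ?thesis by (rule that[rotated]) (use C_nonneg holder_const_nonneg in auto)
 next
  case smooth
  have "AE u in lborel. \<forall>n. l2 (increment n u) <= ((LINT t|lborel. cmod (fourier_weight a t) * \<bar>t\<bar> powr (2 * \<gamma>)) * (8 * root_c * coeff_norm a)) * sqrt (real n) * \<bar>u\<bar> powr \<gamma>"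
   by (intro AE_I2 allI increment_smooth smooth)
  then show ?thesis
   by (rule that[rotated]) (use root_c_nonneg coeff_norm_nonneg[OF sa] in \<open>auto intro!: mult_nonneg_nonneg integral_nonneg\<close>)
 qed
qed

end

lemma sum_upper_triangle_add:
 fixes t :: "nat => real"
 shows "(\<Sum>j=1..n. \<Sum>i=1..<j. t i + t j) = (real n - 1) * (\<Sum>i=1..n. t i)"
proof (induction n)
 case (Suc n)
 have "(\<Sum>i=1..<Suc n. t i + t (Suc n)) = (\<Sum>i=1..n. t i) + real n * t (Suc n)"
  by (simp add: sum.distrib atLeastLessThanSuc_atLeastAtMost)
 then show ?case using Suc by (simp add: algebra_simps)
qed simp

lemma sum_upper_triangle_const: "(\<Sum>j=1..n. \<Sum>i=1..<j. c) = real n * (real n - 1) / 2 * c" for c :: real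
 using sum_upper_triangle_add[of "\<lambda>_. c / 2" n] by simp

locale smoothing = kernel_process M \<epsilon> \<phi> \<gamma> c_4 a L C_U k \<kappa> B + density_process M \<epsilon> \<phi> \<gamma> c_4 a L C_U f C
 for M :: "'a measure" and \<epsilon> :: "int => 'a => real" and \<phi> :: "real => complex" and \<gamma> c_4 :: real
  and a :: "nat => real" and L :: nat and C_U :: real and k :: "real => real" and \<kappa> B :: real
  and f :: "real => real" and C :: real +
 assumes k_one: "(LINT x|lborel. k x) = 1"
  and k_gamma: "integrable lborel (\<lambda>u. \<bar>k u\<bar> * \<bar>u\<bar> powr \<gamma>)"
  and k_gamma2: "integrable lborel (\<lambda>u. \<bar>k u\<bar> * \<bar>u\<bar> powr (2 * \<gamma>))"
begin

lemma k_mult_integrable: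
 assumes [measurable]: "g \<in> borel_measurable borel" and g: "\<And>u. \<bar>g u\<bar> <= c"
 shows "integrable lborel (\<lambda>u. k u * g u :: real)"
proof (rule integrable_bound)
 show "integrable lborel (\<lambda>u. k u * c)" using k_integrable by simp
 have "\<bar>k u * g u\<bar> <= \<bar>k u * c\<bar>" for u
 proof -
  have "\<bar>k u\<bar> * \<bar>g u\<bar> <= \<bar>k u\<bar> * \<bar>c\<bar>" using g[of u] by (intro mult_left_mono) auto
  then show ?thesis by (simp add: abs_mult)
 qed
 then show "AE u in lborel. norm (k u * g u) <= norm (k u * c)" by simp
qed (use k_integrable in measurable)

lemma fk_eq: "fk x = (LINT u|lborel. k u * f (x - u))"
proof -
 have "fk x = (LINT z|M. (LINT u|distr M borel (U 0). (\<lambda>w u. k (x - w - u)) (W 0 z) u))"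
  unfolding fk_def k_1_def distr_U by simp
 also have "... = (LINT z|M. (\<lambda>w u. k (x - w - u)) (W 0 z) (U 0 z))"
  by (rule freeze[OF _ W_noise_alg U_noise_alg, symmetric, where C = B]) (auto simp: k_bounded)
 also have "... = (LINT z|M. k (x - X 0 z))" unfolding X_def by (simp add: algebra_simps)
 also have "... = (LINT y|lborel. f y * k (x - y))" by (rule expectation_X_density) measurable
 also have "... = (LINT u|lborel. k u * f (x - u))"
  by (subst lborel_integral_real_affine[where c = "-1" and t = x]) (auto simp: mult.commute)
 finally show ?thesis .
qed

lemma shift_mean: "(LINT w|M. f (X 0 w - u) - f (X 0 w)) = autocorr f (- u) - autocorr f 0"
proof -
 have i: "integrable M (\<lambda>w. f (X 0 w - u))" "integrable M (\<lambda>w. f (X 0 w))"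
  by (intro bdd_rv_integrable bounded_f; measurable)+
 have "(LINT w|M. f (X 0 w - u)) = autocorr f (- u)" "(LINT w|M. f (X 0 w)) = autocorr f 0"
  unfolding autocorr_def using expectation_X_density[of "\<lambda>x. f (x - u)" 0] expectation_X_density[of f 0] by simp_all
 then show ?thesis using i by simp
qed

lemma fk_diff: "fk x - f x = (LINT u|lborel. k u * (f (x - u) - f x))"
proof -
 have i: "integrable lborel (\<lambda>u. k u * f (x - u))" "integrable lborel (\<lambda>u. k u * f x)"
  by (intro k_mult_integrable[where c = C]; simp add: abs_f_le)+
 have "(LINT u|lborel. k u * f x) = f x" using k_one by simp
 then show ?thesis unfolding fk_eq right_diff_distrib integral_diff[OF i] by simp
qed

lemma theta_diff: "\<theta> - autocorr f 0 = (LINT u|lborel. k u * (autocorr f (- u) - autocorr f 0))"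
proof -
 have [measurable]: "k \<in> borel_measurable borel" using k_integrable by simp
 have e: "(LINT w|M. f (X 0 w)) = autocorr f 0"
  unfolding autocorr_def using expectation_X_density[of f 0] by simp
 have i: "integrable M (\<lambda>w. fk (X 0 w))" "integrable M (\<lambda>w. f (X 0 w))"
  by (rule bdd_rv_integrable, rule bdd_rvI[where B = c_1]; simp add: fk_le)
   (intro bdd_rv_integrable bounded_f; measurable)
 have Z: "(\<lambda>(u, w). complex_of_real (f (X 0 w - u) - f (X 0 w))) \<in> borel_measurable (borel \<Otimes>\<^sub>M M)"
  unfolding split_beta' by measurable
 have Zb: "cmod (complex_of_real (f (X 0 w - u) - f (X 0 w))) <= 2 * C" for u w
  unfolding norm_of_real using abs_f_le[of "X 0 w - u"] abs_f_le[of "X 0 w"] by linarith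
 have ik: "integrable lborel (\<lambda>u. complex_of_real (k u))" using k_integrable by simp
 have "\<theta> - autocorr f 0 = (LINT w|M. fk (X 0 w) - f (X 0 w))"
  unfolding \<theta>_def e[symmetric] integral_diff[OF i] ..
 also have "... = (LINT w|M. LINT u|lborel. k u * (f (X 0 w - u) - f (X 0 w)))" unfolding fk_diff ..
 finally have 1: "complex_of_real (\<theta> - autocorr f 0)
   = (LINT w|M. LINT u|lborel. complex_of_real (k u) * complex_of_real (f (X 0 w - u) - f (X 0 w)))"
  by (simp only: of_real_mult[symmetric] integral_complex_of_real)
 also have "... = (LINT u|lborel. complex_of_real (k u) * (LINT w|M. complex_of_real (f (X 0 w - u) - f (X 0 w))))"
  by (rule expectation_fourier(1)[OF ik Z Zb])
 also have "... = complex_of_real (LINT u|lborel. k u * (autocorr f (- u) - autocorr f 0))"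
  unfolding integral_complex_of_real shift_mean of_real_mult[symmetric] ..
 finally show ?thesis by (simp only: of_real_eq_iff)
qed

text \<open>The mean of the smoothed density averages increments of the autocorrelation at 0 rather
  than of f. This is where the rate has exponent 2 \<gamma> instead of \<gamma>.\<close>

theorem theta_bias: "\<bar>\<theta> - autocorr f 0\<bar> <= holder_const * (LINT u|lborel. \<bar>k u\<bar> * \<bar>u\<bar> powr (2 * \<gamma>))"
proof -
 have [measurable]: "k \<in> borel_measurable borel" using k_integrable by simp
 have "\<bar>\<theta> - autocorr f 0\<bar> <= (LINT u|lborel. \<bar>k u * (autocorr f (- u) - autocorr f 0)\<bar>)"
  unfolding theta_diff using integral_norm_bound[of lborel "\<lambda>u. k u * (autocorr f (- u) - autocorr f 0)"] by simp
 also have "... <= (LINT u|lborel. holder_const * (\<bar>k u\<bar> * \<bar>u\<bar> powr (2 * \<gamma>)))"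
 proof (rule integral_mono_AE')
  show "integrable lborel (\<lambda>u. holder_const * (\<bar>k u\<bar> * \<bar>u\<bar> powr (2 * \<gamma>)))"
   using k_gamma2 by (rule integrable_mult_right)
  show "AE u in lborel. \<bar>k u * (autocorr f (- u) - autocorr f 0)\<bar> <= holder_const * (\<bar>k u\<bar> * \<bar>u\<bar> powr (2 * \<gamma>))"
   using AE_lborel_uminus[OF AE_autocorr_le]
  proof eventually_elim
   case (elim u)
   then have "\<bar>k u\<bar> * \<bar>autocorr f (- u) - autocorr f 0\<bar> <= \<bar>k u\<bar> * (holder_const * \<bar>u\<bar> powr (2 * \<gamma>))"
    by (intro mult_left_mono) auto
   then show ?case by (simp add: abs_mult mult_ac)
  qed
 qed (use holder_const_nonneg in auto)
 also have "... = holder_const * (LINT u|lborel. \<bar>k u\<bar> * \<bar>u\<bar> powr (2 * \<gamma>))" by (rule integral_mult_right_zero)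
 finally show ?thesis .
qed

definition smoothing_error :: "nat => 'a => real" where
 "smoothing_error n w = (\<Sum>i=1..n. (fk (X (int i) w) - f (X (int i) w)) - (\<theta> - autocorr f 0))"

lemma smoothing_error_bounded: "bdd_rv (smoothing_error n)"
 unfolding smoothing_error_def
 by (intro bdd_rv_sum bdd_rv_diff bdd_rv_const bounded_f bdd_rvI[where B = c_1]) (auto simp: fk_le)

lemma smoothing_error_eq: "smoothing_error n w = (LINT u|lborel. k u * increment n u w)"
proof -
 let ?g = "\<lambda>i u. f (X (int i) w - u) - f (X (int i) w)" and ?m = "\<lambda>u. autocorr f (- u) - autocorr f 0"
 have g: "\<bar>?g i u\<bar> <= 2 * C" for i u
  using abs_f_le[of "X (int i) w - u"] abs_f_le[of "X (int i) w"] by linarith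
 have m: "\<bar>?m u\<bar> <= 2 * C" for u
 proof -
  have "\<bar>?m u\<bar> <= (LINT w|M. \<bar>f (X 0 w - u) - f (X 0 w)\<bar>)"
   unfolding shift_mean[symmetric] using integral_norm_bound[of M "\<lambda>w. f (X 0 w - u) - f (X 0 w)"] by simp
  also have "... <= (LINT w|M. 2 * C)"
  proof (rule integral_mono)
   show "integrable M (\<lambda>w. \<bar>f (X 0 w - u) - f (X 0 w)\<bar>)"
    by (intro bdd_rv_integrable bdd_rv_abs bdd_rv_diff bounded_f; measurable)
   show "\<bar>f (X 0 w - u) - f (X 0 w)\<bar> <= 2 * C" for w
    using abs_f_le[of "X 0 w - u"] abs_f_le[of "X 0 w"] by linarith
  qed simp
  finally show ?thesis by (simp add: prob_space)
 qed
 have ig: "integrable lborel (\<lambda>u. k u * ?g i u)" for i by (rule k_mult_integrable[OF _ g]) measurable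
 have im: "integrable lborel (\<lambda>u. k u * ?m u)" by (rule k_mult_integrable[OF _ m]) measurable
 have "smoothing_error n w = (\<Sum>i=1..n. (LINT u|lborel. k u * ?g i u) - (LINT u|lborel. k u * ?m u))"
  unfolding smoothing_error_def fk_diff theta_diff ..
 also have "... = (\<Sum>i=1..n. LINT u|lborel. k u * ?g i u - k u * ?m u)"
  unfolding integral_diff[OF ig im] ..
 also have "... = (LINT u|lborel. (\<Sum>i=1..n. k u * ?g i u - k u * ?m u))"
  by (rule integral_sum[symmetric]) (intro integrable_diff ig im)
 also have "... = (LINT u|lborel. k u * increment n u w)"
  unfolding increment_def shift_mean sum_distrib_left right_diff_distrib ..
 finally show ?thesis .
qed

text \<open>The error is the integral of k u times \<open>increment n u\<close>, and Minkowski takes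
  the norm inside; the kernel moment of order \<gamma> then yields the rate.\<close>

theorem smoothing_error_le:
 assumes D: "0 <= D_0" and inc: "AE u in lborel. \<forall>n. l2 (increment n u) <= D_0 * sqrt (real n) * \<bar>u\<bar> powr \<gamma>"
 shows "l2 (smoothing_error n) <= D_0 * sqrt (real n) * (LINT u|lborel. \<bar>k u\<bar> * \<bar>u\<bar> powr \<gamma>)"
proof -
 have [measurable]: "k \<in> borel_measurable borel" using k_integrable by simp
 obtain N where N: "N \<in> null_sets lborel" "{u. \<not> (\<forall>n. l2 (increment n u) <= D_0 * sqrt (real n) * \<bar>u\<bar> powr \<gamma>)} \<subseteq> N"
  using inc unfolding eventually_ae_filter by auto
 have [measurable]: "N \<in> sets borel" using N(1) null_setsD2 by fastforce
 \<comment> \<open>Set to 0 on the exceptional null set, since the Minkowski bound asks for an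
   estimate at every u.\<close>
 define Z where "Z u w = (if u \<in> N then 0 else complex_of_real (increment n u w))" for u w
 define b where "b u = D_0 * sqrt (real n) * \<bar>u\<bar> powr \<gamma>" for u
 have [measurable]: "(\<lambda>x. increment n (fst x) (snd x)) \<in> borel_measurable (borel \<Otimes>\<^sub>M M)"
  using increment_measurable[of n] by (simp add: split_beta')
 have Am: "(\<lambda>u. complex_of_real (k u)) \<in> borel_measurable borel" by measurable
 have bm: "b \<in> borel_measurable borel" unfolding b_def by measurable
 have int: "integrable lborel (\<lambda>u. (D_0 * sqrt (real n)) * (\<bar>k u\<bar> * \<bar>u\<bar> powr \<gamma>))" using k_gamma by (rule integrable_mult_right)
 have eq: "cmod (complex_of_real (k u)) * b u = (D_0 * sqrt (real n)) * (\<bar>k u\<bar> * \<bar>u\<bar> powr \<gamma>)" for u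
  unfolding b_def by simp
 have "l2 (smoothing_error n) <= (LINT u|lborel. cmod (complex_of_real (k u)) * b u)"
 proof (rule l2_Re_fourier_le[OF Am _ bm])
  show "(\<lambda>(u, w). Z u w) \<in> borel_measurable (borel \<Otimes>\<^sub>M M)" unfolding Z_def split_beta' by measurable
  show b0: "0 <= b u" for u unfolding b_def using D by simp
  show "bdd_rv (Z u)" for u
   unfolding Z_def[abs_def] by (cases "u \<in> N") (simp_all add: bdd_rv_of_real increment_bounded)
  show "\<E> (\<lambda>w. (cmod (Z u w))^2) <= (b u)^2" for u
  proof (cases "u \<in> N")
   case False
   then have "l2 (increment n u) <= b u" using N(2) unfolding b_def by blast
   then have "(l2 (increment n u))^2 <= (b u)^2" by (intro power_mono l2_nonneg)
   then show ?thesis using False unfolding Z_def l2_sq by simp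
  qed (simp add: Z_def)
  show "integrable lborel (\<lambda>u. cmod (complex_of_real (k u)) * b u)" unfolding eq by (rule int)
  show "bdd_rv (smoothing_error n)" by (rule smoothing_error_bounded)
  show "AE w in M. smoothing_error n w = Re (LINT u|lborel. complex_of_real (k u) * Z u w)"
  proof (rule AE_I2)
   fix w assume [measurable]: "w \<in> space M"
   have [measurable]: "(\<lambda>u. increment n u w) \<in> borel_measurable borel"
    unfolding increment_def shift_mean by measurable
   have "(LINT u|lborel. complex_of_real (k u) * Z u w) = (LINT u|lborel. complex_of_real (k u * increment n u w))"
   proof (rule integral_cong_AE)
    show "(\<lambda>u. complex_of_real (k u) * Z u w) \<in> borel_measurable lborel" unfolding Z_def by measurable
    show "AE u in lborel. complex_of_real (k u) * Z u w = complex_of_real (k u * increment n u w)"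
     using AE_not_in[OF N(1)] by eventually_elim (simp add: Z_def)
   qed measurable
   also have "... = complex_of_real (LINT u|lborel. k u * increment n u w)" by (rule integral_complex_of_real)
   finally show "smoothing_error n w = Re (LINT u|lborel. complex_of_real (k u) * Z u w)"
    by (simp add: smoothing_error_eq)
  qed
 qed
 also have "... = D_0 * sqrt (real n) * (LINT u|lborel. \<bar>k u\<bar> * \<bar>u\<bar> powr \<gamma>)"
  unfolding eq by (rule integral_mult_right_zero)
 finally show ?thesis .
qed

definition V :: "nat => 'a => real" where
 "V n w = 2 / (real n * (real n - 1)) * (\<Sum>j=1..n. \<Sum>i=1..<j. k (X (int j) w - X (int i) w))"

definition remainder :: "nat => 'a => real" where
 "remainder n w = (\<Sum>j=1..n. \<Sum>i=1..<j. DD (int i) (int j) w) + (\<Sum>j=1..n. \<Sum>i=1..<j. T (int i) (int j) w)"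

lemma remainder_bounded: "bdd_rv (remainder n)"
 unfolding remainder_def by (intro bdd_rv_add bdd_rv_sum bdd_rv_DD B_bounded)

lemma V_bounded: "bdd_rv (V n)"
 unfolding V_def
 by (intro bdd_rv_mult bdd_rv_const bdd_rv_sum bdd_rvI[where B = B]) (use k_integrable in \<open>auto simp: k_bounded\<close>)

text \<open>A decomposition of Hoeffding type: each index occurs in n - 1 pairs, which produces the
  linear term, and \<open>remainder\<close> collects the \<open>DD\<close> and T terms.\<close>

lemma V_eq:
 assumes n: "2 <= n"
 shows "V n w = 2 / real n * (\<Sum>i=1..n. fk (X (int i) w)) - \<theta> + 2 / (real n * (real n - 1)) * remainder n w"
proof -
 have "(\<Sum>j=1..n. \<Sum>i=1..<j. k (X (int j) w - X (int i) w))
   = (\<Sum>j=1..n. \<Sum>i=1..<j. DD (int i) (int j) w + T (int i) (int j) w + (fk (X (int i) w) + fk (X (int j) w)) + (- \<theta>))"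
  unfolding T_def by (intro sum.cong refl) simp
 also have "... = remainder n w + (real n - 1) * (\<Sum>i=1..n. fk (X (int i) w)) - real n * (real n - 1) / 2 * \<theta>"
  unfolding remainder_def
  using sum_upper_triangle_add[of "\<lambda>i. fk (X (int i) w)" n] sum_upper_triangle_const[of "- \<theta>" n]
  by (simp only: sum.distrib)
 finally have 1: "(\<Sum>j=1..n. \<Sum>i=1..<j. k (X (int j) w - X (int i) w))
  = remainder n w + (real n - 1) * (\<Sum>i=1..n. fk (X (int i) w)) - real n * (real n - 1) / 2 * \<theta>" .
 have "2 / (p * q) * (r + q * s - p * q / 2 * t) = 2 / p * s - t + 2 / (p * q) * r" if "p \<noteq> 0" "q \<noteq> 0" for p q r s t :: real
  using that by (simp add: field_simps)
 then show ?thesis using n unfolding V_def 1 by simp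
qed

lemma remainder_sq: "\<E> (\<lambda>w. (remainder n w)^2) <= (real n)^2 * (20 * (real L)^2 * q + 16 * real L * C_off * \<eta> n + 2 * C_T)"
proof -
 let ?D = "\<lambda>w. \<Sum>j=1..n. \<Sum>i=1..<j. DD (int i) (int j) w" and ?T = "\<lambda>w. \<Sum>j=1..n. \<Sum>i=1..<j. T (int i) (int j) w"
 have b: "bdd_rv ?D" "bdd_rv ?T" by (intro bdd_rv_sum bdd_rv_DD B_bounded)+
 have i: "integrable M (\<lambda>w. (?D w)^2)" "integrable M (\<lambda>w. (?T w)^2)" by (intro bdd_rv_integrable bdd_rv_power b)+
 have "\<E> (\<lambda>w. (remainder n w)^2) <= \<E> (\<lambda>w. 2 * (?D w)^2 + 2 * (?T w)^2)"
 proof (rule integral_mono)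
  show "integrable M (\<lambda>w. (remainder n w)^2)" by (intro bdd_rv_integrable bdd_rv_power remainder_bounded)
  show "integrable M (\<lambda>w. 2 * (?D w)^2 + 2 * (?T w)^2)"
   by (intro integrable_add integrable_mult_right i)
  show "(remainder n w)^2 <= 2 * (?D w)^2 + 2 * (?T w)^2" for w
   unfolding remainder_def by (rule power2_sum_le)
 qed
 also have "... = 2 * \<E> (\<lambda>w. (?D w)^2) + 2 * \<E> (\<lambda>w. (?T w)^2)"
  using i by simp
 also have "... <= 2 * ((real n)^2 * (10 * (real L)^2 * q + 8 * real L * C_off * \<eta> n)) + 2 * ((real n)^2 * C_T)"
  using DD_total_sq[of n] T_total_sq[of n] by linarith
 finally show ?thesis by (simp add: algebra_simps)
qed

lemma remainder_mean: "\<bar>\<E> (remainder n)\<bar> <= real n * (real L * (C_d * \<kappa> + 3 * c_1) + sqrt C_T)"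
proof -
 let ?D = "\<lambda>w. \<Sum>j=1..n. \<Sum>i=1..<j. DD (int i) (int j) w" and ?T = "\<lambda>w. \<Sum>j=1..n. \<Sum>i=1..<j. T (int i) (int j) w"
 have b: "bdd_rv ?D" "bdd_rv ?T" by (intro bdd_rv_sum bdd_rv_DD B_bounded)+
 have e: "\<E> (remainder n) = \<E> ?D + \<E> ?T"
  unfolding remainder_def[abs_def]
  by (rule integral_add) (intro bdd_rv_integrable b)+
 have "\<bar>\<E> ?T\<bar> <= \<E> (\<lambda>w. \<bar>?T w\<bar>)" using integral_norm_bound[of M ?T] by simp
 also have "... <= l2 ?T" by (rule expectation_abs_le_l2[OF b(2)])
 also have "... <= sqrt ((real n)^2 * C_T)" unfolding l2_def by (rule real_sqrt_le_mono[OF T_total_sq])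
 also have "... = real n * sqrt C_T" by (simp add: real_sqrt_mult)
 finally show ?thesis unfolding e using DD_total_mean[of n] by (simp add: distrib_left)
qed

lemma V_mean: "2 <= n ==> \<E> (V n) = \<theta> + 2 / (real n * (real n - 1)) * \<E> (remainder n)"
proof -
 assume n: "2 <= n"
 have b: "bdd_rv (\<lambda>w. fk (X i w))" for i by (rule bdd_rvI[where B = c_1]) (auto simp: fk_le)
 have Efk: "\<E> (\<lambda>w. fk (X i w)) = \<theta>" for i
  unfolding \<theta>_def expectation_X[OF fk_measurable] ..
 have i: "integrable M (\<lambda>w. \<Sum>i=1..n. fk (X (int i) w))" "integrable M (remainder n)"
  by (intro bdd_rv_integrable bdd_rv_sum b remainder_bounded)+
 have "\<E> (\<lambda>w. \<Sum>i=1..n. fk (X (int i) w)) = real n * \<theta>"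
  by (subst integral_sum) (simp_all add: bdd_rv_integrable[OF b] Efk)
 moreover have "\<E> (V n) = 2 / real n * \<E> (\<lambda>w. \<Sum>i=1..n. fk (X (int i) w)) - \<theta> + 2 / (real n * (real n - 1)) * \<E> (remainder n)"
  unfolding V_eq[OF n, abs_def] using i by (simp add: prob_space del: times_divide_eq_left)
 ultimately show ?thesis using n by simp
qed

theorem V_bias:
 assumes n: "2 <= n"
 shows "\<bar>\<E> (V n) - autocorr f 0\<bar>
  <= holder_const * (LINT u|lborel. \<bar>k u\<bar> * \<bar>u\<bar> powr (2 * \<gamma>)) + 4 * (real L * (C_d * \<kappa> + 3 * c_1) + sqrt C_T) / real n"
proof -
 let ?c = "real L * (C_d * \<kappa> + 3 * c_1) + sqrt C_T"
 have pos: "0 <= real n * ?c" using remainder_mean[of n] by linarith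
 then have c0: "0 <= ?c" using n by (simp add: zero_le_mult_iff)
 have "\<bar>2 / (real n * (real n - 1)) * \<E> (remainder n)\<bar> <= 2 / (real n * (real n - 1)) * (real n * ?c)"
 proof -
  have r0: "0 <= 2 / (real n * (real n - 1))" using n by simp
  show ?thesis unfolding abs_mult abs_of_nonneg[OF r0] by (rule mult_left_mono[OF remainder_mean r0])
 qed
 also have "... = 2 / (real n - 1) * ?c" using n by simp
 also have "... <= 4 / real n * ?c" using n c0 by (intro mult_right_mono) (auto simp: field_simps)
 also have "4 / real n * ?c = 4 * ?c / real n" by simp
 finally have A: "\<bar>2 / (real n * (real n - 1)) * \<E> (remainder n)\<bar> <= 4 * ?c / real n" .
 have "\<bar>\<theta> + x - autocorr f 0\<bar> <= \<bar>\<theta> - autocorr f 0\<bar> + \<bar>x\<bar>" for x by linarith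
 then show ?thesis unfolding V_mean[OF n] by (rule order_trans) (intro add_mono theta_bias A)
qed

text \<open>The difference is 2/n times the smoothing error plus a multiple of the centred
  remainder. The factor 32 arises from squaring 2/(n (n - 1)), which is at most 4/n^2, and
  doubling.\<close>

theorem V_linearization:
 assumes D: "0 <= D_0" and inc: "AE u in lborel. \<forall>n. l2 (increment n u) <= D_0 * sqrt (real n) * \<bar>u\<bar> powr \<gamma>" and n: "2 <= n"
 shows "\<E> (\<lambda>w. (V n w - \<E> (V n) - 1 / real n * (\<Sum>i=1..n. 2 * (f (X (int i) w) - autocorr f 0)))^2)
  <= 8 * (D_0 * (LINT u|lborel. \<bar>k u\<bar> * \<bar>u\<bar> powr \<gamma>))^2 / real n
   + 32 * (20 * (real L)^2 * q + 16 * real L * C_off * \<eta> n + 2 * C_T) / (real n)^2"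
proof -
 let ?r = "2 / (real n * (real n - 1))" and ?I = "LINT u|lborel. \<bar>k u\<bar> * \<bar>u\<bar> powr \<gamma>"
 let ?R = "\<lambda>w. remainder n w - \<E> (remainder n)"
 have eq: "V n w - \<E> (V n) - 1 / real n * (\<Sum>i=1..n. 2 * (f (X (int i) w) - autocorr f 0))
   = 2 / real n * smoothing_error n w + ?r * ?R w" for w
 proof -
  have "smoothing_error n w = (\<Sum>i=1..n. fk (X (int i) w)) - (\<Sum>i=1..n. f (X (int i) w) - autocorr f 0) - real n * \<theta>"
   unfolding smoothing_error_def by (simp only: sum_subtractf) (simp add: right_diff_distrib)
  then have "2 / real n * smoothing_error n w = 2 / real n * (\<Sum>i=1..n. fk (X (int i) w)) - 2 / real n * (\<Sum>i=1..n. f (X (int i) w) - autocorr f 0) - 2 * \<theta>"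
   using n by (simp add: field_simps)
  moreover have "1 / real n * (\<Sum>i=1..n. 2 * (f (X (int i) w) - autocorr f 0)) = 2 / real n * (\<Sum>i=1..n. f (X (int i) w) - autocorr f 0)"
   by (simp only: sum_distrib_left[symmetric])
  moreover have "?r * ?R w = ?r * remainder n w - ?r * \<E> (remainder n)" by (rule right_diff_distrib)
  ultimately show ?thesis unfolding V_eq[OF n] V_mean[OF n] by linarith
 qed
 have bR: "bdd_rv ?R" by (intro bdd_rv_diff bdd_rv_const remainder_bounded)
 have i: "integrable M (\<lambda>w. (smoothing_error n w)^2)" "integrable M (\<lambda>w. (?R w)^2)"
  by (intro bdd_rv_integrable bdd_rv_power bR smoothing_error_bounded)+
 have b1: "\<E> (\<lambda>w. (smoothing_error n w)^2) <= (D_0 * ?I)^2 * real n"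
 proof -
  have "(l2 (smoothing_error n))^2 <= (D_0 * sqrt (real n) * ?I)^2"
   by (rule power_mono[OF smoothing_error_le[OF D inc] l2_nonneg])
  then show ?thesis unfolding l2_sq by (simp add: power_mult_distrib mult_ac)
 qed
 have b2: "\<E> (\<lambda>w. (?R w)^2) <= (real n)^2 * (20 * (real L)^2 * q + 16 * real L * C_off * \<eta> n + 2 * C_T)"
 proof -
  have "\<E> (\<lambda>w. (?R w)^2) = \<E> (\<lambda>w. (remainder n w)^2) - (\<E> (remainder n))^2"
   by (rule variance_eq) (intro bdd_rv_integrable bdd_rv_power remainder_bounded)+
  then show ?thesis using remainder_sq[of n] zero_le_power2[of "\<E> (remainder n)"] by linarith
 qed
 have "\<E> (\<lambda>w. (2 / real n * smoothing_error n w + ?r * ?R w)^2)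
   <= \<E> (\<lambda>w. 8 / (real n)^2 * (smoothing_error n w)^2 + 2 * ?r^2 * (?R w)^2)"
 proof (rule integral_mono)
  show "integrable M (\<lambda>w. (2 / real n * smoothing_error n w + ?r * ?R w)^2)"
   by (intro bdd_rv_integrable bdd_rv_power bdd_rv_add bdd_rv_mult bdd_rv_const bR smoothing_error_bounded)
  show "integrable M (\<lambda>w. 8 / (real n)^2 * (smoothing_error n w)^2 + 2 * ?r^2 * (?R w)^2)"
   by (intro integrable_add integrable_mult_right i)
  show "(2 / real n * smoothing_error n w + ?r * ?R w)^2 <= 8 / (real n)^2 * (smoothing_error n w)^2 + 2 * ?r^2 * (?R w)^2" for w
  proof -
   have "(2 / real n * smoothing_error n w + ?r * ?R w)^2 <= 2 * (2 / real n * smoothing_error n w)^2 + 2 * (?r * ?R w)^2"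
    by (rule power2_sum_le)
   moreover have "2 * (2 / real n * y)^2 = 8 / (real n)^2 * y^2" for y by (simp add: power_mult_distrib power_divide)
   moreover have "2 * (?r * y)^2 = 2 * ?r^2 * y^2" for y by (simp only: power_mult_distrib mult.assoc)
   ultimately show ?thesis by (simp only:)
  qed
 qed
 also have "... = 8 / (real n)^2 * \<E> (\<lambda>w. (smoothing_error n w)^2) + 2 * ?r^2 * \<E> (\<lambda>w. (?R w)^2)"
  unfolding integral_add[OF integrable_mult_right[OF i(1)] integrable_mult_right[OF i(2)]] integral_mult_right_zero ..
 also have "... <= 8 / (real n)^2 * ((D_0 * ?I)^2 * real n) + 2 * (16 / (real n) ^ 4) * ((real n)^2 * (20 * (real L)^2 * q + 16 * real L * C_off * \<eta> n + 2 * C_T))"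
 proof (rule add_mono)
  have "?r <= 4 / (real n)^2"
  proof -
   have "(real n)^2 / 2 <= real n * (real n - 1)" using n by (simp add: power2_eq_square)
   then have "2 / (real n * (real n - 1)) <= 2 / ((real n)^2 / 2)" using n by (intro divide_left_mono) auto
   then show ?thesis by simp
  qed
  then have "?r^2 <= (4 / (real n)^2)^2" using n by (intro power_mono) auto
  also have "(4 / (real n)^2)^2 = 16 / real n ^ 4" by (simp add: power_divide)
  finally have r2: "2 * ?r^2 <= 2 * (16 / real n ^ 4)" by simp
  show "2 * ?r^2 * \<E> (\<lambda>w. (?R w)^2)
    <= 2 * (16 / (real n) ^ 4) * ((real n)^2 * (20 * (real L)^2 * q + 16 * real L * C_off * \<eta> n + 2 * C_T))"
   by (rule mult_mono[OF r2 b2]) (simp, rule integral_nonneg, simp)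
  show "8 / (real n)^2 * \<E> (\<lambda>w. (smoothing_error n w)^2) <= 8 / (real n)^2 * ((D_0 * ?I)^2 * real n)"
   by (rule mult_left_mono[OF b1]) simp
 qed
 also have "... = 8 * (D_0 * ?I)^2 / real n + 32 * (20 * (real L)^2 * q + 16 * real L * C_off * \<eta> n + 2 * C_T) / (real n)^2"
 proof -
  have 1: "8 / (real n)^2 * (x * real n) = 8 * x / real n" for x using n by (simp add: power2_eq_square)
  have 2: "2 * (16 / real n ^ 4) * ((real n)^2 * x) = 32 * x / (real n)^2" for x
   using n by (simp add: power2_eq_square power4_eq_xxxx)
  show ?thesis unfolding 1 2 ..
 qed
 finally show ?thesis unfolding eq .
qed

end

section \<open>The kernel estimator\<close>

lemma scaled_kernel:
 fixes g :: "real => real"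
 assumes h: "0 < h"
 shows "(LINT x|lborel. g (x / h) / h) = (LINT x|lborel. g x)"
  "integrable lborel g ==> integrable lborel (\<lambda>x. g (x / h) / h)"
proof -
 have "(LINT x|lborel. g (x / h) / h) = \<bar>h\<bar> *\<^sub>R (LINT x|lborel. g ((0 + h * x) / h) / h)"
  by (rule lborel_integral_real_affine) (use h in auto)
 then show "(LINT x|lborel. g (x / h) / h) = (LINT x|lborel. g x)" using h by simp
 assume g: "integrable lborel g"
 have "integrable lborel (\<lambda>x. g (0 + (1 / h) * x))"
  by (rule lborel_integrable_real_affine[OF g]) (use h in auto)
 then show "integrable lborel (\<lambda>x. g (x / h) / h)" by simp
qed

lemma cesaro_tendsto_zero:
 fixes x :: "nat => real"
 assumes x: "x ----> 0"
 shows "(\<lambda>n. (\<Sum>l=0..n. x l) / real n) ----> 0"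
proof (rule LIMSEQ_I)
 fix e :: real assume e: "0 < e"
 obtain N where N: "\<And>l. N <= l ==> \<bar>x l\<bar> < e / 4" using LIMSEQ_D[OF x, of "e / 4"] e by auto
 define s where "s = (\<Sum>l<N. \<bar>x l\<bar>)"
 have "(\<lambda>n. s / real n) ----> 0" by (rule lim_const_over_n)
 then obtain N' where N': "\<And>n. N' <= n ==> \<bar>s / real n\<bar> < e / 4" using LIMSEQ_D[of "\<lambda>n. s / real n" 0 "e / 4"] e by auto
 show "\<exists>n0. \<forall>n\<ge>n0. norm ((\<Sum>l=0..n. x l) / real n - 0) < e"
 proof (intro exI allI impI)
  fix n assume n: "max (Suc N') (Suc N) <= n"
  have split: "{0..n} = {..<N} \<union> {N..n}" "{..<N} \<inter> {N..n} = {}" using n by auto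
  have "\<bar>\<Sum>l=0..n. x l\<bar> <= (\<Sum>l=0..n. \<bar>x l\<bar>)" by (rule sum_abs)
  also have "... = s + (\<Sum>l=N..n. \<bar>x l\<bar>)" unfolding split(1) s_def by (rule sum.union_disjoint) (use split in auto)
  also have "(\<Sum>l=N..n. \<bar>x l\<bar>) <= (\<Sum>l=N..n. e / 4)" by (rule sum_mono, rule less_imp_le, rule N) simp
  also have "... = real (Suc n - N) * (e / 4)" by simp
  also have "... <= real (2 * n) * (e / 4)" using e n by (intro mult_right_mono) auto
  finally have "\<bar>\<Sum>l=0..n. x l\<bar> <= s + real n * (e / 2)" by (simp add: mult.commute)
  then have "\<bar>\<Sum>l=0..n. x l\<bar> / real n <= (s + real n * (e / 2)) / real n" by (rule divide_right_mono) simp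
  also have "... = s / real n + e / 2" using n by (simp add: add_divide_distrib)
  finally have le: "\<bar>\<Sum>l=0..n. x l\<bar> / real n <= s / real n + e / 2" .
  have "\<bar>s / real n\<bar> < e / 4" by (rule N') (use n in auto)
  then have "\<bar>\<Sum>l=0..n. x l\<bar> / real n < e" using le e by linarith
  then show "norm ((\<Sum>l=0..n. x l) / real n - 0) < e" by (simp add: abs_divide)
 qed
qed

context smoothing
begin

lemma k_sq_le: "k_sq <= B * \<kappa>"
proof -
 have "k_sq <= (LINT x|lborel. B * \<bar>k x\<bar>)"
  unfolding k_sq_def
 proof (rule integral_mono[OF k_sq_integrable])
  show "integrable lborel (\<lambda>x. B * \<bar>k x\<bar>)" using k_integrable by simp
  show "(k x)^2 <= B * \<bar>k x\<bar>" for x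
   using mult_right_mono[OF k_bounded[of x] abs_ge_zero[of "k x"]] by (simp add: power2_eq_square flip: abs_mult)
 qed
 also have "... = B * (LINT x|lborel. \<bar>k x\<bar>)" by simp
 also have "... <= B * \<kappa>" using k_bounded[of 0] by (intro mult_left_mono k_L1) linarith
 finally show ?thesis .
qed

text \<open>The bound on the remainder sorted by origin: \<open>P_1\<close> is free of h,
  \<open>P_2\<close> multiplies the sup bound B and becomes the 1/h term, and \<open>P_3\<close>
  multiplies eta. The split of q rests on \<open>k_sq_le\<close>.\<close>

definition P_1 :: real where "P_1 = 32 * (20 * (real L)^2 * (12 * c_1^2) + 2 * C_T)"
definition P_2 :: real where "P_2 = 32 * (20 * (real L)^2 * (4 * C_d * \<kappa>))"
definition P_3 :: real where "P_3 = 32 * (16 * real L * C_off)"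

lemma V_linearization':
 assumes D: "0 <= D_0" and inc: "AE u in lborel. \<forall>n. l2 (increment n u) <= D_0 * sqrt (real n) * \<bar>u\<bar> powr \<gamma>" and n: "2 <= n"
 shows "\<E> (\<lambda>w. (V n w - \<E> (V n) - 1 / real n * (\<Sum>i=1..n. 2 * (f (X (int i) w) - autocorr f 0)))^2)
  <= 8 * (D_0 * (LINT u|lborel. \<bar>k u\<bar> * \<bar>u\<bar> powr \<gamma>))^2 / real n + (P_1 + P_2 * B + P_3 * \<eta> n) / (real n)^2"
proof (rule order_trans[OF V_linearization[OF assms]], intro add_left_mono divide_right_mono)
 have "q <= 4 * (C_d * (B * \<kappa>) + 3 * c_1^2)"
  unfolding q_def using k_sq_le C_delta by (intro mult_left_mono add_right_mono) auto
 then have "20 * (real L)^2 * q <= 20 * (real L)^2 * (4 * (C_d * (B * \<kappa>) + 3 * c_1^2))" by (intro mult_left_mono) auto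
 then show "32 * (20 * (real L)^2 * q + 16 * real L * C_off * \<eta> n + 2 * C_T) <= P_1 + P_2 * B + P_3 * \<eta> n"
  unfolding P_1_def P_2_def P_3_def by (simp add: algebra_simps)
qed simp

lemma P_nonneg: "0 <= P_1" "0 <= P_2" "0 <= P_3"
proof -
 have "0 <= C_T" unfolding C_T_def by simp
 then show "0 <= P_1" unfolding P_1_def by simp
 show "0 <= P_2" unfolding P_2_def using C_delta kappa_nonneg by (intro mult_nonneg_nonneg) auto
 show "0 <= P_3" unfolding P_3_def using C_off_nonneg by simp
qed

end

locale estimation = density_process M \<epsilon> \<phi> \<gamma> c_4 a L C_U f C
 for M :: "'a measure" and \<epsilon> :: "int => 'a => real" and \<phi> :: "real => complex" and \<gamma> c_4 :: real
  and a :: "nat => real" and L :: nat and C_U :: real and f :: "real => real" and C :: real +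
 fixes K :: "real => real" and S_K :: real and h :: "nat => real"
 assumes K_sym: "\<And>u. K (- u) = K u" and K_le: "\<And>u. \<bar>K u\<bar> <= S_K"
  and K_integral: "has_bochner_integral lborel K 1"
  and K_moment: "integrable lborel (\<lambda>u. u^2 * \<bar>K u\<bar>)"
  and h_pos: "\<And>n. 1 <= n ==> 0 < h n" and h_lim: "h ----> 0"
begin

lemma K_integrable: "integrable lborel K" using K_integral by (rule integrable.intros)

lemma K_measurable[measurable]: "K \<in> borel_measurable borel" using K_integrable by simp

lemma K_powr_integrable:
 assumes "0 <= p" "p <= 2"
 shows "integrable lborel (\<lambda>u. \<bar>K u\<bar> * \<bar>u\<bar> powr p)"
proof (rule integrable_bound)
 show "integrable lborel (\<lambda>u. \<bar>K u\<bar> + u^2 * \<bar>K u\<bar>)" using K_integrable K_moment by simp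
 have "\<bar>u\<bar> powr p <= 1 + u^2" for u :: real
 proof (cases "\<bar>u\<bar> <= 1")
  case True
  then have "\<bar>u\<bar> powr p <= 1" using assms by (intro powr_le1) auto
  then show ?thesis by (smt (verit) zero_le_power2)
 next
  case False
  then have "\<bar>u\<bar> powr p <= \<bar>u\<bar> powr 2" using assms by (intro powr_mono) auto
  also have "\<bar>u\<bar> powr 2 = u^2" using False by (simp add: powr_numeral)
  finally show ?thesis by simp
 qed
 then have "\<bar>K u\<bar> * \<bar>u\<bar> powr p <= \<bar>K u\<bar> * (1 + u^2)" for u by (intro mult_left_mono) auto
 then show "AE u in lborel. norm (\<bar>K u\<bar> * \<bar>u\<bar> powr p) <= norm (\<bar>K u\<bar> + u^2 * \<bar>K u\<bar>)"
  by (intro AE_I2) (simp add: abs_mult distrib_left mult.commute)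
qed measurable

definition Kh :: "nat => real => real" where "Kh n x = K (x / h n) / h n"
definition \<kappa>\<^sub>K :: real where "\<kappa>\<^sub>K = (LINT u|lborel. \<bar>K u\<bar>)"
definition moment :: "real => real" where "moment p = (LINT u|lborel. \<bar>K u\<bar> * \<bar>u\<bar> powr p)"

lemma moment_nonneg: "0 <= moment p"
 unfolding moment_def by (rule integral_nonneg) simp

lemma Kh_moment:
 assumes n: "1 <= n" and p: "0 <= p" "p <= 2"
 shows "integrable lborel (\<lambda>u. \<bar>Kh n u\<bar> * \<bar>u\<bar> powr p)"
  "(LINT u|lborel. \<bar>Kh n u\<bar> * \<bar>u\<bar> powr p) = h n powr p * moment p"
proof -
 note h = h_pos[OF n]
 have e: "\<bar>Kh n u\<bar> * \<bar>u\<bar> powr p = h n powr p * (\<bar>K (u / h n)\<bar> * \<bar>u / h n\<bar> powr p / h n)" for u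
  using h unfolding Kh_def by (simp add: abs_divide powr_divide)
 show "integrable lborel (\<lambda>u. \<bar>Kh n u\<bar> * \<bar>u\<bar> powr p)"
  unfolding e by (intro integrable_mult_right scaled_kernel(2)[OF h, of "\<lambda>x. \<bar>K x\<bar> * \<bar>x\<bar> powr p"] K_powr_integrable p)
 show "(LINT u|lborel. \<bar>Kh n u\<bar> * \<bar>u\<bar> powr p) = h n powr p * moment p"
  unfolding e integral_mult_right_zero moment_def scaled_kernel(1)[OF h, of "\<lambda>x. \<bar>K x\<bar> * \<bar>x\<bar> powr p"] ..
qed

text \<open>Every n has its own kernel and thus its own instance of \<open>smoothing\<close>. The L1
  bound is the same for all n, and only the sup bound varies with h n.\<close>

lemma smoothing_Kh:
 assumes n: "1 <= n"
 shows "smoothing M \<epsilon> \<phi> \<gamma> c_4 a L C_U (Kh n) \<kappa>\<^sub>K (S_K / h n) f C"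
proof -
 note h = h_pos[OF n]
 show ?thesis
 proof unfold_locales
  show "Kh n (- x) = Kh n x" for x unfolding Kh_def by (simp add: K_sym)
  show "\<bar>Kh n x\<bar> <= S_K / h n" for x
   unfolding Kh_def using h K_le[of "x / h n"] by (simp add: abs_divide divide_right_mono)
  show "integrable lborel (Kh n)"
   unfolding Kh_def[abs_def] by (rule scaled_kernel(2)[OF h K_integrable])
  have "(LINT x|lborel. \<bar>Kh n x\<bar>) = (LINT x|lborel. \<bar>K (x / h n)\<bar> / h n)" unfolding Kh_def using h by (simp add: abs_divide)
  also have "... = \<kappa>\<^sub>K" unfolding \<kappa>\<^sub>K_def by (rule scaled_kernel(1)[OF h, of "\<lambda>x. \<bar>K x\<bar>"])
  finally show "(LINT x|lborel. \<bar>Kh n x\<bar>) <= \<kappa>\<^sub>K" by simp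
  show "(LINT x|lborel. Kh n x) = 1"
   unfolding Kh_def scaled_kernel(1)[OF h, of K] using K_integral by (rule has_bochner_integral_integral_eq)
 qed (use Kh_moment(1)[OF n, of \<gamma>] Kh_moment(1)[OF n, of "2 * \<gamma>"] gamma in auto)
qed

definition est :: "nat => 'a => real" where
 "est n w = 2 / (real n * (real n - 1)) * (\<Sum>j=1..n. \<Sum>i=1..<j. Kh n (X (int j) w - X (int i) w))"

definition linear_part :: "nat => 'a => real" where
 "linear_part n w = (\<Sum>i=1..n. f (X (int i) w) - autocorr f 0)"

lemma est_eq: "1 <= n ==> smoothing.V \<epsilon> a L (Kh n) n = est n"
 by (rule ext) (simp only: est_def smoothing.V_def[OF smoothing_Kh])

lemma est_bounded: "1 <= n ==> bdd_rv (est n)"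
 unfolding est_eq[symmetric] by (rule smoothing.V_bounded[OF smoothing_Kh])

lemma linear_part_bounded: "bdd_rv (linear_part n)"
 unfolding linear_part_def by (intro bdd_rv_sum bdd_rv_diff bdd_rv_const bounded_f) measurable

lemma expectation_f_X: "(LINT w|M. f (X i w)) = autocorr f 0"
 unfolding autocorr_def using expectation_X_density[of f i] by simp

theorem est_bias: "\<exists>c>0. \<forall>n\<ge>2. \<bar>\<E> (est n) - autocorr f 0\<bar> <= c * (1 / real n + h n powr (2 * \<gamma>))"
proof -
 \<comment> \<open>The exported constants take the L1 bound but neither the kernel nor its supremum
   as argument, so c is the same for all n.\<close>
 define c where "c = 4 * (real L * (C_d * \<kappa>\<^sub>K + 3 * kernel_process.c_1 C_U \<kappa>\<^sub>K) + sqrt (kernel_process.C_T M \<epsilon> \<gamma> c_4 a L C_U \<kappa>\<^sub>K))"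
 define d where "d = holder_const * moment (2 * \<gamma>)"
 have d0: "0 <= d" unfolding d_def using holder_const_nonneg moment_nonneg by simp
 show ?thesis
 proof (intro exI[of _ "\<bar>c\<bar> + d + 1"] conjI allI impI)
  fix n :: nat assume n: "2 <= n"
  have n1: "1 <= n" using n by simp
  have "\<bar>\<E> (est n) - autocorr f 0\<bar> <= holder_const * (LINT u|lborel. \<bar>Kh n u\<bar> * \<bar>u\<bar> powr (2 * \<gamma>)) + c / real n"
   using smoothing.V_bias[OF smoothing_Kh[OF n1] n] unfolding est_eq[OF n1] c_def .
  also have "(LINT u|lborel. \<bar>Kh n u\<bar> * \<bar>u\<bar> powr (2 * \<gamma>)) = h n powr (2 * \<gamma>) * moment (2 * \<gamma>)"
   using gamma by (intro Kh_moment(2)[OF n1]) auto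
  also have "holder_const * (h n powr (2 * \<gamma>) * moment (2 * \<gamma>)) + c / real n = d * h n powr (2 * \<gamma>) + c * (1 / real n)"
   unfolding d_def by simp
  also have "... <= (\<bar>c\<bar> + d + 1) * h n powr (2 * \<gamma>) + (\<bar>c\<bar> + d + 1) * (1 / real n)"
   using d0 by (intro add_mono mult_right_mono) auto
  finally show "\<bar>\<E> (est n) - autocorr f 0\<bar> <= (\<bar>c\<bar> + d + 1) * (1 / real n + h n powr (2 * \<gamma>))"
   by (simp add: distrib_left)
 qed (use d0 in auto)
qed

lemma coeff_norm_pos: "0 < coeff_norm a"
proof -
 obtain l where l: "a l \<noteq> 0" using a_nonzero by blast
 show ?thesis
  unfolding coeff_norm_def
  by (rule suminf_pos2[of _ l]) (use sa l in \<open>auto simp: summable_coeffs_def\<close>)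
qed

lemma coeff_tail_sum_eq: "coeff_tail_sum a \<gamma> n = (\<Sum>l=0..n. tail_norm l)"
 unfolding coeff_tail_sum_def tail_norm_def coeff_norm_def by (simp add: add.commute)

lemma coeff_tail_sum_ge: "coeff_norm a <= coeff_tail_sum a \<gamma> n"
proof -
 have "tail_norm 0 <= (\<Sum>l=0..n. tail_norm l)"
  by (rule member_le_sum) (auto intro: tail_norm_nonneg)
 then show ?thesis unfolding coeff_tail_sum_eq by (simp add: tail_norm_def)
qed

lemma coeff_tail_sum_small: "(\<lambda>n. coeff_tail_sum a \<gamma> n / real n) ----> 0"
 unfolding coeff_tail_sum_eq
proof (rule cesaro_tendsto_zero)
 have "summable (\<lambda>l. \<bar>a l\<bar> powr \<gamma>)" using sa by (simp add: summable_coeffs_def)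
 then have "(\<lambda>l. \<Sum>i. \<bar>a (i + l)\<bar> powr \<gamma>) ----> 0" by (rule suminf_exist_split2)
 then show "tail_norm ----> 0" unfolding tail_norm_def[abs_def] coeff_norm_def .
qed

text \<open>The three terms of the bound stem from the supremum \<open>S_K / h n\<close>, from the
  tails, and from the \<gamma>-moment of the rescaled kernel, whose square scales like
  \<open>h n powr (2 * \<gamma>)\<close>.\<close>

theorem est_linearization:
 "\<exists>c>0. \<forall>n\<ge>2. \<E> (\<lambda>w. (est n w - \<E> (est n) - 2 / real n * linear_part n w)^2)
  <= c * (1 / ((real n)^2 * h n) + coeff_tail_sum a \<gamma> n / (real n)^2 + h n powr (2 * \<gamma>) / real n)"
proof -
 obtain D_0 where D: "0 <= D_0" "AE u in lborel. \<forall>n. l2 (increment n u) <= D_0 * sqrt (real n) * \<bar>u\<bar> powr \<gamma>"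
  by (rule increment_bound)
 define p_1 where "p_1 = smoothing.P_1 M \<epsilon> \<gamma> c_4 a L C_U \<kappa>\<^sub>K"
 define p_2 where "p_2 = smoothing.P_2 M \<epsilon> a L C_U \<kappa>\<^sub>K"
 define p_3 where "p_3 = smoothing.P_3 M \<epsilon> \<gamma> a L C_U \<kappa>\<^sub>K"
 note one = smoothing_Kh[of 1, simplified]
 have p0: "0 <= p_1" "0 <= p_2" "0 <= p_3"
  unfolding p_1_def p_2_def p_3_def using smoothing.P_nonneg[OF one] by auto
 \<comment> \<open>The sum eta is at least A > 0 for every n, so the term p_1 / n^2, which has no
   counterpart of its own in the claim, is absorbed into eta / n^2.\<close>
 define A where "A = coeff_norm a"
 have A: "0 < A" unfolding A_def by (rule coeff_norm_pos)
 define e where "e = 8 * (D_0 * moment \<gamma>)^2"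
 have S0: "0 <= S_K" using K_le[of 0] by linarith
 define c where "c = e + p_2 * S_K + (p_1 / A + p_3) + 1"
 have e0: "0 <= e" "0 <= p_2 * S_K" "0 <= p_1 / A + p_3" unfolding e_def using p0 A S0 by auto
 show ?thesis
 proof (intro exI[of _ c] conjI allI impI)
  show "0 < c" unfolding c_def using e0 by linarith
  fix n :: nat assume n: "2 <= n"
  have n1: "1 <= n" using n by simp
  note h = h_pos[OF n1]
  let ?\<eta> = "coeff_tail_sum a \<gamma> n"
  have \<eta>: "kernel_process.\<eta> \<gamma> a n = ?\<eta>"
   unfolding coeff_tail_sum_eq using kernel_process.\<eta>_def smoothing.axioms(1)[OF one] by metis
  have lp: "1 / real n * (\<Sum>i=1..n. 2 * (f (X (int i) w) - autocorr f 0)) = 2 / real n * linear_part n w" for w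
   unfolding linear_part_def sum_distrib_left[symmetric] by simp
  have "\<E> (\<lambda>w. (est n w - \<E> (est n) - 2 / real n * linear_part n w)^2)
    <= 8 * (D_0 * (LINT u|lborel. \<bar>Kh n u\<bar> * \<bar>u\<bar> powr \<gamma>))^2 / real n + (p_1 + p_2 * (S_K / h n) + p_3 * ?\<eta>) / (real n)^2"
   using smoothing.V_linearization'[OF smoothing_Kh[OF n1] D n]
   unfolding est_eq[OF n1] lp \<eta> p_1_def p_2_def p_3_def .
  also have "8 * (D_0 * (LINT u|lborel. \<bar>Kh n u\<bar> * \<bar>u\<bar> powr \<gamma>))^2 / real n = e * (h n powr (2 * \<gamma>) / real n)"
  proof -
   have "(LINT u|lborel. \<bar>Kh n u\<bar> * \<bar>u\<bar> powr \<gamma>) = h n powr \<gamma> * moment \<gamma>"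
    using gamma by (intro Kh_moment(2)[OF n1]) auto
   moreover have "h n powr (2 * \<gamma>) = (h n powr \<gamma>)^2" by (simp add: power2_eq_square powr_add[symmetric])
   ultimately show ?thesis unfolding e_def by (simp add: power_mult_distrib)
  qed
  also have "(p_1 + p_2 * (S_K / h n) + p_3 * ?\<eta>) / (real n)^2
    = p_2 * S_K * (1 / ((real n)^2 * h n)) + (p_1 + p_3 * ?\<eta>) / (real n)^2"
   by (simp add: add_divide_distrib mult.commute)
  also have "(p_1 + p_3 * ?\<eta>) / (real n)^2 <= (p_1 / A + p_3) * ?\<eta> / (real n)^2"
  proof (rule divide_right_mono)
   have "p_1 / A * A <= p_1 / A * ?\<eta>" using coeff_tail_sum_ge[of n] p0 A unfolding A_def by (intro mult_left_mono) auto
   then show "p_1 + p_3 * ?\<eta> <= (p_1 / A + p_3) * ?\<eta>" using A by (simp add: distrib_right)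
  qed simp
  also have "e * (h n powr (2 * \<gamma>) / real n) + (p_2 * S_K * (1 / ((real n)^2 * h n)) + (p_1 / A + p_3) * ?\<eta> / (real n)^2)
    <= c * (h n powr (2 * \<gamma>) / real n) + (c * (1 / ((real n)^2 * h n)) + c * (?\<eta> / (real n)^2))"
  proof -
   have "0 <= ?\<eta>" using coeff_tail_sum_ge[of n] coeff_norm_pos by linarith
   then show ?thesis
    unfolding times_divide_eq_right[of "p_1 / A + p_3", symmetric]
    using e0 h by (intro add_mono mult_right_mono) (auto simp: c_def)
  qed
  finally show "\<E> (\<lambda>w. (est n w - \<E> (est n) - 2 / real n * linear_part n w)^2)
   <= c * (1 / ((real n)^2 * h n) + ?\<eta> / (real n)^2 + h n powr (2 * \<gamma>) / real n)"
   by (simp only: distrib_left) linarith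
 qed
qed

text \<open>Multiplied by n, all three terms of the linearization error vanish: the first by the
  extra condition on n h, the second as a Cesaro mean of tails of a convergent series, the third
  because h tends to 0.\<close>

theorem est_clt:
 obtains \<sigma> :: real where "(\<lambda>n. \<E> (\<lambda>v. (linear_part n v)^2) / real n) ----> \<sigma>^2"
  "\<And>t. filterlim (\<lambda>n. real n * h n) at_top sequentially ==>
   (\<lambda>n. LINT v|M. iexp (t * (sqrt (real n) * (est n v - \<E> (est n))))) ----> complex_of_real (exp (- (t^2 * (4 * \<sigma>^2) / 2)))"
proof -
 obtain \<sigma> :: real where \<sigma>: "(\<lambda>n. l2 (linear_part n) / sqrt (real n)) ----> \<sigma>"
  "\<And>t. (\<lambda>n. LINT v|M. iexp (t * (linear_part n v / sqrt (real n)))) ----> complex_of_real (exp (- (t^2 * \<sigma>^2 / 2)))"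
  using clt_density[OF f_measurable f_nonneg f_le law_X] unfolding expectation_f_X linear_part_def[symmetric, abs_def] by blast
 have 1: "(\<lambda>n. \<E> (\<lambda>v. (linear_part n v)^2) / real n) ----> \<sigma>^2"
 proof -
  have "(\<lambda>n. (l2 (linear_part n) / sqrt (real n))^2) ----> \<sigma>^2" by (intro tendsto_power \<sigma>)
  then show ?thesis by (simp add: power_divide l2_sq)
 qed
 obtain c where c: "0 < c" "\<And>n. 2 <= n ==> \<E> (\<lambda>v. (est n v - \<E> (est n) - 2 / real n * linear_part n v)^2)
  <= c * (1 / ((real n)^2 * h n) + coeff_tail_sum a \<gamma> n / (real n)^2 + h n powr (2 * \<gamma>) / real n)"
  using est_linearization by blast
 show ?thesis
 proof (rule that[OF 1])
  fix t assume nh: "filterlim (\<lambda>n. real n * h n) at_top sequentially"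
  define r where "r n = c * (1 / (real n * h n) + coeff_tail_sum a \<gamma> n / real n + h n powr (2 * \<gamma>))" for n
  have r: "r ----> 0"
  proof -
   have "(\<lambda>n. 1 / (real n * h n)) ----> 0"
    by (rule tendsto_divide_0[OF tendsto_const filterlim_at_top_imp_at_infinity[OF nh]])
   moreover have "(\<lambda>n. h n powr (2 * \<gamma>)) ----> 0"
   proof -
    have "\<forall>\<^sub>F n in sequentially. 0 <= h n"
     using eventually_ge_at_top[of 1] by eventually_elim (use h_pos in \<open>auto intro: less_imp_le\<close>)
    then show ?thesis using tendsto_powr2[OF h_lim tendsto_const[of "2 * \<gamma>"]] gamma by simp
   qed
   ultimately have "r ----> c * (0 + 0 + 0)"
    unfolding r_def[abs_def] by (intro tendsto_mult tendsto_add tendsto_const coeff_tail_sum_small)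
   then show ?thesis by simp
  qed
  let ?E = "\<lambda>n v. sqrt (real n) * (est n v - \<E> (est n))" and ?G = "\<lambda>n v. 2 * (linear_part n v / sqrt (real n))"
  have diff: "l2 (\<lambda>v. ?E n v - ?G n v) <= sqrt (r n)" if n: "2 <= n" for n
  proof -
   let ?N = "\<lambda>v. est n v - \<E> (est n) - 2 / real n * linear_part n v"
   have s: "sqrt (real n) * sqrt (real n) = real n" by simp
   have "?E n v - ?G n v = sqrt (real n) * ?N v" for v
   proof -
    have "linear_part n v / sqrt (real n) = sqrt (real n) * (linear_part n v / real n)"
     using n by (simp add: field_simps)
    then show ?thesis by (simp add: right_diff_distrib)
   qed
   then have "\<E> (\<lambda>v. (?E n v - ?G n v)^2) = real n * \<E> (\<lambda>v. (?N v)^2)"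
    by (simp add: power_mult_distrib)
   also have "... <= real n * (c * (1 / ((real n)^2 * h n) + coeff_tail_sum a \<gamma> n / (real n)^2 + h n powr (2 * \<gamma>) / real n))"
    by (intro mult_left_mono c n) simp
   also have "... = r n"
   proof -
    have "x * (c * (1 / (x^2 * y) + z / x^2 + w / x)) = c * (1 / (x * y) + z / x + w)" if "x \<noteq> 0" for x y z w :: real
     using that by (cases "y = 0") (simp_all add: field_simps power2_eq_square)
    then show ?thesis unfolding r_def using n by simp
   qed
   finally show ?thesis unfolding l2_def by (rule real_sqrt_le_mono)
  qed
  have lim0: "(\<lambda>n. (LINT v|M. iexp (t * ?E n v)) - (LINT v|M. iexp (t * ?G n v))) ----> 0"
  proof (rule Lim_null_comparison)
   show "\<forall>\<^sub>F n in sequentially. norm ((LINT v|M. iexp (t * ?E n v)) - (LINT v|M. iexp (t * ?G n v))) <= 2 * \<bar>t\<bar> * sqrt (r n)"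
    using eventually_ge_at_top[of 2]
   proof eventually_elim
    case (elim n)
    have b1: "bdd_rv (?E n)" using elim by (intro bdd_rv_mult bdd_rv_diff bdd_rv_const est_bounded) auto
    have b2: "bdd_rv (?G n)"
     unfolding divide_inverse by (intro bdd_rv_mult bdd_rv_const linear_part_bounded)
    show ?case
     by (rule order_trans[OF char_diff_le_l2[OF b1 b2]]) (intro mult_left_mono diff elim, simp)
   qed
   have "(\<lambda>n. 2 * \<bar>t\<bar> * sqrt (r n)) ----> 2 * \<bar>t\<bar> * sqrt 0" by (intro tendsto_mult tendsto_const tendsto_real_sqrt r)
   then show "(\<lambda>n. 2 * \<bar>t\<bar> * sqrt (r n)) ----> 0" by simp
  qed
  \<comment> \<open>The linear part enters twice, so its limit is taken at 2 t, which turns the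
    variance into 4 \<sigma>^2.\<close>
  have "(\<lambda>n. LINT v|M. iexp (t * ?G n v)) ----> complex_of_real (exp (- ((t * 2)^2 * \<sigma>^2 / 2)))"
   using \<sigma>(2)[of "t * 2"] by (simp only: mult.assoc)
  then have lim1: "(\<lambda>n. LINT v|M. iexp (t * ?G n v)) ----> complex_of_real (exp (- (t^2 * (4 * \<sigma>^2) / 2)))"
   by (simp only: power_mult_distrib) simp
  show "(\<lambda>n. LINT v|M. iexp (t * ?E n v)) ----> complex_of_real (exp (- (t^2 * (4 * \<sigma>^2) / 2)))"
   using tendsto_add[OF lim0 lim1] by simp
 qed
qed

end

section \<open>The normal law, the choice of L, and the assembly of the result\<close>

lemma char_normal_law:
 assumes v: "0 <= v"
 shows "real_distribution (normal_law 0 v)" "char (normal_law 0 v) t = complex_of_real (exp (- (t^2 * v / 2)))"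
proof -
 have "real_distribution (normal_law 0 v) \<and> char (normal_law 0 v) t = complex_of_real (exp (- (t^2 * v / 2)))"
 proof (cases "v = 0")
  case True
  interpret R: prob_space "return borel (0::real)" by (rule prob_space_return) simp
  have "real_distribution (return borel (0::real))" by unfold_locales auto
  then show ?thesis using True by (simp add: normal_law_def char_def integral_return)
 next
  case False
  define s where "s = sqrt v"
  have s: "0 < s" "s^2 = v" using v False unfolding s_def by auto
  interpret N: real_distribution std_normal_distribution by (rule real_dist_normal_dist)
  have "distributed std_normal_distribution lborel (\<lambda>x. x) (normal_density 0 1)"
   unfolding distributed_def by (auto simp: distr_id2)
  then have "distributed std_normal_distribution lborel (\<lambda>x. 0 + s * x) (normal_density (0 + s * 0) (\<bar>s\<bar> * 1))"
   by (rule N.normal_density_affine) (use s in auto)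
  then have "distr std_normal_distribution lborel (\<lambda>x. s * x) = density lborel (normal_density 0 s)"
   using s unfolding distributed_def by simp
  moreover have "distr std_normal_distribution lborel (\<lambda>x. s * x) = distr std_normal_distribution borel (\<lambda>x. s * x)"
   by (rule distr_cong) auto
  ultimately have law: "normal_law 0 v = distr std_normal_distribution borel (\<lambda>x. s * x)"
   using False unfolding normal_law_def s_def by simp
  have "char (distr std_normal_distribution borel (\<lambda>x. s * x)) t = char std_normal_distribution (t * s)"
   unfolding char_def by (subst integral_distr) (simp_all add: mult.assoc)
  also have "... = complex_of_real (exp (- (t^2 * v / 2)))"
   unfolding char_std_normal_distribution by (simp add: power_mult_distrib s)
  finally show ?thesis unfolding law by (auto intro!: N.real_distribution_distr)
 qed
 then show "real_distribution (normal_law 0 v)" "char (normal_law 0 v) t = complex_of_real (exp (- (t^2 * v / 2)))"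
  by auto
qed

text \<open>With finitely many nonzero coefficients L exceeds all of them, U is the whole process
  and the assumed bounded density serves for it. With infinitely many, enough of them are taken into
  U and the bound comes from Fourier inversion.\<close>

lemma (in noise) split_exists:
 assumes sa: "summable_coeffs a" and nz: "\<exists>l. a l \<noteq> 0" and f: "bdd_law (distr M borel (lin a 0)) C"
 obtains L C_U where "split_process M \<epsilon> \<phi> \<gamma> c_4 a L C_U"
proof (cases "finite {l. a l \<noteq> 0}")
 case True
 then obtain N where N: "\<And>l. a l \<noteq> 0 ==> l < N" using finite_nat_bounded[of "{l. a l \<noteq> 0}"] by blast
 define L where "L = Suc N"
 have z: "\<forall>l\<ge>L. a l = 0" unfolding L_def using N by (metis not_less Suc_leD)
 have "psum a L 0 = lin a 0"
  unfolding psum_def[abs_def] using z by (intro ext lin_finite[symmetric]) auto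
 then have "split_process M \<epsilon> \<phi> \<gamma> c_4 a L C"
  using sa nz f z by unfold_locales (auto simp: L_def)
 then show ?thesis by (rule that)
next
 case False
 \<comment> \<open>Three nonzero coefficients, so that two remain after any one is deleted.\<close>
 obtain F where F: "finite F" "card F = 3" "F \<subseteq> {l. a l \<noteq> 0}"
  using infinite_arbitrarily_large[OF False] by blast
 define L where "L = Suc (Max F)"
 have FL: "l < L" if "l \<in> F" for l unfolding L_def using F(1) that by (simp add: less_Suc_eq_le)
 have two: "two_coeffs (\<lambda>l. if l < L \<and> l \<noteq> s then a l else 0)" for s
 proof -
  have "2 <= card (F - {s})" using F(1,2) card_Diff_singleton_if[of F s] by (auto split: if_splits)
  then obtain l l' where l: "l \<in> F - {s}" "l' \<in> F - {s}" "l \<noteq> l'"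
   by (metis card_le_Suc0_iff_eq finite_Diff F(1) not_less_eq_eq numeral_2_eq_2)
  have "summable_coeffs (\<lambda>l. if l < L \<and> l \<noteq> s then a l else 0)" by (rule summable_coeffs_finite[of L]) auto
  moreover have "\<exists>l l'. l \<noteq> l' \<and> (if l < L \<and> l \<noteq> s then a l else 0) \<noteq> 0 \<and> (if l' < L \<and> l' \<noteq> s then a l' else 0) \<noteq> 0"
   using l F(3) FL by (intro exI[of _ l] exI[of _ l']) auto
  ultimately show ?thesis unfolding two_coeffs_def by blast
 qed
 let ?b = "\<lambda>l. if l < L then a l else 0"
 have b: "?b = (\<lambda>l. if l < L \<and> l \<noteq> L then a l else 0)" by auto
 have "psum a L 0 = lin ?b 0" by (rule ext) (rule psum_eq_lin)
 then have "bdd_law (distr M borel (psum a L 0)) (density_bound ?b)"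
  using bdd_law_lin[OF two[of L], of 0] unfolding b by simp
 then have "split_process M \<epsilon> \<phi> \<gamma> c_4 a L (density_bound ?b)"
  using sa nz two by unfold_locales (auto simp: L_def)
 then show ?thesis by (rule that)
qed

theorem theorem2p1:
  fixes M :: "'a measure"
    and \<epsilon> :: "int \<Rightarrow> 'a \<Rightarrow> real"
    and a h :: "nat \<Rightarrow> real"
    and f K :: "real \<Rightarrow> real"
    and \<phi> :: "real \<Rightarrow> complex"
    and X T Y S :: "nat \<Rightarrow> 'a \<Rightarrow> real"
    and \<gamma> c\<^sub>4 :: real
  assumes prob: "prob_space M"
    and indep: "prob_space.indep_vars M (\<lambda>_. borel) \<epsilon> UNIV"
    and ident: "\<And>k. distr M borel (\<epsilon> k) = distr M borel (\<epsilon> 1)"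
    and conv: "\<And>n::nat. conv_in_distribution M (\<lambda>N \<omega>. \<Sum>i\<le>N. a i * \<epsilon> (int n - int i) \<omega>)"
    and X_eq: "X = linear_process a \<epsilon>"
    and f_nonneg: "\<And>x. 0 \<le> f x"
    and density: "\<And>n. distributed M lborel (X n) (\<lambda>x. ennreal (f x))"
    and phi_eq: "\<phi> = char (distr M borel (\<epsilon> 1))"
    and K_sym: "\<And>u. K (- u) = K u"
    and K_bounded: "bounded (range K)"
    and K_integral: "has_bochner_integral lborel K 1"
    and K_moment: "integrable lborel (\<lambda>u. u\<^sup>2 * \<bar>K u\<bar>)"
    and h_pos: "\<And>n. 1 \<le> n \<Longrightarrow> 0 < h n"
    and h_lim: "h \<longlonglongrightarrow> 0"
    and T_eq: "T = (\<lambda>n. kernel_estimator K X n (h n))"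
    and Y_eq: "Y = (\<lambda>i \<omega>. 2 * (f (X i \<omega>) - quadratic_functional f))"
    and S_eq: "S = (\<lambda>n \<omega>. \<Sum>i = 1..n. (f (X i \<omega>) - quadratic_functional f))"
    and gamma: "0 < \<gamma>" "\<gamma> \<le> 1"
    and a_summable: "summable (\<lambda>i. \<bar>a i\<bar> powr \<gamma>)"
    and phi_integrable: "integrable lborel (\<lambda>t. \<bar>t\<bar> powr (2 * \<gamma>) * (cmod (\<phi> t))\<^sup>2)"
    and phi_fourth: "\<And>t. (LINT \<omega>|M. cmod (iexp (t * \<epsilon> 1 \<omega>) - \<phi> t) ^ 4)
                          \<le> c\<^sub>4 * min (\<bar>t\<bar> powr (4 * \<gamma>)) 1"
    and f_bounded: "bounded (range f)"
  shows "\<exists>c\<^sub>1>0. \<exists>c\<^sub>2>0. \<exists>\<sigma>::real.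
      (\<forall>n\<ge>2. \<bar>(LINT \<omega>|M. T n \<omega>) - quadratic_functional f\<bar>
                \<le> c\<^sub>1 * (1 / real n + h n powr (2 * \<gamma>))) \<and>
      (\<forall>n\<ge>2. (LINT \<omega>|M. (T n \<omega> - (LINT \<omega>|M. T n \<omega>) - 1 / real n * (\<Sum>i = 1..n. Y i \<omega>))\<^sup>2)
                \<le> c\<^sub>2 * (1 / ((real n)\<^sup>2 * h n) + coeff_tail_sum a \<gamma> n / (real n)\<^sup>2
                          + h n powr (2 * \<gamma>) / real n)) \<and>
      (\<lambda>n. (LINT \<omega>|M. (S n \<omega> - (LINT \<omega>|M. S n \<omega>))\<^sup>2) / real n) \<longlonglongrightarrow> \<sigma>\<^sup>2 \<and>
      (filterlim (\<lambda>n. real n * h n) at_top sequentially \<longrightarrow>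
        weak_conv_m
          (\<lambda>n. distr M borel (\<lambda>\<omega>. sqrt (real n) * (T n \<omega> - (LINT \<omega>|M. T n \<omega>))))
          (normal_law 0 (4 * \<sigma>\<^sup>2)))"
proof -
 interpret noise M \<epsilon> \<phi> \<gamma> c\<^sub>4
  using prob indep ident phi_eq gamma phi_integrable phi_fourth by (intro noise.intro noise_axioms.intro)
 have sa: "summable_coeffs a" unfolding summable_coeffs_def by (rule a_summable)
 have X_lin: "X n = lin a (int n)" for n
  unfolding X_eq by (rule ext) (simp add: linear_process_def lin_def)
 have law_lin: "distr M borel (lin a 0) = density lborel (\<lambda>x. ennreal (f x))"
 proof -
  have "distr M borel (X 0) = distr M lborel (X 0)" by (rule distr_cong) auto
  also have "... = density lborel (\<lambda>x. ennreal (f x))" using density[of 0] by (simp add: distributed_def)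
  finally show ?thesis unfolding X_lin by simp
 qed
 have fm: "f \<in> borel_measurable borel"
 proof -
  have "(\<lambda>x. ennreal (f x)) \<in> borel_measurable borel" using density[of 0] by (simp add: distributed_def)
  then have "(\<lambda>x. enn2real (ennreal (f x))) \<in> borel_measurable borel" by measurable
  then show ?thesis using f_nonneg by simp
 qed
 obtain C where C: "\<And>x. f x <= C" using f_bounded unfolding bounded_iff by (metis abs_le_D1 rangeI real_norm_def)
 have C0: "0 <= C" using f_nonneg[of 0] C[of 0] by linarith
 obtain S_K where SK: "\<And>u. \<bar>K u\<bar> <= S_K" using K_bounded unfolding bounded_iff by (metis rangeI real_norm_def)
 interpret D: prob_space "distr M borel (lin a 0)" by (rule prob_space_distr) (rule lin_measurable)
 have fi: "(\<integral>\<^sup>+x. ennreal (f x) \<partial>lborel) = 1"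
  using D.emeasure_space_1 fm unfolding law_lin by (simp add: emeasure_density)
 \<comment> \<open>If all coefficients vanished, the process would be constantly 0 and its law an
   atom, which has no density.\<close>
 have nz: "\<exists>l. a l \<noteq> 0"
 proof (rule ccontr)
  assume "\<nexists>l. a l \<noteq> 0"
  then have "lin a 0 = (\<lambda>_. 0)" by (auto simp: lin_def)
  then have "emeasure (distr M borel (lin a 0)) {0} = 1" by (simp add: emeasure_distr emeasure_space_1)
  moreover have "emeasure (distr M borel (lin a 0)) {0} = 0"
   unfolding law_lin using fm AE_lborel_singleton[of "0::real"]
   by (subst emeasure_density) (auto intro!: nn_integral_0_iff_AE[THEN iffD2] simp: indicator_def elim!: eventually_mono)
  ultimately show False by simp
 qed
 obtain L C_U where sp: "split_process M \<epsilon> \<phi> \<gamma> c\<^sub>4 a L C_U"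
  by (rule split_exists[OF sa nz, of C]) (unfold law_lin, rule bdd_law_density[OF fm C C0])
 interpret P: split_process M \<epsilon> \<phi> \<gamma> c\<^sub>4 a L C_U by (rule sp)
 interpret E: estimation M \<epsilon> \<phi> \<gamma> c\<^sub>4 a L C_U f C K S_K h
  by unfold_locales (fact fm f_nonneg C fi law_lin K_sym SK K_integral K_moment h_pos h_lim)+
 have qf: "quadratic_functional f = autocorr f 0"
  unfolding quadratic_functional_def autocorr_def by (simp add: power2_eq_square)
 have Xm[measurable]: "X n \<in> borel_measurable M" for n unfolding X_lin by (rule lin_measurable)
 note [measurable] = fm E.K_measurable
 have ae: "AE w in M. \<forall>n. X n w = P.X (int n) w"
  using P.AE_X_eq_lin by eventually_elim (simp add: X_lin)
 have Tm[measurable]: "T n \<in> borel_measurable M" for n unfolding T_eq kernel_estimator_def[abs_def] by measurable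
 have Sm[measurable]: "S n \<in> borel_measurable M" for n unfolding S_eq by measurable
 have Ym[measurable]: "Y n \<in> borel_measurable M" for n unfolding Y_eq by measurable
 have Em: "E.est n \<in> borel_measurable M" if "1 <= n" for n using E.est_bounded[OF that] by (rule bdd_rv_measurable)
 have Lm: "E.linear_part n \<in> borel_measurable M" for n by (rule bdd_rv_measurable[OF E.linear_part_bounded])
 have T_ae: "AE w in M. T n w = E.est n w" for n
  using ae
 proof eventually_elim
  case (elim w)
  \<comment> \<open>The estimator is written with X i - X j, the internal form with X j - X i; K is
    even.\<close>
  have "K ((X i w - X j w) / h n) = K ((P.X (int j) w - P.X (int i) w) / h n)" for i j
   using K_sym[of "(P.X (int j) w - P.X (int i) w) / h n"] elim by (simp add: minus_divide_left)
  then show ?case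
   unfolding T_eq kernel_estimator_def E.est_def E.Kh_def by (simp only: sum_divide_distrib[symmetric]) simp
 qed
 have S_ae: "AE w in M. S n w = E.linear_part n w" for n
  using ae by eventually_elim (simp add: S_eq E.linear_part_def qf)
 have ET: "(LINT w|M. T n w) = (LINT w|M. E.est n w)" if "1 <= n" for n
  by (rule integral_cong_AE) (use T_ae Em[OF that] in auto)
 have ES: "(LINT w|M. S n w) = 0" for n
 proof -
  have b: "integrable M (\<lambda>w. f (P.X i w))" for i by (intro bdd_rv_integrable E.bounded_f) measurable
  have "(LINT w|M. S n w) = (LINT w|M. E.linear_part n w)"
   by (rule integral_cong_AE) (use S_ae Lm in auto)
  also have "... = (\<Sum>i=1..n. (LINT w|M. f (P.X (int i) w)) - autocorr f 0)"
   unfolding E.linear_part_def by (subst integral_sum) (use b in \<open>simp_all add: prob_space\<close>)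
  finally show ?thesis by (simp add: E.expectation_f_X)
 qed
 obtain c_1 where c1: "0 < c_1" "\<And>n. 2 <= n ==> \<bar>(LINT w|M. E.est n w) - autocorr f 0\<bar> <= c_1 * (1 / real n + h n powr (2 * \<gamma>))"
  using E.est_bias by blast
 obtain c_2 where c2: "0 < c_2" "\<And>n. 2 <= n ==> (LINT w|M. (E.est n w - (LINT w|M. E.est n w) - 2 / real n * E.linear_part n w)^2)
   <= c_2 * (1 / ((real n)^2 * h n) + coeff_tail_sum a \<gamma> n / (real n)^2 + h n powr (2 * \<gamma>) / real n)"
  using E.est_linearization by blast
 obtain \<sigma> :: real where s: "(\<lambda>n. (LINT w|M. (E.linear_part n w)^2) / real n) ----> \<sigma>^2"
  "\<And>t. filterlim (\<lambda>n. real n * h n) at_top sequentially ==>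
   (\<lambda>n. LINT w|M. iexp (t * (sqrt (real n) * (E.est n w - (LINT w|M. E.est n w))))) ----> complex_of_real (exp (- (t^2 * (4 * \<sigma>^2) / 2)))"
  using E.est_clt by blast
 show ?thesis
 proof (rule exI[of _ c_1], rule conjI[OF c1(1)], rule exI[of _ c_2], rule conjI[OF c2(1)], rule exI[of _ \<sigma>], intro conjI allI impI)
  fix n :: nat assume n: "2 <= n"
  then have n1: "1 <= n" by simp
  show "\<bar>(LINT w|M. T n w) - quadratic_functional f\<bar> <= c_1 * (1 / real n + h n powr (2 * \<gamma>))"
   unfolding ET[OF n1] qf by (rule c1(2)[OF n])
  have "(LINT w|M. (T n w - (LINT w|M. T n w) - 1 / real n * (\<Sum>i=1..n. Y i w))^2)
    = (LINT w|M. (E.est n w - (LINT w|M. E.est n w) - 2 / real n * E.linear_part n w)^2)"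
   unfolding ET[OF n1]
  proof (rule integral_cong_AE)
   show "AE w in M. (T n w - (LINT w|M. E.est n w) - 1 / real n * (\<Sum>i=1..n. Y i w))^2
     = (E.est n w - (LINT w|M. E.est n w) - 2 / real n * E.linear_part n w)^2"
    using T_ae[of n] S_ae[of n]
   proof eventually_elim
    case (elim w)
    have "(\<Sum>i=1..n. Y i w) = 2 * S n w" unfolding Y_eq S_eq sum_distrib_left ..
    then show ?case unfolding elim by simp
   qed
  qed (use Em[OF n1] Lm in measurable)
  then show "(LINT w|M. (T n w - (LINT w|M. T n w) - 1 / real n * (\<Sum>i=1..n. Y i w))^2)
    <= c_2 * (1 / ((real n)^2 * h n) + coeff_tail_sum a \<gamma> n / (real n)^2 + h n powr (2 * \<gamma>) / real n)"
   using c2(2)[OF n] by (simp only:)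
 next
  have "(LINT w|M. (S n w - (LINT w|M. S n w))^2) = (LINT w|M. (E.linear_part n w)^2)" for n
   unfolding ES by (rule integral_cong_AE) (use S_ae[of n] Lm in auto)
  then show "(\<lambda>n. (LINT w|M. (S n w - (LINT w|M. S n w))^2) / real n) ----> \<sigma>^2"
   using s(1) by (simp only:)
 next
  assume nh: "filterlim (\<lambda>n. real n * h n) at_top sequentially"
  let ?Z = "\<lambda>n w. sqrt (real n) * (T n w - (LINT w|M. T n w))"
  have Zm[measurable]: "?Z n \<in> borel_measurable M" for n by measurable
  show "weak_conv_m (\<lambda>n. distr M borel (?Z n)) (normal_law 0 (4 * \<sigma>^2))"
  proof (rule levy_continuity)
   show "real_distribution (distr M borel (?Z n))" for n by (rule real_distribution_distr) measurable
   show "real_distribution (normal_law 0 (4 * \<sigma>^2))" by (rule char_normal_law(1)) simp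
   fix t
   have ce: "char (distr M borel (?Z n)) t = (LINT w|M. iexp (t * (sqrt (real n) * (E.est n w - (LINT w|M. E.est n w)))))" if n: "1 <= n" for n
   proof -
    note [measurable] = Em[OF n]
    have "char (distr M borel (?Z n)) t = (LINT w|M. iexp (t * ?Z n w))"
     unfolding char_def by (rule integral_distr) auto
    also have "... = (LINT w|M. iexp (t * (sqrt (real n) * (E.est n w - (LINT w|M. E.est n w)))))"
     unfolding ET[OF n]
    proof (rule integral_cong_AE)
     show "AE w in M. iexp (t * (sqrt (real n) * (T n w - (LINT w|M. E.est n w))))
       = iexp (t * (sqrt (real n) * (E.est n w - (LINT w|M. E.est n w))))"
      using T_ae[of n] by eventually_elim simp
    qed measurable
    finally show ?thesis .
   qed
   have ev: "\<forall>\<^sub>F n in sequentially. (LINT w|M. iexp (t * (sqrt (real n) * (E.est n w - (LINT w|M. E.est n w))))) = char (distr M borel (?Z n)) t"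
    using eventually_ge_at_top[of 1] by eventually_elim (rule ce[symmetric])
   have nonneg: "0 <= 4 * \<sigma>^2" by simp
   show "(\<lambda>n. char (distr M borel (?Z n)) t) ----> char (normal_law 0 (4 * \<sigma>^2)) t"
    unfolding char_normal_law(2)[OF nonneg] by (rule Lim_transform_eventually[OF s(2)[OF nh] ev])
  qed
 qed
qed

end
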